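(* Let $M$ be an irreducible calibrated $\tilde H$-module. Let $t\in T$ be the central character of $M$, and let $J=R(w)\cap P(t)$ for any $w\in W$ such that $M_{wt}\neq0$. Then $(t,J)$ is a placed skew shape and $$M\cong\tilde H^{(t,J)}.$$
   Context: **Affine Hecke algebra.** $R$ is a reduced irreducible root system in $\mathbb{R}^n$ (of rank $n$), with positive roots $R^+$ (write $\alpha>0$ for $\alpha\in R^+$ and $\alpha<0$ for $-\alpha\in R^+$), simple roots $\alpha_1,\dots,\alpha_n$, Weyl group $W$ and simple reflections $s_1,\dots,s_n$; for $i\neq j$, $m_{ij}$ is the order of $s_is_j$ in $W$. Fix $q\in\mathbb{C}^*$, not a root of unity. The fundamental weights $\omega_i$ satisfy $\langle\omega_i,\alpha_j^\vee\rangle=\delta_{ij}$, where $\alpha_j^\vee=2\alpha_j/\langle\alpha_j,\alpha_j\rangle$, and $P=\sum_i\mathbb{Z}\omega_i$ is the weight lattice. $X=\{X^\lambda\mid\lambda\in P\}$ is $P$ written multiplicatively: $X^\lambda X^\mu=X^{\lambda+\mu}$; $\mathbb{C}[X]$ is its group algebra, with $W$-action $wX^\lambda=X^{w\lambda}$. $\tilde H$ is the associative unital $\mathbb{C}$-algebra generated by $T_1,\dots,T_n$ and $X^\lambda$ ($\lambda\in P$) with relations: $T_i^2=(q-q^{-1})T_i+1$; $T_iT_jT_i\cdots=T_jT_iT_j\cdots$ ($m_{ij}$ factors on each side, $i\ne j$); $X^\lambda X^\mu=X^{\lambda+\mu}$, $X^0=1$; and $$X^\lambda T_i=T_iX^{s_i\lambda}+(q-q^{-1})\frac{X^\lambda-X^{s_i\lambda}}{1-X^{-\alpha_i}}.$$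 With $T_w=T_{i_1}\cdots T_{i_p}$ for a reduced expression $w=s_{i_1}\cdots s_{i_p}$, the elements $T_wX^\lambda$ ($w\in W$, $\lambda\in P$) form a basis of $\tilde H$. The center of $\tilde H$ is $\mathbb{C}[X]^W$. **Weights and calibrated modules.** $T=\{\text{group homomorphisms }t:X\to\mathbb{C}^*\}$, with $W$-action $(wt)(X^\lambda)=t(X^{w^{-1}\lambda})$; each $t\in T$ is extended linearly to $\mathbb{C}[X]$. For a finite dimensional $\tilde H$-module $M$, $M_t=\{m\in M\mid X^\lambda m=t(X^\lambda)m\ \forall\lambda\in P\}$ and $M_t^{\mathrm{gen}}=\{m\in M\mid\text{for each }\lambda\in P,\ (X^\lambda-t(X^\lambda))^km=0\text{ for some }k>0\}$. A finite dimensional $\tilde H$-module $M$ is *calibrated* if $M_t^{\mathrm{gen}}=M_t$ for all $t\in T$. For an irreducible finite dimensional $M$ there is $t\in T$ such that every $p\in\mathbb{C}[X]^W$ acts on $M$ by the scalar $t(p)$; the orbit $Wt$ is the *central character* of $M$, and, by abuse of notation, any weight in $Wt$ is also referred to as the central character of $M$. **Placed shapes and standard tableaux.** For $t\in T$ put $Z(t)=\{\alpha>0\mid t(X^\alpha)=1\}$ and $P(t)=\{\alpha>0\mid t(X^\alpha)=q^{2}\text{ or }q^{-2}\}$. For $w\in W$ let $R(w)=\{\alpha>0\mid w\alpha<0\}$. For $J\subseteq P(t)$ let $$\mathcal{F}^{(t,J)}=\{w\in W\mid R(w)\cap Z(t)=\emptyset,\ R(w)\cap P(t)=J\}.$$ A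 *placed shape* is a pair $(t,J)$ with $t\in T$, $J\subseteq P(t)$ and $\mathcal{F}^{(t,J)}\neq\emptyset$. **Placed skew shapes.** For simple roots $\alpha_i,\alpha_j$ let $R_{ij}$ be the rank two root subsystem of $R$ generated by $\alpha_i,\alpha_j$ and $W_{ij}$ its Weyl group, the subgroup of $W$ generated by $s_i$ and $s_j$. A weight $t\in T$ is *calibratable* for $R_{ij}$ if one of the following holds: (a) $t(X^\alpha)\neq1$ for all $\alpha\in R_{ij}$; (b) $R_{ij}$ is of type $C_2$ or $G_2$ and, naming the two simple roots so that $\alpha_i$ is long and $\alpha_j$ is short, $(ut)(X^{\alpha_i})=q^2$ and $(ut)(X^{\alpha_j})=1$ for some $u\in W_{ij}$, and $t(X^{\alpha_i})\ne1$ and $t(X^{\alpha_j})\neq1$. A *placed skew shape* is a placed shape $(t,J)$ such that for all $w\in\mathcal{F}^{(t,J)}$ and all pairs $\alpha_i,\alpha_j$ of simple roots in $R$ the weight $wt$ is calibratable for $R_{ij}$. **The module $\tilde H^{(t,J)}$.** For a placed skew shape $(t,J)$, $\tilde H^{(t,J)}$ is the $\tilde H$-module with $\mathbb{C}$-basis $\{v_w\mid w\in\mathcal{F}^{(t,J)}\}$ and action $$X^\lambda v_w=(wt)(X^\lambda)v_w,\qquad T_iv_w=(T_i)_{ww}v_w+(q^{-1}+(T_i)_{ww})v_{s_iw},\qquad (T_i)_{ww}=\frac{q-q^{-1}}{1-(wt)(X^{-\alpha_i})},$$ for $X^\lambda\in X$ and $1\le i\le n$, where $v_{s_iw}=0$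 if $s_iw\notin\mathcal{F}^{(t,J)}$ (these formulas do define an $\tilde H$-module, and it is irreducible).
   Formalization: The claim is proved for those w with M_{wt}≠0 and R(w)∩Z(t)=∅ (for other w it can fail, e.g. type C_2, t=(q,q)); it is also proved that every w with M_{wt}≠0 has some u with ut=wt and R(u)∩Z(t)=∅. *)

theory Defs
  imports
    "HOL-Analysis.Analysis"
    "HOL-Library.Poly_Mapping"
    "HOL-Algebra.Module"
    "HOL-Algebra.QuotRing"
begin

section \<open>Root systems and Weyl groups\<close>

definition coroot :: "real^'n \<Rightarrow> real^'n" where
  "coroot \<beta> = (2 / (\<beta> \<bullet> \<beta>)) *\<^sub>R \<beta>"

definition refl :: "real^'n \<Rightarrow> real^'n \<Rightarrow> real^'n" where
  "refl \<beta> v = v - (v \<bullet> coroot \<beta>) *\<^sub>R \<beta>"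

definition root_system :: "(real^'n) set \<Rightarrow> bool" where
  "root_system R \<longleftrightarrow>
     finite R \<and> 0 \<notin> R \<and> span R = UNIV \<and>
     (\<forall>\<beta>\<in>R. \<forall>\<gamma>\<in>R. refl \<beta> \<gamma> \<in> R) \<and>
     (\<forall>\<beta>\<in>R. \<forall>\<gamma>\<in>R. \<gamma> \<bullet> coroot \<beta> \<in> \<int>)"

definition reduced_roots :: "(real^'n) set \<Rightarrow> bool" where
  "reduced_roots R \<longleftrightarrow> (\<forall>\<beta>\<in>R. \<forall>c. c *\<^sub>R \<beta> \<in> R \<longrightarrow> c = 1 \<or> c = -1)"

definition irreducible_roots :: "(real^'n) set \<Rightarrow> bool" where
  "irreducible_roots R \<longleftrightarrow>
     R \<noteq> {} \<and>
     \<not> (\<exists>A B. A \<noteq> {} \<and> B \<noteq> {} \<and> R = A \<union> B \<and> (\<forall>\<beta>\<in>A. \<forall>\<gamma>\<in>B. \<beta> \<bullet> \<gamma> = 0))"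

text \<open>The simple roots are indexed by the index type of the ambient Euclidean space, which
  encodes that the rank is the dimension.  The positive roots are determined by them.\<close>

definition simple_roots :: "(real^'n) set \<Rightarrow> ('n \<Rightarrow> real^'n) \<Rightarrow> bool" where
  "simple_roots R \<alpha> \<longleftrightarrow>
     inj \<alpha> \<and> range \<alpha> \<subseteq> R \<and> independent (range \<alpha>) \<and>
     (\<forall>\<beta>\<in>R. \<exists>c :: 'n \<Rightarrow> int.
        \<beta> = (\<Sum>i\<in>UNIV. of_int (c i) *\<^sub>R \<alpha> i) \<and> ((\<forall>i. 0 \<le> c i) \<or> (\<forall>i. c i \<le> 0)))"

definition pos_roots :: "(real^'n) set \<Rightarrow> ('n \<Rightarrow> real^'n) \<Rightarrow> (real^'n) set" where
  "pos_roots R \<alpha> = {\<beta>\<in>R. \<exists>c :: 'n \<Rightarrow> nat. \<beta> = (\<Sum>i\<in>UNIV. of_nat (c i) *\<^sub>R \<alpha> i)}"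

inductive_set refl_group :: "(real^'n) set \<Rightarrow> (real^'n \<Rightarrow> real^'n) set"
  for B :: "(real^'n) set" where
  refl_group_id: "id \<in> refl_group B"
| refl_group_step: "\<beta> \<in> B \<Longrightarrow> w \<in> refl_group B \<Longrightarrow> refl \<beta> \<circ> w \<in> refl_group B"

abbreviation weyl :: "(real^'n) set \<Rightarrow> (real^'n \<Rightarrow> real^'n) set" where
  "weyl R \<equiv> refl_group R"

definition cox_order :: "('n \<Rightarrow> real^'n) \<Rightarrow> 'n \<Rightarrow> 'n \<Rightarrow> nat" where
  "cox_order \<alpha> i j = (LEAST m. 0 < m \<and> (refl (\<alpha> i) \<circ> refl (\<alpha> j)) ^^ m = id)"

definition fund_weight :: "('n \<Rightarrow> real^'n) \<Rightarrow> 'n \<Rightarrow> real^'n" where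
  "fund_weight \<alpha> i = (THE v. \<forall>j. v \<bullet> coroot (\<alpha> j) = (if i = j then 1 else 0))"

definition weight_lattice :: "('n \<Rightarrow> real^'n) \<Rightarrow> (real^'n) set" where
  "weight_lattice \<alpha> = {\<Sum>i\<in>UNIV. of_int (c i) *\<^sub>R fund_weight \<alpha> i | c :: 'n \<Rightarrow> int. True}"

section \<open>The group algebra of the weight lattice\<close>

text \<open>Finitely supported functions with the convolution product; the monomial $X^\nu$ is
  \<^term>\<open>Poly_Mapping.single \<nu> (1::complex)\<close>.\<close>

definition group_algebra :: "('n \<Rightarrow> real^'n) \<Rightarrow> (real^'n \<Rightarrow>\<^sub>0 complex) set" where
  "group_algebra \<alpha> = {p. Poly_Mapping.keys p \<subseteq> weight_lattice \<alpha>}"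

definition weyl_act :: "(real^'n \<Rightarrow> real^'n) \<Rightarrow> (real^'n \<Rightarrow>\<^sub>0 complex) \<Rightarrow> (real^'n \<Rightarrow>\<^sub>0 complex)" where
  "weyl_act w p =
     (\<Sum>\<nu>\<in>Poly_Mapping.keys p. Poly_Mapping.single (w \<nu>) (Poly_Mapping.lookup p \<nu>))"

definition invariants ::
  "(real^'n) set \<Rightarrow> ('n \<Rightarrow> real^'n) \<Rightarrow> (real^'n \<Rightarrow>\<^sub>0 complex) set" where
  "invariants R \<alpha> = {p \<in> group_algebra \<alpha>. \<forall>w\<in>weyl R. weyl_act w p = p}"

section \<open>The affine Hecke algebra\<close>

text \<open>The free algebra on a set of generators is the monoid algebra of the free monoid; a
  wrapper around lists makes the convolution product on \<^type>\<open>poly_mapping\<close> available.\<close>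

datatype 'g fword = Word (letters: "'g list")

instantiation fword :: (type) monoid_add
begin

definition zero_fword :: "'a fword" where "0 = Word []"

definition plus_fword :: "'a fword \<Rightarrow> 'a fword \<Rightarrow> 'a fword" where
  "u + v = Word (letters u @ letters v)"

instance
  by standard (simp_all add: zero_fword_def plus_fword_def)

end

datatype 'n hgen = GenT 'n | GenX "real^'n"

type_synonym 'n free = "'n hgen fword \<Rightarrow>\<^sub>0 complex"

definition hgens :: "('n \<Rightarrow> real^'n) \<Rightarrow> 'n hgen set" where
  "hgens \<alpha> = range GenT \<union> GenX ` weight_lattice \<alpha>"

definition free_algebra :: "('n \<Rightarrow> real^'n) \<Rightarrow> ('n free) ring" where
  "free_algebra \<alpha> =
     \<lparr>carrier = {p. \<forall>w\<in>Poly_Mapping.keys p. set (letters w) \<subseteq> hgens \<alpha>},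
      monoid.mult = (*), one = 1, zero = 0, add = (+)\<rparr>"

definition fconst :: "complex \<Rightarrow> 'n free" where
  "fconst c = Poly_Mapping.single 0 c"

definition fgen :: "'n hgen \<Rightarrow> 'n free" where
  "fgen g = Poly_Mapping.single (Word [g]) 1"

definition fpoly :: "(real^'n \<Rightarrow>\<^sub>0 complex) \<Rightarrow> 'n free" where
  "fpoly p = (\<Sum>\<nu>\<in>Poly_Mapping.keys p. fconst (Poly_Mapping.lookup p \<nu>) * fgen (GenX \<nu>))"

fun braid_word :: "'n::finite \<Rightarrow> 'n \<Rightarrow> nat \<Rightarrow> 'n free" where
  "braid_word i j 0 = 1"
| "braid_word i j (Suc m) = fgen (GenT i) * braid_word j i m"

text \<open>In the last family, \<^term>\<open>p\<close> ranges over the (unique) element of the group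
  algebra which is the quotient $(X^\nu - X^{s_i\nu})/(1 - X^{-\alpha_i})$.\<close>

inductive_set hecke_relators :: "('n \<Rightarrow> real^'n) \<Rightarrow> complex \<Rightarrow> ('n free) set"
  for \<alpha> :: "'n \<Rightarrow> real^'n" and q :: complex where
  quadratic:
    "fgen (GenT i) * fgen (GenT i) - (fconst (q - inverse q) * fgen (GenT i) + 1) \<in> hecke_relators \<alpha> q"
| braid:
    "i \<noteq> j \<Longrightarrow> braid_word i j (cox_order \<alpha> i j) - braid_word j i (cox_order \<alpha> i j)
       \<in> hecke_relators \<alpha> q"
| X_mult:
    "\<nu> \<in> weight_lattice \<alpha> \<Longrightarrow> \<mu> \<in> weight_lattice \<alpha> \<Longrightarrow>
       fgen (GenX \<nu>) * fgen (GenX \<mu>) - fgen (GenX (\<nu> + \<mu>)) \<in> hecke_relators \<alpha> q"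
| X_one:
    "fgen (GenX 0) - 1 \<in> hecke_relators \<alpha> q"
| bernstein:
    "\<nu> \<in> weight_lattice \<alpha> \<Longrightarrow> p \<in> group_algebra \<alpha> \<Longrightarrow>
     p * (1 - Poly_Mapping.single (- \<alpha> i) 1)
       = Poly_Mapping.single \<nu> 1 - Poly_Mapping.single (refl (\<alpha> i) \<nu>) 1 \<Longrightarrow>
       fgen (GenX \<nu>) * fgen (GenT i)
         - (fgen (GenT i) * fgen (GenX (refl (\<alpha> i) \<nu>)) + fconst (q - inverse q) * fpoly p)
       \<in> hecke_relators \<alpha> q"

definition hecke_ideal :: "('n \<Rightarrow> real^'n) \<Rightarrow> complex \<Rightarrow> ('n free) set" where
  "hecke_ideal \<alpha> q = genideal (free_algebra \<alpha>) (hecke_relators \<alpha> q)"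

definition affine_hecke :: "('n \<Rightarrow> real^'n) \<Rightarrow> complex \<Rightarrow> ('n free set) ring" where
  "affine_hecke \<alpha> q = free_algebra \<alpha> Quot hecke_ideal \<alpha> q"

definition hclass :: "('n \<Rightarrow> real^'n) \<Rightarrow> complex \<Rightarrow> 'n free \<Rightarrow> 'n free set" where
  "hclass \<alpha> q p = hecke_ideal \<alpha> q +>\<^bsub>free_algebra \<alpha>\<^esub> p"

definition hconst :: "('n \<Rightarrow> real^'n) \<Rightarrow> complex \<Rightarrow> complex \<Rightarrow> 'n free set" where
  "hconst \<alpha> q c = hclass \<alpha> q (fconst c)"

definition hX :: "('n \<Rightarrow> real^'n) \<Rightarrow> complex \<Rightarrow> real^'n \<Rightarrow> 'n free set" where
  "hX \<alpha> q \<nu> = hclass \<alpha> q (fgen (GenX \<nu>))"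

section \<open>Modules\<close>

text \<open>The library locale \<^locale>\<open>module\<close> requires a commutative ring, so left modules over a
  noncommutative ring are axiomatised here in the same way (on the same record type).\<close>

locale left_module = H?: ring H + M?: abelian_group M
  for H :: "('h, 'a) ring_scheme" (structure) and M :: "('h, 'm, 'b) module_scheme" (structure) +
  assumes lm_smult_closed:
      "\<lbrakk>a \<in> carrier H; x \<in> carrier M\<rbrakk> \<Longrightarrow> a \<odot>\<^bsub>M\<^esub> x \<in> carrier M"
    and lm_smult_l_distr:
      "\<lbrakk>a \<in> carrier H; b \<in> carrier H; x \<in> carrier M\<rbrakk> \<Longrightarrow>
        (a \<oplus>\<^bsub>H\<^esub> b) \<odot>\<^bsub>M\<^esub> x = a \<odot>\<^bsub>M\<^esub> x \<oplus>\<^bsub>M\<^esub> b \<odot>\<^bsub>M\<^esub> x"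
    and lm_smult_r_distr:
      "\<lbrakk>a \<in> carrier H; x \<in> carrier M; y \<in> carrier M\<rbrakk> \<Longrightarrow>
        a \<odot>\<^bsub>M\<^esub> (x \<oplus>\<^bsub>M\<^esub> y) = a \<odot>\<^bsub>M\<^esub> x \<oplus>\<^bsub>M\<^esub> a \<odot>\<^bsub>M\<^esub> y"
    and lm_smult_assoc:
      "\<lbrakk>a \<in> carrier H; b \<in> carrier H; x \<in> carrier M\<rbrakk> \<Longrightarrow>
        (a \<otimes>\<^bsub>H\<^esub> b) \<odot>\<^bsub>M\<^esub> x = a \<odot>\<^bsub>M\<^esub> (b \<odot>\<^bsub>M\<^esub> x)"
    and lm_smult_one:
      "x \<in> carrier M \<Longrightarrow> \<one>\<^bsub>H\<^esub> \<odot>\<^bsub>M\<^esub> x = x"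

definition left_submodule ::
  "('h, 'a) ring_scheme \<Rightarrow> ('h, 'm, 'b) module_scheme \<Rightarrow> 'm set \<Rightarrow> bool" where
  "left_submodule H M N \<longleftrightarrow>
     subgroup N (add_monoid M) \<and> (\<forall>h\<in>carrier H. \<forall>x\<in>N. h \<odot>\<^bsub>M\<^esub> x \<in> N)"

definition irreducible_module ::
  "('h, 'a) ring_scheme \<Rightarrow> ('h, 'm, 'b) module_scheme \<Rightarrow> bool" where
  "irreducible_module H M \<longleftrightarrow>
     left_module H M \<and> carrier M \<noteq> {\<zero>\<^bsub>M\<^esub>} \<and>
     (\<forall>N. left_submodule H M N \<longrightarrow> N = {\<zero>\<^bsub>M\<^esub>} \<or> N = carrier M)"

definition module_iso ::
  "('h, 'a) ring_scheme \<Rightarrow> ('h, 'm, 'b) module_scheme \<Rightarrow> ('h, 'k, 'c) module_scheme \<Rightarrow> bool" where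
  "module_iso H M N \<longleftrightarrow>
     (\<exists>\<phi>. bij_betw \<phi> (carrier M) (carrier N) \<and>
        (\<forall>x\<in>carrier M. \<forall>y\<in>carrier M. \<phi> (x \<oplus>\<^bsub>M\<^esub> y) = \<phi> x \<oplus>\<^bsub>N\<^esub> \<phi> y) \<and>
        (\<forall>h\<in>carrier H. \<forall>x\<in>carrier M. \<phi> (h \<odot>\<^bsub>M\<^esub> x) = h \<odot>\<^bsub>N\<^esub> \<phi> x))"

text \<open>The complex vector space structure of a module is the one induced by the structure map
  \<^const>\<open>hconst\<close> of the algebra.\<close>

definition finite_dim ::
  "('n \<Rightarrow> real^'n) \<Rightarrow> complex \<Rightarrow> ('n free set, 'm, 'b) module_scheme \<Rightarrow> bool" where
  "finite_dim \<alpha> q M \<longleftrightarrow>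
     (\<exists>B. finite B \<and> B \<subseteq> carrier M \<and>
        (\<forall>x\<in>carrier M. \<exists>c. x = (\<Oplus>\<^bsub>M\<^esub>b\<in>B. hconst \<alpha> q (c b) \<odot>\<^bsub>M\<^esub> b)))"

section \<open>Weights and calibrated modules\<close>

text \<open>A point of the torus is a function on the ambient space of which only the values on the
  weight lattice matter.\<close>

definition torus :: "('n \<Rightarrow> real^'n) \<Rightarrow> (real^'n \<Rightarrow> complex) set" where
  "torus \<alpha> = {t. (\<forall>\<nu>\<in>weight_lattice \<alpha>. t \<nu> \<noteq> 0) \<and>
     (\<forall>\<nu>\<in>weight_lattice \<alpha>. \<forall>\<mu>\<in>weight_lattice \<alpha>. t (\<nu> + \<mu>) = t \<nu> * t \<mu>)}"

definition torus_act :: "(real^'n \<Rightarrow> real^'n) \<Rightarrow> (real^'n \<Rightarrow> complex) \<Rightarrow> real^'n \<Rightarrow> complex" where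
  "torus_act w t = (\<lambda>\<nu>. t (inv_into UNIV w \<nu>))"

definition torus_eval :: "(real^'n \<Rightarrow> complex) \<Rightarrow> (real^'n \<Rightarrow>\<^sub>0 complex) \<Rightarrow> complex" where
  "torus_eval t p = (\<Sum>\<nu>\<in>Poly_Mapping.keys p. Poly_Mapping.lookup p \<nu> * t \<nu>)"

definition weight_space ::
  "('n \<Rightarrow> real^'n) \<Rightarrow> complex \<Rightarrow> ('n free set, 'm, 'b) module_scheme \<Rightarrow>
     (real^'n \<Rightarrow> complex) \<Rightarrow> 'm set" where
  "weight_space \<alpha> q M t =
     {m \<in> carrier M. \<forall>\<nu>\<in>weight_lattice \<alpha>. hX \<alpha> q \<nu> \<odot>\<^bsub>M\<^esub> m = hconst \<alpha> q (t \<nu>) \<odot>\<^bsub>M\<^esub> m}"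

definition gen_weight_space ::
  "('n \<Rightarrow> real^'n) \<Rightarrow> complex \<Rightarrow> ('n free set, 'm, 'b) module_scheme \<Rightarrow>
     (real^'n \<Rightarrow> complex) \<Rightarrow> 'm set" where
  "gen_weight_space \<alpha> q M t =
     {m \<in> carrier M. \<forall>\<nu>\<in>weight_lattice \<alpha>. \<exists>k::nat. 0 < k \<and>
        ((hX \<alpha> q \<nu> \<ominus>\<^bsub>affine_hecke \<alpha> q\<^esub> hconst \<alpha> q (t \<nu>)) [^]\<^bsub>affine_hecke \<alpha> q\<^esub> k)
          \<odot>\<^bsub>M\<^esub> m = \<zero>\<^bsub>M\<^esub>}"

definition calibrated ::
  "('n \<Rightarrow> real^'n) \<Rightarrow> complex \<Rightarrow> ('n free set, 'm, 'b) module_scheme \<Rightarrow> bool" where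
  "calibrated \<alpha> q M \<longleftrightarrow>
     left_module (affine_hecke \<alpha> q) M \<and> finite_dim \<alpha> q M \<and>
     (\<forall>t\<in>torus \<alpha>. gen_weight_space \<alpha> q M t = weight_space \<alpha> q M t)"

definition central_character ::
  "(real^'n) set \<Rightarrow> ('n \<Rightarrow> real^'n) \<Rightarrow> complex \<Rightarrow> ('n free set, 'm, 'b) module_scheme \<Rightarrow>
     (real^'n \<Rightarrow> complex) \<Rightarrow> bool" where
  "central_character R \<alpha> q M t \<longleftrightarrow>
     t \<in> torus \<alpha> \<and>
     (\<forall>p\<in>invariants R \<alpha>. \<forall>m\<in>carrier M.
        hclass \<alpha> q (fpoly p) \<odot>\<^bsub>M\<^esub> m = hconst \<alpha> q (torus_eval t p) \<odot>\<^bsub>M\<^esub> m)"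

section \<open>Placed shapes and placed skew shapes\<close>

definition Zset :: "(real^'n) set \<Rightarrow> ('n \<Rightarrow> real^'n) \<Rightarrow> (real^'n \<Rightarrow> complex) \<Rightarrow> (real^'n) set" where
  "Zset R \<alpha> t = {\<beta> \<in> pos_roots R \<alpha>. t \<beta> = 1}"

definition Pset ::
  "(real^'n) set \<Rightarrow> ('n \<Rightarrow> real^'n) \<Rightarrow> complex \<Rightarrow> (real^'n \<Rightarrow> complex) \<Rightarrow> (real^'n) set" where
  "Pset R \<alpha> q t = {\<beta> \<in> pos_roots R \<alpha>. t \<beta> = q\<^sup>2 \<or> t \<beta> = inverse (q\<^sup>2)}"

definition inversions ::
  "(real^'n) set \<Rightarrow> ('n \<Rightarrow> real^'n) \<Rightarrow> (real^'n \<Rightarrow> real^'n) \<Rightarrow> (real^'n) set" where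
  "inversions R \<alpha> w = {\<beta> \<in> pos_roots R \<alpha>. - w \<beta> \<in> pos_roots R \<alpha>}"

text \<open>Tableaux are group elements with no inversion in the zero set.  A weight in the orbit of
  \<^term>\<open>t\<close> may also be of the form \<^term>\<open>torus_act w t\<close> for elements \<^term>\<open>w\<close> that do have such
  inversions (when the stabilizer of \<^term>\<open>t\<close> is not trivial), and for these the set
  \<^term>\<open>inversions R \<alpha> w \<inter> Pset R \<alpha> q t\<close> need not belong to a placed shape.  So a weight has to
  be labelled by an element without inversions in the zero set.\<close>

definition tableaux ::
  "(real^'n) set \<Rightarrow> ('n \<Rightarrow> real^'n) \<Rightarrow> complex \<Rightarrow> (real^'n \<Rightarrow> complex) \<Rightarrow> (real^'n) set \<Rightarrow>
     (real^'n \<Rightarrow> real^'n) set" where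
  "tableaux R \<alpha> q t J =
     {w \<in> weyl R. inversions R \<alpha> w \<inter> Zset R \<alpha> t = {} \<and> inversions R \<alpha> w \<inter> Pset R \<alpha> q t = J}"

definition placed_shape ::
  "(real^'n) set \<Rightarrow> ('n \<Rightarrow> real^'n) \<Rightarrow> complex \<Rightarrow> (real^'n \<Rightarrow> complex) \<Rightarrow> (real^'n) set \<Rightarrow> bool" where
  "placed_shape R \<alpha> q t J \<longleftrightarrow>
     t \<in> torus \<alpha> \<and> J \<subseteq> Pset R \<alpha> q t \<and> tableaux R \<alpha> q t J \<noteq> {}"

definition weyl2 :: "('n \<Rightarrow> real^'n) \<Rightarrow> 'n \<Rightarrow> 'n \<Rightarrow> (real^'n \<Rightarrow> real^'n) set" where
  "weyl2 \<alpha> i j = refl_group {\<alpha> i, \<alpha> j}"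

definition roots2 :: "('n \<Rightarrow> real^'n) \<Rightarrow> 'n \<Rightarrow> 'n \<Rightarrow> (real^'n) set" where
  "roots2 \<alpha> i j = {w \<beta> | w \<beta>. w \<in> weyl2 \<alpha> i j \<and> \<beta> \<in> {\<alpha> i, \<alpha> j}}"

text \<open>The type of a rank two subsystem is read off from its Cartan matrix; the two off-diagonal
  entries also determine that the first simple root is the long one.\<close>

definition type_C2_long_short :: "('n \<Rightarrow> real^'n) \<Rightarrow> 'n \<Rightarrow> 'n \<Rightarrow> bool" where
  "type_C2_long_short \<alpha> l s \<longleftrightarrow> \<alpha> l \<bullet> coroot (\<alpha> s) = -2 \<and> \<alpha> s \<bullet> coroot (\<alpha> l) = -1"

definition type_G2_long_short :: "('n \<Rightarrow> real^'n) \<Rightarrow> 'n \<Rightarrow> 'n \<Rightarrow> bool" where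
  "type_G2_long_short \<alpha> l s \<longleftrightarrow> \<alpha> l \<bullet> coroot (\<alpha> s) = -3 \<and> \<alpha> s \<bullet> coroot (\<alpha> l) = -1"

definition calibratable_b ::
  "('n \<Rightarrow> real^'n) \<Rightarrow> complex \<Rightarrow> 'n \<Rightarrow> 'n \<Rightarrow> (real^'n \<Rightarrow> complex) \<Rightarrow> bool" where
  "calibratable_b \<alpha> q l s t \<longleftrightarrow>
     (type_C2_long_short \<alpha> l s \<or> type_G2_long_short \<alpha> l s) \<and>
     (\<exists>u\<in>weyl2 \<alpha> l s. torus_act u t (\<alpha> l) = q\<^sup>2 \<and> torus_act u t (\<alpha> s) = 1) \<and>
     t (\<alpha> l) \<noteq> 1 \<and> t (\<alpha> s) \<noteq> 1"

definition calibratable ::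
  "('n \<Rightarrow> real^'n) \<Rightarrow> complex \<Rightarrow> 'n \<Rightarrow> 'n \<Rightarrow> (real^'n \<Rightarrow> complex) \<Rightarrow> bool" where
  "calibratable \<alpha> q i j t \<longleftrightarrow>
     (\<forall>\<beta>\<in>roots2 \<alpha> i j. t \<beta> \<noteq> 1) \<or> calibratable_b \<alpha> q i j t \<or> calibratable_b \<alpha> q j i t"

text \<open>The pairs of simple roots include the pairs with equal entries, for which \<^const>\<open>roots2\<close>
  has rank one.  This only matters in rank one, where there are no other pairs: it excludes the
  weights with $t(X^{\alpha_i}) = 1$, for which the matrix entries defining the module attached
  to the shape have a vanishing denominator.  In rank at least two the condition for equal
  entries follows from the others.\<close>

definition placed_skew_shape ::
  "(real^'n) set \<Rightarrow> ('n \<Rightarrow> real^'n) \<Rightarrow> complex \<Rightarrow> (real^'n \<Rightarrow> complex) \<Rightarrow> (real^'n) set \<Rightarrow> bool" where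
  "placed_skew_shape R \<alpha> q t J \<longleftrightarrow>
     placed_shape R \<alpha> q t J \<and>
     (\<forall>w\<in>tableaux R \<alpha> q t J. \<forall>i j. calibratable \<alpha> q i j (torus_act w t))"

section \<open>The module attached to a placed skew shape\<close>

text \<open>A vector is the function of its coordinates with respect to the basis indexed by the
  standard tableaux; \<^term>\<open>shape_basis F w\<close> is zero when \<^term>\<open>w\<close> is not in \<^term>\<open>F\<close>.\<close>

definition shape_basis ::
  "(real^'n \<Rightarrow> real^'n) set \<Rightarrow> (real^'n \<Rightarrow> real^'n) \<Rightarrow> (real^'n \<Rightarrow> real^'n) \<Rightarrow> complex" where
  "shape_basis F w = (\<lambda>u. if u = w \<and> w \<in> F then 1 else 0)"

definition T_diag ::
  "('n \<Rightarrow> real^'n) \<Rightarrow> complex \<Rightarrow> (real^'n \<Rightarrow> complex) \<Rightarrow> 'n \<Rightarrow> (real^'n \<Rightarrow> real^'n) \<Rightarrow> complex" where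
  "T_diag \<alpha> q t i w = (q - inverse q) / (1 - torus_act w t (- \<alpha> i))"

fun gen_on_basis ::
  "('n \<Rightarrow> real^'n) \<Rightarrow> complex \<Rightarrow> (real^'n \<Rightarrow> complex) \<Rightarrow> (real^'n \<Rightarrow> real^'n) set \<Rightarrow> 'n hgen \<Rightarrow>
     (real^'n \<Rightarrow> real^'n) \<Rightarrow> (real^'n \<Rightarrow> real^'n) \<Rightarrow> complex" where
  "gen_on_basis \<alpha> q t F (GenX \<nu>) w = (\<lambda>u. torus_act w t \<nu> * shape_basis F w u)"
| "gen_on_basis \<alpha> q t F (GenT i) w =
     (\<lambda>u. T_diag \<alpha> q t i w * shape_basis F w u
        + (inverse q + T_diag \<alpha> q t i w) * shape_basis F (refl (\<alpha> i) \<circ> w) u)"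

definition gen_act ::
  "('n \<Rightarrow> real^'n) \<Rightarrow> complex \<Rightarrow> (real^'n \<Rightarrow> complex) \<Rightarrow> (real^'n \<Rightarrow> real^'n) set \<Rightarrow> 'n hgen \<Rightarrow>
     ((real^'n \<Rightarrow> real^'n) \<Rightarrow> complex) \<Rightarrow> (real^'n \<Rightarrow> real^'n) \<Rightarrow> complex" where
  "gen_act \<alpha> q t F g f = (\<lambda>u. \<Sum>w\<in>F. f w * gen_on_basis \<alpha> q t F g w u)"

definition free_act ::
  "('n \<Rightarrow> real^'n) \<Rightarrow> complex \<Rightarrow> (real^'n \<Rightarrow> complex) \<Rightarrow> (real^'n \<Rightarrow> real^'n) set \<Rightarrow> 'n free \<Rightarrow>
     ((real^'n \<Rightarrow> real^'n) \<Rightarrow> complex) \<Rightarrow> (real^'n \<Rightarrow> real^'n) \<Rightarrow> complex" where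
  "free_act \<alpha> q t F p f =
     (\<lambda>u. \<Sum>x\<in>Poly_Mapping.keys p.
        Poly_Mapping.lookup p x * foldr (gen_act \<alpha> q t F) (letters x) f u)"

text \<open>An element of the affine Hecke algebra is a coset, and it acts through any of its
  representatives; for a placed skew shape the result does not depend on the choice.  The
  multiplicative fields of the record are irrelevant for modules.\<close>

definition shape_module ::
  "(real^'n) set \<Rightarrow> ('n \<Rightarrow> real^'n) \<Rightarrow> complex \<Rightarrow> (real^'n \<Rightarrow> complex) \<Rightarrow> (real^'n) set \<Rightarrow>
     ('n free set, (real^'n \<Rightarrow> real^'n) \<Rightarrow> complex) module" where
  "shape_module R \<alpha> q t J =
     (let F = tableaux R \<alpha> q t J in
       \<lparr>carrier = {f. \<forall>w. w \<notin> F \<longrightarrow> f w = 0},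
        monoid.mult = undefined, one = undefined,
        zero = (\<lambda>w. 0), add = (\<lambda>f g w. f w + g w),
        smult = (\<lambda>h f. free_act \<alpha> q t F (SOME p. p \<in> h) f)\<rparr>)"

end

(*
  In a calibrated module a nonzero weight vector of weight t forces t(X^alpha_i) to differ from 1 for
  every simple root, since otherwise T_i produces a generalized weight vector. The scalar part
  d_i = (q - q^-1) / (1 - t(X^-alpha_i)) of T_i is therefore defined on all weight vectors, and the
  intertwiners tau_i = T_i - d_i map weight spaces to weight spaces, with tau_i^2 scalar and nonzero
  exactly when t(X^alpha_i) differs from q^2 and q^-2. When no root of a rank two subsystem takes the
  value 1, the weights met along an alternating word are distinct, and the braid relation for the
  tau_i is the leading term of that for the T_i; the remaining rank two weights are excluded or found
  calibratable by comparing coefficients in the braid relation.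

  Weights separate tableaux because an element of W that fixes t and keeps the roots with value 1
  positive is trivial (Steinberg); this is derived from the simply transitive action of the affine
  Weyl group on alcoves, which is available because the coroot lattice is dual to P. Hence, for m in
  M_wt, tau_x m does not depend on the reduced word of x, and by irreducibility these vectors span M
  and tau_x m vanishes as soon as xw and w invert different roots of P(t). Normalizing the
  tau_x m gives the basis v_w.
*)
theory Submission
  imports Defs "HOL-Library.Function_Algebras"
begin

unbundle no m_inv_syntax

section \<open>Reflections and Weyl groups\<close>

text \<open>The square of an intertwiner is the scalar \<open>g\<close>, zero at q^2 and q^-2; that
  \<open>tau\<close> itself vanishes there needs irreducibility. If n = \<open>tau\<close> i x were
  nonzero, intertwiner words applied to n would span the module. The stabilizer theorem leaves s_i
  as the only element of W leading from n back to the weight of x, and along it n goes to g x = 0,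
  so x = 0. In rank two, a value 1 at a non-simple root makes some intertwiner vanish on a nonzero
  weight vector, because its target weight cannot occur. This pins a simple-root value to e^2 with e
  = q or e = -q^-1, an eigenvalue of T_i. In the excluded cases the braid relation then becomes an
  equation in e that no non-root of unity solves. For the stabilizer, t = exp(b + 2 pi i a). The
  point a need not be regular, so it is perturbed to a + eps b + eps^2 r, where r is fixed by the
  element and positive on the positive roots with value 1. The factor \<open>nrm\<close> reconciles
  two normal forms: \<open>tau\<close> has coefficient 1 on its target, the module formulas have
  q^-1 + d_i.\<close>

lemma refl_add: "refl \<beta> (v + w) = refl \<beta> v + refl \<beta> w"
  by (simp add: refl_def inner_left_distrib scaleR_left_distrib)

lemma refl_scaleR: "refl \<beta> (c *\<^sub>R v) = c *\<^sub>R refl \<beta> v"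
  by (simp add: refl_def scaleR_right_diff_distrib)

lemma linear_refl: "linear (refl \<beta>)"
  by (rule linearI) (simp_all add: refl_add refl_scaleR)

lemma inner_coroot_self: "\<beta> \<noteq> 0 \<Longrightarrow> \<beta> \<bullet> coroot \<beta> = 2"
  by (simp add: coroot_def)

lemma inner_coroot: "v \<bullet> coroot \<beta> = 2 * (v \<bullet> \<beta>) / (\<beta> \<bullet> \<beta>)"
  by (simp add: coroot_def)

lemma refl_self: "\<beta> \<noteq> 0 \<Longrightarrow> refl \<beta> \<beta> = - \<beta>"
  by (simp add: refl_def inner_coroot_self scaleR_2)

lemma refl_involution: "\<beta> \<noteq> 0 \<Longrightarrow> refl \<beta> (refl \<beta> v) = v"
  by (simp add: refl_def inner_diff_left inner_coroot_self algebra_simps scaleR_2)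

lemma inner_refl_refl:
  fixes v w :: "real^'n"
  shows "refl \<beta> v \<bullet> refl \<beta> w = v \<bullet> w"
proof (cases "\<beta> = 0")
  case False
  define a b where "a = v \<bullet> coroot \<beta>" and "b = w \<bullet> coroot \<beta>"
  have a: "a * (\<beta> \<bullet> \<beta>) = 2 * (v \<bullet> \<beta>)" and b: "b * (\<beta> \<bullet> \<beta>) = 2 * (w \<bullet> \<beta>)"
    using False by (simp_all add: a_def b_def inner_coroot)
  have "refl \<beta> v \<bullet> refl \<beta> w
      = v \<bullet> w - b * (v \<bullet> \<beta>) - a * (w \<bullet> \<beta>) + a * b * (\<beta> \<bullet> \<beta>)"
    by (simp add: refl_def inner_diff_left inner_diff_right inner_commute
        flip: a_def b_def)
  moreover have "a * b * (\<beta> \<bullet> \<beta>) = 2 * (b * (v \<bullet> \<beta>))" using a by (simp add: mult.assoc mult.left_commute)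
  moreover have "a * b * (\<beta> \<bullet> \<beta>) = 2 * (a * (w \<bullet> \<beta>))" using b by (simp add: mult.assoc)
  ultimately show ?thesis by linarith
qed (simp add: refl_def)

lemma refl_minus_root: "refl (- \<beta>) = refl \<beta>"
  by (rule ext) (simp add: refl_def coroot_def)

lemma refl_orthogonal_conjugate:
  assumes "linear w" "\<And>x y. w x \<bullet> w y = x \<bullet> y"
  shows "refl (w \<beta>) (w v) = w (refl \<beta> v)"
  using assms by (simp add: refl_def coroot_def linear_diff linear_scale)

lemma coroot_orthogonal_image:
  assumes "linear w" "\<And>x y. w x \<bullet> w y = x \<bullet> y"
  shows "coroot (w \<beta>) = w (coroot \<beta>)"
  using assms by (simp add: coroot_def linear_scale)

lemma refl_in_refl_group: "\<beta> \<in> B \<Longrightarrow> refl \<beta> \<in> refl_group B"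
  using refl_group_step[OF _ refl_group_id] by fastforce

lemma refl_group_comp: "v \<in> refl_group B \<Longrightarrow> w \<in> refl_group B \<Longrightarrow> v \<circ> w \<in> refl_group B"
  by (induction rule: refl_group.induct) (auto simp: comp_assoc intro: refl_group.intros)

lemma refl_group_linear: "w \<in> refl_group B \<Longrightarrow> linear w"
proof (induction rule: refl_group.induct)
  case refl_group_id
  show ?case by (rule linear_id)
next
  case (refl_group_step \<beta> w)
  then show ?case using linear_compose linear_refl by blast
qed

lemma refl_group_inner: "w \<in> refl_group B \<Longrightarrow> w x \<bullet> w y = x \<bullet> y"
  by (induction rule: refl_group.induct) (simp_all add: inner_refl_refl)

lemma refl_group_inverse:
  assumes "w \<in> refl_group B" "0 \<notin> B"
  shows "\<exists>v\<in>refl_group B. v \<circ> w = id \<and> w \<circ> v = id"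
  using assms
proof (induction rule: refl_group.induct)
  case refl_group_id
  show ?case by (rule bexI[of _ id]) (simp_all add: refl_group.refl_group_id)
next
  case (refl_group_step \<beta> w)
  then obtain v where v: "v \<in> refl_group B" "v \<circ> w = id" "w \<circ> v = id" by blast
  have "\<beta> \<noteq> 0" using refl_group_step by auto
  then have r: "refl \<beta> (refl \<beta> x) = x" for x by (rule refl_involution)
  have "v \<circ> refl \<beta> \<in> refl_group B"
    using v refl_group_step by (intro refl_group_comp refl_in_refl_group)
  moreover have "(v \<circ> refl \<beta>) \<circ> (refl \<beta> \<circ> w) = id" "(refl \<beta> \<circ> w) \<circ> (v \<circ> refl \<beta>) = id"
    using v r by (auto simp: fun_eq_iff)
  ultimately show ?case by blast
qed

lemma refl_group_bij: "w \<in> refl_group B \<Longrightarrow> 0 \<notin> B \<Longrightarrow> bij w"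
  using refl_group_inverse by (metis o_bij)

lemma refl_group_inv: "w \<in> refl_group B \<Longrightarrow> 0 \<notin> B \<Longrightarrow> inv w \<in> refl_group B"
  using refl_group_inverse inv_unique_comp by metis

lemma refl_group_mono: "w \<in> refl_group B \<Longrightarrow> B \<subseteq> C \<Longrightarrow> w \<in> refl_group C"
  by (induction rule: refl_group.induct) (auto intro: refl_group.intros)

locale simple_root_system =
  fixes R :: "(real^'n) set" and \<alpha> :: "'n \<Rightarrow> real^'n"
  assumes root_system: "root_system R" and reduced: "reduced_roots R"
    and simple: "simple_roots R \<alpha>"
begin

abbreviation pos :: "(real^'n) set" where "pos \<equiv> pos_roots R \<alpha>"
abbreviation s :: "'n \<Rightarrow> real^'n \<Rightarrow> real^'n" where "s i \<equiv> refl (\<alpha> i)"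
abbreviation P :: "(real^'n) set" where "P \<equiv> weight_lattice \<alpha>"

lemma finite_R: "finite R" and zero_notin_R: "0 \<notin> R" and span_R: "span R = UNIV"
  and refl_root: "\<beta> \<in> R \<Longrightarrow> \<gamma> \<in> R \<Longrightarrow> refl \<beta> \<gamma> \<in> R"
  and coroot_Ints: "\<beta> \<in> R \<Longrightarrow> \<gamma> \<in> R \<Longrightarrow> \<gamma> \<bullet> coroot \<beta> \<in> \<int>"
  using root_system by (auto simp: root_system_def)

lemma root_nonzero: "\<beta> \<in> R \<Longrightarrow> \<beta> \<noteq> 0" using zero_notin_R by auto

lemma simple_root_R [simp]: "\<alpha> i \<in> R" using simple by (auto simp: simple_roots_def)

lemma simple_root_nonzero [simp]: "\<alpha> i \<noteq> 0" using root_nonzero by auto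

lemma inj_simple: "inj \<alpha>" and independent_simple: "independent (range \<alpha>)"
  using simple by (auto simp: simple_roots_def)

lemma span_simple: "span (range \<alpha>) = UNIV"
proof -
  have "R \<subseteq> span (range \<alpha>)"
  proof
    fix \<beta> assume "\<beta> \<in> R"
    then obtain c :: "'n \<Rightarrow> int" where "\<beta> = (\<Sum>i\<in>UNIV. of_int (c i) *\<^sub>R \<alpha> i)"
      using simple unfolding simple_roots_def by blast
    then show "\<beta> \<in> span (range \<alpha>)"
      by (simp add: span_sum span_scale span_base)
  qed
  then show ?thesis using span_R span_minimal[OF _ subspace_span] by blast
qed

lemma neg_root: "\<beta> \<in> R \<Longrightarrow> - \<beta> \<in> R"
  using refl_root[of \<beta> \<beta>] refl_self root_nonzero by metis

lemma s_involution [simp]: "s i (s i v) = v"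
  by (simp add: refl_involution)

lemma s_s_comp [simp]: "s i \<circ> (s i \<circ> w) = w"
  by (auto simp: fun_eq_iff)

lemma s_weyl [simp, intro]: "s i \<in> weyl R" by (simp add: refl_in_refl_group)

lemma weyl_linear: "w \<in> weyl R \<Longrightarrow> linear w" by (rule refl_group_linear)
lemma weyl_inner: "w \<in> weyl R \<Longrightarrow> w x \<bullet> w y = x \<bullet> y" by (rule refl_group_inner)
lemma weyl_bij: "w \<in> weyl R \<Longrightarrow> bij w" using refl_group_bij zero_notin_R by blast
lemma weyl_inv: "w \<in> weyl R \<Longrightarrow> inv w \<in> weyl R" using refl_group_inv zero_notin_R by blast
lemma weyl_comp: "v \<in> weyl R \<Longrightarrow> w \<in> weyl R \<Longrightarrow> v \<circ> w \<in> weyl R" by (rule refl_group_comp)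
lemma weyl_id [simp]: "id \<in> weyl R" by (rule refl_group_id)

lemma weyl_inv_f [simp]: "w \<in> weyl R \<Longrightarrow> inv w (w x) = x"
  using weyl_bij by (simp add: bij_is_inj)
lemma weyl_f_inv [simp]: "w \<in> weyl R \<Longrightarrow> w (inv w x) = x"
  using weyl_bij by (simp add: bij_is_surj surj_f_inv_f)

lemma inv_s [simp]: "inv (s i) = s i"
  by (rule inv_unique_comp) (auto simp: fun_eq_iff)

lemma weyl_inv_comp: "v \<in> weyl R \<Longrightarrow> w \<in> weyl R \<Longrightarrow> inv (v \<circ> w) = inv w \<circ> inv v"
  using o_inv_distrib weyl_bij by blast

lemma weyl_adjoint: "w \<in> weyl R \<Longrightarrow> w x \<bullet> y = x \<bullet> inv w y"
  using weyl_inner[of w x "inv w y"] by simp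

lemma weyl_root: "w \<in> weyl R \<Longrightarrow> \<beta> \<in> R \<Longrightarrow> w \<beta> \<in> R"
  by (induction rule: refl_group.induct) (auto simp: refl_root)

lemma weyl_minus: "w \<in> weyl R \<Longrightarrow> w (- x) = - w x"
  using weyl_linear linear_neg by blast

text \<open>An element is determined by its permutation of R, because R spans the space.\<close>

lemma finite_weyl: "finite (weyl R)"
proof -
  have "inj_on (\<lambda>w. restrict w R) (weyl R)"
  proof (rule inj_onI)
    fix v w assume vw: "v \<in> weyl R" "w \<in> weyl R" "restrict v R = restrict w R"
    have "v x = w x" if "x \<in> R" for x
      using vw(3) that by (metis restrict_apply')
    then have "v x = w x" for x
      using linear_eq_on_span[of v w R x] vw weyl_linear span_R by auto
    then show "v = w" by auto
  qed
  moreover have "(\<lambda>w. restrict w R) ` weyl R \<subseteq> R \<rightarrow>\<^sub>E R"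
    using weyl_root by auto
  moreover have "finite (R \<rightarrow>\<^sub>E R)" using finite_R by (simp add: finite_PiE)
  ultimately show ?thesis by (meson finite_imageD finite_subset)
qed

subsection \<open>Fundamental weights and positive roots\<close>

lemma orthogonal_simple_zero:
  assumes "\<And>i. v \<bullet> \<alpha> i = 0" shows "v = 0"
proof -
  have "v \<bullet> x = 0" for x
  proof -
    have "x \<in> span (range \<alpha>)" using span_simple by simp
    then show ?thesis
      by (induction rule: span_induct_alt) (auto simp: inner_right_distrib assms)
  qed
  then show ?thesis using inner_eq_zero_iff by blast
qed

text \<open>The pairings with the simple coroots are taken as the coordinates of a vector of the
  same space, which is possible because its index type also indexes the simple roots. This gives an
  injective linear endomorphism in finite dimension, hence a bijection.\<close>

lemma ex1_fund_weight: "\<exists>!v. \<forall>j. v \<bullet> coroot (\<alpha> j) = (if i = j then 1 else 0)"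
proof -
  let ?f = "\<lambda>v::real^'n. (\<chi> j. v \<bullet> coroot (\<alpha> j)) :: real^'n"
  have lin: "linear ?f"
    by (rule linearI) (simp_all add: vec_eq_iff inner_left_distrib)
  have z: "v = 0" if "\<And>j. v \<bullet> coroot (\<alpha> j) = 0" for v
    using that by (intro orthogonal_simple_zero) (simp add: coroot_def)
  have "inj ?f"
    using z by (subst linear_injective_0[OF lin]) (auto simp: vec_eq_iff)
  then have "bij ?f" using linear_injective_imp_surjective[OF lin] by (simp add: bij_def)
  then have "\<exists>!v. ?f v = (\<chi> j. if i = j then 1 else 0)"
    unfolding bij_iff by blast
  then show ?thesis by (simp add: vec_eq_iff)
qed

lemma fund_weight_coroot: "fund_weight \<alpha> i \<bullet> coroot (\<alpha> j) = (if i = j then 1 else 0)"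
  using theI'[OF ex1_fund_weight[of i]] unfolding fund_weight_def by blast

lemma fund_weight_simple: "fund_weight \<alpha> i \<bullet> \<alpha> j = (if i = j then (\<alpha> i \<bullet> \<alpha> i) / 2 else 0)"
  using fund_weight_coroot[of i j] by (simp add: coroot_def field_simps split: if_splits)

text \<open>The Weyl vector. Pairing with it serves as height function: among the roots it is
  positive exactly on the positive ones.\<close>

definition \<rho> :: "real^'n" where "\<rho> = (\<Sum>i\<in>UNIV. fund_weight \<alpha> i)"

lemma rho_simple: "\<alpha> j \<bullet> \<rho> = (\<alpha> j \<bullet> \<alpha> j) / 2"
  unfolding \<rho>_def inner_sum_right inner_commute[of "\<alpha> j" "fund_weight \<alpha> _"] fund_weight_simple
  by (subst sum.delta) auto

text \<open>Coordinate at alpha_i in the basis of simple roots; the rescaled fundamental weights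
  form the dual basis.\<close>

definition cf :: "real^'n \<Rightarrow> 'n \<Rightarrow> real" where
  "cf v i = v \<bullet> ((2 / (\<alpha> i \<bullet> \<alpha> i)) *\<^sub>R fund_weight \<alpha> i)"

lemma cf_sum: "cf (\<Sum>i\<in>UNIV. c i *\<^sub>R \<alpha> i) i = c i"
proof -
  have "(\<Sum>i\<in>UNIV. c i *\<^sub>R \<alpha> i) \<bullet> fund_weight \<alpha> i = c i * (\<alpha> i \<bullet> \<alpha> i) / 2"
    unfolding inner_sum_left inner_scaleR_left
    by (subst inner_commute, subst fund_weight_simple) (simp add: if_distrib cong: if_cong)
  then show ?thesis by (simp add: cf_def field_simps)
qed

lemma cf_expand: "v = (\<Sum>i\<in>UNIV. cf v i *\<^sub>R \<alpha> i)"
proof -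
  have "v - (\<Sum>i\<in>UNIV. cf v i *\<^sub>R \<alpha> i) = 0"
  proof -
    have "v \<in> span (range \<alpha>)" using span_simple by simp
    then obtain c where "v = (\<Sum>i\<in>UNIV. c i *\<^sub>R \<alpha> i)"
      unfolding span_finite[OF finite_imageI[OF finite]]
      by (force simp: sum.reindex[OF inj_simple])
    then show ?thesis by (simp add: cf_sum)
  qed
  then show ?thesis by simp
qed

lemma cf_add: "cf (v + w) i = cf v i + cf w i"
  and cf_diff: "cf (v - w) i = cf v i - cf w i"
  and cf_scale: "cf (c *\<^sub>R v) i = c * cf v i"
  and cf_minus: "cf (- v) i = - cf v i"
  unfolding cf_def inner_left_distrib inner_diff_left inner_minus_left inner_scaleR_left
  by (rule HOL.refl)+

lemma cf_simple: "cf (\<alpha> j) i = (if i = j then 1 else 0)"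
  using fund_weight_simple[of i j] by (auto simp: cf_def inner_commute)

lemma cf_root: assumes "\<beta> \<in> R"
  shows "cf \<beta> i \<in> \<int>" "(\<forall>i. 0 \<le> cf \<beta> i) \<or> (\<forall>i. cf \<beta> i \<le> 0)"
proof -
  obtain c :: "'n \<Rightarrow> int" where c: "\<beta> = (\<Sum>i\<in>UNIV. of_int (c i) *\<^sub>R \<alpha> i)"
    "(\<forall>i. 0 \<le> c i) \<or> (\<forall>i. c i \<le> 0)"
    using simple assms unfolding simple_roots_def by blast
  have "cf \<beta> i = of_int (c i)" for i unfolding c(1) by (rule cf_sum)
  then show "cf \<beta> i \<in> \<int>" "(\<forall>i. 0 \<le> cf \<beta> i) \<or> (\<forall>i. cf \<beta> i \<le> 0)" using c(2) by auto
qed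

lemma pos_iff_cf: "\<beta> \<in> pos \<longleftrightarrow> \<beta> \<in> R \<and> (\<forall>i. 0 \<le> cf \<beta> i)"
proof
  assume "\<beta> \<in> pos"
  then obtain c :: "'n \<Rightarrow> nat" where "\<beta> \<in> R" "\<beta> = (\<Sum>i\<in>UNIV. of_nat (c i) *\<^sub>R \<alpha> i)"
    unfolding pos_roots_def by blast
  then show "\<beta> \<in> R \<and> (\<forall>i. 0 \<le> cf \<beta> i)" by (metis cf_sum of_nat_0_le_iff)
next
  assume a: "\<beta> \<in> R \<and> (\<forall>i. 0 \<le> cf \<beta> i)"
  have "\<exists>n. cf \<beta> i = of_nat n" for i
    using a cf_root(1)[of \<beta> i] by (metis Ints_cases nonneg_int_cases of_int_0_le_iff of_int_of_nat_eq)
  then obtain c where "\<And>i. cf \<beta> i = of_nat (c i)" by metis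
  then show "\<beta> \<in> pos" using a cf_expand[of \<beta>] unfolding pos_roots_def by auto
qed

lemma pos_root: "\<beta> \<in> pos \<Longrightarrow> \<beta> \<in> R" by (simp add: pos_roots_def)

lemma finite_pos: "finite pos" using finite_R by (simp add: pos_roots_def)

lemma simple_pos [simp]: "\<alpha> i \<in> pos" by (simp add: pos_iff_cf cf_simple)

lemma pos_or_neg: "\<beta> \<in> R \<Longrightarrow> \<beta> \<in> pos \<or> - \<beta> \<in> pos"
  using cf_root(2)[of \<beta>] neg_root by (auto simp: pos_iff_cf cf_minus)

lemma cf_eq_0: "(\<And>i. cf v i = 0) \<Longrightarrow> v = 0"
  using cf_expand[of v] by simp

lemma rho_cf: "v \<bullet> \<rho> = (\<Sum>i\<in>UNIV. cf v i * (\<alpha> i \<bullet> \<alpha> i) / 2)"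
proof -
  have "v \<bullet> \<rho> = (\<Sum>i\<in>UNIV. cf v i *\<^sub>R \<alpha> i) \<bullet> \<rho>" using cf_expand[of v] by simp
  also have "\<dots> = (\<Sum>i\<in>UNIV. cf v i * (\<alpha> i \<bullet> \<rho>))"
    unfolding inner_sum_left by simp
  finally show ?thesis by (simp add: rho_simple)
qed

lemma rho_pos: assumes "\<beta> \<in> pos" shows "\<beta> \<bullet> \<rho> > 0"
proof -
  have nn: "\<And>i. 0 \<le> cf \<beta> i" and R: "\<beta> \<in> R" using assms by (auto simp: pos_iff_cf)
  obtain i where "cf \<beta> i \<noteq> 0" using cf_eq_0 root_nonzero[OF R] by blast
  then have "cf \<beta> i > 0" using nn[of i] by simp
  then show ?thesis unfolding rho_cf using nn
    by (intro sum_pos2[of _ i]) auto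
qed

lemma pos_neg_exclusive: "\<beta> \<in> pos \<Longrightarrow> - \<beta> \<in> pos \<Longrightarrow> False"
  using rho_pos[of \<beta>] rho_pos[of "- \<beta>"] by simp

lemma not_pos_iff: "\<beta> \<in> R \<Longrightarrow> \<beta> \<notin> pos \<longleftrightarrow> - \<beta> \<in> pos"
  using pos_or_neg pos_neg_exclusive by blast

text \<open>Since R is reduced, a positive root other than alpha_i has a positive coordinate at some
  other alpha_j. The reflection s_i leaves that coordinate alone, and one positive coordinate
  decides the sign of a root.\<close>

lemma s_pos:
  assumes "\<beta> \<in> pos" "\<beta> \<noteq> \<alpha> i" shows "s i \<beta> \<in> pos"
proof -
  have R: "\<beta> \<in> R" and nn: "\<And>j. cf \<beta> j \<ge> 0" using assms by (auto simp: pos_iff_cf)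
  have "\<exists>j. j \<noteq> i \<and> cf \<beta> j \<noteq> 0"
  proof (rule ccontr)
    assume "\<not> ?thesis"
    then have z: "cf \<beta> j = 0" if "j \<noteq> i" for j using that by auto
    have "\<beta> - cf \<beta> i *\<^sub>R \<alpha> i = 0"
      by (rule cf_eq_0) (simp add: cf_diff cf_scale cf_simple z)
    then have b: "\<beta> = cf \<beta> i *\<^sub>R \<alpha> i" by simp
    then have "cf \<beta> i *\<^sub>R \<alpha> i \<in> R" using R by metis
    then have "cf \<beta> i = 1 \<or> cf \<beta> i = -1"
      using reduced by (auto simp: reduced_roots_def)
    then show False using nn[of i] b assms(2) by auto
  qed
  then obtain j where j: "j \<noteq> i" "cf \<beta> j > 0" using nn by (metis less_eq_real_def)
  have "cf (s i \<beta>) j = cf \<beta> j" using j by (simp add: refl_def cf_diff cf_scale cf_simple)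
  moreover have "s i \<beta> \<in> R" using R by (simp add: refl_root)
  ultimately show ?thesis using j cf_root(2)[of "s i \<beta>"] unfolding pos_iff_cf
    by (metis not_le)
qed

text \<open>The pairing is minus the coordinate at alpha_j of s_j alpha_i, which is a positive root
  by \<open>s_pos\<close>.\<close>

lemma simple_inner_nonpos: assumes "i \<noteq> j" shows "\<alpha> i \<bullet> coroot (\<alpha> j) \<le> 0"
proof -
  have "\<alpha> i \<noteq> \<alpha> j" using assms inj_simple by (auto dest: injD)
  then have "s j (\<alpha> i) \<in> pos" by (simp add: s_pos)
  then have "cf (s j (\<alpha> i)) j \<ge> 0" by (simp add: pos_iff_cf)
  then show ?thesis using assms by (simp add: refl_def cf_diff cf_scale cf_simple)
qed

lemma weyl_not_pos: "w \<in> weyl R \<Longrightarrow> \<beta> \<in> R \<Longrightarrow> w \<beta> \<notin> pos \<longleftrightarrow> - w \<beta> \<in> pos"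
  using not_pos_iff weyl_root by blast

subsection \<open>Words in the simple reflections\<close>

definition wprod :: "'n list \<Rightarrow> real^'n \<Rightarrow> real^'n" where
  "wprod is = foldr (\<lambda>i w. s i \<circ> w) is id"

lemma wprod_Nil [simp]: "wprod [] = id"
  and wprod_Cons [simp]: "wprod (i # is) = s i \<circ> wprod is"
  by (simp_all add: wprod_def)

lemma wprod_append: "wprod (is @ js) = wprod is \<circ> wprod js"
  by (induction "is") (simp_all add: comp_assoc)

lemma wprod_weyl [simp]: "wprod is \<in> weyl R"
proof (induction "is")
  case (Cons i "is")
  then show ?case unfolding wprod_Cons by (intro weyl_comp s_weyl)
qed (simp only: wprod_Nil weyl_id)

lemma weyl_conj_refl:
  assumes "w \<in> weyl R" shows "w \<circ> refl \<beta> = refl (w \<beta>) \<circ> w"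
  using refl_orthogonal_conjugate[OF weyl_linear[OF assms], of \<beta>] weyl_inner[OF assms]
  by (auto simp: fun_eq_iff)

text \<open>Otherwise the expansion of beta in nonnegative coordinates would make its squared norm
  nonpositive.\<close>

lemma pos_inner_simple_pos: assumes "\<beta> \<in> pos" shows "\<exists>i. \<beta> \<bullet> \<alpha> i > 0"
proof (rule ccontr)
  assume "\<not> ?thesis"
  then have n: "\<beta> \<bullet> \<alpha> i \<le> 0" for i by (meson not_le)
  have "\<beta> \<bullet> \<beta> = (\<Sum>i\<in>UNIV. cf \<beta> i * (\<beta> \<bullet> \<alpha> i))"
    by (subst (2) cf_expand[of \<beta>]) (simp add: inner_sum_right)
  also have "\<dots> \<le> 0" using n assms
    by (intro sum_nonpos) (auto simp: pos_iff_cf mult_nonneg_nonpos)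
  finally show False using root_nonzero[OF pos_root[OF assms]] inner_gt_zero_iff[of \<beta>] by linarith
qed

text \<open>Induction on height: a simple reflection with positive pairing lowers a non-simple
  positive root and keeps it positive. Heights are real numbers, so the number of positive roots of
  smaller height is the measure.\<close>

lemma root_simple_conjugate: "\<beta> \<in> pos \<Longrightarrow> \<exists>is i. \<beta> = wprod is (\<alpha> i)"
proof (induction "card {\<gamma>\<in>pos. \<gamma> \<bullet> \<rho> < \<beta> \<bullet> \<rho>}" arbitrary: \<beta> rule: less_induct)
  case less
  show ?case
  proof (cases "\<exists>i. \<beta> = \<alpha> i")
    case True
    then obtain i where "\<beta> = \<alpha> i" by blast
    then have "\<beta> = wprod [] (\<alpha> i)" by simp
    then show ?thesis by blast
  next
    case False
    obtain i where i: "\<beta> \<bullet> \<alpha> i > 0" using pos_inner_simple_pos less.prems by blast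
    have p: "s i \<beta> \<in> pos" using s_pos less.prems False by auto
    have lt: "s i \<beta> \<bullet> \<rho> < \<beta> \<bullet> \<rho>"
      using i by (simp add: refl_def inner_diff_left inner_coroot rho_simple)
    have "card {\<gamma>\<in>pos. \<gamma> \<bullet> \<rho> < s i \<beta> \<bullet> \<rho>} < card {\<gamma>\<in>pos. \<gamma> \<bullet> \<rho> < \<beta> \<bullet> \<rho>}"
      using lt p finite_pos by (intro psubset_card_mono) auto
    then obtain js j where "s i \<beta> = wprod js (\<alpha> j)" using less.hyps p by blast
    then have "\<beta> = s i (wprod js (\<alpha> j))" by (metis s_involution)
    then have "\<beta> = wprod (i # js) (\<alpha> j)" by simp
    then show ?thesis by blast
  qed
qed

lemma wprod_rev: "wprod is (wprod (rev is) v) = v"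
  by (induction "is" arbitrary: v) (simp_all add: wprod_append)

text \<open>The Weyl group is generated by the reflections in all roots. For beta = w alpha_i the
  reflection is w s_i w^-1, and the inverse of a word is the reversed word.\<close>

lemma refl_wprod: assumes "\<beta> \<in> R" shows "\<exists>is. refl \<beta> = wprod is"
proof -
  have p: "\<exists>is. refl \<beta> = wprod is" if b: "\<beta> \<in> pos" for \<beta>
  proof -
    obtain "is" i where b: "\<beta> = wprod is (\<alpha> i)" using b root_simple_conjugate by blast
    have "refl \<beta> = refl \<beta> \<circ> (wprod is \<circ> wprod (rev is))" by (simp add: fun_eq_iff wprod_rev)
    also have "\<dots> = (refl \<beta> \<circ> wprod is) \<circ> wprod (rev is)" by (simp only: comp_assoc)
    also have "\<dots> = wprod (is @ [i] @ rev is)"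
      unfolding b weyl_conj_refl[OF wprod_weyl, symmetric] by (simp add: wprod_append comp_assoc)
    finally show ?thesis by blast
  qed
  then show ?thesis using pos_or_neg[OF assms] refl_minus_root[of \<beta>] by metis
qed

lemma weyl_wprod: "w \<in> weyl R \<Longrightarrow> \<exists>is. w = wprod is"
proof (induction rule: refl_group.induct)
  case refl_group_id
  then show ?case by (metis wprod_Nil)
next
  case (refl_group_step \<beta> w)
  then show ?case using refl_wprod wprod_append by metis
qed

text \<open>Exchange condition. Reading the word from the right, the image of alpha_j becomes
  negative at some letter i; just before, it must equal alpha_i by \<open>s_pos\<close>, so s_j can
  be pulled through to cancel that letter.\<close>

lemma exchange:
  assumes "wprod is (\<alpha> j) \<notin> pos"
  shows "\<exists>js. length js < length is \<and> wprod is \<circ> s j = wprod js"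
  using assms
proof (induction "is")
  case Nil
  then show ?case by simp
next
  case (Cons i "is")
  show ?case
  proof (cases "wprod is (\<alpha> j) \<in> pos")
    case True
    then have "wprod is (\<alpha> j) = \<alpha> i" using Cons.prems s_pos by auto
    then have "wprod is \<circ> s j = s i \<circ> wprod is"
      using weyl_conj_refl[of "wprod is" "\<alpha> j"] by simp
    then have "wprod (i # is) \<circ> s j = wprod is" by (simp add: comp_assoc)
    then show ?thesis by (metis length_Cons lessI)
  next
    case False
    then obtain js where "length js < length is" "wprod is \<circ> s j = wprod js"
      using Cons.IH by blast
    then have "length (i # js) < length (i # is)" "wprod (i # is) \<circ> s j = wprod (i # js)"
      by (auto simp: comp_assoc)
    then show ?thesis by blast
  qed
qed

text \<open>A shortest word for w has no last letter j: as w alpha_j is positive, the word without j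
  makes alpha_j negative, and \<open>exchange\<close> would shorten w.\<close>

lemma weyl_simple_pos_imp_id:
  assumes "w \<in> weyl R" "\<And>i. w (\<alpha> i) \<in> pos" shows "w = id"
proof -
  obtain "is" where is0: "w = wprod is" using weyl_wprod assms by blast
  define n where "n = (LEAST n. \<exists>is. w = wprod is \<and> length is = n)"
  have "\<exists>is. w = wprod is \<and> length is = n" unfolding n_def
    by (rule LeastI_ex) (use is0 in blast)
  then obtain "is" where is1: "w = wprod is" "length is = n" by blast
  have min: "n \<le> length js" if "w = wprod js" for js
    unfolding n_def by (rule Least_le) (use that in blast)
  show ?thesis
  proof (cases "is" rule: rev_cases)
    case Nil
    then show ?thesis using is1 by simp
  next
    case (snoc ks j)
    have w: "w = wprod ks \<circ> s j" using is1 snoc by (simp add: wprod_append)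
    have "w (\<alpha> j) = - wprod ks (\<alpha> j)" by (simp add: w refl_self weyl_minus)
    then have "wprod ks (\<alpha> j) \<notin> pos" using assms(2)[of j] pos_neg_exclusive by metis
    then obtain js where "length js < length ks" "w = wprod js" using exchange w by metis
    then show ?thesis using min[of js] is1 snoc by simp
  qed
qed

lemma weyl_pos_imp_id:
  assumes "w \<in> weyl R" "inversions R \<alpha> w = {}" shows "w = id"
proof (rule weyl_simple_pos_imp_id[OF assms(1)])
  fix i show "w (\<alpha> i) \<in> pos"
    using assms weyl_not_pos[of w "\<alpha> i"] by (auto simp: inversions_def)
qed

text \<open>Applying s_i to w beta changes its sign only when w beta is alpha_i or its
  negative.\<close>

lemma inversions_s_up:
  assumes "w \<in> weyl R" "inv w (\<alpha> i) \<in> pos"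
  shows "inversions R \<alpha> (s i \<circ> w) = insert (inv w (\<alpha> i)) (inversions R \<alpha> w)"
    "inv w (\<alpha> i) \<notin> inversions R \<alpha> w"
proof -
  show "inv w (\<alpha> i) \<notin> inversions R \<alpha> w"
    using assms pos_neg_exclusive[of "\<alpha> i"] by (auto simp: inversions_def)
  have "- s i (w \<beta>) \<in> pos \<longleftrightarrow> \<beta> = inv w (\<alpha> i) \<or> - w \<beta> \<in> pos" if b: "\<beta> \<in> pos" for \<beta>
  proof (cases "\<beta> = inv w (\<alpha> i)")
    case True
    then show ?thesis using assms by (simp add: refl_self)
  next
    case False
    have 1: "w \<beta> \<noteq> \<alpha> i" using False assms(1) by (metis weyl_inv_f)
    have 2: "- w \<beta> \<noteq> \<alpha> i"
    proof
      assume "- w \<beta> = \<alpha> i"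
      then have "inv w (\<alpha> i) = - \<beta>" using assms(1) by (metis weyl_inv_f weyl_minus)
      then show False using assms(2) b pos_neg_exclusive by metis
    qed
    have m: "s i (- w \<beta>) = - s i (w \<beta>)" by (simp add: weyl_minus)
    have wb: "w \<beta> \<in> R" using assms b pos_root weyl_root by blast
    show ?thesis
      using s_pos[of "- w \<beta>" i] s_pos[of "w \<beta>" i] 1 2 m False pos_or_neg[OF wb]
        pos_neg_exclusive by metis
  qed
  then show "inversions R \<alpha> (s i \<circ> w) = insert (inv w (\<alpha> i)) (inversions R \<alpha> w)"
    using assms by (auto simp: inversions_def)
qed

lemma finite_inversions: "finite (inversions R \<alpha> w)"
  using finite_pos by (simp add: inversions_def)

definition len :: "(real^'n \<Rightarrow> real^'n) \<Rightarrow> nat" where "len w = card (inversions R \<alpha> w)"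

lemma len_s_up: "w \<in> weyl R \<Longrightarrow> inv w (\<alpha> i) \<in> pos \<Longrightarrow> len (s i \<circ> w) = Suc (len w)"
  using inversions_s_up finite_inversions by (simp add: len_def)

lemma inv_s_comp: "w \<in> weyl R \<Longrightarrow> inv (s i \<circ> w) (\<alpha> i) = - inv w (\<alpha> i)"
  by (simp add: weyl_inv_comp refl_self weyl_minus weyl_inv)

lemma inversions_s_down:
  assumes "w \<in> weyl R" "inv w (\<alpha> i) \<notin> pos"
  shows "inversions R \<alpha> w = insert (- inv w (\<alpha> i)) (inversions R \<alpha> (s i \<circ> w))"
    "- inv w (\<alpha> i) \<notin> inversions R \<alpha> (s i \<circ> w)" "- inv w (\<alpha> i) \<in> pos"
proof -
  show p: "- inv w (\<alpha> i) \<in> pos"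
    using assms weyl_not_pos[OF weyl_inv[OF assms(1)], of "\<alpha> i"] by simp
  then have q: "inv (s i \<circ> w) (\<alpha> i) \<in> pos" using inv_s_comp assms by simp
  have w: "s i \<circ> w \<in> weyl R" using assms by (simp add: weyl_comp)
  show "inversions R \<alpha> w = insert (- inv w (\<alpha> i)) (inversions R \<alpha> (s i \<circ> w))"
    "- inv w (\<alpha> i) \<notin> inversions R \<alpha> (s i \<circ> w)"
    using inversions_s_up[OF w q] inv_s_comp[OF assms(1)] by simp_all
qed

lemma len_s_down: "w \<in> weyl R \<Longrightarrow> inv w (\<alpha> i) \<notin> pos \<Longrightarrow> len w = Suc (len (s i \<circ> w))"
  using inversions_s_down finite_inversions by (simp add: len_def)

lemma inversions_id: "inversions R \<alpha> id = {}"
  using pos_neg_exclusive by (auto simp: inversions_def)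

lemma len_id [simp]: "len id = 0"
  by (simp add: len_def inversions_id)

lemma len_0_imp_id: "w \<in> weyl R \<Longrightarrow> len w = 0 \<Longrightarrow> w = id"
  using weyl_pos_imp_id finite_inversions by (simp add: len_def)

lemma ex_descent:
  assumes "w \<in> weyl R" "w \<noteq> id" shows "\<exists>i. inv w (\<alpha> i) \<notin> pos"
proof (rule ccontr)
  assume "\<not> ?thesis"
  then have "inv w = id" using weyl_simple_pos_imp_id[OF weyl_inv[OF assms(1)]] by blast
  then show False using assms by (metis inv_id inv_inv_eq weyl_bij)
qed

end

context simple_root_system begin

subsection \<open>The weight lattice\<close>

lemma sum_fund_weight_coroot:
  "(\<Sum>i\<in>UNIV. c i *\<^sub>R fund_weight \<alpha> i) \<bullet> coroot (\<alpha> j) = c j"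
  unfolding inner_sum_left inner_scaleR_left fund_weight_coroot
  by (simp add: if_distrib cong: if_cong)

lemma fund_weight_expand: "v = (\<Sum>i\<in>UNIV. (v \<bullet> coroot (\<alpha> i)) *\<^sub>R fund_weight \<alpha> i)"
proof -
  have "v - (\<Sum>i\<in>UNIV. (v \<bullet> coroot (\<alpha> i)) *\<^sub>R fund_weight \<alpha> i) = 0" (is "?d = 0")
  proof (rule orthogonal_simple_zero)
    fix j
    have "?d \<bullet> coroot (\<alpha> j) = 0" by (simp add: inner_diff_left sum_fund_weight_coroot)
    then show "?d \<bullet> \<alpha> j = 0" by (simp add: coroot_def)
  qed
  then show ?thesis by simp
qed

lemma weight_lattice_iff: "v \<in> P \<longleftrightarrow> (\<forall>j. v \<bullet> coroot (\<alpha> j) \<in> \<int>)"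
proof
  assume "v \<in> P"
  then obtain c :: "'n \<Rightarrow> int" where "v = (\<Sum>i\<in>UNIV. of_int (c i) *\<^sub>R fund_weight \<alpha> i)"
    unfolding weight_lattice_def by blast
  then show "\<forall>j. v \<bullet> coroot (\<alpha> j) \<in> \<int>" by (simp add: sum_fund_weight_coroot)
next
  assume "\<forall>j. v \<bullet> coroot (\<alpha> j) \<in> \<int>"
  then have "\<forall>j. \<exists>c::int. v \<bullet> coroot (\<alpha> j) = of_int c" by (auto elim: Ints_cases)
  then obtain c :: "'n \<Rightarrow> int" where "\<And>j. v \<bullet> coroot (\<alpha> j) = of_int (c j)" by metis
  then have "v = (\<Sum>i\<in>UNIV. of_int (c i) *\<^sub>R fund_weight \<alpha> i)" using fund_weight_expand[of v] by simp
  then show "v \<in> P" unfolding weight_lattice_def by blast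
qed

lemma P_add [intro]: "v \<in> P \<Longrightarrow> w \<in> P \<Longrightarrow> v + w \<in> P"
  and P_diff [intro]: "v \<in> P \<Longrightarrow> w \<in> P \<Longrightarrow> v - w \<in> P"
  and P_minus [intro]: "v \<in> P \<Longrightarrow> - v \<in> P"
  and P_zero [simp]: "0 \<in> P"
  by (auto simp: weight_lattice_iff inner_left_distrib inner_diff_left)

lemma fund_weight_P [simp]: "fund_weight \<alpha> i \<in> P"
  by (simp add: weight_lattice_iff fund_weight_coroot)

lemma root_P: "\<beta> \<in> R \<Longrightarrow> \<beta> \<in> P"
  by (simp add: weight_lattice_iff coroot_Ints)

lemma simple_P [simp]: "\<alpha> i \<in> P" by (simp add: root_P)

lemma P_scale_Int: "c \<in> \<int> \<Longrightarrow> v \<in> P \<Longrightarrow> c *\<^sub>R v \<in> P"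
  by (simp add: weight_lattice_iff)

lemma s_P [intro]: "v \<in> P \<Longrightarrow> s i v \<in> P"
  unfolding refl_def by (rule P_diff, assumption, rule P_scale_Int) (auto simp: weight_lattice_iff[of v])

lemma weyl_P: "w \<in> weyl R \<Longrightarrow> v \<in> P \<Longrightarrow> w v \<in> P"
proof -
  have "v \<in> P \<Longrightarrow> wprod is v \<in> P" for "is" by (induction "is") auto
  then show "w \<in> weyl R \<Longrightarrow> v \<in> P \<Longrightarrow> w v \<in> P" using weyl_wprod by metis
qed

lemma coroot_weyl: "w \<in> weyl R \<Longrightarrow> coroot (w \<beta>) = w (coroot \<beta>)"
  by (simp add: coroot_orthogonal_image weyl_linear weyl_inner)

text \<open>Membership in P speaks of the simple coroots only; every coroot is, up to sign,
  conjugate to a simple one, and W preserves P.\<close>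

lemma P_coroot_Ints: assumes "\<beta> \<in> R" "v \<in> P" shows "v \<bullet> coroot \<beta> \<in> \<int>"
proof -
  have p: "v \<bullet> coroot \<beta> \<in> \<int>" if b: "\<beta> \<in> pos" for \<beta>
  proof -
    obtain "is" i where "\<beta> = wprod is (\<alpha> i)" using b root_simple_conjugate by blast
    then have "v \<bullet> coroot \<beta> = inv (wprod is) v \<bullet> coroot (\<alpha> i)"
      using weyl_adjoint[of "wprod is" "coroot (\<alpha> i)" v]
      by (simp add: coroot_weyl inner_commute)
    then show ?thesis using weyl_P[OF weyl_inv assms(2)] by (simp add: weight_lattice_iff)
  qed
  have "coroot (- \<beta>) = - coroot \<beta>" by (simp add: coroot_def)
  then show ?thesis using p[of \<beta>] p[of "- \<beta>"] pos_or_neg[OF assms(1)] by auto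
qed

text \<open>Defined as the dual lattice of P: the pairings with the fundamental weights are the
  coordinates with respect to the simple coroots.\<close>

definition coroot_lattice :: "(real^'n) set" where
  "coroot_lattice = {v. \<forall>i. v \<bullet> fund_weight \<alpha> i \<in> \<int>}"

lemma coroot_lattice_iff: "v \<in> coroot_lattice \<longleftrightarrow> (\<forall>\<nu>\<in>P. v \<bullet> \<nu> \<in> \<int>)"
proof
  assume v: "v \<in> coroot_lattice"
  show "\<forall>\<nu>\<in>P. v \<bullet> \<nu> \<in> \<int>"
  proof
    fix \<nu> assume "\<nu> \<in> P"
    have "v \<bullet> \<nu> = (\<Sum>i\<in>UNIV. (\<nu> \<bullet> coroot (\<alpha> i)) * (v \<bullet> fund_weight \<alpha> i))"
      by (subst fund_weight_expand[of \<nu>]) (simp add: inner_sum_right)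
    then show "v \<bullet> \<nu> \<in> \<int>" using v \<open>\<nu> \<in> P\<close>
      by (auto simp: coroot_lattice_def weight_lattice_iff intro!: Ints_mult)
  qed
qed (auto simp: coroot_lattice_def)

lemma coroot_lattice_add: "v \<in> coroot_lattice \<Longrightarrow> w \<in> coroot_lattice \<Longrightarrow> v + w \<in> coroot_lattice"
  and coroot_lattice_diff: "v \<in> coroot_lattice \<Longrightarrow> w \<in> coroot_lattice \<Longrightarrow> v - w \<in> coroot_lattice"
  and coroot_lattice_0: "0 \<in> coroot_lattice"
  by (auto simp: coroot_lattice_def inner_left_distrib inner_diff_left)

lemma coroot_lattice_weyl: "w \<in> weyl R \<Longrightarrow> v \<in> coroot_lattice \<Longrightarrow> w v \<in> coroot_lattice"
  by (simp add: coroot_lattice_iff weyl_adjoint weyl_P weyl_inv)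

lemma coroot_in_lattice: "\<beta> \<in> R \<Longrightarrow> coroot \<beta> \<in> coroot_lattice"
  using P_coroot_Ints by (simp add: coroot_lattice_iff inner_commute)

lemma coroot_expand: "v = (\<Sum>i\<in>UNIV. (v \<bullet> fund_weight \<alpha> i) *\<^sub>R coroot (\<alpha> i))"
proof -
  have "cf v i *\<^sub>R \<alpha> i = (v \<bullet> fund_weight \<alpha> i) *\<^sub>R coroot (\<alpha> i)" for i
    by (simp add: cf_def coroot_def)
  then show ?thesis using cf_expand[of v] by simp
qed

lemma int_mult_less_4:
  fixes a b :: int assumes "a * b < 4" "a \<le> -1" "b \<le> -1" shows "a = -1 \<or> b = -1"
proof (rule ccontr)
  assume "\<not> ?thesis"
  then have "- a \<ge> 2" "- b \<ge> 2" using assms by auto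
  then have "2 * 2 \<le> (- a) * (- b)" by (intro mult_mono) auto
  then show False using assms by simp
qed

lemma Cauchy_Schwarz_strict:
  fixes x y :: "real^'n"
  assumes "x \<noteq> 0" "\<And>c. y \<noteq> c *\<^sub>R x"
  shows "(x \<bullet> y)\<^sup>2 < (x \<bullet> x) * (y \<bullet> y)"
proof -
  let ?c = "(x \<bullet> y) / (x \<bullet> x)"
  have xx: "x \<bullet> x > 0" using assms by simp
  have "y - ?c *\<^sub>R x \<noteq> 0" using assms(2) by auto
  then have "(y - ?c *\<^sub>R x) \<bullet> (y - ?c *\<^sub>R x) > 0" by simp
  also have "(y - ?c *\<^sub>R x) \<bullet> (y - ?c *\<^sub>R x) = y \<bullet> y - (x \<bullet> y)\<^sup>2 / (x \<bullet> x)"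
    using xx by (simp add: inner_diff_left inner_diff_right inner_commute power2_eq_square)
  finally show ?thesis using xx by (simp add: field_simps)
qed

text \<open>The product is 4 cos^2 of the angle between x and y; non-parallel vectors make it
  strict.\<close>

lemma cartan_product_less_4:
  fixes x y :: "real^'n"
  assumes "x \<noteq> 0" "y \<noteq> 0" "\<And>c. y \<noteq> c *\<^sub>R x"
  shows "(x \<bullet> coroot y) * (y \<bullet> coroot x) < 4"
proof -
  have p: "x \<bullet> x > 0" "y \<bullet> y > 0" using assms by auto
  have "(x \<bullet> coroot y) * (y \<bullet> coroot x) = 4 * (x \<bullet> y)\<^sup>2 / ((x \<bullet> x) * (y \<bullet> y))"
    by (simp add: inner_coroot power2_eq_square inner_commute)
  then show ?thesis using Cauchy_Schwarz_strict[OF assms(1) assms(3)] p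
    by (simp add: divide_less_eq)
qed

lemma root_not_multiple:
  assumes "\<beta> \<in> R" "\<gamma> \<in> R" "\<gamma> \<noteq> \<beta>" "\<gamma> \<noteq> - \<beta>" shows "\<gamma> \<noteq> c *\<^sub>R \<beta>"
proof
  assume g: "\<gamma> = c *\<^sub>R \<beta>"
  then have "c = 1 \<or> c = -1" using reduced assms by (auto simp: reduced_roots_def)
  then show False using g assms by auto
qed

text \<open>At an obtuse angle both Cartan integers are negative and their product is below 4, so
  one of them is -1. The corresponding reflection adds one coroot to the other.\<close>

lemma coroot_add_coroot:
  assumes "\<beta> \<in> R" "\<gamma> \<in> R" "\<gamma> \<noteq> - \<beta>" "\<gamma> \<bullet> \<beta> < 0"
  shows "\<exists>\<delta>\<in>R. coroot \<delta> = coroot \<beta> + coroot \<gamma>"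
proof -
  have ne: "\<gamma> \<noteq> \<beta>" using assms(4) inner_ge_zero[of \<beta>] by (metis not_le)
  have nz: "\<beta> \<noteq> 0" "\<gamma> \<noteq> 0" using assms root_nonzero by auto
  obtain a b :: int where ab: "\<beta> \<bullet> coroot \<gamma> = of_int a" "\<gamma> \<bullet> coroot \<beta> = of_int b"
    using coroot_Ints assms by (meson Ints_cases)
  have lt: "of_int a * of_int b < (4::real)"
    using cartan_product_less_4[OF nz root_not_multiple[OF assms(1,2) ne assms(3)]] ab by simp
  have "\<beta> \<bullet> coroot \<gamma> < 0" "\<gamma> \<bullet> coroot \<beta> < 0"
    using assms(4) nz by (auto simp: inner_coroot inner_commute divide_neg_pos)
  then have "a \<le> -1" "b \<le> -1" using ab by auto
  moreover have "a * b < 4" using lt by (metis of_int_less_iff of_int_mult of_int_numeral)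
  ultimately have "a = -1 \<or> b = -1" using int_mult_less_4 by blast
  then show ?thesis
  proof
    assume "b = -1"
    have "coroot (refl \<gamma> \<beta>) = refl \<gamma> (coroot \<beta>)"
      by (rule coroot_orthogonal_image[OF linear_refl inner_refl_refl])
    also have "\<dots> = coroot \<beta> - (\<gamma> \<bullet> coroot \<beta>) *\<^sub>R coroot \<gamma>"
      by (simp add: refl_def coroot_def inner_commute)
    finally show ?thesis using ab \<open>b = -1\<close> refl_root[OF assms(2,1)] by auto
  next
    assume "a = -1"
    have "coroot (refl \<beta> \<gamma>) = refl \<beta> (coroot \<gamma>)"
      by (rule coroot_orthogonal_image[OF linear_refl inner_refl_refl])
    also have "\<dots> = coroot \<gamma> - (\<beta> \<bullet> coroot \<gamma>) *\<^sub>R coroot \<beta>"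
      by (simp add: refl_def coroot_def inner_commute)
    finally show ?thesis using ab \<open>a = -1\<close> refl_root[OF assms(1,2)] by (auto simp: add.commute)
  qed
qed

lemma Ints_pos_ge_1: "(x::real) \<in> \<int> \<Longrightarrow> x > 0 \<Longrightarrow> x \<ge> 1"
  by (auto elim!: Ints_cases)

text \<open>A nonzero dominant element of the coroot lattice lies above some positive coroot; a highest
  such coroot pairs with it at least as with itself.\<close>

lemma coroot_lattice_minuscule_zero:
  assumes v: "v \<in> coroot_lattice" and v01: "\<And>\<beta>. \<beta> \<in> pos \<Longrightarrow> v \<bullet> \<beta> = 0 \<or> v \<bullet> \<beta> = 1"
  shows "v = 0"
proof (rule ccontr)
  assume "v \<noteq> 0"
  define c where "c x i = x \<bullet> fund_weight \<alpha> i" for x i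
  have expand: "x = (\<Sum>i\<in>UNIV. c x i *\<^sub>R coroot (\<alpha> i))" for x
    unfolding c_def by (rule coroot_expand)
  have dom: "v \<bullet> \<alpha> i \<ge> 0" for i using v01[of "\<alpha> i"] by auto
  \<comment> \<open>Split v = p - n by the signs of its coroot coordinates. Distinct simple coroots
    are mutually obtuse, so p and n pair nonpositively, while dominance makes v pair nonnegatively
    with n; together the squared norm of n is at most 0.\<close>
  have c_nonneg: "c v i \<ge> 0" for i
  proof -
    define n where "n = (\<Sum>i\<in>UNIV. max 0 (- c v i) *\<^sub>R coroot (\<alpha> i))"
    define p where "p = (\<Sum>i\<in>UNIV. max 0 (c v i) *\<^sub>R coroot (\<alpha> i))"
    have vpn: "v = p - n"
    proof -
      have "p - n = (\<Sum>i\<in>UNIV. c v i *\<^sub>R coroot (\<alpha> i))"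
        unfolding p_def n_def sum_subtractf[symmetric] scaleR_diff_left[symmetric]
        by (intro sum.cong) (auto simp: max_def)
      then show ?thesis using expand by simp
    qed
    have pn: "p \<bullet> n \<le> 0"
      unfolding p_def n_def inner_sum_left inner_sum_right
    proof (intro sum_nonpos)
      fix i j
      show "(max 0 (c v i) *\<^sub>R coroot (\<alpha> i)) \<bullet> (max 0 (- c v j) *\<^sub>R coroot (\<alpha> j)) \<le> 0"
      proof (cases "i = j")
        case False
        then have "\<alpha> i \<bullet> coroot (\<alpha> j) \<le> 0" by (rule simple_inner_nonpos)
        then have "coroot (\<alpha> i) \<bullet> coroot (\<alpha> j) \<le> 0"
          by (simp add: coroot_def[of "\<alpha> i"] divide_nonpos_nonneg)
        then show ?thesis by (simp add: mult_nonneg_nonpos)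
      qed (auto simp: max_def)
    qed
    have "v \<bullet> n \<ge> 0" unfolding n_def inner_sum_right
      by (intro sum_nonneg) (simp add: coroot_def dom)
    then have "n \<bullet> n \<le> 0" using vpn pn by (simp add: inner_diff_left)
    then have "n = 0" using inner_gt_zero_iff[of n] by linarith
    have "n \<bullet> fund_weight \<alpha> i = max 0 (- c v i)"
      unfolding n_def inner_sum_left inner_scaleR_left
      by (subst inner_commute, subst fund_weight_coroot) (simp add: if_distrib cong: if_cong)
    then show ?thesis using \<open>n = 0\<close> by simp
  qed
  \<comment> \<open>The positive roots whose coroot lies below v in every coordinate. One with
    coroot of maximal height plays the role of the highest coroot.\<close>
  define B where "B = {\<beta>\<in>pos. \<forall>i. c (coroot \<beta>) i \<le> c v i}"
  have "\<exists>i. c v i \<noteq> 0"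
  proof (rule ccontr)
    assume "\<not> ?thesis"
    then show False using expand[of v] \<open>v \<noteq> 0\<close> by simp
  qed
  then obtain i where "c v i \<noteq> 0" by blast
  moreover have cint: "c v j \<in> \<int>" for j using v by (simp add: c_def coroot_lattice_def)
  ultimately have "c v i \<ge> 1" using c_nonneg[of i] Ints_pos_ge_1[OF cint] by simp
  then have "\<alpha> i \<in> B" using c_nonneg
    by (auto simp: B_def c_def inner_commute[of "coroot _"] fund_weight_coroot)
  then have "B \<noteq> {}" by blast
  moreover have finB: "finite B" using finite_pos by (simp add: B_def)
  ultimately have "Max ((\<lambda>\<beta>. coroot \<beta> \<bullet> \<rho>) ` B) \<in> (\<lambda>\<beta>. coroot \<beta> \<bullet> \<rho>) ` B" by (intro Max_in) auto
  then obtain \<beta> where b: "\<beta> \<in> B" and bm: "coroot \<beta> \<bullet> \<rho> = Max ((\<lambda>\<beta>. coroot \<beta> \<bullet> \<rho>) ` B)" by auto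
  have bmax: "coroot \<gamma> \<bullet> \<rho> \<le> coroot \<beta> \<bullet> \<rho>" if "\<gamma> \<in> B" for \<gamma>
    unfolding bm using that finB by (intro Max_ge) auto
  have bp: "\<beta> \<in> pos" and bR: "\<beta> \<in> R" using b pos_root by (auto simp: B_def)
  \<comment> \<open>Where v and the coroot of beta differ in coordinate k they differ by at least 1.
    If alpha_k were obtuse to beta, the sum of their coroots would be a higher coroot still below v.
    So every term is nonnegative, and as beta pairs to 2 with its own coroot, v pairs to at least 2
    with beta.\<close>
  have "(v - coroot \<beta>) \<bullet> \<beta> \<ge> 0"
  proof -
    have "c (v - coroot \<beta>) k * (coroot (\<alpha> k) \<bullet> \<beta>) \<ge> 0" for k
    proof (cases "c (v - coroot \<beta>) k = 0")
      case False
      have cd: "c (v - coroot \<beta>) k = c v k - c (coroot \<beta>) k" by (simp add: c_def inner_diff_left)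
      have "c (coroot \<beta>) k \<in> \<int>" using coroot_in_lattice[OF bR] by (simp add: c_def coroot_lattice_def)
      then have "c v k - c (coroot \<beta>) k \<in> \<int>" using cint by simp
      moreover have "c v k - c (coroot \<beta>) k > 0" using b False cd by (auto simp: B_def less_eq_real_def)
      ultimately have ge: "c v k - c (coroot \<beta>) k \<ge> 1" by (auto elim!: Ints_cases)
      have "\<alpha> k \<bullet> \<beta> \<ge> 0"
      proof (rule ccontr)
        assume "\<not> ?thesis"
        then have neg: "\<alpha> k \<bullet> \<beta> < 0" by simp
        have "\<alpha> k \<noteq> - \<beta>" using bp pos_neg_exclusive[of \<beta>] by (metis simple_pos)
        then obtain \<delta> where d: "\<delta> \<in> R" "coroot \<delta> = coroot \<beta> + coroot (\<alpha> k)"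
          using coroot_add_coroot[OF bR simple_root_R[of k]] neg by blast
        have dr: "coroot \<delta> \<bullet> \<rho> > coroot \<beta> \<bullet> \<rho>"
          by (simp add: d inner_left_distrib coroot_def[of "\<alpha> k"] rho_simple)
        have "coroot \<beta> \<bullet> \<rho> > 0" using rho_pos[OF bp] root_nonzero[OF bR] by (simp add: coroot_def)
        then have "coroot \<delta> \<bullet> \<rho> > 0" using dr by simp
        then have "(2 / (\<delta> \<bullet> \<delta>)) * (\<delta> \<bullet> \<rho>) > 0" by (simp add: coroot_def)
        moreover have "2 / (\<delta> \<bullet> \<delta>) > 0" using root_nonzero[OF d(1)] by simp
        ultimately have "\<delta> \<bullet> \<rho> > 0" by (rule zero_less_mult_pos)
        then have dp: "\<delta> \<in> pos" using not_pos_iff[OF d(1)] rho_pos[of "- \<delta>"] by auto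
        have "\<forall>i. c (coroot \<delta>) i \<le> c v i"
        proof
          fix i show "c (coroot \<delta>) i \<le> c v i"
            using b ge by (cases "i = k")
             (auto simp: B_def c_def d inner_left_distrib inner_commute[of "coroot (\<alpha> _)"] fund_weight_coroot)
        qed
        then have "\<delta> \<in> B" using dp by (simp add: B_def)
        then show False using bmax dr by fastforce
      qed
      then have "coroot (\<alpha> k) \<bullet> \<beta> \<ge> 0" by (simp add: coroot_def)
      then show ?thesis using ge cd by simp
    qed simp
    then show ?thesis by (subst expand) (simp add: inner_sum_left sum_nonneg)
  qed
  then have "v \<bullet> \<beta> \<ge> 2"
    using inner_coroot_self[OF root_nonzero[OF bR]] by (simp add: inner_diff_right inner_commute)
  then show False using v01[OF bp] by auto
qed

end

fun altw :: "'n \<Rightarrow> 'n \<Rightarrow> nat \<Rightarrow> 'n list" where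
  "altw i j 0 = []"
| "altw i j (Suc k) = i # altw j i k"

lemma length_altw [simp]: "length (altw i j k) = k"
  by (induction k arbitrary: i j) auto

lemma altw_snoc: "altw i j (Suc k) = altw i j k @ [if even k then i else j]"
  by (induction k arbitrary: i j) auto

lemma rev_altw: "rev (altw i j k) = (if even k then altw j i k else altw i j k)"
proof (induction k arbitrary: i j)
  case (Suc k)
  have "rev (altw i j (Suc k)) = rev (altw j i k) @ [i]" by simp
  also have "\<dots> = (if even (Suc k) then altw j i (Suc k) else altw i j (Suc k))"
    unfolding Suc.IH altw_snoc by simp
  finally show ?case .
qed simp

context simple_root_system begin

subsection \<open>Rank two\<close>

text \<open>The positive roots of the subsystem generated by two simple roots in the order in which the
  alternating word crosses them.\<close>

definition alt_root :: "'n \<Rightarrow> 'n \<Rightarrow> nat \<Rightarrow> real^'n" where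
  "alt_root i j k = wprod (altw i j k) (\<alpha> (if even k then i else j))"

text \<open>The interface between the computations for the individual Cartan matrices and the
  uniform arguments about alternating words, which use only these facts.\<close>

definition rank2 :: "'n \<Rightarrow> 'n \<Rightarrow> nat \<Rightarrow> bool" where
  "rank2 i j m \<longleftrightarrow>
     (\<forall>k<m. \<exists>p\<ge>0. \<exists>r\<ge>0. alt_root i j k = p *\<^sub>R \<alpha> i + r *\<^sub>R \<alpha> j) \<and>
     (\<forall>\<beta>\<in>roots2 \<alpha> i j. \<exists>k<m. \<beta> = alt_root i j k \<or> \<beta> = - alt_root i j k) \<and>
     wprod (altw i j m) = wprod (altw j i m) \<and> cox_order \<alpha> i j = m"

lemma roots2_induct:
  assumes "\<alpha> i \<in> S" "\<alpha> j \<in> S" "\<And>\<beta>. \<beta> \<in> S \<Longrightarrow> s i \<beta> \<in> S \<and> s j \<beta> \<in> S"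
  shows "roots2 \<alpha> i j \<subseteq> S"
proof -
  have "w \<beta> \<in> S" if "w \<in> refl_group {\<alpha> i, \<alpha> j}" "\<beta> \<in> S" for w \<beta>
    using that by (induction rule: refl_group.induct) (use assms in auto)
  then show ?thesis using assms unfolding roots2_def weyl2_def by auto
qed

text \<open>The powers of s_i s_j and of s_j s_i with the same exponent are inverse to each
  other.\<close>

lemma cox_order_sym: "cox_order \<alpha> i j = cox_order \<alpha> j i"
proof -
  have 1: "(s i \<circ> s j) ^^ m = id" if "(s j \<circ> s i) ^^ m = id" for i j m
  proof -
    have c: "((s i \<circ> s j) ^^ m) (((s j \<circ> s i) ^^ m) v) = v" for v
    proof (induction m arbitrary: v)
      case (Suc m)
      have "((s i \<circ> s j) ^^ Suc m) (((s j \<circ> s i) ^^ Suc m) v)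
        = ((s i \<circ> s j) ^^ m) ((s i \<circ> s j) ((s j \<circ> s i) (((s j \<circ> s i) ^^ m) v)))"
        by (simp only: funpow_Suc_right[of m "s i \<circ> s j"] funpow.simps(2)[of m "s j \<circ> s i"] o_apply)
      also have "\<dots> = v" by (simp only: o_apply s_involution Suc)
      finally show ?case .
    qed simp
    then show ?thesis using that by (auto simp: fun_eq_iff)
  qed
  show ?thesis unfolding cox_order_def using 1 by metis
qed

context
  fixes i j :: 'n and A B :: real
  assumes ij: "i \<noteq> j"
    and A: "\<alpha> i \<bullet> coroot (\<alpha> j) = A" and B: "\<alpha> j \<bullet> coroot (\<alpha> i) = B"
begin

definition lc :: "real \<Rightarrow> real \<Rightarrow> real^'n" where "lc x y = x *\<^sub>R \<alpha> i + y *\<^sub>R \<alpha> j"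
text \<open>An arbitrary vector shifted within the plane of the two simple roots. Both reflections
  act on the pair (x, y) by affine formulas, so an identity of words on the whole space is checked
  on two real coordinates.\<close>

definition vl :: "real^'n \<Rightarrow> real \<Rightarrow> real \<Rightarrow> real^'n" where "vl v x y = v + x *\<^sub>R \<alpha> i + y *\<^sub>R \<alpha> j"

lemma two_mult_vec: "2 * (v :: real^'n) = 2 *\<^sub>R v" by (simp add: vec_eq_iff)

lemma inner_lc: "lc x y \<bullet> coroot (\<alpha> i) = x + x + y * B" "lc x y \<bullet> coroot (\<alpha> j) = y + y + x * A"
  by (simp_all add: lc_def inner_left_distrib inner_coroot_self A B)

lemma s_lc: "s i (lc x y) = lc (- x - y * B) y" "s j (lc x y) = lc x (- y - x * A)"
  unfolding refl_def inner_lc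
  by (simp_all add: lc_def scaleR_left_distrib scaleR_left_diff_distrib two_mult_vec)

lemma inner_vl: "vl v x y \<bullet> coroot (\<alpha> i) = v \<bullet> coroot (\<alpha> i) + x + x + y * B"
  "vl v x y \<bullet> coroot (\<alpha> j) = v \<bullet> coroot (\<alpha> j) + y + y + x * A"
  by (simp_all add: vl_def inner_left_distrib inner_coroot_self A B)

lemma s_vl: "s i (vl v x y) = vl v (- x - y * B - v \<bullet> coroot (\<alpha> i)) y"
  "s j (vl v x y) = vl v x (- y - x * A - v \<bullet> coroot (\<alpha> j))"
  unfolding refl_def inner_vl
  by (simp_all add: vl_def scaleR_left_distrib scaleR_left_diff_distrib two_mult_vec)

lemma minus_lc: "- lc x y = lc (- x) (- y)" by (simp add: lc_def)

lemma simple_lc: "\<alpha> i = lc 1 0" "\<alpha> j = lc 0 1" by (simp_all add: lc_def)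

lemma lc_eq_iff: "lc x y = lc x' y' \<longleftrightarrow> x = x' \<and> y = y'"
proof
  assume "lc x y = lc x' y'"
  then have "cf (lc x y) k = cf (lc x' y') k" for k by simp
  from this[of i] this[of j] show "x = x' \<and> y = y'"
    using ij by (simp add: lc_def cf_add cf_scale cf_simple)
qed auto

lemma vl_0: "v = vl v 0 0" by (simp add: vl_def)

lemma lc_lc_sym: "\<exists>p\<ge>0. \<exists>r\<ge>0. lc x y = p *\<^sub>R \<alpha> j + r *\<^sub>R \<alpha> i" if "x \<ge> 0" "y \<ge> 0"
  using that lc_def add.commute by metis

lemma lc_lc: "\<exists>p\<ge>0. \<exists>r\<ge>0. lc x y = p *\<^sub>R \<alpha> i + r *\<^sub>R \<alpha> j" if "x \<ge> 0" "y \<ge> 0"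
  using that lc_def by blast

lemma wprod_vl_eqI:
  "(\<And>v. wprod is (vl v 0 0) = wprod js (vl v 0 0)) \<Longrightarrow> wprod is = wprod js"
  by (rule ext) (metis vl_0)

lemma funpow_idI: "(\<And>v. (f ^^ m) (vl v 0 0) = vl v 0 0) \<Longrightarrow> f ^^ m = id"
  by (rule ext) (metis vl_0 id_apply)

lemma funpow_neq_id: "(f ^^ k) (lc 1 0) \<noteq> lc 1 0 \<Longrightarrow> f ^^ k \<noteq> id"
  by auto

text \<open>That a power is the identity must be checked on every vector, but smaller powers are
  refuted on the single vector alpha_i.\<close>

lemma cox_orderI:
  assumes "(s i \<circ> s j) ^^ m = id" "m > 0" "\<And>k. k > 0 \<Longrightarrow> k < m \<Longrightarrow> ((s i \<circ> s j) ^^ k) (lc 1 0) \<noteq> lc 1 0"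
  shows "cox_order \<alpha> i j = m"
  unfolding cox_order_def
proof (rule Least_equality)
  show "0 < m \<and> (s i \<circ> s j) ^^ m = id" using assms by simp
  fix k assume "0 < k \<and> (s i \<circ> s j) ^^ k = id"
  then show "m \<le> k" using assms(3)[of k] funpow_neq_id by (metis not_le)
qed

lemma s_simple: "s i (\<alpha> i) = lc (-1) 0" "s i (\<alpha> j) = lc (- B) 1"
  "s j (\<alpha> i) = lc 1 (- A)" "s j (\<alpha> j) = lc 0 (-1)"
  by (simp_all add: lc_def refl_self) (simp_all add: refl_def A B)

lemma roots2_lc_A1A1: assumes "A = 0" "B = 0" shows "roots2 \<alpha> i j \<subseteq> {lc 1 0, lc 0 1, lc (-1) 0, lc 0 (-1)}"
proof -
  let ?S = "{lc 1 0, lc 0 1, lc (-1) 0, lc 0 (-1)}"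
  have a: "\<alpha> i \<in> ?S" "\<alpha> j \<in> ?S" by (simp_all add: simple_lc)
  show ?thesis by (rule roots2_induct[OF a]) (auto simp: s_lc assms)
qed

lemma roots2_A1A1:
  assumes "A = 0" "B = 0" and "\<beta> \<in> roots2 \<alpha> i j"
  shows "\<exists>(m, n)\<in>{(1, 0), (0, 1)}. \<beta> = of_nat m *\<^sub>R \<alpha> i + of_nat n *\<^sub>R \<alpha> j \<or>
    \<beta> = - (of_nat m *\<^sub>R \<alpha> i + of_nat n *\<^sub>R \<alpha> j)"
  using roots2_lc_A1A1[OF assms(1,2)] assms(3) by (auto simp: lc_def)

lemma rank2_A1A1: assumes "A = 0" "B = 0" shows "rank2 i j 2"
proof -
  have r: "alt_root i j 0 = lc 1 0"
    "alt_root i j (Suc 0) = lc 0 1"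
    by (simp_all add: alt_root_def s_simple s_lc assms) (simp_all add: lc_def)
  have 1: "\<forall>k<2. \<exists>p\<ge>0. \<exists>r\<ge>0. alt_root i j k = p *\<^sub>R \<alpha> i + r *\<^sub>R \<alpha> j"
    by (auto simp: numeral_eq_Suc less_Suc_eq r intro!: lc_lc)
  let ?S = "{lc 1 0, lc 0 1, lc (-1) 0, lc 0 (-1)}"
  have "roots2 \<alpha> i j \<subseteq> ?S" by (rule roots2_lc_A1A1) (use assms in auto)
  moreover have "\<forall>\<beta>\<in>?S. \<exists>k<2. \<beta> = alt_root i j k \<or> \<beta> = - alt_root i j k"
    by (simp add: numeral_eq_Suc less_Suc_eq conj_disj_distribR ex_disj_distrib r minus_lc lc_eq_iff)
  ultimately have 2: "\<forall>\<beta>\<in>roots2 \<alpha> i j. \<exists>k<2. \<beta> = alt_root i j k \<or> \<beta> = - alt_root i j k"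
    by blast
  have 3: "wprod (altw i j 2) = wprod (altw j i 2)"
    by (rule wprod_vl_eqI) (simp add: numeral_eq_Suc s_vl assms algebra_simps)
  have "cox_order \<alpha> i j = 2"
    by (rule cox_orderI, rule funpow_idI)
      (auto simp: numeral_eq_Suc s_vl s_lc assms lc_eq_iff less_Suc_eq)
  then show ?thesis using 1 2 3 by (simp add: rank2_def)
qed

lemma roots2_lc_A2: assumes "A = -1" "B = -1" shows "roots2 \<alpha> i j \<subseteq> {lc 1 0, lc 1 1, lc 0 1, lc (-1) 0, lc (-1) (-1), lc 0 (-1)}"
proof -
  let ?S = "{lc 1 0, lc 1 1, lc 0 1, lc (-1) 0, lc (-1) (-1), lc 0 (-1)}"
  have a: "\<alpha> i \<in> ?S" "\<alpha> j \<in> ?S" by (simp_all add: simple_lc)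
  show ?thesis by (rule roots2_induct[OF a]) (auto simp: s_lc assms)
qed

lemma roots2_A2:
  assumes "A = -1" "B = -1" and "\<beta> \<in> roots2 \<alpha> i j"
  shows "\<exists>(m, n)\<in>{(1, 0), (1, 1), (0, 1)}. \<beta> = of_nat m *\<^sub>R \<alpha> i + of_nat n *\<^sub>R \<alpha> j \<or>
    \<beta> = - (of_nat m *\<^sub>R \<alpha> i + of_nat n *\<^sub>R \<alpha> j)"
  using roots2_lc_A2[OF assms(1,2)] assms(3) by (auto simp: lc_def)

lemma rank2_A2: assumes "A = -1" "B = -1" shows "rank2 i j 3"
proof -
  have r: "alt_root i j 0 = lc 1 0"
    "alt_root i j (Suc 0) = lc 1 1"
    "alt_root i j (Suc (Suc 0)) = lc 0 1"
    by (simp_all add: alt_root_def s_simple s_lc assms) (simp_all add: lc_def)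
  have 1: "\<forall>k<3. \<exists>p\<ge>0. \<exists>r\<ge>0. alt_root i j k = p *\<^sub>R \<alpha> i + r *\<^sub>R \<alpha> j"
    by (auto simp: numeral_eq_Suc less_Suc_eq r intro!: lc_lc)
  let ?S = "{lc 1 0, lc 1 1, lc 0 1, lc (-1) 0, lc (-1) (-1), lc 0 (-1)}"
  have "roots2 \<alpha> i j \<subseteq> ?S" by (rule roots2_lc_A2) (use assms in auto)
  moreover have "\<forall>\<beta>\<in>?S. \<exists>k<3. \<beta> = alt_root i j k \<or> \<beta> = - alt_root i j k"
    by (simp add: numeral_eq_Suc less_Suc_eq conj_disj_distribR ex_disj_distrib r minus_lc lc_eq_iff)
  ultimately have 2: "\<forall>\<beta>\<in>roots2 \<alpha> i j. \<exists>k<3. \<beta> = alt_root i j k \<or> \<beta> = - alt_root i j k"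
    by blast
  have 3: "wprod (altw i j 3) = wprod (altw j i 3)"
    by (rule wprod_vl_eqI) (simp add: numeral_eq_Suc s_vl assms algebra_simps)
  have "cox_order \<alpha> i j = 3"
    by (rule cox_orderI, rule funpow_idI)
      (auto simp: numeral_eq_Suc s_vl s_lc assms lc_eq_iff less_Suc_eq)
  then show ?thesis using 1 2 3 by (simp add: rank2_def)
qed

lemma roots2_lc_C2: assumes "A = -2" "B = -1" shows "roots2 \<alpha> i j \<subseteq> {lc 1 0, lc 1 1, lc 1 2, lc 0 1, lc (-1) 0, lc (-1) (-1), lc (-1) (-2), lc 0 (-1)}"
proof -
  let ?S = "{lc 1 0, lc 1 1, lc 1 2, lc 0 1, lc (-1) 0, lc (-1) (-1), lc (-1) (-2), lc 0 (-1)}"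
  have a: "\<alpha> i \<in> ?S" "\<alpha> j \<in> ?S" by (simp_all add: simple_lc)
  show ?thesis by (rule roots2_induct[OF a]) (auto simp: s_lc assms)
qed

lemma roots2_C2:
  assumes "A = -2" "B = -1" and "\<beta> \<in> roots2 \<alpha> i j"
  shows "\<exists>(m, n)\<in>{(1, 0), (1, 1), (1, 2), (0, 1)}. \<beta> = of_nat m *\<^sub>R \<alpha> i + of_nat n *\<^sub>R \<alpha> j \<or>
    \<beta> = - (of_nat m *\<^sub>R \<alpha> i + of_nat n *\<^sub>R \<alpha> j)"
  using roots2_lc_C2[OF assms(1,2)] assms(3) by (auto simp: lc_def)

lemma rank2_C2: assumes "A = -2" "B = -1" shows "rank2 i j 4"
proof -
  have r: "alt_root i j 0 = lc 1 0"
    "alt_root i j (Suc 0) = lc 1 1"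
    "alt_root i j (Suc (Suc 0)) = lc 1 2"
    "alt_root i j (Suc (Suc (Suc 0))) = lc 0 1"
    by (simp_all add: alt_root_def s_simple s_lc assms) (simp_all add: lc_def)
  have 1: "\<forall>k<4. \<exists>p\<ge>0. \<exists>r\<ge>0. alt_root i j k = p *\<^sub>R \<alpha> i + r *\<^sub>R \<alpha> j"
    by (auto simp: numeral_eq_Suc less_Suc_eq r intro!: lc_lc)
  let ?S = "{lc 1 0, lc 1 1, lc 1 2, lc 0 1, lc (-1) 0, lc (-1) (-1), lc (-1) (-2), lc 0 (-1)}"
  have "roots2 \<alpha> i j \<subseteq> ?S" by (rule roots2_lc_C2) (use assms in auto)
  moreover have "\<forall>\<beta>\<in>?S. \<exists>k<4. \<beta> = alt_root i j k \<or> \<beta> = - alt_root i j k"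
    by (simp add: numeral_eq_Suc less_Suc_eq conj_disj_distribR ex_disj_distrib r minus_lc lc_eq_iff)
  ultimately have 2: "\<forall>\<beta>\<in>roots2 \<alpha> i j. \<exists>k<4. \<beta> = alt_root i j k \<or> \<beta> = - alt_root i j k"
    by blast
  have 3: "wprod (altw i j 4) = wprod (altw j i 4)"
    by (rule wprod_vl_eqI) (simp add: numeral_eq_Suc s_vl assms algebra_simps)
  have "cox_order \<alpha> i j = 4"
    by (rule cox_orderI, rule funpow_idI)
      (auto simp: numeral_eq_Suc s_vl s_lc assms lc_eq_iff less_Suc_eq)
  then show ?thesis using 1 2 3 by (simp add: rank2_def)
qed

text \<open>The definition of \<open>rank2\<close> is not visibly symmetric. Starting with the short
  root lists the same positive roots in reverse order, computed in the same coordinates.\<close>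

lemma rank2_C2_sym: assumes "A = -2" "B = -1" shows "rank2 j i 4"
proof -
  have r: "alt_root j i 0 = lc 0 1"
    "alt_root j i (Suc 0) = lc 1 2"
    "alt_root j i (Suc (Suc 0)) = lc 1 1"
    "alt_root j i (Suc (Suc (Suc 0))) = lc 1 0"
    by (simp_all add: alt_root_def s_simple s_lc assms) (simp_all add: lc_def)
  have 1: "\<forall>k<4. \<exists>p\<ge>0. \<exists>r\<ge>0. alt_root j i k = p *\<^sub>R \<alpha> j + r *\<^sub>R \<alpha> i"
    by (auto simp: numeral_eq_Suc less_Suc_eq r intro!: lc_lc_sym)
  let ?S = "{lc 1 0, lc 1 1, lc 1 2, lc 0 1, lc (-1) 0, lc (-1) (-1), lc (-1) (-2), lc 0 (-1)}"
  have a: "\<alpha> j \<in> ?S" "\<alpha> i \<in> ?S" by (simp_all add: simple_lc)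
  have "roots2 \<alpha> j i \<subseteq> ?S"
    by (rule roots2_induct[OF a]) (auto simp: s_lc assms)
  moreover have "\<forall>\<beta>\<in>?S. \<exists>k<4. \<beta> = alt_root j i k \<or> \<beta> = - alt_root j i k"
    by (simp add: numeral_eq_Suc less_Suc_eq conj_disj_distribR ex_disj_distrib r minus_lc lc_eq_iff)
  ultimately have 2: "\<forall>\<beta>\<in>roots2 \<alpha> j i. \<exists>k<4. \<beta> = alt_root j i k \<or> \<beta> = - alt_root j i k"
    by blast
  have 3: "wprod (altw j i 4) = wprod (altw i j 4)"
    by (rule wprod_vl_eqI) (simp add: numeral_eq_Suc s_vl assms algebra_simps)
  have "cox_order \<alpha> i j = 4"
    by (rule cox_orderI, rule funpow_idI)
      (auto simp: numeral_eq_Suc s_vl s_lc assms lc_eq_iff less_Suc_eq)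
  then have "cox_order \<alpha> j i = 4" using cox_order_sym by metis
  then show ?thesis using 1 2 3 by (simp add: rank2_def)
qed

lemma roots2_lc_G2: assumes "A = -3" "B = -1" shows "roots2 \<alpha> i j \<subseteq> {lc 1 0, lc 1 1, lc 2 3, lc 1 2, lc 1 3, lc 0 1, lc (-1) 0, lc (-1) (-1), lc (-2) (-3), lc (-1) (-2), lc (-1) (-3), lc 0 (-1)}"
proof -
  let ?S = "{lc 1 0, lc 1 1, lc 2 3, lc 1 2, lc 1 3, lc 0 1, lc (-1) 0, lc (-1) (-1), lc (-2) (-3), lc (-1) (-2), lc (-1) (-3), lc 0 (-1)}"
  have a: "\<alpha> i \<in> ?S" "\<alpha> j \<in> ?S" by (simp_all add: simple_lc)
  show ?thesis by (rule roots2_induct[OF a]) (auto simp: s_lc assms)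
qed

lemma roots2_G2:
  assumes "A = -3" "B = -1" and "\<beta> \<in> roots2 \<alpha> i j"
  shows "\<exists>(m, n)\<in>{(1, 0), (1, 1), (2, 3), (1, 2), (1, 3), (0, 1)}. \<beta> = of_nat m *\<^sub>R \<alpha> i + of_nat n *\<^sub>R \<alpha> j \<or>
    \<beta> = - (of_nat m *\<^sub>R \<alpha> i + of_nat n *\<^sub>R \<alpha> j)"
  using roots2_lc_G2[OF assms(1,2)] assms(3) by (auto simp: lc_def)

lemma rank2_G2: assumes "A = -3" "B = -1" shows "rank2 i j 6"
proof -
  have r: "alt_root i j 0 = lc 1 0"
    "alt_root i j (Suc 0) = lc 1 1"
    "alt_root i j (Suc (Suc 0)) = lc 2 3"
    "alt_root i j (Suc (Suc (Suc 0))) = lc 1 2"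
    "alt_root i j (Suc (Suc (Suc (Suc 0)))) = lc 1 3"
    "alt_root i j (Suc (Suc (Suc (Suc (Suc 0))))) = lc 0 1"
    by (simp_all add: alt_root_def s_simple s_lc assms) (simp_all add: lc_def)
  have 1: "\<forall>k<6. \<exists>p\<ge>0. \<exists>r\<ge>0. alt_root i j k = p *\<^sub>R \<alpha> i + r *\<^sub>R \<alpha> j"
    by (auto simp: numeral_eq_Suc less_Suc_eq r intro!: lc_lc)
  let ?S = "{lc 1 0, lc 1 1, lc 2 3, lc 1 2, lc 1 3, lc 0 1, lc (-1) 0, lc (-1) (-1), lc (-2) (-3), lc (-1) (-2), lc (-1) (-3), lc 0 (-1)}"
  have "roots2 \<alpha> i j \<subseteq> ?S" by (rule roots2_lc_G2) (use assms in auto)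
  moreover have "\<forall>\<beta>\<in>?S. \<exists>k<6. \<beta> = alt_root i j k \<or> \<beta> = - alt_root i j k"
    by (simp add: numeral_eq_Suc less_Suc_eq conj_disj_distribR ex_disj_distrib r minus_lc lc_eq_iff)
  ultimately have 2: "\<forall>\<beta>\<in>roots2 \<alpha> i j. \<exists>k<6. \<beta> = alt_root i j k \<or> \<beta> = - alt_root i j k"
    by blast
  have 3: "wprod (altw i j 6) = wprod (altw j i 6)"
    by (rule wprod_vl_eqI) (simp add: numeral_eq_Suc s_vl assms algebra_simps)
  have "cox_order \<alpha> i j = 6"
    by (rule cox_orderI, rule funpow_idI)
      (auto simp: numeral_eq_Suc s_vl s_lc assms lc_eq_iff less_Suc_eq)
  then show ?thesis using 1 2 3 by (simp add: rank2_def)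
qed

lemma rank2_G2_sym: assumes "A = -3" "B = -1" shows "rank2 j i 6"
proof -
  have r: "alt_root j i 0 = lc 0 1"
    "alt_root j i (Suc 0) = lc 1 3"
    "alt_root j i (Suc (Suc 0)) = lc 1 2"
    "alt_root j i (Suc (Suc (Suc 0))) = lc 2 3"
    "alt_root j i (Suc (Suc (Suc (Suc 0)))) = lc 1 1"
    "alt_root j i (Suc (Suc (Suc (Suc (Suc 0))))) = lc 1 0"
    by (simp_all add: alt_root_def s_simple s_lc assms) (simp_all add: lc_def)
  have 1: "\<forall>k<6. \<exists>p\<ge>0. \<exists>r\<ge>0. alt_root j i k = p *\<^sub>R \<alpha> j + r *\<^sub>R \<alpha> i"
    by (auto simp: numeral_eq_Suc less_Suc_eq r intro!: lc_lc_sym)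
  let ?S = "{lc 1 0, lc 1 1, lc 2 3, lc 1 2, lc 1 3, lc 0 1, lc (-1) 0, lc (-1) (-1), lc (-2) (-3), lc (-1) (-2), lc (-1) (-3), lc 0 (-1)}"
  have a: "\<alpha> j \<in> ?S" "\<alpha> i \<in> ?S" by (simp_all add: simple_lc)
  have "roots2 \<alpha> j i \<subseteq> ?S"
    by (rule roots2_induct[OF a]) (auto simp: s_lc assms)
  moreover have "\<forall>\<beta>\<in>?S. \<exists>k<6. \<beta> = alt_root j i k \<or> \<beta> = - alt_root j i k"
    by (simp add: numeral_eq_Suc less_Suc_eq conj_disj_distribR ex_disj_distrib r minus_lc lc_eq_iff)
  ultimately have 2: "\<forall>\<beta>\<in>roots2 \<alpha> j i. \<exists>k<6. \<beta> = alt_root j i k \<or> \<beta> = - alt_root j i k"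
    by blast
  have 3: "wprod (altw j i 6) = wprod (altw i j 6)"
    by (rule wprod_vl_eqI) (simp add: numeral_eq_Suc s_vl assms algebra_simps)
  have "cox_order \<alpha> i j = 6"
    by (rule cox_orderI, rule funpow_idI)
      (auto simp: numeral_eq_Suc s_vl s_lc assms lc_eq_iff less_Suc_eq)
  then have "cox_order \<alpha> j i = 6" using cox_order_sym by metis
  then show ?thesis using 1 2 3 by (simp add: rank2_def)
qed

end

lemma roots2_sym: "roots2 \<alpha> i j = roots2 \<alpha> j i"
  unfolding roots2_def weyl2_def by (simp add: insert_commute)

text \<open>Both Cartan integers are nonpositive, they vanish together and their product is below 4.
  Hence each is at least -3, which leaves finitely many pairs to inspect.\<close>

lemma cartan_cases:
  assumes ij: "i \<noteq> j"
  defines "A \<equiv> \<alpha> i \<bullet> coroot (\<alpha> j)" and "B \<equiv> \<alpha> j \<bullet> coroot (\<alpha> i)"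
  shows "(A = 0 \<and> B = 0) \<or> (A = -1 \<and> B = -1) \<or> (A = -2 \<and> B = -1) \<or> (A = -3 \<and> B = -1)
    \<or> (B = -2 \<and> A = -1) \<or> (B = -3 \<and> A = -1)"
proof -
  have "A \<in> \<int>" "B \<in> \<int>" using coroot_Ints by (auto simp: A_def B_def)
  then obtain a b :: int where ab: "A = of_int a" "B = of_int b" by (metis Ints_cases)
  have n: "a \<le> 0" "b \<le> 0" using simple_inner_nonpos[OF ij] simple_inner_nonpos[OF ij[symmetric]] ab
    by (auto simp: A_def B_def)
  have "(A = 0) = (B = 0)" by (simp add: A_def B_def inner_coroot inner_commute)
  then have z: "(a = 0) = (b = 0)" using ab by simp
  have "\<alpha> j \<noteq> c *\<^sub>R \<alpha> i" for c
  proof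
    assume "\<alpha> j = c *\<^sub>R \<alpha> i"
    then have "cf (\<alpha> j) j = cf (c *\<^sub>R \<alpha> i) j" by simp
    then show False using ij by (simp add: cf_scale cf_simple)
  qed
  then have "A * B < 4" unfolding A_def B_def
    using cartan_product_less_4[of "\<alpha> i" "\<alpha> j"] by simp
  then have lt: "a * b < 4" using ab by (metis of_int_less_iff of_int_mult of_int_numeral)
  have "a \<ge> -3"
  proof (rule ccontr)
    assume "\<not> a \<ge> -3"
    then have "- a \<ge> 4" "- b \<ge> 1" using z n by auto
    then have "4 * 1 \<le> (- a) * (- b)" by (intro mult_mono) auto
    then show False using lt by simp
  qed
  moreover have "b \<ge> -3"
  proof (rule ccontr)
    assume "\<not> b \<ge> -3"
    then have "- b \<ge> 4" "- a \<ge> 1" using z n by auto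
    then have "1 * 4 \<le> (- a) * (- b)" by (intro mult_mono) auto
    then show False using lt by simp
  qed
  ultimately have "a = -3 \<or> a = -2 \<or> a = -1 \<or> a = 0" "b = -3 \<or> b = -2 \<or> b = -1 \<or> b = 0" using n by linarith+
  then have "(a = 0 \<and> b = 0) \<or> (a = -1 \<and> b = -1) \<or> (a = -2 \<and> b = -1) \<or> (a = -3 \<and> b = -1)
    \<or> (b = -2 \<and> a = -1) \<or> (b = -3 \<and> a = -1)"
    using z lt by (elim disjE) simp_all
  then show ?thesis unfolding ab by (elim disjE) simp_all
qed

lemma rank2_cox_order:
  assumes ij: "i \<noteq> j" shows "rank2 i j (cox_order \<alpha> i j)"
proof -
  have "\<exists>m. rank2 i j m"
    using cartan_cases[OF ij] rank2_A1A1[OF ij HOL.refl HOL.refl] rank2_A2[OF ij HOL.refl HOL.refl]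
      rank2_C2[OF ij HOL.refl HOL.refl] rank2_C2_sym[OF ij[symmetric] HOL.refl HOL.refl]
      rank2_G2[OF ij HOL.refl HOL.refl] rank2_G2_sym[OF ij[symmetric] HOL.refl HOL.refl]
    by blast
  then show ?thesis by (auto simp: rank2_def)
qed

lemma alt_root_root: "alt_root i j k \<in> R"
  unfolding alt_root_def by (rule weyl_root) simp_all

end

section \<open>Points of the torus, and perturbation away from the integers\<close>

lemma torusD:
  assumes "t \<in> torus \<alpha>"
  shows "\<nu> \<in> weight_lattice \<alpha> \<Longrightarrow> t \<nu> \<noteq> 0"
    "\<nu> \<in> weight_lattice \<alpha> \<Longrightarrow> \<mu> \<in> weight_lattice \<alpha> \<Longrightarrow> t (\<nu> + \<mu>) = t \<nu> * t \<mu>"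
  using assms by (auto simp: torus_def)

text \<open>If A is not an integer, nearby values are not either, since the integers are closed. If
  A is an integer, the first nonzero coefficient among B and C moves the value off A by a nonzero
  amount less than 1. The point perturbed in \<open>torus_stabilizer_trivial\<close> has this
  quadratic form against each root.\<close>

lemma eventually_quadratic_notin_Ints:
  fixes A B C :: real
  assumes "A \<notin> \<int> \<or> B \<noteq> 0 \<or> C \<noteq> 0"
  shows "eventually (\<lambda>e. A + e * B + e\<^sup>2 * C \<notin> \<int>) (at_right 0)"
proof (cases "A \<in> \<int>")
  case False
  have "((\<lambda>e. A + e * B + e\<^sup>2 * C) \<longlongrightarrow> A + 0 * B + 0\<^sup>2 * C) (at_right 0)"
    by (intro tendsto_intros)
  then have "((\<lambda>e. A + e * B + e\<^sup>2 * C) \<longlongrightarrow> A) (at_right 0)" by simp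
  moreover have "open (- (\<int> :: real set))" using closed_Ints by (simp add: open_Compl)
  ultimately have "eventually (\<lambda>e. A + e * B + e\<^sup>2 * C \<in> - \<int>) (at_right 0)"
    using False by (intro topological_tendstoD) auto
  then show ?thesis by simp
next
  case True
  have "((\<lambda>e. e * B + e\<^sup>2 * C) \<longlongrightarrow> 0 * B + 0\<^sup>2 * C) (at_right 0)"
    by (intro tendsto_intros)
  then have "((\<lambda>e. e * B + e\<^sup>2 * C) \<longlongrightarrow> 0) (at_right 0)" by simp
  then have small: "eventually (\<lambda>e. \<bar>e * B + e\<^sup>2 * C\<bar> < 1) (at_right 0)"
    by (auto dest!: tendstoD[of _ 0 _ 1] simp: dist_real_def)
  have p: "eventually (\<lambda>e::real. e > 0) (at_right 0)" by (rule eventually_at_right_less)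
  have nz: "eventually (\<lambda>e. B + e * C \<noteq> 0) (at_right 0)"
  proof (cases "B = 0")
    case True
    then have "C \<noteq> 0" using assms \<open>A \<in> \<int>\<close> by simp
    then show ?thesis using p True by (auto elim: eventually_mono)
  next
    case False
    have "((\<lambda>e. B + e * C) \<longlongrightarrow> B + 0 * C) (at_right 0)" by (intro tendsto_intros)
    then have "((\<lambda>e. B + e * C) \<longlongrightarrow> B) (at_right 0)" by simp
    then show ?thesis using False by (intro tendsto_imp_eventually_ne)
  qed
  show ?thesis using small p nz
  proof eventually_elim
    case (elim e)
    have d: "e * B + e\<^sup>2 * C = e * (B + e * C)" by (simp add: algebra_simps power2_eq_square)
    then have "e * B + e\<^sup>2 * C \<noteq> 0" using elim by simp
    then have "e * B + e\<^sup>2 * C \<notin> \<int>" using elim(1) Ints_nonzero_abs_less1 by blast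
    moreover have "A + e * B + e\<^sup>2 * C - A = e * B + e\<^sup>2 * C" by simp
    ultimately show ?case using True by (metis Ints_diff)
  qed
qed

lemma Ints_between: fixes x :: real assumes "x \<in> \<int>"
  shows "-1 < x \<Longrightarrow> x < 1 \<Longrightarrow> x = 0" "-2 < x \<Longrightarrow> x < 0 \<Longrightarrow> x = -1"
proof -
  obtain n where n: "x = of_int n" using assms by (auto elim: Ints_cases)
  show "-1 < x \<Longrightarrow> x < 1 \<Longrightarrow> x = 0" using n by simp
  assume "-2 < x" "x < 0"
  then have "n = -1" using n by linarith
  then show "x = -1" using n by simp
qed

context simple_root_system begin

subsection \<open>Stabilizers in the torus\<close>

lemma torus_zero: "t \<in> torus \<alpha> \<Longrightarrow> t 0 = 1"
  using torusD[of t \<alpha>] by (metis P_zero add_0 mult_cancel_right1)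

lemma torus_minus: "t \<in> torus \<alpha> \<Longrightarrow> \<nu> \<in> P \<Longrightarrow> t (- \<nu>) = inverse (t \<nu>)"
  using torusD(2)[of t \<alpha> \<nu> "- \<nu>"] torus_zero[of t] by (simp add: P_minus inverse_unique)

lemma torus_eq_on_P:
  assumes t: "t \<in> torus \<alpha>" and u: "u \<in> torus \<alpha>"
    and eq: "\<And>i. t (fund_weight \<alpha> i) = u (fund_weight \<alpha> i)" and v: "v \<in> P"
  shows "t v = u v"
proof -
  have nat: "of_nat n *\<^sub>R w \<in> P \<and> t (of_nat n *\<^sub>R w) = u (of_nat n *\<^sub>R w)"
    if w: "w \<in> P" "t w = u w" for n w
  proof (induction n)
    case 0 then show ?case using torus_zero[OF t] torus_zero[OF u] by simp
  next
    case (Suc n)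
    have "of_nat (Suc n) *\<^sub>R w = w + of_nat n *\<^sub>R w" by (simp add: scaleR_left_distrib)
    then show ?case using Suc w torusD(2)[OF t w(1)] torusD(2)[OF u w(1)] by (auto simp: P_add)
  qed
  have int: "of_int n *\<^sub>R w \<in> P \<and> t (of_int n *\<^sub>R w) = u (of_int n *\<^sub>R w)"
    if w: "w \<in> P" "t w = u w" for n :: int and w
  proof (cases "n \<ge> 0")
    case True
    then show ?thesis using nat[OF w, of "nat n"] by simp
  next
    case False
    then have "of_int n *\<^sub>R w = - (of_nat (nat (- n)) *\<^sub>R w)" by simp
    then show ?thesis using nat[OF w, of "nat (- n)"] torus_minus t u by (metis P_minus)
  qed
  obtain c :: "'n \<Rightarrow> int" where c: "v = (\<Sum>i\<in>UNIV. of_int (c i) *\<^sub>R fund_weight \<alpha> i)"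
    using v unfolding weight_lattice_def by blast
  have "(\<Sum>i\<in>F. of_int (c i) *\<^sub>R fund_weight \<alpha> i) \<in> P \<and>
    t (\<Sum>i\<in>F. of_int (c i) *\<^sub>R fund_weight \<alpha> i) = u (\<Sum>i\<in>F. of_int (c i) *\<^sub>R fund_weight \<alpha> i)"
    if "finite F" for F
    using that
  proof (induction F rule: finite_induct)
    case empty then show ?case using torus_zero[OF t] torus_zero[OF u] by simp
  next
    case (insert i F)
    then show ?case using int[OF fund_weight_P eq, of "c i" i] torusD(2)[OF t] torusD(2)[OF u]
      by (auto simp: P_add)
  qed
  then show ?thesis unfolding c by simp
qed

text \<open>Take logarithms of the values at the fundamental weights. The simple coroots are the
  dual basis, so the real parts assemble to b and the imaginary parts over 2 pi to a.\<close>

lemma torus_exp: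
  assumes t: "t \<in> torus \<alpha>"
  obtains a b where "\<And>\<nu>. \<nu> \<in> P \<Longrightarrow>
    t \<nu> = exp (complex_of_real (b \<bullet> \<nu>) + complex_of_real (2 * pi * (a \<bullet> \<nu>)) * \<i>)"
proof -
  have "\<forall>i. \<exists>z. exp z = t (fund_weight \<alpha> i)" using torusD(1)[OF t] by (metis exp_Ln fund_weight_P)
  then obtain z where z: "\<And>i. exp (z i) = t (fund_weight \<alpha> i)" by metis
  define b where "b = (\<Sum>i\<in>UNIV. Re (z i) *\<^sub>R coroot (\<alpha> i))"
  define a where "a = (\<Sum>i\<in>UNIV. (Im (z i) / (2 * pi)) *\<^sub>R coroot (\<alpha> i))"
  let ?u = "\<lambda>\<nu>. exp (complex_of_real (b \<bullet> \<nu>) + complex_of_real (2 * pi * (a \<bullet> \<nu>)) * \<i>)"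
  have u: "?u \<in> torus \<alpha>"
    by (auto simp: torus_def inner_right_distrib algebra_simps simp flip: exp_add)
  have fw: "(\<Sum>j\<in>UNIV. g j *\<^sub>R coroot (\<alpha> j)) \<bullet> fund_weight \<alpha> i = g i" for g i
    unfolding inner_sum_left inner_scaleR_left
    by (subst inner_commute, subst fund_weight_coroot) (simp add: if_distrib cong: if_cong)
  have "?u (fund_weight \<alpha> i) = t (fund_weight \<alpha> i)" for i
  proof -
    have "z i = complex_of_real (b \<bullet> fund_weight \<alpha> i) + complex_of_real (2 * pi * (a \<bullet> fund_weight \<alpha> i)) * \<i>"
      unfolding a_def b_def fw by (simp add: complex_eq_iff)
    then show ?thesis using z by metis
  qed
  then have "t \<nu> = ?u \<nu>" if "\<nu> \<in> P" for \<nu> using torus_eq_on_P[OF t u _ that] by metis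
  then show ?thesis using that by blast
qed

text \<open>A lattice vector is determined by its integer pairings with the fundamental weights, and
  Cauchy-Schwarz bounds these on a ball.\<close>

lemma finite_coroot_lattice_ball: "finite {v \<in> coroot_lattice. norm v \<le> K}"
proof -
  define f where "f (v :: real^'n) = (\<lambda>i. \<lfloor>v \<bullet> fund_weight \<alpha> i\<rfloor>)" for v
  define N where "N = \<lceil>(\<Sum>i\<in>UNIV. \<bar>K\<bar> * norm (fund_weight \<alpha> i))\<rceil>"
  have "f ` {v \<in> coroot_lattice. norm v \<le> K} \<subseteq> (\<Pi>\<^sub>E i\<in>UNIV. {-N-1..N})"
  proof (clarsimp simp: PiE_def Pi_def)
    fix v :: "real^'n" and i assume v: "norm v \<le> K"
    have "\<bar>v \<bullet> fund_weight \<alpha> i\<bar> \<le> norm v * norm (fund_weight \<alpha> i)" by (rule Cauchy_Schwarz_ineq2)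
    also have "\<dots> \<le> \<bar>K\<bar> * norm (fund_weight \<alpha> i)" using v by (intro mult_right_mono) auto
    also have "\<dots> \<le> (\<Sum>i\<in>UNIV. \<bar>K\<bar> * norm (fund_weight \<alpha> i))" by (rule member_le_sum) auto
    also have "\<dots> \<le> of_int N" unfolding N_def by linarith
    finally show "- N - 1 \<le> f v i \<and> f v i \<le> N" unfolding f_def by linarith
  qed
  then have "finite (f ` {v \<in> coroot_lattice. norm v \<le> K})"
    by (rule finite_subset) (simp add: finite_PiE)
  moreover have "inj_on f coroot_lattice"
  proof (rule inj_onI)
    fix v w assume vw: "v \<in> coroot_lattice" "w \<in> coroot_lattice" "f v = f w"
    have "v \<bullet> fund_weight \<alpha> i = w \<bullet> fund_weight \<alpha> i" for i
    proof -
      have "v \<bullet> fund_weight \<alpha> i \<in> \<int>" "w \<bullet> fund_weight \<alpha> i \<in> \<int>" using vw by (auto simp: coroot_lattice_def)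
      moreover have "\<lfloor>v \<bullet> fund_weight \<alpha> i\<rfloor> = \<lfloor>w \<bullet> fund_weight \<alpha> i\<rfloor>"
        using vw(3) unfolding f_def by metis
      ultimately show ?thesis by (auto elim!: Ints_cases)
    qed
    then show "v = w" using coroot_expand[of v] coroot_expand[of w] by simp
  qed
  then have "inj_on f {v \<in> coroot_lattice. norm v \<le> K}" by (rule inj_on_subset) auto
  ultimately show ?thesis by (rule finite_imageD)
qed

text \<open>Reflection in the hyperplane of level k changes the squared distance to d by 4 / (beta,
  beta) times the product in the hypothesis, which is negative exactly when the hyperplane separates
  q from d.\<close>

lemma affine_reflection_closer:
  assumes "\<beta> \<noteq> 0" and "(q \<bullet> \<beta> - k) * (d \<bullet> \<beta> - k) < 0"
  shows "norm (q - (q \<bullet> \<beta> - k) *\<^sub>R coroot \<beta> - d) < norm (q - d)"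
proof -
  let ?u = "q \<bullet> \<beta> - k"
  have bb: "\<beta> \<bullet> \<beta> > 0" using assms by simp
  have "(q - ?u *\<^sub>R coroot \<beta> - d) \<bullet> (q - ?u *\<^sub>R coroot \<beta> - d)
    = (q - d) \<bullet> (q - d) - 2 * ?u * ((q - d) \<bullet> coroot \<beta>) + ?u\<^sup>2 * (coroot \<beta> \<bullet> coroot \<beta>)"
    by (simp add: inner_diff_left inner_diff_right inner_commute power2_eq_square algebra_simps)
  also have "coroot \<beta> \<bullet> coroot \<beta> = 4 / (\<beta> \<bullet> \<beta>)" using bb by (simp add: coroot_def)
  also have "(q - d) \<bullet> coroot \<beta> = 2 * (q \<bullet> \<beta> - d \<bullet> \<beta>) / (\<beta> \<bullet> \<beta>)"
    by (simp add: inner_coroot inner_diff_left)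
  also have "(q - d) \<bullet> (q - d) - 2 * ?u * (2 * (q \<bullet> \<beta> - d \<bullet> \<beta>) / (\<beta> \<bullet> \<beta>)) + ?u\<^sup>2 * (4 / (\<beta> \<bullet> \<beta>))
    = (q - d) \<bullet> (q - d) + 4 / (\<beta> \<bullet> \<beta>) * (?u * (d \<bullet> \<beta> - k))"
    using bb by (simp add: field_simps power2_eq_square)
  also have "\<dots> < (q - d) \<bullet> (q - d)" using mult_pos_neg[of "4 / (\<beta> \<bullet> \<beta>)", OF _ assms(2)] bb by simp
  finally show ?thesis by (simp add: norm_lt)
qed

text \<open>Transitivity of the affine Weyl group on alcoves: take the point of the orbit of p
  nearest to a point d of the fundamental alcove. A wall between the two would give a nearer point
  by reflection.\<close>

lemma move_into_alcove:
  assumes reg: "\<And>\<beta>. \<beta> \<in> R \<Longrightarrow> p \<bullet> \<beta> \<notin> \<int>"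
  obtains y \<eta> where "y \<in> weyl R" "\<eta> \<in> coroot_lattice"
    "\<And>\<beta>. \<beta> \<in> pos \<Longrightarrow> 0 < (y p + \<eta>) \<bullet> \<beta> \<and> (y p + \<eta>) \<bullet> \<beta> < 1"
proof -
  obtain M where M: "\<And>\<beta>. \<beta> \<in> pos \<Longrightarrow> \<rho> \<bullet> \<beta> \<le> M"
    using finite_pos finite_imageI[of pos "\<lambda>\<beta>. \<rho> \<bullet> \<beta>"] Max_ge[of "(\<lambda>\<beta>. \<rho> \<bullet> \<beta>) ` pos"] by blast
  \<comment> \<open>Rescaling the Weyl vector puts it inside the fundamental alcove; the
    \<open>max\<close> with 0 and the added 1 keep the denominator positive and above every pairing
    of a positive root with it.\<close>
  define d where "d = (1 / (max M 0 + 1)) *\<^sub>R \<rho>"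
  have d01: "0 < d \<bullet> \<beta> \<and> d \<bullet> \<beta> < 1" if "\<beta> \<in> pos" for \<beta>
    using rho_pos[OF that] M[OF that] by (simp add: d_def inner_commute field_simps)
  define Orb where "Orb = (\<lambda>(y, \<eta>). y p + \<eta>) ` (weyl R \<times> coroot_lattice)"
  define K where "K = norm (p - d)"
  \<comment> \<open>Only finitely many points of the orbit are as close to d as p is, so a nearest
    one exists.\<close>
  define S where "S = {q \<in> Orb. norm (q - d) \<le> K}"
  have "S \<subseteq> (\<lambda>(y, \<eta>). y p + \<eta>) ` (weyl R \<times> {v \<in> coroot_lattice. norm v \<le> K + norm d + norm p})"
  proof
    fix q assume "q \<in> S"
    then obtain y \<eta> where q: "q = y p + \<eta>" "y \<in> weyl R" "\<eta> \<in> coroot_lattice" "norm (q - d) \<le> K"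
      by (auto simp: S_def Orb_def)
    have "norm (y p) = norm p" using weyl_inner[OF q(2), of p p] by (simp add: norm_eq_sqrt_inner)
    moreover have "norm \<eta> \<le> norm (q - d) + norm d + norm (y p)"
      using norm_triangle_ineq4[of "(q - d) + d" "y p"] norm_triangle_ineq[of "q - d" d] q(1) by simp
    ultimately show "q \<in> (\<lambda>(y, \<eta>). y p + \<eta>) ` (weyl R \<times> {v \<in> coroot_lattice. norm v \<le> K + norm d + norm p})"
      using q by auto
  qed
  then have finS: "finite S"
    by (rule finite_subset) (simp add: finite_weyl finite_coroot_lattice_ball)
  have "p \<in> S" unfolding S_def Orb_def K_def using coroot_lattice_0
    by (auto intro!: image_eqI[of _ _ "(id, 0)"])
  then have "Min ((\<lambda>q. norm (q - d)) ` S) \<in> (\<lambda>q. norm (q - d)) ` S" using finS by (intro Min_in) auto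
  then obtain q where q: "q \<in> S" "norm (q - d) = Min ((\<lambda>q. norm (q - d)) ` S)" by auto
  have qmin: "norm (q - d) \<le> norm (q' - d)" if "q' \<in> Orb" for q'
  proof (cases "q' \<in> S")
    case True
    then show ?thesis unfolding q(2) using finS by (intro Min_le) auto
  next
    case False
    then show ?thesis using q(1) that by (auto simp: S_def)
  qed
  obtain y \<eta> where y: "q = y p + \<eta>" "y \<in> weyl R" "\<eta> \<in> coroot_lattice"
    using q(1) by (auto simp: S_def Orb_def)
  have qreg: "q \<bullet> \<beta> \<notin> \<int>" if "\<beta> \<in> R" for \<beta>
  proof
    assume "q \<bullet> \<beta> \<in> \<int>"
    moreover have "\<eta> \<bullet> \<beta> \<in> \<int>" using y root_P[OF that] by (simp add: coroot_lattice_iff)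
    ultimately have "q \<bullet> \<beta> - \<eta> \<bullet> \<beta> \<in> \<int>" by simp
    then have "p \<bullet> inv y \<beta> \<in> \<int>" using y by (simp add: inner_left_distrib weyl_adjoint)
    then show False using reg weyl_root[OF weyl_inv[OF y(2)] that] by blast
  qed
  have refl_Orb: "q - (q \<bullet> \<beta> - of_int k) *\<^sub>R coroot \<beta> \<in> Orb" if b: "\<beta> \<in> R" for \<beta> k
  proof -
    have "q - (q \<bullet> \<beta> - of_int k) *\<^sub>R coroot \<beta> = refl \<beta> q + of_int k *\<^sub>R coroot \<beta>"
      by (simp add: refl_def coroot_def scaleR_left_diff_distrib left_diff_distrib diff_divide_distrib)
    also have "\<dots> = (refl \<beta> \<circ> y) p + (refl \<beta> \<eta> + of_int k *\<^sub>R coroot \<beta>)" by (simp add: y refl_add)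
    finally have e: "q - (q \<bullet> \<beta> - of_int k) *\<^sub>R coroot \<beta>
      = (refl \<beta> \<circ> y) p + (refl \<beta> \<eta> + of_int k *\<^sub>R coroot \<beta>)" .
    have 1: "refl \<beta> \<in> weyl R" using b by (rule refl_in_refl_group)
    have "of_int k *\<^sub>R coroot \<beta> \<in> coroot_lattice"
      using coroot_in_lattice[OF b] by (simp add: coroot_lattice_def)
    then have "refl \<beta> \<eta> + of_int k *\<^sub>R coroot \<beta> \<in> coroot_lattice"
      using coroot_lattice_weyl[OF 1 y(3)] by (rule coroot_lattice_add[rotated])
    then show ?thesis unfolding e Orb_def using weyl_comp[OF 1 y(2)]
      by (intro image_eqI[of _ _ "(refl \<beta> \<circ> y, refl \<beta> \<eta> + of_int k *\<^sub>R coroot \<beta>)"]) auto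
  qed
  have "0 < q \<bullet> \<beta> \<and> q \<bullet> \<beta> < 1" if b: "\<beta> \<in> pos" for \<beta>
  proof -
    have bR: "\<beta> \<in> R" and b0: "\<beta> \<noteq> 0" using b pos_root root_nonzero by auto
    \<comment> \<open>No integral hyperplane separates q from d. The levels 0 and 1 suffice, because
      d lies strictly between them; regularity then keeps q off both walls.\<close>
    have "(q \<bullet> \<beta> - of_int k) * (d \<bullet> \<beta> - of_int k) \<ge> 0" for k
      using affine_reflection_closer[OF b0, of q "of_int k" d] qmin[OF refl_Orb[OF bR, of k]]
      by (meson not_le)
    from this[of 0] this[of 1] have "q \<bullet> \<beta> \<ge> 0" "q \<bullet> \<beta> \<le> 1"
      using d01[OF b] by (auto simp: zero_le_mult_iff)
    moreover have "q \<bullet> \<beta> \<noteq> 0" "q \<bullet> \<beta> \<noteq> 1" using qreg[OF bR] Ints_0 Ints_1 by metis+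
    ultimately show ?thesis by simp
  qed
  then show ?thesis using that y by blast
qed

text \<open>Move p to a point q of the fundamental alcove and replace z by its conjugate x. The
  lattice vector q - x q pairs with positive roots as an integer that the alcove inequalities
  restrict to 0 or 1, so it vanishes by \<open>coroot_lattice_minuscule_zero\<close>. An element
  fixing an interior point of the alcove keeps the simple roots positive.\<close>

lemma regular_point_stabilizer:
  assumes z: "z \<in> weyl R" and reg: "\<And>\<beta>. \<beta> \<in> R \<Longrightarrow> p \<bullet> \<beta> \<notin> \<int>"
    and g: "z p - p \<in> coroot_lattice"
  shows "z = id"
proof -
  obtain y \<eta> where y: "y \<in> weyl R" "\<eta> \<in> coroot_lattice"
    and alc: "\<And>\<beta>. \<beta> \<in> pos \<Longrightarrow> 0 < (y p + \<eta>) \<bullet> \<beta> \<and> (y p + \<eta>) \<bullet> \<beta> < 1"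
    using move_into_alcove[OF reg] by blast
  define q where "q = y p + \<eta>"
  define x where "x = y \<circ> z \<circ> inv y"
  have x: "x \<in> weyl R" unfolding x_def using y z by (intro weyl_comp weyl_inv)
  have "x q - q = y (z p - p) + (x \<eta> - \<eta>)"
    using y by (simp add: x_def q_def linear_add[OF weyl_linear] linear_diff[OF weyl_linear] weyl_inv z)
  then have gq: "x q - q \<in> coroot_lattice"
    using coroot_lattice_weyl[OF y(1) g] coroot_lattice_weyl[OF x y(2)] y(2)
    by (simp add: coroot_lattice_add coroot_lattice_diff)
  have xq: "(x q - q) \<bullet> \<beta> = q \<bullet> inv x \<beta> - q \<bullet> \<beta>" for \<beta>
    using x by (simp add: inner_diff_left weyl_adjoint)
  have val: "(q - x q) \<bullet> \<beta> = 0 \<or> (q - x q) \<bullet> \<beta> = 1" if b: "\<beta> \<in> pos" for \<beta>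
  proof -
    have i: "(x q - q) \<bullet> \<beta> \<in> \<int>" using gq root_P[OF pos_root[OF b]] by (simp add: coroot_lattice_iff)
    have r: "inv x \<beta> \<in> R" using weyl_root[OF weyl_inv[OF x] pos_root[OF b]] .
    have ab: "0 < q \<bullet> \<beta>" "q \<bullet> \<beta> < 1" using alc[OF b] by (auto simp: q_def)
    have "(x q - q) \<bullet> \<beta> = 0 \<or> (x q - q) \<bullet> \<beta> = -1"
    proof (cases "inv x \<beta> \<in> pos")
      case True
      then have "0 < q \<bullet> inv x \<beta>" "q \<bullet> inv x \<beta> < 1" using alc by (auto simp: q_def)
      then show ?thesis using Ints_between(1)[OF i] ab unfolding xq by auto
    next
      case False
      then have "- inv x \<beta> \<in> pos" using not_pos_iff[OF r] by simp
      from alc[OF this] have "0 < - (q \<bullet> inv x \<beta>)" "- (q \<bullet> inv x \<beta>) < 1" by (auto simp: q_def)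
      then show ?thesis using Ints_between(2)[OF i] ab unfolding xq by auto
    qed
    then show ?thesis by (auto simp: inner_diff_left)
  qed
  have "q - x q \<in> coroot_lattice" using coroot_lattice_diff[OF coroot_lattice_0 gq] by simp
  then have "q - x q = 0" using coroot_lattice_minuscule_zero val by blast
  then have fixq: "q \<bullet> inv x \<beta> = q \<bullet> \<beta>" for \<beta> using xq[of \<beta>] by simp
  have "inv x (\<alpha> i) \<in> pos" for i
  proof (rule ccontr)
    assume "inv x (\<alpha> i) \<notin> pos"
    then have "- inv x (\<alpha> i) \<in> pos" using not_pos_iff weyl_root[OF weyl_inv[OF x]] by simp
    from alc[OF this] alc[of "\<alpha> i"] fixq[of "\<alpha> i"] show False by (simp add: q_def)
  qed
  then have "inv x = id" using weyl_simple_pos_imp_id[OF weyl_inv[OF x]] by blast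
  then have "x v = v" for v using weyl_f_inv[OF x, of v] by simp
  then have "y (z (inv y (y v))) = y v" for v by (simp add: x_def)
  then have "z v = v" for v using y(1) by (metis weyl_inv_f)
  then show ?thesis by auto
qed

text \<open>Invariance of the absolute value of t means that z = x^-1 fixes b; invariance of the
  argument means that z moves a by a coroot lattice vector. As z also fixes r, it moves the
  perturbed point p by that same lattice vector.\<close>

theorem torus_stabilizer_trivial:
  assumes t: "t \<in> torus \<alpha>" and x: "x \<in> weyl R"
    and fixt: "\<And>\<nu>. \<nu> \<in> P \<Longrightarrow> t (x \<nu>) = t \<nu>"
    and pos: "\<And>\<beta>. \<beta> \<in> pos \<Longrightarrow> t \<beta> = 1 \<Longrightarrow> x \<beta> \<in> pos"
  shows "x = id"
proof -
  obtain a b where tab: "\<And>\<nu>. \<nu> \<in> P \<Longrightarrow>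
    t \<nu> = exp (complex_of_real (b \<bullet> \<nu>) + complex_of_real (2 * pi * (a \<bullet> \<nu>)) * \<i>)"
    using torus_exp[OF t] by blast
  have norm_t: "norm (t \<nu>) = exp (b \<bullet> \<nu>)" if "\<nu> \<in> P" for \<nu>
    using tab[OF that] by simp
  define z where "z = inv x"
  have z: "z \<in> weyl R" using weyl_inv[OF x] by (simp add: z_def)
  have zadj: "z v \<bullet> w = v \<bullet> x w" for v w
    using weyl_adjoint[OF x, of w v] by (simp add: z_def inner_commute)
  have zb: "z b = b"
  proof -
    have "(z b - b) \<bullet> fund_weight \<alpha> i = 0" for i
    proof -
      have "exp (b \<bullet> x (fund_weight \<alpha> i)) = exp (b \<bullet> fund_weight \<alpha> i)"
        using norm_t[OF weyl_P[OF x fund_weight_P]] norm_t[OF fund_weight_P] fixt[OF fund_weight_P] by metis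
      then show ?thesis by (simp add: inner_diff_left zadj)
    qed
    then have "z b - b = 0" using coroot_expand[of "z b - b"] by simp
    then show ?thesis by simp
  qed
  have za: "z a - a \<in> coroot_lattice"
    unfolding coroot_lattice_def
  proof (clarify)
    fix i
    let ?w = "fund_weight \<alpha> i"
    have "t (x ?w) = t ?w" using fixt by simp
    moreover have "b \<bullet> x ?w = b \<bullet> ?w" using zadj[of b ?w] zb by simp
    ultimately have "exp (complex_of_real (2 * pi * (a \<bullet> x ?w)) * \<i>) = exp (complex_of_real (2 * pi * (a \<bullet> ?w)) * \<i>)"
      using tab[OF weyl_P[OF x fund_weight_P]] tab[OF fund_weight_P] by (simp add: exp_add)
    then obtain n :: int where "complex_of_real (2 * pi * (a \<bullet> x ?w)) * \<i>
        = complex_of_real (2 * pi * (a \<bullet> ?w)) * \<i> + (of_int (2 * n) * pi) * \<i>"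
      unfolding exp_eq by blast
    then have "2 * pi * (a \<bullet> x ?w) = 2 * pi * (a \<bullet> ?w) + 2 * of_int n * pi"
      by (simp add: complex_eq_iff)
    then have "2 * pi * (a \<bullet> x ?w - a \<bullet> ?w - of_int n) = 0" by (simp add: algebra_simps)
    then have "a \<bullet> x ?w - a \<bullet> ?w = of_int n" by simp
    then show "(z a - a) \<bullet> ?w \<in> \<int>" by (simp add: inner_diff_left zadj)
  qed
  define F where "F = {\<beta>\<in>pos. t \<beta> = 1}"
  have finF: "finite F" using finite_pos by (simp add: F_def)
  have xF: "x \<beta> \<in> F" if "\<beta> \<in> F" for \<beta>
    using that pos fixt root_P[OF pos_root] by (auto simp: F_def)
  have "x ` F = F"
    using finF xF weyl_bij[OF x] by (intro endo_inj_surj) (auto intro: inj_on_subset bij_is_inj)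
  then have zF: "z \<beta> \<in> F" if "\<beta> \<in> F" for \<beta> using that weyl_inv_f[OF x] unfolding z_def by (metis imageE)
  have xz: "x (z v) = v" "z (x v) = v" for v using x by (simp_all add: z_def)
  \<comment> \<open>The elements whose inverse maps F into itself. Left multiplication by z permutes
    them, so the sum r of the vectors w rho over S is fixed by z, and each summand is positive on
    F.\<close>
  define S where "S = {w \<in> weyl R. \<forall>\<beta>\<in>F. inv w \<beta> \<in> F}"
  have finS: "finite S" using finite_weyl by (simp add: S_def)
  have zS: "z \<circ> w \<in> S" if "w \<in> S" for w
  proof -
    have w: "w \<in> weyl R" using that by (simp add: S_def)
    have "inv z = x" using x by (simp add: z_def weyl_bij inv_inv_eq)
    then have "inv (z \<circ> w) = inv w \<circ> x" using weyl_inv_comp[OF z w] by simp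
    then show ?thesis using that weyl_comp[OF z w] xF by (simp add: S_def)
  qed
  have injz: "inj_on (\<lambda>w. z \<circ> w) S" by (rule inj_onI) (metis comp_assoc fun.map_comp xz(1) ext o_apply)
  have zS_eq: "(\<lambda>w. z \<circ> w) ` S = S" using finS zS injz by (intro endo_inj_surj) auto
  define r where "r = (\<Sum>w\<in>S. w \<rho>)"
  have zr: "z r = r"
  proof -
    have "z r = (\<Sum>w\<in>S. (z \<circ> w) \<rho>)" using linear_sum[OF weyl_linear[OF z]] by (simp add: r_def)
    also have "\<dots> = (\<Sum>w\<in>(\<lambda>w. z \<circ> w) ` S. w \<rho>)" by (simp add: sum.reindex[OF injz])
    finally show ?thesis by (simp add: zS_eq r_def)
  qed
  have "id \<in> S" using weyl_id unfolding S_def by (simp only: mem_Collect_eq inv_id id_apply) blast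
  have rF: "r \<bullet> \<beta> > 0" if "\<beta> \<in> F" for \<beta>
  proof -
    have "w \<rho> \<bullet> \<beta> > 0" if w: "w \<in> S" for w
    proof -
      have "w \<rho> \<bullet> \<beta> = inv w \<beta> \<bullet> \<rho>"
        using w weyl_adjoint[of w \<rho> \<beta>] by (simp add: S_def inner_commute)
      moreover have "inv w \<beta> \<in> pos" using w \<open>\<beta> \<in> F\<close> by (auto simp: S_def F_def)
      ultimately show ?thesis using rho_pos by simp
    qed
    then show ?thesis unfolding r_def inner_sum_left using finS \<open>id \<in> S\<close> by (intro sum_pos) auto
  qed
  \<comment> \<open>A root integral on a and zero on b has t-value 1, so up to sign it lies in F,
    where r is not zero.\<close>
  have reg0: "a \<bullet> \<beta> \<notin> \<int> \<or> b \<bullet> \<beta> \<noteq> 0 \<or> r \<bullet> \<beta> \<noteq> 0" if bR: "\<beta> \<in> R" for \<beta>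
  proof (rule ccontr)
    assume "\<not> ?thesis"
    then have c: "a \<bullet> \<beta> \<in> \<int>" "b \<bullet> \<beta> = 0" "r \<bullet> \<beta> = 0" by auto
    then obtain n :: int where n: "a \<bullet> \<beta> = of_int n" by (auto elim: Ints_cases)
    have "t \<beta> = exp (of_real (2 * pi * of_int n) * \<i>)" using tab[OF root_P[OF bR]] c n by simp
    also have "\<dots> = 1" by (subst exp_eq_1) (auto intro!: exI[of _ n])
    finally have t1: "t \<beta> = 1" .
    then have "t (- \<beta>) = 1" using torus_minus[OF t root_P[OF bR]] by simp
    then have "\<beta> \<in> F \<or> - \<beta> \<in> F" using t1 pos_or_neg[OF bR] by (auto simp: F_def)
    then show False using rF[of \<beta>] rF[of "- \<beta>"] c by auto
  qed
  have "eventually (\<lambda>e. \<forall>\<beta>\<in>R. a \<bullet> \<beta> + e * (b \<bullet> \<beta>) + e\<^sup>2 * (r \<bullet> \<beta>) \<notin> \<int>) (at_right 0)"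
    using finite_R reg0 by (intro eventually_ball_finite ballI eventually_quadratic_notin_Ints) auto
  then obtain e where e: "\<And>\<beta>. \<beta> \<in> R \<Longrightarrow> a \<bullet> \<beta> + e * (b \<bullet> \<beta>) + e\<^sup>2 * (r \<bullet> \<beta>) \<notin> \<int>"
    using eventually_happens'[OF trivial_limit_at_right_real] by blast
  define p where "p = a + e *\<^sub>R b + e\<^sup>2 *\<^sub>R r"
  have "p \<bullet> \<beta> \<notin> \<int>" if "\<beta> \<in> R" for \<beta> using e[OF that] by (simp add: p_def inner_left_distrib)
  moreover have "z p - p = z a - a"
    using zb zr by (simp add: p_def linear_add[OF weyl_linear[OF z]] linear_scale[OF weyl_linear[OF z]])
  ultimately have "z = id" using regular_point_stabilizer[OF z, of p] za by metis
  then have "x v = v" for v using xz(1)[of v] by simp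
  then show ?thesis by auto
qed

end

section \<open>Calibrated representations\<close>

context simple_root_system begin

lemma torus_act_id [simp]: "torus_act id \<sigma> = \<sigma>"
  by (rule ext) (simp add: torus_act_def)

lemma torus_act_s: "torus_act (s i) \<sigma> \<nu> = \<sigma> (s i \<nu>)"
  by (simp add: torus_act_def)

lemma torus_act_comp:
  "v \<in> weyl R \<Longrightarrow> w \<in> weyl R \<Longrightarrow> torus_act (v \<circ> w) \<sigma> = torus_act v (torus_act w \<sigma>)"
  by (rule ext) (simp add: torus_act_def weyl_inv_comp)

lemma torus_act_torus: "w \<in> weyl R \<Longrightarrow> \<sigma> \<in> torus \<alpha> \<Longrightarrow> torus_act w \<sigma> \<in> torus \<alpha>"
  using weyl_P[OF weyl_inv] linear_add[OF weyl_linear[OF weyl_inv]]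
  by (auto simp: torus_def torus_act_def)

lemma torus_scale_nat:
  assumes "\<sigma> \<in> torus \<alpha>" "\<nu> \<in> P" "\<mu> \<in> P"
  shows "\<nu> + of_nat n *\<^sub>R \<mu> \<in> P" "\<sigma> (\<nu> + of_nat n *\<^sub>R \<mu>) = \<sigma> \<nu> * \<sigma> \<mu> ^ n"
proof (induction n)
  case (Suc n)
  have e: "\<nu> + of_nat (Suc n) *\<^sub>R \<mu> = (\<nu> + of_nat n *\<^sub>R \<mu>) + \<mu>" by (simp add: algebra_simps)
  show "\<nu> + of_nat (Suc n) *\<^sub>R \<mu> \<in> P" unfolding e using Suc assms by (simp only: P_add)
  show "\<sigma> (\<nu> + of_nat (Suc n) *\<^sub>R \<mu>) = \<sigma> \<nu> * \<sigma> \<mu> ^ Suc n"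
    unfolding e using Suc torusD(2)[OF assms(1) Suc(1) assms(3)] by simp
qed (use assms in auto)

lemma torus_act_root: "\<sigma> \<in> torus \<alpha> \<Longrightarrow> \<beta> \<in> P \<Longrightarrow> \<sigma> (- \<beta>) = 1 / \<sigma> \<beta>"
  by (simp add: torus_minus inverse_eq_divide)

end

text \<open>A module realized as a subspace \<open>V\<close> of a complex vector space with
  operators. In \<open>X_T\<close> the quotient of the Bernstein relation is written out as a
  geometric sum, whose direction depends on the sign of the pairing k.\<close>

locale hecke_rep = simple_root_system R \<alpha> + vector_space scale
  for R :: "(real^'n) set" and \<alpha> :: "'n \<Rightarrow> real^'n"
    and scale :: "complex \<Rightarrow> 'v::ab_group_add \<Rightarrow> 'v" (infixr "\<star>" 75) +
  fixes q :: complex and V :: "'v set" and T :: "'n \<Rightarrow> 'v \<Rightarrow> 'v" and X :: "real^'n \<Rightarrow> 'v \<Rightarrow> 'v"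
  assumes q_nonzero: "q \<noteq> 0" and q_not_root_of_unity: "\<And>k. 0 < k \<Longrightarrow> q ^ k \<noteq> 1"
    and subspace_V: "subspace V"
    and T_add: "T i (x + y) = T i x + T i y" and T_scale: "T i (c \<star> x) = c \<star> T i x"
    and X_add: "X \<nu> (x + y) = X \<nu> x + X \<nu> y" and X_scale: "X \<nu> (c \<star> x) = c \<star> X \<nu> x"
    and T_V: "x \<in> V \<Longrightarrow> T i x \<in> V" and X_V: "\<nu> \<in> P \<Longrightarrow> x \<in> V \<Longrightarrow> X \<nu> x \<in> V"
    and T_T: "x \<in> V \<Longrightarrow> T i (T i x) = (q - inverse q) \<star> T i x + x"
    and T_braid: "i \<noteq> j \<Longrightarrow> x \<in> V \<Longrightarrow>
      foldr T (altw i j (cox_order \<alpha> i j)) x = foldr T (altw j i (cox_order \<alpha> i j)) x"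
    and X_X: "\<nu> \<in> P \<Longrightarrow> \<mu> \<in> P \<Longrightarrow> x \<in> V \<Longrightarrow> X \<nu> (X \<mu> x) = X (\<nu> + \<mu>) x"
    and X_zero: "x \<in> V \<Longrightarrow> X 0 x = x"
    and X_T: "\<nu> \<in> P \<Longrightarrow> x \<in> V \<Longrightarrow> \<nu> \<bullet> coroot (\<alpha> i) = of_int k \<Longrightarrow>
      X \<nu> (T i x) = T i (X (s i \<nu>) x) + (q - inverse q) \<star>
        (if 0 \<le> k then \<Sum>j<nat k. X (\<nu> + of_nat j *\<^sub>R (- \<alpha> i)) x
         else - (\<Sum>j<nat (- k). X (\<nu> + of_nat (Suc j) *\<^sub>R \<alpha> i) x))"
    and irreducible: "subspace N \<Longrightarrow> N \<subseteq> V \<Longrightarrow> (\<And>i x. x \<in> N \<Longrightarrow> T i x \<in> N) \<Longrightarrow>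
      (\<And>\<nu> x. \<nu> \<in> P \<Longrightarrow> x \<in> N \<Longrightarrow> X \<nu> x \<in> N) \<Longrightarrow> N \<subseteq> {0} \<or> N = V"
    and calibrated: "\<sigma> \<in> torus \<alpha> \<Longrightarrow> x \<in> V \<Longrightarrow>
      (\<And>\<nu>. \<nu> \<in> P \<Longrightarrow> \<exists>k>0. ((\<lambda>y. X \<nu> y - \<sigma> \<nu> \<star> y) ^^ k) x = 0) \<Longrightarrow> \<nu> \<in> P \<Longrightarrow> X \<nu> x = \<sigma> \<nu> \<star> x"
begin

abbreviation \<kappa> :: complex where "\<kappa> \<equiv> q - inverse q"

lemma T_0 [simp]: "T i 0 = 0" using T_add[of i 0 0] by simp
lemma X_0 [simp]: "X \<nu> 0 = 0" using X_add[of \<nu> 0 0] by simp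
lemma T_minus: "T i (- x) = - T i x"
proof -
  have "T i x + T i (- x) = 0" by (simp flip: T_add)
  then show ?thesis using minus_unique by metis
qed
lemma X_minus: "X \<nu> (- x) = - X \<nu> x"
proof -
  have "X \<nu> x + X \<nu> (- x) = 0" by (simp flip: X_add)
  then show ?thesis using minus_unique by metis
qed
lemma T_diff: "T i (x - y) = T i x - T i y" using T_add[of i x "- y"] by (simp add: T_minus)
lemma X_diff: "X \<nu> (x - y) = X \<nu> x - X \<nu> y" using X_add[of \<nu> x "- y"] by (simp add: X_minus)

lemma q_square_neq_1: "q\<^sup>2 \<noteq> 1" "q ^ 4 \<noteq> 1"
  using q_not_root_of_unity[of 2] q_not_root_of_unity[of 4] by auto

lemma kappa_nonzero: "\<kappa> \<noteq> 0"
proof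
  assume "\<kappa> = 0"
  then have "q * q = 1" using q_nonzero by (simp add: field_simps)
  then show False using q_square_neq_1 by (simp add: power2_eq_square)
qed

definition wsp :: "(real^'n \<Rightarrow> complex) \<Rightarrow> 'v set" where
  "wsp \<sigma> = {x \<in> V. \<forall>\<nu>\<in>P. X \<nu> x = \<sigma> \<nu> \<star> x}"

lemma wsp_V: "x \<in> wsp \<sigma> \<Longrightarrow> x \<in> V" and wsp_X: "x \<in> wsp \<sigma> \<Longrightarrow> \<nu> \<in> P \<Longrightarrow> X \<nu> x = \<sigma> \<nu> \<star> x"
  by (auto simp: wsp_def)

lemma subspace_wsp: "subspace (wsp \<sigma>)"
  using subspace_V unfolding wsp_def
  by (auto simp: subspace_def X_add X_scale scale_right_distrib scale_left_commute)

lemma wsp_0 [simp]: "0 \<in> wsp \<sigma>" and wsp_scale: "x \<in> wsp \<sigma> \<Longrightarrow> c \<star> x \<in> wsp \<sigma>"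
  and wsp_add: "x \<in> wsp \<sigma> \<Longrightarrow> y \<in> wsp \<sigma> \<Longrightarrow> x + y \<in> wsp \<sigma>"
  and wsp_diff: "x \<in> wsp \<sigma> \<Longrightarrow> y \<in> wsp \<sigma> \<Longrightarrow> x - y \<in> wsp \<sigma>"
  using subspace_wsp[of \<sigma>] subspace_0 subspace_scale subspace_add subspace_diff by auto

lemma V_add: "x \<in> V \<Longrightarrow> y \<in> V \<Longrightarrow> x + y \<in> V" and V_scale: "x \<in> V \<Longrightarrow> c \<star> x \<in> V"
  and V_diff: "x \<in> V \<Longrightarrow> y \<in> V \<Longrightarrow> x - y \<in> V"
  using subspace_V subspace_scale subspace_add subspace_diff by auto

subsection \<open>The intertwiners\<close>

definition d :: "'n \<Rightarrow> (real^'n \<Rightarrow> complex) \<Rightarrow> complex" where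
  "d i \<sigma> = \<kappa> / (1 - \<sigma> (- \<alpha> i))"

definition tau :: "'n \<Rightarrow> (real^'n \<Rightarrow> complex) \<Rightarrow> 'v \<Rightarrow> 'v" where
  "tau i \<sigma> x = T i x - d i \<sigma> \<star> x"

text \<open>The scalar of the double intertwiner in \<open>tau_tau\<close>; the factor after d is
  the value of d at the reflected weight, by \<open>d_flip\<close>.\<close>

definition g :: "'n \<Rightarrow> (real^'n \<Rightarrow> complex) \<Rightarrow> complex" where
  "g i \<sigma> = 1 + d i \<sigma> * (\<kappa> - d i \<sigma>)"

lemma tau_0 [simp]: "tau i \<sigma> 0 = 0" by (simp add: tau_def)

lemma T_eq_tau: "T i x = tau i \<sigma> x + d i \<sigma> \<star> x" by (simp add: tau_def)

lemma tau_V: "x \<in> V \<Longrightarrow> tau i \<sigma> x \<in> V" by (simp add: tau_def V_diff V_scale T_V)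

lemma tau_scale: "tau i \<sigma> (c \<star> x) = c \<star> tau i \<sigma> x"
  by (simp add: tau_def T_scale scale_right_diff_distrib scale_left_commute)

context
  fixes \<sigma> x i \<nu> k
  assumes sg: "\<sigma> \<in> torus \<alpha>" and x: "x \<in> wsp \<sigma>" and nu: "\<nu> \<in> P"
    and k: "\<nu> \<bullet> coroot (\<alpha> i) = of_int k"
begin

lemma wsp_X_T_sum:
  "X \<nu> (T i x) = \<sigma> (s i \<nu>) \<star> T i x + (\<kappa> * (if 0 \<le> k then \<sigma> \<nu> * (\<Sum>j<nat k. \<sigma> (- \<alpha> i) ^ j)
     else - (\<sigma> \<nu> * \<sigma> (\<alpha> i) * (\<Sum>j<nat (- k). \<sigma> (\<alpha> i) ^ j)))) \<star> x"
proof -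
  have 1: "X (\<nu> + of_nat j *\<^sub>R (- \<alpha> i)) x = (\<sigma> \<nu> * \<sigma> (- \<alpha> i) ^ j) \<star> x" for j
    using wsp_X[OF x torus_scale_nat(1)[OF sg nu P_minus[OF simple_P], of j i]]
      torus_scale_nat(2)[OF sg nu P_minus[OF simple_P], of j i] by simp
  have 2: "X (\<nu> + of_nat (Suc j) *\<^sub>R \<alpha> i) x = (\<sigma> \<nu> * \<sigma> (\<alpha> i) * \<sigma> (\<alpha> i) ^ j) \<star> x" for j
    using wsp_X[OF x torus_scale_nat(1)[OF sg nu simple_P, of "Suc j" i]]
      torus_scale_nat(2)[OF sg nu simple_P, of "Suc j" i] by (simp add: mult_ac)
  show ?thesis
    unfolding X_T[OF nu wsp_V[OF x] k] wsp_X[OF x s_P[OF nu]] T_scale 1 2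
    by (simp add: scale_sum_left[symmetric] sum_distrib_left[symmetric])
qed

lemma torus_s: "\<sigma> (s i \<nu>) = (if 0 \<le> k then \<sigma> \<nu> * \<sigma> (- \<alpha> i) ^ nat k else \<sigma> \<nu> * \<sigma> (\<alpha> i) ^ nat (- k))"
proof (cases "0 \<le> k")
  case True
  then have "s i \<nu> = \<nu> + of_nat (nat k) *\<^sub>R (- \<alpha> i)" by (simp add: refl_def k)
  then show ?thesis using True torus_scale_nat(2)[OF sg nu P_minus[OF simple_P], of "nat k" i] by simp
next
  case False
  then have "s i \<nu> = \<nu> + of_nat (nat (- k)) *\<^sub>R \<alpha> i" by (simp add: refl_def k)
  then show ?thesis using False torus_scale_nat(2)[OF sg nu simple_P, of "nat (- k)" i] by simp
qed

lemma wsp_X_T: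
  assumes "\<sigma> (\<alpha> i) \<noteq> 1"
  shows "X \<nu> (T i x) = \<sigma> (s i \<nu>) \<star> T i x + (d i \<sigma> * (\<sigma> \<nu> - \<sigma> (s i \<nu>))) \<star> x"
proof -
  let ?a = "\<sigma> (\<alpha> i)"
  have a: "?a \<noteq> 0" using torusD(1)[OF sg] by simp
  have m: "\<sigma> (- \<alpha> i) = 1 / ?a" using sg by (simp add: torus_act_root)
  have z: "1 - 1 / ?a \<noteq> 0" using assms a by (simp add: field_simps)
  have "\<kappa> * (if 0 \<le> k then \<sigma> \<nu> * (\<Sum>j<nat k. \<sigma> (- \<alpha> i) ^ j)
     else - (\<sigma> \<nu> * \<sigma> (\<alpha> i) * (\<Sum>j<nat (- k). \<sigma> (\<alpha> i) ^ j))) = d i \<sigma> * (\<sigma> \<nu> - \<sigma> (s i \<nu>))"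
  proof (cases "0 \<le> k")
    case True
    have "1 - (1 / ?a) ^ nat k = (1 - 1 / ?a) * (\<Sum>j<nat k. (1 / ?a) ^ j)" by (rule one_diff_power_eq)
    then have "(\<Sum>j<nat k. (1 / ?a) ^ j) = (1 - (1 / ?a) ^ nat k) / (1 - 1 / ?a)" using z by simp
    moreover have "K * (c * ((1 - y) / D)) = K / D * (c - c * y)" for K c y D :: complex
      by (simp add: diff_divide_distrib algebra_simps)
    ultimately show ?thesis using True by (simp only: torus_s m d_def if_True)
  next
    case False
    have "1 - ?a ^ nat (- k) = (1 - ?a) * (\<Sum>j<nat (- k). ?a ^ j)" by (rule one_diff_power_eq)
    then have e: "(\<Sum>j<nat (- k). ?a ^ j) = (1 - ?a ^ nat (- k)) / (1 - ?a)" using assms by simp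
    have "d i \<sigma> = - (\<kappa> * ?a / (1 - ?a))"
    proof -
      have "1 - ?a \<noteq> 0" using assms by simp
      then show ?thesis using z a unfolding d_def m by (simp add: divide_simps) (simp add: algebra_simps)
    qed
    moreover have "K * - (c * a * ((1 - y) / D)) = - (K * a / D) * (c - c * y)" for K c a y D :: complex
      by (simp add: diff_divide_distrib algebra_simps)
    ultimately show ?thesis using False by (simp only: torus_s e if_False)
  qed
  then show ?thesis unfolding wsp_X_T_sum by simp
qed

text \<open>At value 1 all terms of the geometric sum coincide. For nonzero k and x, the vectors x
  and T_i x then span a Jordan block of X^nu.\<close>

lemma wsp_X_T_one:
  assumes "\<sigma> (\<alpha> i) = 1"
  shows "X \<nu> (T i x) = \<sigma> \<nu> \<star> T i x + (\<kappa> * of_int k * \<sigma> \<nu>) \<star> x"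
proof -
  have m: "\<sigma> (- \<alpha> i) = 1" using sg assms by (simp add: torus_act_root)
  show ?thesis unfolding wsp_X_T_sum torus_s using assms m by (simp add: mult_ac)
qed

end

lemma wsp_simple_one:
  assumes sg: "\<sigma> \<in> torus \<alpha>" and x: "x \<in> wsp \<sigma>" and one: "\<sigma> (\<alpha> i) = 1"
  shows "x = 0"
proof -
  have gen: "\<exists>k>0. ((\<lambda>y. X \<nu> y - \<sigma> \<nu> \<star> y) ^^ k) (T i x) = 0" if nu: "\<nu> \<in> P" for \<nu>
  proof -
    obtain k where k: "\<nu> \<bullet> coroot (\<alpha> i) = of_int k" using nu by (auto simp: weight_lattice_iff elim: Ints_cases)
    have "((\<lambda>y. X \<nu> y - \<sigma> \<nu> \<star> y) ^^ 2) (T i x) = 0"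
      using wsp_X[OF x nu]
      by (simp add: numeral_2_eq_2 wsp_X_T_one[OF sg x nu k one] X_scale scale_left_commute)
    then show ?thesis by (intro exI[of _ 2]) simp
  qed
  \<comment> \<open>The fundamental weight pairs to 1 with the coroot, so the off-diagonal term is a
    nonzero multiple of x.\<close>
  have k: "fund_weight \<alpha> i \<bullet> coroot (\<alpha> i) = of_int 1" by (simp add: fund_weight_coroot)
  have "X (fund_weight \<alpha> i) (T i x) = \<sigma> (fund_weight \<alpha> i) \<star> T i x"
    using calibrated[OF sg T_V[OF wsp_V[OF x]] gen] by simp
  then have "(\<kappa> * \<sigma> (fund_weight \<alpha> i)) \<star> x = 0"
    using wsp_X_T_one[OF sg x fund_weight_P k one] by simp
  then show ?thesis using kappa_nonzero torusD(1)[OF sg fund_weight_P] by simp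
qed

lemma tau_wsp:
  assumes sg: "\<sigma> \<in> torus \<alpha>" and x: "x \<in> wsp \<sigma>"
  shows "tau i \<sigma> x \<in> wsp (torus_act (s i) \<sigma>)"
proof (cases "\<sigma> (\<alpha> i) = 1")
  \<comment> \<open>Here x = 0, so the default value of the division by zero in \<open>d\<close>
    does no harm.\<close>
  case True
  then show ?thesis using wsp_simple_one[OF sg x] by simp
next
  case False
  show ?thesis unfolding wsp_def
  proof (clarsimp simp: tau_V wsp_V[OF x] torus_act_s)
    fix \<nu> assume nu: "\<nu> \<in> P"
    obtain k where k: "\<nu> \<bullet> coroot (\<alpha> i) = of_int k" using nu by (auto simp: weight_lattice_iff elim: Ints_cases)
    show "X \<nu> (tau i \<sigma> x) = \<sigma> (s i \<nu>) \<star> tau i \<sigma> x"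
      unfolding tau_def X_diff X_scale wsp_X_T[OF sg x nu k False] wsp_X[OF x nu]
      by (simp add: scale_right_diff_distrib right_diff_distrib scale_left_diff_distrib mult_ac)
  qed
qed

lemma d_flip: "\<sigma> \<in> torus \<alpha> \<Longrightarrow> \<sigma> (\<alpha> i) \<noteq> 1 \<Longrightarrow> d i (torus_act (s i) \<sigma>) = \<kappa> - d i \<sigma>"
proof -
  assume sg: "\<sigma> \<in> torus \<alpha>" and ne: "\<sigma> (\<alpha> i) \<noteq> 1"
  have a: "\<sigma> (\<alpha> i) \<noteq> 0" using torusD(1)[OF sg] by simp
  have m: "\<sigma> (- \<alpha> i) = 1 / \<sigma> (\<alpha> i)" using sg by (simp add: torus_act_root)
  have e: "s i (- \<alpha> i) = \<alpha> i" by (simp add: weyl_minus refl_self)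
  have nz: "1 - \<sigma> (\<alpha> i) \<noteq> 0" "1 - 1 / \<sigma> (\<alpha> i) \<noteq> 0" using ne a by (auto simp: field_simps)
  show "d i (torus_act (s i) \<sigma>) = \<kappa> - d i \<sigma>"
    unfolding d_def torus_act_s e m using nz a
    by (simp add: divide_simps) (simp add: algebra_simps)
qed

lemma tau_tau:
  assumes sg: "\<sigma> \<in> torus \<alpha>" and x: "x \<in> wsp \<sigma>"
  shows "tau i (torus_act (s i) \<sigma>) (tau i \<sigma> x) = g i \<sigma> \<star> x"
proof (cases "\<sigma> (\<alpha> i) = 1")
  case True
  then show ?thesis using wsp_simple_one[OF sg x] by simp
next
  case False
  show ?thesis
    unfolding tau_def d_flip[OF sg False] T_diff T_scale T_T[OF wsp_V[OF x]] g_def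
    by (simp add: scale_right_diff_distrib scale_left_diff_distrib scale_left_distrib
        right_diff_distrib mult_ac)
qed

text \<open>With a the simple-root value, g (a - 1)^2 = (a - q^2)(a - q^-2).\<close>

lemma g_eq_0_iff:
  assumes sg: "\<sigma> \<in> torus \<alpha>" and ne: "\<sigma> (\<alpha> i) \<noteq> 1"
  shows "g i \<sigma> = 0 \<longleftrightarrow> \<sigma> (\<alpha> i) = q\<^sup>2 \<or> \<sigma> (\<alpha> i) = inverse (q\<^sup>2)"
proof -
  let ?a = "\<sigma> (\<alpha> i)"
  have a: "?a \<noteq> 0" using torusD(1)[OF sg] by simp
  have m: "\<sigma> (- \<alpha> i) = 1 / ?a" using sg by (simp add: torus_act_root)
  have nz: "?a - 1 \<noteq> 0" using ne by simp
  have dd: "d i \<sigma> = \<kappa> * ?a / (?a - 1)" unfolding d_def m using nz a by (simp add: divide_simps)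
  have "g i \<sigma> * (?a - 1)\<^sup>2 = (?a - 1)\<^sup>2 - \<kappa>\<^sup>2 * ?a"
    unfolding g_def dd using nz by (simp add: divide_simps power2_eq_square) (simp add: algebra_simps)
  also have "\<dots> = (?a - q\<^sup>2) * (?a - inverse (q\<^sup>2))"
    using q_nonzero by (simp add: field_simps power2_eq_square)
  finally have "g i \<sigma> * (?a - 1)\<^sup>2 = (?a - q\<^sup>2) * (?a - inverse (q\<^sup>2))" .
  then show ?thesis using nz by (metis eq_iff_diff_eq_0 mult_eq_0_iff power_eq_0_iff)
qed

lemma tau_nonzero:
  assumes "\<sigma> \<in> torus \<alpha>" "x \<in> wsp \<sigma>" "x \<noteq> 0" "\<sigma> (\<alpha> i) \<noteq> q\<^sup>2" "\<sigma> (\<alpha> i) \<noteq> inverse (q\<^sup>2)"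
  shows "tau i \<sigma> x \<noteq> 0"
proof
  assume "tau i \<sigma> x = 0"
  then have "g i \<sigma> = 0" using tau_tau[OF assms(1,2), of i] assms(3) by simp
  moreover have "\<sigma> (\<alpha> i) \<noteq> 1" using wsp_simple_one assms by blast
  ultimately show False using g_eq_0_iff assms by blast
qed

subsection \<open>Separation of weight spaces\<close>

text \<open>E is the product of the operators X^nu - tau(nu), one for each tau in S, with nu chosen
  to tell tau from sigma; c collects the nonzero factors sigma(nu) - tau(nu).\<close>

lemma wsp_separating_operator:
  assumes "finite S" "\<And>\<tau>. \<tau> \<in> S \<Longrightarrow> \<exists>\<nu>\<in>P. \<tau> \<nu> \<noteq> \<sigma> \<nu>"
  shows "\<exists>E c. (\<forall>x y. E (x + y) = E x + E y) \<and> (\<forall>a x. E (a \<star> x) = a \<star> E x) \<and> c \<noteq> 0 \<and>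
    (\<forall>x\<in>wsp \<sigma>. E x = c \<star> x) \<and> (\<forall>\<tau>\<in>S. \<forall>x\<in>wsp \<tau>. E x = 0)"
  using assms
proof (induction S rule: finite_induct)
  case empty
  show ?case by (intro exI[of _ id] exI[of _ 1]) auto
next
  case (insert \<tau> S)
  have "\<And>\<tau>. \<tau> \<in> S \<Longrightarrow> \<exists>\<nu>\<in>P. \<tau> \<nu> \<noteq> \<sigma> \<nu>" using insert.prems by simp
  then obtain E c where E': "\<forall>x y. E (x + y) = E x + E y" "\<forall>a x. E (a \<star> x) = a \<star> E x" "c \<noteq> 0"
    "\<forall>x\<in>wsp \<sigma>. E x = c \<star> x" "\<forall>\<tau>\<in>S. \<forall>x\<in>wsp \<tau>. E x = 0" using insert.IH by blast
  then have E: "\<And>x y. E (x + y) = E x + E y" "\<And>a x. E (a \<star> x) = a \<star> E x" "c \<noteq> 0"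
    "\<And>x. x \<in> wsp \<sigma> \<Longrightarrow> E x = c \<star> x" "\<And>\<tau> x. \<tau> \<in> S \<Longrightarrow> x \<in> wsp \<tau> \<Longrightarrow> E x = 0" by blast+
  obtain \<nu> where nu: "\<nu> \<in> P" "\<tau> \<nu> \<noteq> \<sigma> \<nu>" using insert.prems by blast
  have on_wsp: "E (X \<nu> x - \<tau> \<nu> \<star> x) = (\<upsilon> \<nu> - \<tau> \<nu>) \<star> E x" if "x \<in> wsp \<upsilon>" for x \<upsilon>
    using wsp_X[OF that nu(1)] by (simp add: E(2) scale_left_diff_distrib[symmetric])
  let ?E = "\<lambda>x. E (X \<nu> x - \<tau> \<nu> \<star> x)"
  have "?E (x + y) = ?E x + ?E y" for x y
    by (simp add: E(1)[symmetric] X_add scale_right_distrib add_diff_add)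
  moreover have "?E (a \<star> x) = a \<star> ?E x" for a x
    by (simp add: E(2)[symmetric] X_scale scale_right_diff_distrib mult.commute)
  moreover have "?E x = ((\<sigma> \<nu> - \<tau> \<nu>) * c) \<star> x" if "x \<in> wsp \<sigma>" for x
    using on_wsp[OF that] E(4)[OF that] by simp
  moreover have "?E x = 0" if "\<upsilon> \<in> insert \<tau> S" "x \<in> wsp \<upsilon>" for x \<upsilon>
    using that E(5)[of \<upsilon> x] on_wsp[OF that(2)] by auto
  ultimately show ?case using E(3) nu(2)
    by (intro exI[of _ ?E] exI[of _ "(\<sigma> \<nu> - \<tau> \<nu>) * c"]) auto
qed

lemma wsp_disjoint_span:
  assumes "finite S" "\<And>\<tau>. \<tau> \<in> S \<Longrightarrow> \<exists>\<nu>\<in>P. \<tau> \<nu> \<noteq> \<sigma> \<nu>"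
    and x: "x \<in> wsp \<sigma>" "x \<in> span (\<Union>\<tau>\<in>S. wsp \<tau>)"
  shows "x = 0"
proof -
  obtain E c where E: "\<forall>x y. E (x + y) = E x + E y" "\<forall>a x. E (a \<star> x) = a \<star> E x" "c \<noteq> 0"
    "\<forall>x\<in>wsp \<sigma>. E x = c \<star> x" "\<forall>\<tau>\<in>S. \<forall>x\<in>wsp \<tau>. E x = 0"
    using wsp_separating_operator[OF assms(1,2)] by blast
  have E0: "E 0 = 0" using E(1) by (metis add_cancel_right_right)
  have "E x = 0" using x(2)
    by (induction rule: span_induct_alt) (use E E0 in auto)
  then show ?thesis using E(3,4) x(1) by simp
qed

end

context hecke_rep begin

subsection \<open>Calibrated weights in rank two\<close>

text \<open>The two eigenvalues of T_i. Their squares are q^2 and q^-2, so a single computation with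
  e settles both exceptional values.\<close>

definition qlike :: "complex \<Rightarrow> bool" where
  "qlike e \<longleftrightarrow> e = q \<or> e = - inverse q"

lemma qlike:
  assumes "qlike e"
  shows "e \<noteq> 0" "\<kappa> = e - inverse e" "{q\<^sup>2, inverse (q\<^sup>2)} = {e\<^sup>2, inverse (e\<^sup>2)}"
    "0 < n \<Longrightarrow> e ^ n \<noteq> 1"
proof -
  show "e \<noteq> 0" "\<kappa> = e - inverse e" "{q\<^sup>2, inverse (q\<^sup>2)} = {e\<^sup>2, inverse (e\<^sup>2)}"
    using assms q_nonzero by (auto simp: qlike_def power_inverse)
  show "e ^ n \<noteq> 1" if "0 < n"
  proof
    assume "e ^ n = 1"
    then have e: "(e\<^sup>2) ^ n = 1" by (metis power_commutes power_mult power_one mult.commute)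
    have "(q\<^sup>2) ^ n = 1"
    proof (cases "e = q")
      case False
      then have "e\<^sup>2 = inverse (q\<^sup>2)" using assms by (simp add: qlike_def power_inverse)
      then have "inverse ((q\<^sup>2) ^ n) = 1" using e by (simp add: power_inverse)
      then show ?thesis by simp
    qed (use e in simp)
    then have "q ^ (2 * n) = 1" by (simp only: power_mult)
    then show False using q_not_root_of_unity[of "2 * n"] that by simp
  qed
qed

lemma qlike_of_square:
  assumes "a = q\<^sup>2 \<or> a = inverse (q\<^sup>2)" obtains e where "qlike e" "a = e\<^sup>2"
  using assms that[of q] that[of "- inverse q"] by (auto simp: qlike_def power_inverse)

text \<open>A weight vector killed by \<open>tau\<close> i is therefore an eigenvector of T_i with
  eigenvalue e; replacing e by -1/e gives \<open>d_inverse_square\<close>.\<close>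

lemma d_square:
  assumes "\<sigma> \<in> torus \<alpha>" "qlike e" "\<sigma> (\<alpha> i) = e\<^sup>2" shows "d i \<sigma> = e"
proof -
  have e: "e \<noteq> 0" "\<kappa> = e - inverse e" "e\<^sup>2 \<noteq> 1" using qlike[OF assms(2)] by auto
  have m: "\<sigma> (- \<alpha> i) = 1 / e\<^sup>2" using assms by (simp add: torus_act_root)
  have "e * e - 1 \<noteq> 0" using e by (simp add: power2_eq_square)
  then show ?thesis unfolding d_def m e(2) using e(1)
    by (simp add: divide_simps power2_eq_square)
qed

lemma d_inverse_square:
  assumes "\<sigma> \<in> torus \<alpha>" "qlike e" "\<sigma> (\<alpha> i) = inverse (e\<^sup>2)" shows "d i \<sigma> = - inverse e"
proof -
  have "qlike (- inverse e)" using assms(2) q_nonzero by (auto simp: qlike_def)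
  then show ?thesis using d_square[OF assms(1), of "- inverse e"] assms(3) by (simp add: power_inverse)
qed

lemma d_eq:
  assumes "\<sigma> \<in> torus \<alpha>" "\<sigma> (\<alpha> i) = a" shows "d i \<sigma> = \<kappa> / (1 - 1 / a)"
  using assms by (simp add: d_def torus_act_root)

lemma tau_zero_imp:
  assumes "\<sigma> \<in> torus \<alpha>" "x \<in> wsp \<sigma>" "x \<noteq> 0" "tau i \<sigma> x = 0"
  shows "\<sigma> (\<alpha> i) = q\<^sup>2 \<or> \<sigma> (\<alpha> i) = inverse (q\<^sup>2)"
  using tau_nonzero[OF assms(1-3)] assms(4) by blast

lemma tau_nonzero_qlike:
  assumes "\<sigma> \<in> torus \<alpha>" "x \<in> wsp \<sigma>" "x \<noteq> 0" "qlike e" "\<sigma> (\<alpha> i) \<noteq> e\<^sup>2" "\<sigma> (\<alpha> i) \<noteq> inverse (e\<^sup>2)"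
  shows "tau i \<sigma> x \<noteq> 0"
  using assms qlike(3)[OF assms(4)] tau_nonzero[OF assms(1-3)] unfolding doubleton_eq_iff by metis

definition Nwt :: "(real^'n \<Rightarrow> complex) \<Rightarrow> bool" where
  "Nwt \<sigma> \<longleftrightarrow> \<sigma> \<in> torus \<alpha> \<and> (\<exists>x\<in>wsp \<sigma>. x \<noteq> 0)"

lemma Nwt_neq_1: "Nwt \<sigma> \<Longrightarrow> \<sigma> (\<alpha> i) \<noteq> 1"
  using wsp_simple_one by (auto simp: Nwt_def)

lemma tau_Nwt:
  assumes "\<sigma> \<in> torus \<alpha>" "x \<in> wsp \<sigma>" "tau i \<sigma> x \<noteq> 0" shows "Nwt (torus_act (s i) \<sigma>)"
  using tau_wsp[OF assms(1,2)] torus_act_torus[OF s_weyl assms(1)] assms(3) by (auto simp: Nwt_def)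

lemma torus_s_self: "\<sigma> \<in> torus \<alpha> \<Longrightarrow> torus_act (s i) \<sigma> (\<alpha> i) = 1 / \<sigma> (\<alpha> i)"
  by (simp add: torus_act_s refl_self torus_act_root)

lemma torus_s_other:
  assumes "\<sigma> \<in> torus \<alpha>" "\<alpha> j \<bullet> coroot (\<alpha> i) = - of_nat n"
  shows "torus_act (s i) \<sigma> (\<alpha> j) = \<sigma> (\<alpha> j) * \<sigma> (\<alpha> i) ^ n"
  using torus_scale_nat(2)[OF assms(1) simple_P simple_P, of j n i] assms(2)
  by (simp add: torus_act_s refl_def)

lemma torus_lc:
  assumes "\<sigma> \<in> torus \<alpha>"
  shows "\<sigma> (of_nat m *\<^sub>R \<alpha> i + of_nat n *\<^sub>R \<alpha> j) = \<sigma> (\<alpha> i) ^ m * \<sigma> (\<alpha> j) ^ n"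
proof -
  have "of_nat m *\<^sub>R \<alpha> i \<in> P" "\<sigma> (of_nat m *\<^sub>R \<alpha> i) = \<sigma> (\<alpha> i) ^ m"
    using torus_scale_nat[OF assms P_zero simple_P, of m i] torus_zero[OF assms] by auto
  then show ?thesis using torus_scale_nat(2)[OF assms _ simple_P, of "of_nat m *\<^sub>R \<alpha> i" n j] by simp
qed

text \<open>Both reflected weights take the value 1 at a simple root, so both intertwiners kill x,
  and x is a common eigenvector with eigenvalues e and -1/e. The braid relation reads -e = 1/e,
  whence e^4 = 1.\<close>

lemma A2_no_zero:
  assumes ij: "i \<noteq> j" and A: "\<alpha> i \<bullet> coroot (\<alpha> j) = -1" and B: "\<alpha> j \<bullet> coroot (\<alpha> i) = -1"
    and sg: "\<sigma> \<in> torus \<alpha>" and x: "x \<in> wsp \<sigma>" "x \<noteq> 0"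
  shows "\<sigma> (\<alpha> i) * \<sigma> (\<alpha> j) \<noteq> 1"
proof
  assume ab: "\<sigma> (\<alpha> i) * \<sigma> (\<alpha> j) = 1"
  have i1: "torus_act (s i) \<sigma> (\<alpha> j) = 1" and j1: "torus_act (s j) \<sigma> (\<alpha> i) = 1"
    using torus_s_other[OF sg, of j i 1] torus_s_other[OF sg, of i j 1] A B ab by (auto simp: mult.commute)
  have ti: "tau i \<sigma> x = 0" using tau_Nwt[OF sg x(1), of i] Nwt_neq_1[of _ j] i1 by blast
  have tj: "tau j \<sigma> x = 0" using tau_Nwt[OF sg x(1), of j] Nwt_neq_1[of _ i] j1 by blast
  obtain e where e: "qlike e" "\<sigma> (\<alpha> i) = e\<^sup>2" using tau_zero_imp[OF sg x ti] by (rule qlike_of_square)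
  have b: "\<sigma> (\<alpha> j) = inverse (e\<^sup>2)" using ab e by (metis inverse_unique)
  have Ti: "T i x = e \<star> x" using ti d_square[OF sg e] by (simp add: tau_def)
  have Tj: "T j x = (- inverse e) \<star> x" using T_eq_tau[of j x \<sigma>] tj d_inverse_square[OF sg e(1) b] by simp
  have m: "cox_order \<alpha> i j = 3" using rank2_A2[OF ij A B HOL.refl HOL.refl] by (simp add: rank2_def)
  have "T i (T j (T i x)) = T j (T i (T j x))"
    using T_braid[OF ij wsp_V[OF x(1)]] by (simp add: m numeral_3_eq_3)
  then have "(e * - inverse e * e) \<star> x = (- inverse e * e * - inverse e) \<star> x"
    by (simp only: Ti Tj T_scale scale_scale mult.assoc)
  then have "e * - inverse e * e = - inverse e * e * - inverse e" using x(2) scale_cancel_right by blast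
  then have "- (e ^ 2) = 1" using qlike(1)[OF e(1)] by (simp add: field_simps power2_eq_square)
  then have "e ^ 2 = -1" by (metis minus_minus)
  then have "e ^ 4 = 1" by (metis (no_types) power2_minus power_even_eq one_power2 mult_2 numeral_Bit0 power_add)
  then show False using qlike(4)[OF e(1), of 4] by simp
qed

text \<open>From here on \<open>i\<close> is the long root.\<close>

lemma C2_no_long_zero:
  assumes ij: "i \<noteq> j" and A: "\<alpha> i \<bullet> coroot (\<alpha> j) = -2" and B: "\<alpha> j \<bullet> coroot (\<alpha> i) = -1"
    and sg: "\<sigma> \<in> torus \<alpha>" and x: "x \<in> wsp \<sigma>" "x \<noteq> 0"
  shows "\<sigma> (\<alpha> i) * \<sigma> (\<alpha> j) ^ 2 \<noteq> 1"
proof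
  assume ab: "\<sigma> (\<alpha> i) * \<sigma> (\<alpha> j) ^ 2 = 1"
  have sj: "torus_act (s j) \<tau> (\<alpha> i) = \<tau> (\<alpha> i) * \<tau> (\<alpha> j) ^ 2" if "\<tau> \<in> torus \<alpha>" for \<tau>
    using torus_s_other[OF that, of i j 2] A by simp
  have si: "torus_act (s i) \<tau> (\<alpha> j) = \<tau> (\<alpha> j) * \<tau> (\<alpha> i)" if "\<tau> \<in> torus \<alpha>" for \<tau>
    using torus_s_other[OF that, of j i 1] B by simp
  have tj: "tau j \<sigma> x = 0" using tau_Nwt[OF sg x(1), of j] Nwt_neq_1[of _ i] sj[OF sg] ab by metis
  obtain e where e: "qlike e" "\<sigma> (\<alpha> j) = e\<^sup>2" using tau_zero_imp[OF sg x tj] by (rule qlike_of_square)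
  have e0: "e \<noteq> 0" and en: "\<And>n. 0 < n \<Longrightarrow> e ^ n \<noteq> 1" using qlike[OF e(1)] by auto
  have a: "\<sigma> (\<alpha> i) = inverse (e ^ 4)" using ab e e0 by (simp add: field_simps)
  \<comment> \<open>The plane spanned by x and y = \<open>tau\<close> i x is stable: y is not zero,
    and its simple-root values e^4 and e^-2 again satisfy the equation \<open>ab\<close>, so the
    intertwiner of j kills it too.\<close>
  define \<sigma>2 where "\<sigma>2 = torus_act (s i) \<sigma>"
  define y where "y = tau i \<sigma> x"
  have sg2: "\<sigma>2 \<in> torus \<alpha>" unfolding \<sigma>2_def by (rule torus_act_torus[OF s_weyl sg])
  have y: "y \<in> wsp \<sigma>2" unfolding y_def \<sigma>2_def by (rule tau_wsp[OF sg x(1)])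
  have a2: "\<sigma>2 (\<alpha> i) = e ^ 4" unfolding \<sigma>2_def torus_s_self[OF sg] a by (simp add: field_simps)
  have b2: "\<sigma>2 (\<alpha> j) = inverse (e\<^sup>2)" unfolding \<sigma>2_def si[OF sg] a e using e0 by (simp add: field_simps)
  have ab2: "\<sigma>2 (\<alpha> i) * \<sigma>2 (\<alpha> j) ^ 2 = 1" unfolding a2 b2 using e0 by (simp add: field_simps)
  have tj2: "tau j \<sigma>2 y = 0" using tau_Nwt[OF sg2 y, of j] Nwt_neq_1[of _ i] sj[OF sg2] ab2 by metis
  have "\<sigma> (\<alpha> i) \<notin> {e\<^sup>2, inverse (e\<^sup>2)}"
    using en[of 6] en[of 2] e0 by (auto simp: a field_simps eval_nat_numeral)
  then have y0: "y \<noteq> 0" unfolding y_def using tau_nonzero_qlike[OF sg x e(1), of i] by auto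
  define c1 c2 h where "c1 = d i \<sigma>" and "c2 = d i \<sigma>2" and "h = g i \<sigma>"
  have Tjx: "T j x = e \<star> x" using tj d_square[OF sg e] by (simp add: tau_def)
  have Tjy: "T j y = (- inverse e) \<star> y" using T_eq_tau[of j y \<sigma>2] tj2 d_inverse_square[OF sg2 e(1) b2] by simp
  have Tix: "T i x = c1 \<star> x + y" unfolding c1_def y_def by (simp add: tau_def)
  have Tiy: "T i y = c2 \<star> y + h \<star> x"
    using tau_tau[OF sg x(1), of i] unfolding c2_def h_def y_def[symmetric] \<sigma>2_def[symmetric]
    by (simp add: T_eq_tau[of i y \<sigma>2] add.commute)
  have m: "cox_order \<alpha> i j = 4" using rank2_C2[OF ij A B HOL.refl HOL.refl] by (simp add: rank2_def)
  have br: "T i (T j (T i (T j x))) = T j (T i (T j (T i x)))"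
    using T_braid[OF ij wsp_V[OF x(1)]] by (simp add: m eval_nat_numeral)
  define k1 k2 where "k1 = e * c1 * c1 - inverse e * h" and "k2 = e * c1 - inverse e * c2"
  have w: "T i (T j (T i x)) = k1 \<star> x + k2 \<star> y"
    unfolding k1_def k2_def
    by (simp add: Tix Tiy Tjx Tjy T_add T_scale T_minus T_diff scale_right_distrib scale_left_distrib scale_left_diff_distrib
        scale_right_diff_distrib mult_ac)
  \<comment> \<open>As x has T_j-eigenvalue e, the braid relation makes T_i T_j T_i x an eigenvector
    with that eigenvalue. On y the operator T_j is -1/e, so the y-coefficient k2 must vanish. Since
    c2 = -e^4 c1, this forces e^2 = -1.\<close>
  have "e \<star> (k1 \<star> x + k2 \<star> y) = T j (k1 \<star> x + k2 \<star> y)" using br unfolding Tjx T_scale w .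
  then have "(k2 * (e + inverse e)) \<star> y = 0"
    by (simp add: T_add T_scale Tjx Tjy scale_right_distrib scale_left_distrib distrib_left mult_ac)
  then have "k2 * (e + inverse e) = 0" using y0 by simp
  moreover have "e + inverse e \<noteq> 0"
  proof
    assume "e + inverse e = 0"
    then have "e ^ 2 = -1" using e0 by (simp add: field_simps power2_eq_square add_eq_0_iff)
    then have "e ^ 4 = 1" using power_mult[of e 2 2] by simp
    then show False using en[of 4] by simp
  qed
  ultimately have "e * c1 = inverse e * c2" by (simp add: k2_def)
  moreover have n4: "1 - e ^ 4 \<noteq> 0" using en[of 4] by simp
  moreover have "c1 = \<kappa> / (1 - e ^ 4)" unfolding c1_def d_eq[OF sg a] by (simp add: inverse_eq_divide)
  moreover have "c2 = - (e ^ 4) * (\<kappa> / (1 - e ^ 4))"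
  proof -
    have "K / (1 - 1 / e ^ 4) = - (e ^ 4) * (K / (1 - e ^ 4))" for K
      using e0 n4 by (simp add: divide_simps) (simp add: algebra_simps)
    then show ?thesis unfolding c2_def d_eq[OF sg2 a2] .
  qed
  ultimately have "e * (\<kappa> / (1 - e ^ 4)) = (- inverse e * e ^ 4) * (\<kappa> / (1 - e ^ 4))" by simp
  then have "e = - inverse e * e ^ 4"
    using kappa_nonzero n4 mult_right_cancel[of "\<kappa> / (1 - e ^ 4)"] by (metis divide_eq_0_iff)
  moreover have "inverse e * e ^ 4 = e * e\<^sup>2" using e0 by (simp add: eval_nat_numeral)
  ultimately have "e + e * e\<^sup>2 = 0" by (simp add: eq_neg_iff_add_eq_0[symmetric])
  then have "e * (1 + e\<^sup>2) = 0" by (simp add: algebra_simps)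
  then have "e ^ 2 = -1" using e0 by (simp add: add_eq_0_iff)
  then have "e ^ 4 = 1" using power_mult[of e 2 2] by simp
  then show False using en[of 4] by simp
qed

text \<open>Here a chain of four weight vectors survives; comparing the coefficients of the last one in the
  braid relation gives the contradiction.\<close>

lemma G2_no_zero_ab3:
  assumes ij: "i \<noteq> j" and A: "\<alpha> i \<bullet> coroot (\<alpha> j) = -3" and B: "\<alpha> j \<bullet> coroot (\<alpha> i) = -1"
    and sg: "\<sigma> \<in> torus \<alpha>" and x: "x \<in> wsp \<sigma>" "x \<noteq> 0"
  shows "\<sigma> (\<alpha> i) * \<sigma> (\<alpha> j) ^ 3 \<noteq> 1"
proof
  assume ab: "\<sigma> (\<alpha> i) * \<sigma> (\<alpha> j) ^ 3 = 1"
  have sj: "torus_act (s j) \<tau> (\<alpha> i) = \<tau> (\<alpha> i) * \<tau> (\<alpha> j) ^ 3" if "\<tau> \<in> torus \<alpha>" for \<tau>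
    using torus_s_other[OF that, of i j 3] A by simp
  have si: "torus_act (s i) \<tau> (\<alpha> j) = \<tau> (\<alpha> j) * \<tau> (\<alpha> i)" if "\<tau> \<in> torus \<alpha>" for \<tau>
    using torus_s_other[OF that, of j i 1] B by simp
  have tj: "tau j \<sigma> x = 0" using tau_Nwt[OF sg x(1), of j] Nwt_neq_1[of _ i] sj[OF sg] ab by metis
  obtain e where e: "qlike e" "\<sigma> (\<alpha> j) = e\<^sup>2" using tau_zero_imp[OF sg x tj] by (rule qlike_of_square)
  have e0: "e \<noteq> 0" and en: "\<And>n. 0 < n \<Longrightarrow> e ^ n \<noteq> 1" using qlike[OF e(1)] by auto
  have a: "\<sigma> (\<alpha> i) = inverse (e ^ 6)" using ab e e0 by (simp add: field_simps power_mult[symmetric])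
  \<comment> \<open>The chain follows s_i, s_j, s_i. The simple-root values at (i, j) are (e^-6,
    e^2), (e^6, e^-4), (e^-6, e^4), (e^6, e^-2), and the intertwiner of j vanishes at both
    ends.\<close>
  define \<sigma>2 where "\<sigma>2 = torus_act (s i) \<sigma>"
  define \<sigma>3 where "\<sigma>3 = torus_act (s j) \<sigma>2"
  define \<sigma>4 where "\<sigma>4 = torus_act (s i) \<sigma>3"
  define x2 where "x2 = tau i \<sigma> x"
  define x3 where "x3 = tau j \<sigma>2 x2"
  define x4 where "x4 = tau i \<sigma>3 x3"
  have sg2: "\<sigma>2 \<in> torus \<alpha>" unfolding \<sigma>2_def by (rule torus_act_torus[OF s_weyl sg])
  have sg3: "\<sigma>3 \<in> torus \<alpha>" unfolding \<sigma>3_def by (rule torus_act_torus[OF s_weyl sg2])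
  have sg4: "\<sigma>4 \<in> torus \<alpha>" unfolding \<sigma>4_def by (rule torus_act_torus[OF s_weyl sg3])
  have x2: "x2 \<in> wsp \<sigma>2" unfolding x2_def \<sigma>2_def by (rule tau_wsp[OF sg x(1)])
  have x3: "x3 \<in> wsp \<sigma>3" unfolding x3_def \<sigma>3_def by (rule tau_wsp[OF sg2 x2])
  have x4: "x4 \<in> wsp \<sigma>4" unfolding x4_def \<sigma>4_def by (rule tau_wsp[OF sg3 x3])
  have p: "e ^ m * e ^ n = e ^ (m + n)" for m n by (simp add: power_add)
  have a2: "\<sigma>2 (\<alpha> i) = e ^ 6" unfolding \<sigma>2_def torus_s_self[OF sg] a by (simp add: field_simps)
  have b2: "\<sigma>2 (\<alpha> j) = inverse (e ^ 4)" unfolding \<sigma>2_def si[OF sg] a e using e0 by (simp add: field_simps p)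
  have a3: "\<sigma>3 (\<alpha> i) = inverse (e ^ 6)" unfolding \<sigma>3_def sj[OF sg2] a2 b2
    using e0 by (simp add: field_simps p power_mult[symmetric])
  have b3: "\<sigma>3 (\<alpha> j) = e ^ 4" unfolding \<sigma>3_def torus_s_self[OF sg2] b2 by (simp add: field_simps)
  have a4: "\<sigma>4 (\<alpha> i) = e ^ 6" unfolding \<sigma>4_def torus_s_self[OF sg3] a3 by (simp add: field_simps)
  have b4: "\<sigma>4 (\<alpha> j) = inverse (e\<^sup>2)" unfolding \<sigma>4_def si[OF sg3] a3 b3
    using e0 by (simp add: field_simps p)
  have ab4: "\<sigma>4 (\<alpha> i) * \<sigma>4 (\<alpha> j) ^ 3 = 1" unfolding a4 b4
    using e0 by (simp add: field_simps power_mult[symmetric])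
  have tj4: "tau j \<sigma>4 x4 = 0" using tau_Nwt[OF sg4 x4, of j] Nwt_neq_1[of _ i] sj[OF sg4] ab4 by metis
  have inv_iff: "inverse u = v \<longleftrightarrow> u * v = 1" if "u \<noteq> 0" for u v :: complex
    using that by (auto simp: field_simps)
  have ei: "inverse (e ^ m) = e\<^sup>2 \<longleftrightarrow> e ^ (m + 2) = 1" for m
    unfolding power_add using inv_iff[of "e ^ m" "e\<^sup>2"] e0 by simp
  have ei': "inverse (e ^ (n + 2)) = inverse (e\<^sup>2) \<longleftrightarrow> e ^ n = 1" for n
    unfolding power_add using e0 by simp
  have "inverse (e\<^sup>2) = e ^ n \<longleftrightarrow> e ^ (n + 2) = 1" for n
    unfolding power_add using inv_iff[of "e\<^sup>2" "e ^ n"] e0 by (simp add: mult.commute)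
  then have ep': "e ^ n = inverse (e\<^sup>2) \<longleftrightarrow> e ^ (n + 2) = 1" for n by metis
  have "x2 \<noteq> 0" unfolding x2_def using tau_nonzero_qlike[OF sg x e(1), of i] ei[of 6] ei'[of 4] en[of 8] en[of 4]
    by (auto simp: a)
  then have "x3 \<noteq> 0" unfolding x3_def using tau_nonzero_qlike[OF sg2 x2 _ e(1), of j] ei[of 4] ei'[of 2] en[of 6] en[of 2]
    by (auto simp: b2)
  then have x40: "x4 \<noteq> 0" unfolding x4_def using tau_nonzero_qlike[OF sg3 x3 _ e(1), of i] ei[of 6] ei'[of 4] en[of 8] en[of 4]
    by (auto simp: a3)
  define c1 c2 c3 c4 where "c1 = d i \<sigma>" and "c2 = d i \<sigma>2" and "c3 = d j \<sigma>2" and "c4 = d j \<sigma>3"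
  define h1 h2 h3 where "h1 = g i \<sigma>" and "h2 = g j \<sigma>2" and "h3 = g i \<sigma>3"
  have d3: "d i \<sigma>3 = c1" unfolding c1_def d_eq[OF sg a] d_eq[OF sg3 a3] ..
  have d4: "d i \<sigma>4 = c2" unfolding c2_def d_eq[OF sg2 a2] d_eq[OF sg4 a4] ..
  have Tjx: "T j x = e \<star> x" using tj d_square[OF sg e] by (simp add: tau_def)
  have Tjx4: "T j x4 = (- inverse e) \<star> x4" using T_eq_tau[of j x4 \<sigma>4] tj4 d_inverse_square[OF sg4 e(1) b4] by simp
  have Tix: "T i x = c1 \<star> x + x2" unfolding c1_def x2_def by (simp add: tau_def)
  have Tix2: "T i x2 = c2 \<star> x2 + h1 \<star> x"
    using tau_tau[OF sg x(1), of i] unfolding c2_def h1_def x2_def[symmetric] \<sigma>2_def[symmetric]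
    by (simp add: T_eq_tau[of i x2 \<sigma>2] add.commute)
  have Tjx2: "T j x2 = c3 \<star> x2 + x3" unfolding c3_def x3_def by (simp add: tau_def)
  have Tjx3: "T j x3 = c4 \<star> x3 + h2 \<star> x2"
    using tau_tau[OF sg2 x2, of j] unfolding c4_def h2_def x3_def[symmetric] \<sigma>3_def[symmetric]
    by (simp add: T_eq_tau[of j x3 \<sigma>3] add.commute)
  have Tix3: "T i x3 = c1 \<star> x3 + x4" unfolding d3[symmetric] x4_def by (simp add: tau_def)
  have Tix4: "T i x4 = c2 \<star> x4 + h3 \<star> x3"
    using tau_tau[OF sg3 x3, of i] unfolding d4[symmetric] h3_def x4_def[symmetric] \<sigma>4_def[symmetric]
    by (simp add: T_eq_tau[of i x4 \<sigma>4] add.commute)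
  have m: "cox_order \<alpha> i j = 6" using rank2_G2[OF ij A B HOL.refl HOL.refl] by (simp add: rank2_def)
  have br: "T i (T j (T i (T j (T i (T j x))))) = T j (T i (T j (T i (T j (T i x)))))"
    using T_braid[OF ij wsp_V[OF x(1)]] by (simp add: m eval_nat_numeral)
  define lc4 where "lc4 k1 k2 k3 k4 = k1 \<star> x + k2 \<star> x2 + k3 \<star> x3 + k4 \<star> x4" for k1 k2 k3 k4
  have Ti4: "T i (lc4 k1 k2 k3 k4)
    = lc4 (k1 * c1 + k2 * h1) (k1 + k2 * c2) (k3 * c1 + k4 * h3) (k3 + k4 * c2)" for k1 k2 k3 k4
    unfolding lc4_def by (simp add: T_add T_scale Tix Tix2 Tix3 Tix4 scale_right_distrib scale_left_distrib)
  have Tj4: "T j (lc4 k1 k2 k3 k4)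
    = lc4 (k1 * e) (k2 * c3 + k3 * h2) (k2 + k3 * c4) (k4 * - inverse e)" for k1 k2 k3 k4
    unfolding lc4_def by (simp add: T_add T_scale Tjx Tjx2 Tjx3 Tjx4 scale_right_distrib scale_left_distrib)
  have xl: "x = lc4 1 0 0 0" by (simp add: lc4_def)
  \<comment> \<open>The coefficient of x4 in the word of length five applied to x. Three letters
    move up the chain and two act diagonally, which can happen in four ways, one for each
    summand.\<close>
  define K where "K = c1 * e + c3 * c2 + c1 * c4 - inverse e * c2"
  obtain k1 k2 k3 where w: "T i (T j (T i (T j (T i x)))) = lc4 k1 k2 k3 K"
  proof -
    have "\<exists>k1 k2 k3. T i (T j (T i (T j (T i x)))) = lc4 k1 k2 k3 K"
      unfolding K_def by (subst xl) (simp add: Ti4 Tj4, intro exI, rule HOL.refl)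
    then show ?thesis using that by blast
  qed
  \<comment> \<open>The braid relation makes the word of length five an eigenvector of T_j with
    eigenvalue e, like x. On x4 the operator T_j is -1/e, so K (e + 1/e) must vanish.\<close>
  have "e \<star> lc4 k1 k2 k3 K = T j (lc4 k1 k2 k3 K)" using br unfolding Tjx T_scale w .
  also have "T j (lc4 k1 k2 k3 K) = lc4 (k1 * e) (k2 * c3 + k3 * h2) (k2 + k3 * c4) (K * - inverse e)" by (rule Tj4)
  finally have eq: "e \<star> lc4 k1 k2 k3 K = lc4 (k1 * e) (k2 * c3 + k3 * h2) (k2 + k3 * c4) (K * - inverse e)" .
  define r1 r2 r3 where "r1 = k1 * e - e * k1" and "r2 = k2 * c3 + k3 * h2 - e * k2" and "r3 = k2 + k3 * c4 - e * k3"
  have "(K * (e + inverse e)) \<star> x4 = r1 \<star> x + r2 \<star> x2 + r3 \<star> x3"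
    using eq unfolding lc4_def r1_def r2_def r3_def
    by (simp add: scale_right_distrib scale_left_distrib scale_left_diff_distrib algebra_simps)
  moreover have "r1 \<star> x + r2 \<star> x2 + r3 \<star> x3 \<in> span (\<Union>\<tau>\<in>{\<sigma>, \<sigma>2, \<sigma>3}. wsp \<tau>)"
    using x x2 x3 by (intro span_add span_scale span_base) auto
  moreover have "(K * (e + inverse e)) \<star> x4 \<in> wsp \<sigma>4" using x4 by (rule wsp_scale)
  \<comment> \<open>The values at alpha_j are e^2, e^-4, e^4 on the first three weights and e^-2 on
    the last.\<close>
  moreover have "\<exists>\<nu>\<in>P. \<tau> \<nu> \<noteq> \<sigma>4 \<nu>" if "\<tau> \<in> {\<sigma>, \<sigma>2, \<sigma>3}" for \<tau>
  proof (rule bexI[of _ "\<alpha> j"])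
    have "e\<^sup>2 \<noteq> inverse (e\<^sup>2)" using ep'[of 2] en[of 4] by simp
    moreover have "inverse (e ^ 4) \<noteq> inverse (e\<^sup>2)" using ei'[of 2] en[of 2] by simp
    moreover have "e ^ 4 \<noteq> inverse (e\<^sup>2)" using ep'[of 4] en[of 6] by simp
    ultimately show "\<tau> (\<alpha> j) \<noteq> \<sigma>4 (\<alpha> j)" using that by (auto simp: e b2 b3 b4)
  qed simp
  ultimately have "(K * (e + inverse e)) \<star> x4 = 0" using wsp_disjoint_span[of "{\<sigma>, \<sigma>2, \<sigma>3}" \<sigma>4] by simp
  then have "K * (e + inverse e) = 0" using x40 by simp
  moreover have "e + inverse e \<noteq> 0"
  proof
    assume "e + inverse e = 0"
    then have "e ^ 2 = -1" using e0 by (simp add: field_simps power2_eq_square add_eq_0_iff)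
    then have "e ^ 4 = 1" using power_mult[of e 2 2] by simp
    then show False using en[of 4] by simp
  qed
  ultimately have K0: "K = 0" by simp
  have ke: "\<kappa> = e - inverse e" by (rule qlike(2)[OF e(1)])
  have n2: "1 - e ^ 2 \<noteq> 0" and n4: "1 - e ^ 4 \<noteq> 0" and n6: "1 - e ^ 6 \<noteq> 0" using en[of 2] en[of 4] en[of 6] by auto
  have C1: "c1 = (e - inverse e) / (1 - e ^ 6)" unfolding c1_def d_eq[OF sg a] ke by (simp add: field_simps)
  have C2: "c2 = - (e ^ 6 * (e - inverse e) / (1 - e ^ 6))" unfolding c2_def d_eq[OF sg2 a2] ke
    using e0 n6 by (simp add: divide_simps) (simp add: algebra_simps)
  have C3: "c3 = (e - inverse e) / (1 - e ^ 4)" unfolding c3_def d_eq[OF sg2 b2] ke by (simp add: field_simps)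
  have C4: "c4 = - (e ^ 4 * (e - inverse e) / (1 - e ^ 4))" unfolding c4_def d_eq[OF sg3 b3] ke
    using e0 n4 by (simp add: divide_simps) (simp add: algebra_simps)
  \<comment> \<open>After clearing denominators this says K = -1.\<close>
  have "K * ((1 - e ^ 6) * (1 - e ^ 4)) * e\<^sup>2 = - ((1 - e ^ 6) * (1 - e ^ 4)) * e\<^sup>2"
    unfolding K_def C1 C2 C3 C4 using e0 n4 n6
    by (simp add: divide_simps) (simp add: algebra_simps eval_nat_numeral)
  then show False using K0 n4 n6 e0 by simp
qed

text \<open>The reflection s_i carries this root to the one excluded by
  \<open>G2_no_zero_ab3\<close>, so the intertwiner of i kills x, and likewise y =
  \<open>tau\<close> j x. On the plane of x and y the operator T_i is diagonal with entries e and
  -1/e, and the braid relation of length six is tested there.\<close>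

lemma G2_no_zero_a2b3:
  assumes ij: "i \<noteq> j" and A: "\<alpha> i \<bullet> coroot (\<alpha> j) = -3" and B: "\<alpha> j \<bullet> coroot (\<alpha> i) = -1"
    and sg: "\<sigma> \<in> torus \<alpha>" and x: "x \<in> wsp \<sigma>" "x \<noteq> 0"
  shows "\<sigma> (\<alpha> i) ^ 2 * \<sigma> (\<alpha> j) ^ 3 \<noteq> 1"
proof
  assume ab: "\<sigma> (\<alpha> i) ^ 2 * \<sigma> (\<alpha> j) ^ 3 = 1"
  have si: "torus_act (s i) \<tau> (\<alpha> j) = \<tau> (\<alpha> j) * \<tau> (\<alpha> i)" if "\<tau> \<in> torus \<alpha>" for \<tau>
    using torus_s_other[OF that, of j i 1] B by simp
  have sj: "torus_act (s j) \<tau> (\<alpha> i) = \<tau> (\<alpha> i) * \<tau> (\<alpha> j) ^ 3" if "\<tau> \<in> torus \<alpha>" for \<tau>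
    using torus_s_other[OF that, of i j 3] A by simp
  have ti_zero: "tau i \<tau> y = 0"
    if t: "\<tau> \<in> torus \<alpha>" "y \<in> wsp \<tau>" "\<tau> (\<alpha> i) ^ 2 * \<tau> (\<alpha> j) ^ 3 = 1" for \<tau> y
  proof (rule ccontr)
    assume "tau i \<tau> y \<noteq> 0"
    moreover have "\<tau> (\<alpha> i) \<noteq> 0" using torusD(1)[OF t(1)] by simp
    then have "torus_act (s i) \<tau> (\<alpha> i) * torus_act (s i) \<tau> (\<alpha> j) ^ 3 = 1"
      using t(3) unfolding si[OF t(1)] torus_s_self[OF t(1)]
      by (simp add: power_mult_distrib field_simps eval_nat_numeral)
    ultimately show False
      using G2_no_zero_ab3[OF ij A B torus_act_torus[OF s_weyl t(1)] tau_wsp[OF t(1,2)]] by blast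
  qed
  have ti: "tau i \<sigma> x = 0" by (rule ti_zero[OF sg x(1) ab])
  obtain e where e: "qlike e" "\<sigma> (\<alpha> i) = e\<^sup>2" using tau_zero_imp[OF sg x ti] by (rule qlike_of_square)
  have e0: "e \<noteq> 0" and en: "\<And>n. 0 < n \<Longrightarrow> e ^ n \<noteq> 1" using qlike[OF e(1)] by auto
  define b where "b = \<sigma> (\<alpha> j)"
  have b: "\<sigma> (\<alpha> j) = b" by (simp add: b_def)
  have b0: "b \<noteq> 0" unfolding b_def using torusD(1)[OF sg] by simp
  have b1: "b \<noteq> 1" unfolding b_def using Nwt_neq_1[of \<sigma> j] sg x by (auto simp: Nwt_def)
  have be: "e ^ 4 * b ^ 3 = 1" using ab unfolding b e(2) by (simp add: power_mult[symmetric])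
  define \<sigma>2 where "\<sigma>2 = torus_act (s j) \<sigma>"
  define y where "y = tau j \<sigma> x"
  have sg2: "\<sigma>2 \<in> torus \<alpha>" unfolding \<sigma>2_def by (rule torus_act_torus[OF s_weyl sg])
  have y: "y \<in> wsp \<sigma>2" unfolding y_def \<sigma>2_def by (rule tau_wsp[OF sg x(1)])
  have "b \<noteq> e\<^sup>2" using be en[of 10] by (auto simp: power_mult[symmetric] power_add[symmetric])
  moreover have "b \<noteq> inverse (e\<^sup>2)"
  proof
    assume "b = inverse (e\<^sup>2)"
    then have "b ^ 3 = inverse (e ^ 6)" by (simp add: power_inverse power_mult[symmetric])
    then have "b ^ 3 * e ^ 4 = b ^ 3 * e ^ 6" using be e0 by (simp add: field_simps)
    then have "e ^ 4 = e ^ 6" using b0 by simp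
    then have "e ^ 2 = 1" using e0 by (simp add: eval_nat_numeral)
    then show False using en[of 2] by simp
  qed
  ultimately have y0: "y \<noteq> 0" unfolding y_def using tau_nonzero_qlike[OF sg x e(1), of j] by (auto simp: b)
  have a2: "\<sigma>2 (\<alpha> i) = inverse (e\<^sup>2)" unfolding \<sigma>2_def sj[OF sg] b e(2)
    using be e0 by (simp add: field_simps eval_nat_numeral)
  have b2: "\<sigma>2 (\<alpha> j) = 1 / b" unfolding \<sigma>2_def torus_s_self[OF sg] b ..
  have "\<sigma>2 (\<alpha> i) ^ 2 * \<sigma>2 (\<alpha> j) ^ 3 = 1" unfolding a2 b2 using be e0 b0
    by (simp add: field_simps power_mult[symmetric])
  then have ti2: "tau i \<sigma>2 y = 0" by (rule ti_zero[OF sg2 y])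
  define c1 c2 h where "c1 = d j \<sigma>" and "c2 = d j \<sigma>2" and "h = g j \<sigma>"
  have Tix: "T i x = e \<star> x" using ti d_square[OF sg e] by (simp add: tau_def)
  have Tiy: "T i y = (- inverse e) \<star> y" using T_eq_tau[of i y \<sigma>2] ti2 d_inverse_square[OF sg2 e(1) a2] by simp
  have Tjx: "T j x = c1 \<star> x + y" unfolding c1_def y_def by (simp add: tau_def)
  have Tjy: "T j y = c2 \<star> y + h \<star> x"
    using tau_tau[OF sg x(1), of j] unfolding c2_def h_def y_def[symmetric] \<sigma>2_def[symmetric]
    by (simp add: T_eq_tau[of j y \<sigma>2] add.commute)
  have c12: "c2 = \<kappa> - c1" unfolding c1_def c2_def \<sigma>2_def by (rule d_flip[OF sg]) (use b b1 in simp)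
  have h: "h = 1 + c1 * c2" unfolding h_def g_def c12 c1_def ..
  have m: "cox_order \<alpha> i j = 6" using rank2_G2[OF ij A B HOL.refl HOL.refl] by (simp add: rank2_def)
  have br: "T i (T j (T i (T j (T i (T j x))))) = T j (T i (T j (T i (T j (T i x)))))"
    using T_braid[OF ij wsp_V[OF x(1)]] by (simp add: m eval_nat_numeral)
  define lc where "lc k1 k2 = k1 \<star> x + k2 \<star> y" for k1 k2
  have Ti2: "T i (lc k1 k2) = lc (k1 * e) (k2 * - inverse e)" for k1 k2
    unfolding lc_def by (simp add: T_add T_scale Tix Tiy)
  have Tj2: "T j (lc k1 k2) = lc (k1 * c1 + k2 * h) (k1 + k2 * c2)" for k1 k2
    unfolding lc_def by (simp add: T_add T_scale Tjx Tjy scale_right_distrib scale_left_distrib)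
  have xl: "x = lc 1 0" by (simp add: lc_def)
  \<comment> \<open>The trace of T_j T_i on the plane. Both operators have determinant -1 there, so
    by Cayley-Hamilton the y-coefficient of (T_j T_i)^2 T_j x is t^2 - 1.\<close>
  define t where "t = e * c1 - inverse e * c2"
  define A' B' where "A' = c1 * e * c1 + - inverse e * h" and "B' = c1 * e + - inverse e * c2"
  have "T j (T i (T j (T i (T j x)))) = lc (A' * e * c1 + B' * - inverse e * h) (A' * e + B' * - inverse e * c2)"
    unfolding A'_def B'_def by (subst xl) (simp add: Ti2 Tj2)
  moreover have "A' * e + B' * - inverse e * c2 = t\<^sup>2 - 1"
    unfolding A'_def B'_def t_def h using e0 by (simp add: field_simps power2_eq_square)
  ultimately obtain k1 where w: "T j (T i (T j (T i (T j x)))) = lc k1 (t\<^sup>2 - 1)" by simp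
  have "e \<star> lc k1 (t\<^sup>2 - 1) = T i (lc k1 (t\<^sup>2 - 1))" using br unfolding Tix T_scale w by simp
  then have "((t\<^sup>2 - 1) * (e + inverse e)) \<star> y = 0"
    unfolding Ti2 unfolding lc_def scale_right_distrib scale_scale distrib_left scale_left_distrib
    by (simp add: mult.commute[of e])
  then have "(t\<^sup>2 - 1) * (e + inverse e) = 0" using y0 by simp
  moreover have "e + inverse e \<noteq> 0"
  proof
    assume "e + inverse e = 0"
    then have "e ^ 2 = -1" using e0 by (simp add: field_simps power2_eq_square add_eq_0_iff)
    then have "e ^ 4 = 1" using power_mult[of e 2 2] by simp
    then show False using en[of 4] by simp
  qed
  ultimately have t1: "t = 1 \<or> t = -1" by (simp add: power2_eq_1_iff)
  have ke: "\<kappa> = e - inverse e" by (rule qlike(2)[OF e(1)])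
  have nb: "b - 1 \<noteq> 0" using b1 by simp
  have C1: "c1 = (e - inverse e) * b / (b - 1)" unfolding c1_def d_eq[OF sg b] ke
    using nb b0 by (simp add: divide_simps)
  have C2: "c2 = - (e - inverse e) / (b - 1)" unfolding c2_def d_eq[OF sg2 b2] ke
    using nb b0 by (simp add: divide_simps) (simp add: algebra_simps)
  have t: "t * (b - 1) * e\<^sup>2 = (e\<^sup>2 - 1) * (e\<^sup>2 * b + 1)"
    unfolding t_def C1 C2 using nb e0 by (simp add: divide_simps) (simp add: algebra_simps eval_nat_numeral)
  \<comment> \<open>It remains to combine z^2 b^3 = 1 with t = 1 or t = -1. The value -1 gives z^2 b
    = 1, hence z^4 = 1; for the value 1, eliminating b leaves a polynomial in z with roots 1 and -1
    only.\<close>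
  define z where "z = e\<^sup>2"
  have zb: "z\<^sup>2 * b ^ 3 = 1" using be by (simp add: z_def power_mult[symmetric])
  have z0: "z \<noteq> 0" and zn: "\<And>n. 0 < n \<Longrightarrow> z ^ n \<noteq> 1" using e0 en by (auto simp: z_def power_mult[symmetric])
  show False using t1
  proof
    assume "t = -1"
    then have "z\<^sup>2 * b = 1" using t by (simp add: z_def algebra_simps power2_eq_square)
    then have bz: "b = inverse (z\<^sup>2)" by (metis inverse_unique)
    have "z\<^sup>2 = z ^ 6" using zb z0 unfolding bz by (simp add: field_simps power_mult[symmetric])
    then have "z ^ 4 = 1" using z0 by (simp add: eval_nat_numeral)
    then show False using zn[of 4] by simp
  next
    assume "t = 1"
    then have 1: "b * (z * (z - 2)) = 1 - 2 * z" using t by (simp add: z_def algebra_simps power2_eq_square)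
    have "z * (z - 2) ^ 3 = (z\<^sup>2 * b ^ 3) * (z * (z - 2) ^ 3)" using zb by simp
    also have "\<dots> = (b * (z * (z - 2))) ^ 3" by (simp add: power_mult_distrib eval_nat_numeral)
    also have "\<dots> = (1 - 2 * z) ^ 3" using 1 by simp
    finally have "z * (z - 2) ^ 3 - (1 - 2 * z) ^ 3 = 0" by simp
    moreover have "z * (z - 2) ^ 3 - (1 - 2 * z) ^ 3 = (z\<^sup>2 - 1) * (z + 1)\<^sup>2"
      by (simp add: algebra_simps eval_nat_numeral)
    ultimately have "(z\<^sup>2 - 1) * (z + 1)\<^sup>2 = 0" by simp
    then have "z\<^sup>2 = 1 \<or> z = -1" by (auto simp: eq_neg_iff_add_eq_0)
    then have "z\<^sup>2 = 1" by auto
    then show False using zn[of 2] by simp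
  qed
qed

definition weyl2_reaches :: "'n \<Rightarrow> 'n \<Rightarrow> (real^'n \<Rightarrow> complex) \<Rightarrow> bool" where
  "weyl2_reaches i j \<sigma> \<longleftrightarrow> (\<exists>u\<in>weyl2 \<alpha> i j. torus_act u \<sigma> (\<alpha> i) = q\<^sup>2 \<and> torus_act u \<sigma> (\<alpha> j) = 1)"

lemma weyl2_reaches_here: "\<sigma> (\<alpha> i) = q\<^sup>2 \<Longrightarrow> \<sigma> (\<alpha> j) = 1 \<Longrightarrow> weyl2_reaches i j \<sigma>"
  unfolding weyl2_reaches_def weyl2_def by (rule bexI[of _ id]) (simp_all add: refl_group_id)

lemma weyl2_reaches_step:
  assumes "weyl2_reaches i j (torus_act (s k) \<sigma>)" "k = i \<or> k = j" shows "weyl2_reaches i j \<sigma>"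
proof -
  obtain u where u: "u \<in> weyl2 \<alpha> i j" "torus_act u (torus_act (s k) \<sigma>) (\<alpha> i) = q\<^sup>2"
    "torus_act u (torus_act (s k) \<sigma>) (\<alpha> j) = 1" using assms(1) by (auto simp: weyl2_reaches_def)
  have "u \<in> weyl R" using refl_group_mono[of u "{\<alpha> i, \<alpha> j}" R] u(1) by (simp add: weyl2_def)
  then have "torus_act (u \<circ> s k) \<sigma> = torus_act u (torus_act (s k) \<sigma>)" by (rule torus_act_comp) simp
  moreover have "s k \<in> weyl2 \<alpha> i j" unfolding weyl2_def using assms(2) by (intro refl_in_refl_group) auto
  then have "u \<circ> s k \<in> weyl2 \<alpha> i j" using u(1) refl_group_comp unfolding weyl2_def by blast
  ultimately show ?thesis unfolding weyl2_reaches_def using u by metis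
qed

text \<open>The weight reflected by s_i has value 1 at alpha_j, so the intertwiner of i kills x and
  the value at alpha_i is q^2 or q^-2. In the second case s_i leads to the required pair of values,
  in the first s_i s_j does.\<close>

lemma C2_reaches:
  assumes A: "\<alpha> i \<bullet> coroot (\<alpha> j) = -2" and B: "\<alpha> j \<bullet> coroot (\<alpha> i) = -1"
    and sg: "\<sigma> \<in> torus \<alpha>" and x: "x \<in> wsp \<sigma>" "x \<noteq> 0" and ab: "\<sigma> (\<alpha> i) * \<sigma> (\<alpha> j) = 1"
  shows "weyl2_reaches i j \<sigma>"
proof -
  have sj: "torus_act (s j) \<tau> (\<alpha> i) = \<tau> (\<alpha> i) * \<tau> (\<alpha> j) ^ 2" if "\<tau> \<in> torus \<alpha>" for \<tau>
    using torus_s_other[OF that, of i j 2] A by simp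
  have si: "torus_act (s i) \<tau> (\<alpha> j) = \<tau> (\<alpha> j) * \<tau> (\<alpha> i)" if "\<tau> \<in> torus \<alpha>" for \<tau>
    using torus_s_other[OF that, of j i 1] B by simp
  have ti: "tau i \<sigma> x = 0" using tau_Nwt[OF sg x(1), of i] Nwt_neq_1[of _ j] si[OF sg] ab
    by (metis mult.commute)
  have a0: "\<sigma> (\<alpha> i) \<noteq> 0" using torusD(1)[OF sg] by simp
  have b: "\<sigma> (\<alpha> j) = 1 / \<sigma> (\<alpha> i)" using ab a0 by (simp add: field_simps)
  show ?thesis using tau_zero_imp[OF sg x ti]
  proof
    assume a: "\<sigma> (\<alpha> i) = q\<^sup>2"
    note t1 = torus_act_torus[OF s_weyl sg, of j]
    have "weyl2_reaches i j (torus_act (s i) (torus_act (s j) \<sigma>))"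
      by (rule weyl2_reaches_here, unfold a[symmetric])
        (use a0 in \<open>simp_all add: si sj torus_s_self sg t1 b field_simps power2_eq_square\<close>)
    then show ?thesis using weyl2_reaches_step by blast
  next
    assume a: "\<sigma> (\<alpha> i) = inverse (q\<^sup>2)"
    have "weyl2_reaches i j (torus_act (s i) \<sigma>)"
      by (rule weyl2_reaches_here) (use ab a in \<open>simp_all add: si torus_s_self sg mult.commute inverse_eq_divide\<close>)
    then show ?thesis using weyl2_reaches_step by blast
  qed
qed

text \<open>Phrased by values rather than by a weight vector, because \<open>G2_reaches\<close>
  applies it to a reflected weight at which the vector at hand may be zero. The element for the
  value q^2 is s_i s_j s_i s_j.\<close>

lemma G2_reaches_ab:
  assumes A: "\<alpha> i \<bullet> coroot (\<alpha> j) = -3" and B: "\<alpha> j \<bullet> coroot (\<alpha> i) = -1"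
    and sg: "\<sigma> \<in> torus \<alpha>" and ab: "\<sigma> (\<alpha> i) * \<sigma> (\<alpha> j) = 1"
    and val: "\<sigma> (\<alpha> i) = q\<^sup>2 \<or> \<sigma> (\<alpha> i) = inverse (q\<^sup>2)"
  shows "weyl2_reaches i j \<sigma>"
proof -
  have sj: "torus_act (s j) \<tau> (\<alpha> i) = \<tau> (\<alpha> i) * \<tau> (\<alpha> j) ^ 3" if "\<tau> \<in> torus \<alpha>" for \<tau>
    using torus_s_other[OF that, of i j 3] A by simp
  have si: "torus_act (s i) \<tau> (\<alpha> j) = \<tau> (\<alpha> j) * \<tau> (\<alpha> i)" if "\<tau> \<in> torus \<alpha>" for \<tau>
    using torus_s_other[OF that, of j i 1] B by simp
  have a0: "\<sigma> (\<alpha> i) \<noteq> 0" using torusD(1)[OF sg] by simp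
  have b: "\<sigma> (\<alpha> j) = 1 / \<sigma> (\<alpha> i)" using ab a0 by (simp add: field_simps)
  show ?thesis using val
  proof
    assume a: "\<sigma> (\<alpha> i) = q\<^sup>2"
    note t1 = torus_act_torus[OF s_weyl sg, of j]
    note t2 = torus_act_torus[OF s_weyl t1, of i]
    note t3 = torus_act_torus[OF s_weyl t2, of j]
    have "weyl2_reaches i j (torus_act (s i) (torus_act (s j) (torus_act (s i) (torus_act (s j) \<sigma>))))"
      by (rule weyl2_reaches_here, unfold a[symmetric])
        (use a0 in \<open>simp_all add: si sj torus_s_self sg t1 t2 t3 b field_simps eval_nat_numeral\<close>)
    then show ?thesis using weyl2_reaches_step by blast
  next
    assume a: "\<sigma> (\<alpha> i) = inverse (q\<^sup>2)"
    have "weyl2_reaches i j (torus_act (s i) \<sigma>)"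
      by (rule weyl2_reaches_here) (use ab a in \<open>simp_all add: si torus_s_self sg mult.commute inverse_eq_divide\<close>)
    then show ?thesis using weyl2_reaches_step by blast
  qed
qed

lemma G2_reaches:
  assumes A: "\<alpha> i \<bullet> coroot (\<alpha> j) = -3" and B: "\<alpha> j \<bullet> coroot (\<alpha> i) = -1"
    and sg: "\<sigma> \<in> torus \<alpha>" and x: "x \<in> wsp \<sigma>" "x \<noteq> 0"
    and ab: "\<sigma> (\<alpha> i) * \<sigma> (\<alpha> j) = 1 \<or> \<sigma> (\<alpha> i) * \<sigma> (\<alpha> j) ^ 2 = 1"
  shows "weyl2_reaches i j \<sigma>"
proof -
  have sj: "torus_act (s j) \<tau> (\<alpha> i) = \<tau> (\<alpha> i) * \<tau> (\<alpha> j) ^ 3" if "\<tau> \<in> torus \<alpha>" for \<tau>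
    using torus_s_other[OF that, of i j 3] A by simp
  have si: "torus_act (s i) \<tau> (\<alpha> j) = \<tau> (\<alpha> j) * \<tau> (\<alpha> i)" if "\<tau> \<in> torus \<alpha>" for \<tau>
    using torus_s_other[OF that, of j i 1] B by simp
  have val: "\<tau> (\<alpha> i) = q\<^sup>2 \<or> \<tau> (\<alpha> i) = inverse (q\<^sup>2)"
    if t: "\<tau> \<in> torus \<alpha>" "y \<in> wsp \<tau>" "y \<noteq> 0" "\<tau> (\<alpha> i) * \<tau> (\<alpha> j) = 1" for \<tau> y
  proof -
    have "tau i \<tau> y = 0" using tau_Nwt[OF t(1,2), of i] Nwt_neq_1[of _ j] si[OF t(1)] t(4)
      by (metis mult.commute)
    then show ?thesis by (rule tau_zero_imp[OF t(1-3)])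
  qed
  show ?thesis
  proof (cases "\<sigma> (\<alpha> i) * \<sigma> (\<alpha> j) = 1")
    case True
    then show ?thesis using G2_reaches_ab[OF A B sg] val[OF sg x] by blast
  next
    case False
    then have ab2: "\<sigma> (\<alpha> i) * \<sigma> (\<alpha> j) ^ 2 = 1" using ab by blast
    note t1 = torus_act_torus[OF s_weyl sg, of j]
    have b0: "\<sigma> (\<alpha> j) \<noteq> 0" using torusD(1)[OF sg] by simp
    have a1: "torus_act (s j) \<sigma> (\<alpha> i) = \<sigma> (\<alpha> j)" using ab2 sj[OF sg] by (simp add: eval_nat_numeral)
    have ab1: "torus_act (s j) \<sigma> (\<alpha> i) * torus_act (s j) \<sigma> (\<alpha> j) = 1"
      unfolding a1 torus_s_self[OF sg] using b0 by simp
    \<comment> \<open>Either the intertwiner of j kills x, which gives the value directly, or its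
      image is a nonzero vector at the reflected weight, where \<open>val\<close> applies.\<close>
    have "\<sigma> (\<alpha> j) = q\<^sup>2 \<or> \<sigma> (\<alpha> j) = inverse (q\<^sup>2)"
    proof (cases "tau j \<sigma> x = 0")
      case True
      then show ?thesis by (rule tau_zero_imp[OF sg x])
    next
      case False
      show ?thesis using val[OF t1 tau_wsp[OF sg x(1)] False ab1] unfolding a1 .
    qed
    then have "weyl2_reaches i j (torus_act (s j) \<sigma>)" using G2_reaches_ab[OF A B t1 ab1] a1 by simp
    then show ?thesis using weyl2_reaches_step by blast
  qed
qed

text \<open>If clause (a) fails, some root of the rank two list has value 1, which is a monomial
  equation in the two simple-root values. Each equation is impossible for an occurring weight or
  leads to the orbit condition of \<open>calibratable_b\<close>.\<close>

lemma calibratable_Nwt: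
  assumes "Nwt \<sigma>" shows "calibratable \<alpha> q i j \<sigma>"
proof (rule ccontr)
  assume nc: "\<not> calibratable \<alpha> q i j \<sigma>"
  obtain x where sg: "\<sigma> \<in> torus \<alpha>" and x: "x \<in> wsp \<sigma>" "x \<noteq> 0" using assms by (auto simp: Nwt_def)
  have ne: "\<sigma> (\<alpha> k) \<noteq> 1" for k using Nwt_neq_1[OF assms] .
  obtain \<beta> where b: "\<beta> \<in> roots2 \<alpha> i j" "\<sigma> \<beta> = 1" using nc by (auto simp: calibratable_def)
  have neg: "\<sigma> \<gamma> = 1" if "\<beta> = - \<gamma>" "\<gamma> \<in> P" for \<gamma>
    using b(2) torus_minus[OF sg that(2)] that(1) by simp
  have lcP: "of_nat m *\<^sub>R \<alpha> k + of_nat n *\<^sub>R \<alpha> l \<in> P" for m n k l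
    using torus_scale_nat(1)[OF sg torus_scale_nat(1)[OF sg P_zero simple_P, of m k] simple_P, of n l] by simp
  have val: "\<sigma> (\<alpha> k) ^ m * \<sigma> (\<alpha> l) ^ n = 1"
    if "\<beta> = of_nat m *\<^sub>R \<alpha> k + of_nat n *\<^sub>R \<alpha> l \<or> \<beta> = - (of_nat m *\<^sub>R \<alpha> k + of_nat n *\<^sub>R \<alpha> l)" for m n k l
    using that neg[OF _ lcP] b(2) torus_lc[OF sg] by metis
  show False
  proof (cases "i = j")
    case True
    have "roots2 \<alpha> i j \<subseteq> {\<alpha> i, - \<alpha> i}" unfolding True
      by (rule roots2_induct) (auto simp: refl_self weyl_minus)
    then show False using b ne[of i] neg[of "\<alpha> i"] by auto
  next
    case False
    have C2: False if "\<alpha> k \<bullet> coroot (\<alpha> l) = -2" "\<alpha> l \<bullet> coroot (\<alpha> k) = -1" "k \<noteq> l" "\<beta> \<in> roots2 \<alpha> k l"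
      "\<not> calibratable_b \<alpha> q k l \<sigma>" for k l
    proof -
      have "\<sigma> (\<alpha> k) * \<sigma> (\<alpha> l) = 1 \<or> \<sigma> (\<alpha> k) * \<sigma> (\<alpha> l) ^ 2 = 1"
        using roots2_C2[OF that(3,1,2) HOL.refl HOL.refl that(4)] val[of 1 k 1 l] val[of 1 k 2 l] val[of 1 k 0 l] val[of 0 k 1 l] ne by auto
      then have "weyl2_reaches k l \<sigma>"
        using C2_reaches[OF that(1,2) sg x] C2_no_long_zero[OF that(3,1,2) sg x] by blast
      then show False using that(1,2,5) ne
        by (auto simp: calibratable_b_def type_C2_long_short_def weyl2_reaches_def)
    qed
    have G2: False if "\<alpha> k \<bullet> coroot (\<alpha> l) = -3" "\<alpha> l \<bullet> coroot (\<alpha> k) = -1" "k \<noteq> l" "\<beta> \<in> roots2 \<alpha> k l"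
      "\<not> calibratable_b \<alpha> q k l \<sigma>" for k l
    proof -
      have "\<sigma> (\<alpha> k) * \<sigma> (\<alpha> l) = 1 \<or> \<sigma> (\<alpha> k) * \<sigma> (\<alpha> l) ^ 2 = 1 \<or> \<sigma> (\<alpha> k) * \<sigma> (\<alpha> l) ^ 3 = 1
          \<or> \<sigma> (\<alpha> k) ^ 2 * \<sigma> (\<alpha> l) ^ 3 = 1"
        using roots2_G2[OF that(3,1,2) HOL.refl HOL.refl that(4)] val[of 1 k 1 l] val[of 1 k 2 l] val[of 1 k 3 l] val[of 2 k 3 l]
          val[of 1 k 0 l] val[of 0 k 1 l] ne by auto
      then have "weyl2_reaches k l \<sigma>"
        using G2_reaches[OF that(1,2) sg x] G2_no_zero_ab3[OF that(3,1,2) sg x] G2_no_zero_a2b3[OF that(3,1,2) sg x] by blast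
      then show False using that(1,2,5) ne
        by (auto simp: calibratable_b_def type_G2_long_short_def weyl2_reaches_def)
    qed
    have b': "\<beta> \<in> roots2 \<alpha> j i" using b(1) roots2_sym by metis
    have nb: "\<not> calibratable_b \<alpha> q i j \<sigma>" "\<not> calibratable_b \<alpha> q j i \<sigma>" using nc by (auto simp: calibratable_def)
    have A1: False if "\<alpha> i \<bullet> coroot (\<alpha> j) = 0" "\<alpha> j \<bullet> coroot (\<alpha> i) = 0"
      using roots2_A1A1[OF False that HOL.refl HOL.refl b(1)] val[of 1 i 0 j] val[of 0 i 1 j] ne by auto
    have A2: False if "\<alpha> i \<bullet> coroot (\<alpha> j) = -1" "\<alpha> j \<bullet> coroot (\<alpha> i) = -1"
      using roots2_A2[OF False that HOL.refl HOL.refl b(1)] val[of 1 i 0 j] val[of 0 i 1 j] val[of 1 i 1 j] ne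
        A2_no_zero[OF False that sg x] by auto
    show False using cartan_cases[OF False] A1 A2 C2[OF _ _ False b(1) nb(1)] C2[OF _ _ False[symmetric] b' nb(2)]
        G2[OF _ _ False b(1) nb(1)] G2[OF _ _ False[symmetric] b' nb(2)] by blast
  qed
qed

end

section \<open>Alternating and reduced words\<close>

fun rw :: "'n \<Rightarrow> 'n \<Rightarrow> nat \<Rightarrow> 'n list" where
  "rw i j 0 = []"
| "rw i j (Suc k) = (if even k then i else j) # rw i j k"

text \<open>Products act from the right, so in \<open>rw\<close> the letter i always acts first and
  each step applies one more reflection; \<open>altw\<close> instead fixes the letter acting
  last.\<close>

lemma rw_eq_rev: "rw i j k = rev (altw i j k)"
  by (induction k) (simp_all add: altw_snoc del: altw.simps(2))

lemma length_rw [simp]: "length (rw i j k) = k"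
  by (simp add: rw_eq_rev)

lemma altw_eq_rw: "altw i j k = (if even k then rw j i k else rw i j k)"
  by (simp add: rw_eq_rev rev_altw)

context simple_root_system begin

lemma wprod_rev': "wprod (rev is) (wprod is v) = v"
  using wprod_rev[of "rev is"] by simp

lemma inv_wprod: "inv (wprod is) = wprod (rev is)"
  by (rule inv_unique_comp) (auto simp: fun_eq_iff wprod_rev wprod_rev')

lemma inv_wprod_rw: "inv (wprod (rw i j k)) = wprod (altw i j k)"
  by (simp add: inv_wprod rw_eq_rev)

lemma inv_wprod_rw_root: "inv (wprod (rw i j k)) (\<alpha> (if even k then i else j)) = alt_root i j k"
  by (simp add: inv_wprod_rw alt_root_def)

lemma alt_root_pos: assumes "rank2 i j m" "k < m" shows "alt_root i j k \<in> pos"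
proof -
  obtain p r where pr: "p \<ge> 0" "r \<ge> 0" "alt_root i j k = p *\<^sub>R \<alpha> i + r *\<^sub>R \<alpha> j"
    using assms by (auto simp: rank2_def)
  show ?thesis unfolding pos_iff_cf using alt_root_root[of i j k] pr(1,2)
    by (simp add: pr(3) cf_add cf_scale cf_simple)
qed

lemma rank2_pos: assumes "rank2 i j m" shows "0 < m"
proof -
  have "\<alpha> i \<in> roots2 \<alpha> i j" unfolding roots2_def weyl2_def
    using refl_group_id[of "{\<alpha> i, \<alpha> j}"] by (metis (mono_tags, lifting) id_apply insertI1 mem_Collect_eq)
  then show ?thesis using assms by (auto simp: rank2_def)
qed

text \<open>Each new letter adds the inversion \<open>alt_root\<close> i j k, a positive root for k
  below m.\<close>

lemma len_wprod_rw: assumes "rank2 i j m" "k \<le> m" shows "len (wprod (rw i j k)) = k"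
  using assms(2)
proof (induction k)
  case (Suc k)
  then have "alt_root i j k \<in> pos" using alt_root_pos[OF assms(1)] by simp
  then show ?case using Suc len_s_up[OF wprod_weyl, of "rw i j k"] inv_wprod_rw_root[of i j k]
    by (cases "even k") (simp_all del: o_apply)
qed (simp add: id_def[symmetric])

lemma roots2_s:
  assumes "k = i \<or> k = j" "\<beta> \<in> roots2 \<alpha> i j" shows "s k \<beta> \<in> roots2 \<alpha> i j"
proof -
  obtain w \<gamma> where w: "w \<in> weyl2 \<alpha> i j" "\<gamma> \<in> {\<alpha> i, \<alpha> j}" "\<beta> = w \<gamma>" using assms(2) by (auto simp: roots2_def)
  have "s k \<circ> w \<in> weyl2 \<alpha> i j" using w(1) assms(1) unfolding weyl2_def
    by (intro refl_group_comp[OF refl_in_refl_group]) auto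
  then show ?thesis using w(2,3) unfolding roots2_def by (metis (mono_tags, lifting) comp_apply mem_Collect_eq)
qed

lemma simple_in_roots2: "\<alpha> i \<in> roots2 \<alpha> i j" "\<alpha> j \<in> roots2 \<alpha> i j"
  unfolding roots2_def weyl2_def using refl_group_id[of "{\<alpha> i, \<alpha> j}"]
  by (metis (mono_tags, lifting) id_apply insertI1 insertI2 mem_Collect_eq)+

text \<open>Each letter changes the sign of its own simple root and of no other positive root, and
  the subsystem is stable under both letters. This supplies the positivity required by
  \<open>torus_stabilizer_trivial\<close> for roots outside the subsystem.\<close>

lemma wprod_pos_outside_roots2:
  assumes "set is \<subseteq> {i, j}" "\<beta> \<in> pos" "\<beta> \<notin> roots2 \<alpha> i j"
  shows "wprod is \<beta> \<in> pos \<and> wprod is \<beta> \<notin> roots2 \<alpha> i j"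
  using assms(1)
proof (induction "is")
  case (Cons k "is")
  then have IH: "wprod is \<beta> \<in> pos" "wprod is \<beta> \<notin> roots2 \<alpha> i j" and k: "k = i \<or> k = j" by auto
  have "wprod is \<beta> \<noteq> \<alpha> k" using IH(2) k simple_in_roots2 by metis
  then have "s k (wprod is \<beta>) \<in> pos" using s_pos IH(1) by blast
  moreover have "s k (wprod is \<beta>) \<notin> roots2 \<alpha> i j" using roots2_s[OF k] IH(2) s_involution by metis
  ultimately show ?case by simp
qed (use assms in simp)

lemma set_rw: "set (rw i j k) \<subseteq> {i, j}"
  by (induction k) auto

lemma set_altw: "set (altw i j k) \<subseteq> {i, j}"
  by (induction k arbitrary: i j) auto

lemma rank2_rw:
  assumes "rank2 i j m" shows "wprod (rw i j m) = wprod (rw j i m)"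
proof -
  have "inv (wprod (altw i j m)) = inv (wprod (altw j i m))" using assms by (simp add: rank2_def)
  then show ?thesis by (simp only: inv_wprod rw_eq_rev)
qed

lemma rank2_sym: "i \<noteq> j \<Longrightarrow> rank2 i j m \<Longrightarrow> rank2 j i m"
  using rank2_cox_order[of j i] cox_order_sym[of i j] by (simp add: rank2_def[of i j])

definition reduced_word :: "'n list \<Rightarrow> bool" where
  "reduced_word is \<longleftrightarrow> len (wprod is) = length is"

lemma len_wprod_le: "len (wprod is) \<le> length is"
proof (induction "is")
  case (Cons i "is")
  have "len (s i \<circ> wprod is) \<le> Suc (len (wprod is))"
    using len_s_up[OF wprod_weyl, of "is" i] len_s_down[OF wprod_weyl, of "is" i] by (metis Suc_leD Suc_n_not_le_n nat_le_linear)
  then show ?case using Cons by (simp del: o_apply)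
qed (simp add: id_def[symmetric])

lemma reduced_word_Cons:
  "reduced_word (i # is) \<longleftrightarrow> reduced_word is \<and> inv (wprod is) (\<alpha> i) \<in> pos"
  using len_s_up[OF wprod_weyl, of "is" i] len_s_down[OF wprod_weyl, of "is" i] len_wprod_le[of "is"]
  unfolding reduced_word_def by (cases "inv (wprod is) (\<alpha> i) \<in> pos") (auto simp del: o_apply)

lemma reduced_word_Nil [simp]: "reduced_word []"
  by (simp add: reduced_word_def id_def[symmetric])

lemma ex_reduced_word: "w \<in> weyl R \<Longrightarrow> \<exists>is. reduced_word is \<and> wprod is = w"
proof (induction "len w" arbitrary: w)
  case 0
  then have "w = id" using len_0_imp_id by metis
  then show ?case using reduced_word_Nil wprod_Nil by blast
next
  case (Suc n)
  then have "w \<noteq> id" by auto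
  then obtain i where i: "inv w (\<alpha> i) \<notin> pos" using ex_descent Suc.prems by blast
  have w': "s i \<circ> w \<in> weyl R" using Suc.prems by (simp only: weyl_comp s_weyl)
  have "n = len (s i \<circ> w)" using len_s_down[OF Suc.prems i] Suc.hyps(2) by simp
  then obtain "is" where "is": "reduced_word is" "wprod is = s i \<circ> w" using Suc.hyps(1)[OF _ w'] by blast
  have "wprod (i # is) = w" by (simp only: "is"(2) wprod_Cons s_s_comp)
  moreover have "reduced_word (i # is)"
    using calculation "is" \<open>n = len (s i \<circ> w)\<close> Suc.hyps(2) by (simp add: reduced_word_def)
  ultimately show ?case by blast
qed

end

context hecke_rep begin

subsection \<open>Words in the intertwiners\<close>

text \<open>An intertwiner depends on the weight of its argument; the reflected sigma in the second
  equation is the weight reached by the letters already applied.\<close>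

fun tw :: "'n list \<Rightarrow> (real^'n \<Rightarrow> complex) \<Rightarrow> 'v \<Rightarrow> 'v" where
  "tw [] \<sigma> x = x"
| "tw (i # is) \<sigma> x = tau i (torus_act (wprod is) \<sigma>) (tw is \<sigma> x)"

lemma torus_act_wprod_append:
  "torus_act (wprod (is @ js)) \<sigma> = torus_act (wprod is) (torus_act (wprod js) \<sigma>)"
  unfolding wprod_append by (rule torus_act_comp) simp_all

lemma torus_act_wprod_Cons:
  "torus_act (wprod (i # is)) \<sigma> = torus_act (s i) (torus_act (wprod is) \<sigma>)"
  unfolding wprod_Cons by (rule torus_act_comp) simp_all

lemma tw_append: "tw (is @ js) \<sigma> x = tw is (torus_act (wprod js) \<sigma>) (tw js \<sigma> x)"
  by (induction "is") (simp_all add: torus_act_wprod_append del: wprod_Cons)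

lemma torus_wprod: "\<sigma> \<in> torus \<alpha> \<Longrightarrow> torus_act (wprod is) \<sigma> \<in> torus \<alpha>"
  by (rule torus_act_torus) simp_all

lemma tw_wsp: "\<sigma> \<in> torus \<alpha> \<Longrightarrow> x \<in> wsp \<sigma> \<Longrightarrow> tw is \<sigma> x \<in> wsp (torus_act (wprod is) \<sigma>)"
proof (induction "is")
  case (Cons i "is")
  then show ?case using tau_wsp[OF torus_wprod] unfolding torus_act_wprod_Cons by simp
qed simp

lemma tw_0 [simp]: "tw is \<sigma> 0 = 0" by (induction "is") auto

lemma wprod_rw_value:
  "torus_act (wprod (rw i j k)) \<sigma> (\<alpha> (if even k then i else j)) = \<sigma> (alt_root i j k)"
  using inv_wprod_rw_root[of i j k] by (simp add: torus_act_def)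

lemma tw_rw_zero:
  assumes sg: "\<sigma> \<in> torus \<alpha>" and x: "x \<in> wsp \<sigma>" and k: "k < m" "\<sigma> (alt_root i j k) = 1"
  shows "tw (rw i j m) \<sigma> x = 0"
proof -
  have "tw (rw i j k) \<sigma> x = 0"
    using wsp_simple_one[OF torus_wprod[OF sg] tw_wsp[OF sg x], of "rw i j k" "if even k then i else j"]
      wprod_rw_value[of i j k \<sigma>] k(2) by simp
  then have "tw (rw i j (k + l)) \<sigma> x = 0" for l by (induction l) auto
  from this[of "m - k"] show ?thesis using k(1) by simp
qed

text \<open>Expanding each T as an intertwiner plus a scalar, the word in the intertwiners is the
  leading term. Every other term skips a letter, and after cancelling equal neighbours its weight
  comes from a shorter alternating word.\<close>

lemma foldr_T_tw:
  assumes sg: "\<sigma> \<in> torus \<alpha>" and x: "x \<in> wsp \<sigma>" and ab: "(a, b) = (i, j) \<or> (a, b) = (j, i)"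
  shows "foldr T (rw a b k) x - tw (rw a b k) \<sigma> x
    \<in> span (\<Union>l<k. wsp (torus_act (wprod (rw i j l)) \<sigma>) \<union> wsp (torus_act (wprod (rw j i l)) \<sigma>))"
    (is "_ \<in> span (?U k)")
proof (induction k)
  case 0
  then show ?case by (simp add: span_zero)
next
  case (Suc k)
  define c where "c = (if even k then a else b)"
  have U_mono: "span (?U k) \<subseteq> span (?U (Suc k))" by (rule span_mono) (auto intro: less_SucI)
  have rw_in: "wsp (torus_act (wprod (rw a' b' l)) \<sigma>) \<subseteq> span (?U (Suc k))"
    if "l \<le> k" "(a', b') = (i, j) \<or> (a', b') = (j, i)" for a' b' l
    using that by (auto intro!: span_base bexI[of _ l])
  have step: "T c y \<in> span (?U (Suc k))"
    if y: "y \<in> wsp (torus_act (wprod (rw a' b' l)) \<sigma>)" and l: "l < k"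
      and ab': "(a', b') = (i, j) \<or> (a', b') = (j, i)" for y a' b' l
  proof -
    let ?\<tau> = "torus_act (wprod (rw a' b' l)) \<sigma>"
    have c: "c = a' \<or> c = b'" using ab ab' by (auto simp: c_def)
    have "tau c ?\<tau> y \<in> wsp (torus_act (wprod (c # rw a' b' l)) \<sigma>)"
      using tau_wsp[OF torus_wprod[OF sg] y, of c] unfolding torus_act_wprod_Cons .
    moreover have "wsp (torus_act (wprod (c # rw a' b' l)) \<sigma>) \<subseteq> span (?U (Suc k))"
    \<comment> \<open>A letter that continues the alternation lengthens the word. Otherwise it
      cancels the leading letter, or, if the word is empty, starts the alternation in the other
      order.\<close>
    proof (cases "c = (if even l then a' else b')")
      case True
      then have "c # rw a' b' l = rw a' b' (Suc l)" by simp
      then show ?thesis using rw_in[of "Suc l" a' b'] l ab' by simp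
    next
      case c': False
      show ?thesis
      proof (cases l)
        case 0
        then have "c # rw a' b' l = rw b' a' (Suc 0)" using c c' by auto
        then show ?thesis using rw_in[of "Suc 0" b' a'] l ab' by auto
      next
        case (Suc l')
        then have "rw a' b' l = c # rw a' b' l'" using c c' by auto
        then have "wprod (c # rw a' b' l) = wprod (rw a' b' l')" by (simp only: wprod_Cons s_s_comp)
        then show ?thesis using rw_in[of l' a' b'] l Suc ab' by simp
      qed
    qed
    ultimately have "tau c ?\<tau> y \<in> span (?U (Suc k))" by blast
    moreover have "y \<in> span (?U (Suc k))" using rw_in[of l a' b'] y l ab' by auto
    ultimately show ?thesis unfolding T_eq_tau[of c y ?\<tau>] by (intro span_add span_scale)
  qed
  have "T c z \<in> span (?U (Suc k))" if "z \<in> span (?U k)" for z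
    using that
  proof (induction rule: span_induct_alt)
    case base
    then show ?case by (simp add: span_zero)
  next
    case (step e y z)
    obtain l where "l < k" "y \<in> wsp (torus_act (wprod (rw i j l)) \<sigma>) \<or> y \<in> wsp (torus_act (wprod (rw j i l)) \<sigma>)"
      using step(1) by blast
    then have "T c y \<in> span (?U (Suc k))"
      using \<open>\<And>y l b' a'. y \<in> wsp (torus_act (wprod (rw a' b' l)) \<sigma>) \<Longrightarrow> l < k \<Longrightarrow>
        (a', b') = (i, j) \<or> (a', b') = (j, i) \<Longrightarrow> T c y \<in> span (?U (Suc k))\<close> by blast
    then show ?case using step(2) by (simp add: T_add T_scale span_add span_scale)
  qed
  then have 1: "T c (foldr T (rw a b k) x - tw (rw a b k) \<sigma> x) \<in> span (?U (Suc k))" using Suc by blast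
  have "tw (rw a b k) \<sigma> x \<in> span (?U (Suc k))" using rw_in[of k a b] ab tw_wsp[OF sg x] by blast
  then have 2: "d c (torus_act (wprod (rw a b k)) \<sigma>) \<star> tw (rw a b k) \<sigma> x \<in> span (?U (Suc k))" by (rule span_scale)
  have "foldr T (rw a b (Suc k)) x - tw (rw a b (Suc k)) \<sigma> x
    = T c (foldr T (rw a b k) x - tw (rw a b k) \<sigma> x) + d c (torus_act (wprod (rw a b k)) \<sigma>) \<star> tw (rw a b k) \<sigma> x"
    by (simp add: T_diff tau_def c_def[symmetric])
  then show ?case using span_add[OF 1 2] by simp
qed

text \<open>If a root of the subsystem has value 1, both words vanish when they cross it. Otherwise
  the difference has the weight of the longest element and also lies in the span of weight spaces
  for shorter words, whose weights are different.\<close>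

lemma tw_rw_braid:
  assumes ij: "i \<noteq> j" and m: "m = cox_order \<alpha> i j" and sg: "\<sigma> \<in> torus \<alpha>" and x: "x \<in> wsp \<sigma>"
  shows "tw (rw i j m) \<sigma> x = tw (rw j i m) \<sigma> x"
proof (cases "\<exists>\<beta>\<in>roots2 \<alpha> i j. \<sigma> \<beta> = 1")
  have r: "rank2 i j m" unfolding m by (rule rank2_cox_order[OF ij])
  have r': "rank2 j i m" by (rule rank2_sym[OF ij r])
  case True
  then obtain \<beta> where b: "\<beta> \<in> roots2 \<alpha> i j" "\<sigma> \<beta> = 1" by blast
  have z: "tw (rw a b m) \<sigma> x = 0" if ab: "rank2 a b m" "\<beta> \<in> roots2 \<alpha> a b" for a b
  proof -
    obtain k where k: "k < m" "\<beta> = alt_root a b k \<or> \<beta> = - alt_root a b k"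
      using ab unfolding rank2_def by blast
    then have "\<sigma> (alt_root a b k) = 1"
      using b(2) torus_minus[OF sg root_P[OF alt_root_root], of a b k] by auto
    then show ?thesis using tw_rw_zero[OF sg x k(1)] by blast
  qed
  show ?thesis using z[OF r b(1)] z[OF r'] b(1) roots2_sym[of i j] by simp
next
  have r: "rank2 i j m" unfolding m by (rule rank2_cox_order[OF ij])
  have r': "rank2 j i m" by (rule rank2_sym[OF ij r])
  case False
  define w0 where "w0 = wprod (rw i j m)"
  have w0: "w0 \<in> weyl R" "w0 = wprod (rw j i m)" using rank2_rw[OF r] by (simp_all add: w0_def)
  let ?D = "tw (rw i j m) \<sigma> x - tw (rw j i m) \<sigma> x"
  let ?U = "\<Union>l<m. wsp (torus_act (wprod (rw i j l)) \<sigma>) \<union> wsp (torus_act (wprod (rw j i l)) \<sigma>)"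
  have br: "foldr T (rw i j m) x = foldr T (rw j i m) x"
    using T_braid[OF ij wsp_V[OF x]] unfolding m[symmetric] altw_eq_rw by (auto split: if_splits)
  have "?D = (foldr T (rw j i m) x - tw (rw j i m) \<sigma> x) - (foldr T (rw i j m) x - tw (rw i j m) \<sigma> x)"
    by (simp add: br)
  also have "\<dots> \<in> span ?U"
    by (rule span_diff[OF foldr_T_tw[OF sg x] foldr_T_tw[OF sg x]]) simp_all
  finally have D: "?D \<in> span ?U" .
  let ?S = "(\<lambda>l. torus_act (wprod (rw i j l)) \<sigma>) ` {..<m} \<union> (\<lambda>l. torus_act (wprod (rw j i l)) \<sigma>) ` {..<m}"
  have "?U = (\<Union>\<tau>\<in>?S. wsp \<tau>)" by auto
  then have D': "?D \<in> span (\<Union>\<tau>\<in>?S. wsp \<tau>)" using D by simp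
  have Dw: "?D \<in> wsp (torus_act w0 \<sigma>)"
    using tw_wsp[OF sg x, of "rw i j m"] tw_wsp[OF sg x, of "rw j i m"] w0(2) by (simp add: w0_def[symmetric] wsp_diff)
  have sep: "\<exists>\<nu>\<in>P. torus_act (wprod (rw a b l)) \<sigma> \<nu> \<noteq> torus_act w0 \<sigma> \<nu>"
    if ab: "rank2 a b m" "{a, b} = {i, j}" "l < m" for a b l
  proof (rule ccontr)
    assume "\<not> ?thesis"
    then have eq: "\<sigma> (inv (wprod (rw a b l)) \<nu>) = \<sigma> (inv w0 \<nu>)" if "\<nu> \<in> P" for \<nu>
      using that by (auto simp: torus_act_def)
    define z where "z = inv (wprod (rw a b l)) \<circ> w0"
    have zw: "z = wprod (altw a b l @ rw i j m)"
      unfolding z_def inv_wprod_rw w0_def wprod_append ..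
    have "z \<in> weyl R" unfolding zw by simp
    moreover have "\<sigma> (z \<nu>) = \<sigma> \<nu>" if "\<nu> \<in> P" for \<nu>
      using eq[OF weyl_P[OF w0(1) that]] w0(1) by (simp add: z_def)
    \<comment> \<open>In this case the roots with value 1 lie outside the subsystem, so z, a word in
      the two letters, cannot make them negative.\<close>
    moreover have "z \<beta> \<in> pos" if "\<beta> \<in> pos" "\<sigma> \<beta> = 1" for \<beta>
    proof -
      have "\<beta> \<notin> roots2 \<alpha> i j" using False that by blast
      moreover have "set (altw a b l @ rw i j m) \<subseteq> {i, j}" using set_altw[of a b l] set_rw[of i j m] ab(2) by auto
      ultimately show ?thesis unfolding zw using wprod_pos_outside_roots2 that(1) by blast
    qed
    ultimately have "z = id" using torus_stabilizer_trivial[OF sg] by blast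
    then have "wprod (rw a b l) v = w0 v" for v
      using weyl_f_inv[OF wprod_weyl, of "rw a b l" "w0 v"] unfolding z_def by (metis comp_apply id_apply)
    then have "wprod (rw a b l) = w0" by blast
    then have "l = m" using len_wprod_rw[OF ab(1), of l] len_wprod_rw[OF r, of m] ab(3) by (simp add: w0_def)
    then show False using ab(3) by simp
  qed
  have "\<exists>\<nu>\<in>P. \<tau> \<nu> \<noteq> torus_act w0 \<sigma> \<nu>" if "\<tau> \<in> ?S" for \<tau>
    using that sep[OF r] sep[OF r'] by auto
  then have "?D = 0" using wsp_disjoint_span[OF _ _ Dw D'] by blast
  then show ?thesis by simp
qed

lemma tw_altw_braid:
  assumes "i \<noteq> j" "\<sigma> \<in> torus \<alpha>" "x \<in> wsp \<sigma>"
  shows "tw (altw i j (cox_order \<alpha> i j)) \<sigma> x = tw (altw j i (cox_order \<alpha> i j)) \<sigma> x"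
  using tw_rw_braid[OF assms(1) HOL.refl assms(2,3)] unfolding altw_eq_rw by auto

text \<open>Two reduced words with different first letters are joined, as in Matsumoto's theorem, through a
  third one beginning with the longest alternating word in these letters.\<close>

lemma tw_reduced_unique:
  assumes sg: "\<sigma> \<in> torus \<alpha>" and x: "x \<in> wsp \<sigma>"
  shows "reduced_word is \<Longrightarrow> reduced_word js \<Longrightarrow> wprod is = wprod js \<Longrightarrow> tw is \<sigma> x = tw js \<sigma> x"
proof (induction "length is" arbitrary: "is" js rule: less_induct)
  case less
  have len: "length is = length js" using less.prems by (simp add: reduced_word_def)
  show ?case
  proof (cases "is")
    case Nil
    then show ?thesis using len by simp
  next
    case (Cons i is')
    then obtain j js' where js: "js = j # js'" using len by (cases js) auto
    note red = less.prems(1)[unfolded Cons reduced_word_Cons] less.prems(2)[unfolded js reduced_word_Cons]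
    show ?thesis
    proof (cases "i = j")
      case True
      have "s i \<circ> (s i \<circ> wprod is') = s i \<circ> (s i \<circ> wprod js')" using less.prems(3) Cons js True by (simp only: wprod_Cons)
      then have "wprod is' = wprod js'" by (simp only: s_s_comp)
      then show ?thesis using less.hyps[of is' js'] red Cons js True by simp
    next
      case False
      define m where "m = cox_order \<alpha> i j"
      have r: "rank2 i j m" unfolding m_def by (rule rank2_cox_order[OF False])
      have r': "rank2 j i m" by (rule rank2_sym[OF False r])
      define w where "w = wprod is"
      have w: "w \<in> weyl R" "w = s i \<circ> wprod is'" "w = s j \<circ> wprod js'"
        using less.prems(3) Cons js wprod_weyl[of "is"] by (simp_all only: w_def wprod_Cons)
      have "inv w (\<alpha> i) = - inv (wprod is') (\<alpha> i)" unfolding w(2) by (rule inv_s_comp) simp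
      then have wi: "- inv w (\<alpha> i) \<in> pos" using red by simp
      have "inv w (\<alpha> j) = - inv (wprod js') (\<alpha> j)" unfolding w(3) by (rule inv_s_comp) simp
      then have wj: "- inv w (\<alpha> j) \<in> pos" using red by simp
      have iw: "inv w \<in> weyl R" by (rule weyl_inv[OF w(1)])
      \<comment> \<open>The inverse of w makes both simple roots negative, hence also every
        nonnegative combination that is a root. So w has each positive root of the subsystem to
        remove, and m letters alternating in i and j can be stripped from its left.\<close>
      have neg: "inv w (alt_root i j k) \<notin> pos" if km: "k < m" for k
      proof
        assume p: "inv w (alt_root i j k) \<in> pos"
        obtain a b where ab: "a \<ge> 0" "b \<ge> 0" "alt_root i j k = a *\<^sub>R \<alpha> i + b *\<^sub>R \<alpha> j"
          using r km unfolding rank2_def by blast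
        have "inv w (alt_root i j k) = a *\<^sub>R inv w (\<alpha> i) + b *\<^sub>R inv w (\<alpha> j)"
          unfolding ab(3) using weyl_linear[OF iw] by (simp add: linear_add linear_scale)
        then have "inv w (alt_root i j k) \<bullet> \<rho> = a * (inv w (\<alpha> i) \<bullet> \<rho>) + b * (inv w (\<alpha> j) \<bullet> \<rho>)"
          by (simp add: inner_left_distrib)
        moreover have "inv w (\<alpha> i) \<bullet> \<rho> \<le> 0" "inv w (\<alpha> j) \<bullet> \<rho> \<le> 0"
          using rho_pos[OF wi] rho_pos[OF wj] by simp_all
        ultimately have "inv w (alt_root i j k) \<bullet> \<rho> \<le> 0"
          using ab(1,2) by (simp add: add_nonpos_nonpos mult_nonneg_nonpos)
        then show False using rho_pos[OF p] by simp
      qed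
      define y where "y k = wprod (rw i j k) \<circ> w" for k
      have y: "y k \<in> weyl R" for k unfolding y_def by (rule weyl_comp[OF wprod_weyl w(1)])
      have ylen: "k \<le> m \<Longrightarrow> len w = k + len (y k)" for k
      proof (induction k)
        case 0
        have "y 0 = w" by (simp add: y_def)
        then show ?case by simp
      next
        case (Suc k)
        define c where "c = (if even k then i else j)"
        have "inv (y k) (\<alpha> c) = inv w (alt_root i j k)"
          unfolding y_def weyl_inv_comp[OF wprod_weyl w(1)] c_def o_apply inv_wprod_rw_root ..
        then have "len (y k) = Suc (len (s c \<circ> y k))" using len_s_down[OF y] neg[of k] Suc.prems by simp
        moreover have "s c \<circ> y k = y (Suc k)" by (simp add: y_def c_def comp_assoc)
        ultimately show ?case using Suc by simp
      qed
      obtain ks where ks: "reduced_word ks" "wprod ks = y m" using ex_reduced_word[OF y] by blast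
      have bk: "wprod (altw a b m @ ks) = w" if "wprod (rw a b m) = wprod (rw i j m)" for a b
      proof -
        have "wprod (altw a b m) (wprod (rw a b m) v) = v" for v
          unfolding rw_eq_rev by (rule wprod_rev)
        then show ?thesis unfolding wprod_append ks(2) y_def that[symmetric] by (auto simp: fun_eq_iff)
      qed
      have lenw: "len w = m + length ks" using ylen[of m] ks by (simp add: reduced_word_def)
      have red1: "reduced_word (altw i j m @ ks)" "reduced_word (altw j i m @ ks)"
        using bk[of i j] bk[of j i] rank2_rw[OF r] lenw by (simp_all add: reduced_word_def)
      obtain m' where m': "m = Suc m'" using rank2_pos[OF r] by (cases m) auto
      \<comment> \<open>Both words begin with i. After removing it they are shorter reduced words of
        the same element, so the induction hypothesis applies.\<close>
      have e1: "tw is \<sigma> x = tw (altw i j m @ ks) \<sigma> x"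
      proof -
        have red2: "reduced_word (altw j i m' @ ks)" using red1(1) unfolding m' by (simp add: reduced_word_Cons)
        have "s i \<circ> (s i \<circ> wprod is') = s i \<circ> (s i \<circ> wprod (altw j i m' @ ks))"
          using bk[of i j] w(2) unfolding m' by simp
        then have eq: "wprod is' = wprod (altw j i m' @ ks)" by (simp only: s_s_comp)
        then have "tw is' \<sigma> x = tw (altw j i m' @ ks) \<sigma> x" using less.hyps[of is'] red red2 Cons by simp
        then show ?thesis unfolding Cons m' using eq by simp
      qed
      have e2: "tw js \<sigma> x = tw (altw j i m @ ks) \<sigma> x"
      proof -
        have red2: "reduced_word (altw i j m' @ ks)" using red1(2) unfolding m' by (simp add: reduced_word_Cons)
        have "s j \<circ> (s j \<circ> wprod js') = s j \<circ> (s j \<circ> wprod (altw i j m' @ ks))"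
          using bk[of j i] rank2_rw[OF r] w(3) unfolding m' by simp
        then have eq: "wprod js' = wprod (altw i j m' @ ks)" by (simp only: s_s_comp)
        then have "tw js' \<sigma> x = tw (altw i j m' @ ks) \<sigma> x" using less.hyps[of js'] red red2 js len by simp
        then show ?thesis unfolding js m' using eq by simp
      qed
      show ?thesis unfolding e1 e2 tw_append m_def
        by (rule tw_altw_braid[OF False torus_wprod[OF sg] tw_wsp[OF sg x]])
    qed
  qed
qed

definition rword :: "(real^'n \<Rightarrow> real^'n) \<Rightarrow> 'n list" where
  "rword w = (SOME is. reduced_word is \<and> wprod is = w)"

lemma rword: assumes "w \<in> weyl R" shows "reduced_word (rword w)" "wprod (rword w) = w"
  using someI_ex[OF ex_reduced_word[OF assms]] unfolding rword_def by auto

text \<open>The intertwiner of w applied to x through a chosen reduced word; by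
  \<open>tw_reduced_unique\<close> any reduced word gives the same vector.\<close>

definition f :: "(real^'n \<Rightarrow> complex) \<Rightarrow> 'v \<Rightarrow> (real^'n \<Rightarrow> real^'n) \<Rightarrow> 'v" where
  "f \<sigma> x w = tw (rword w) \<sigma> x"

context
  fixes \<sigma> x
  assumes sg: "\<sigma> \<in> torus \<alpha>" and x: "x \<in> wsp \<sigma>"
begin

lemma f_eq_tw: "reduced_word is \<Longrightarrow> f \<sigma> x (wprod is) = tw is \<sigma> x"
  unfolding f_def using tw_reduced_unique[OF sg x] rword[OF wprod_weyl] by blast

lemma f_id: "f \<sigma> x id = x"
  using f_eq_tw[of "[]"] by simp

lemma f_wsp: "w \<in> weyl R \<Longrightarrow> f \<sigma> x w \<in> wsp (torus_act w \<sigma>)"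
  using tw_wsp[OF sg x, of "rword w"] rword(2)[of w] by (simp add: f_def)

lemma f_up:
  assumes w: "w \<in> weyl R" and up: "inv w (\<alpha> i) \<in> pos"
  shows "f \<sigma> x (s i \<circ> w) = tau i (torus_act w \<sigma>) (f \<sigma> x w)"
proof -
  have "reduced_word (i # rword w)" using rword[OF w] up by (simp add: reduced_word_Cons)
  then show ?thesis using f_eq_tw[of "i # rword w"] rword(2)[OF w] by (simp add: f_def)
qed

lemma f_down:
  assumes w: "w \<in> weyl R" and dn: "inv w (\<alpha> i) \<notin> pos"
  shows "f \<sigma> x w = tau i (torus_act (s i \<circ> w) \<sigma>) (f \<sigma> x (s i \<circ> w))"
    "tau i (torus_act w \<sigma>) (f \<sigma> x w) = g i (torus_act (s i \<circ> w) \<sigma>) \<star> f \<sigma> x (s i \<circ> w)"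
proof -
  have w': "s i \<circ> w \<in> weyl R" by (rule weyl_comp[OF s_weyl w])
  have "inv (s i \<circ> w) (\<alpha> i) = - inv w (\<alpha> i)" by (rule inv_s_comp[OF w])
  then have up: "inv (s i \<circ> w) (\<alpha> i) \<in> pos" using inversions_s_down(3)[OF w dn] by simp
  show 1: "f \<sigma> x w = tau i (torus_act (s i \<circ> w) \<sigma>) (f \<sigma> x (s i \<circ> w))"
    using f_up[OF w' up] by (simp only: s_s_comp)
  have "torus_act w \<sigma> = torus_act (s i) (torus_act (s i \<circ> w) \<sigma>)"
    using torus_act_comp[OF s_weyl w', of i \<sigma>] by (simp only: s_s_comp)
  then show "tau i (torus_act w \<sigma>) (f \<sigma> x w) = g i (torus_act (s i \<circ> w) \<sigma>) \<star> f \<sigma> x (s i \<circ> w)"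
    unfolding 1 using tau_tau[OF torus_act_torus[OF w' sg] f_wsp[OF w']] by simp
qed

text \<open>T_i is an intertwiner plus a scalar on each weight vector, and the intertwiner moves the
  vector of w up to that of s_i w or down to a multiple of it. So the span is a nonzero stable
  subspace.\<close>

lemma span_f: assumes "x \<noteq> 0" shows "span (f \<sigma> x ` weyl R) = V"
proof -
  let ?N = "span (f \<sigma> x ` weyl R)"
  have gen: "f \<sigma> x w \<in> ?N" if "w \<in> weyl R" for w using that by (auto intro: span_base)
  have tauN: "tau i (torus_act w \<sigma>) (f \<sigma> x w) \<in> ?N" if w: "w \<in> weyl R" for i w
  proof (cases "inv w (\<alpha> i) \<in> pos")
    case True
    show ?thesis unfolding f_up[OF w True, symmetric] by (rule gen[OF weyl_comp[OF s_weyl w]])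
  next
    case False
    show ?thesis unfolding f_down(2)[OF w False] by (intro span_scale gen weyl_comp[OF s_weyl w])
  qed
  have TN: "T i y \<in> ?N" if "y \<in> ?N" for i y
    using that
  proof (induction rule: span_induct_alt)
    case (step c y z)
    then obtain w where w: "w \<in> weyl R" "y = f \<sigma> x w" by blast
    have "T i y \<in> ?N" unfolding w(2) T_eq_tau[of i _ "torus_act w \<sigma>"]
      by (intro span_add span_scale tauN gen w)
    then show ?case using step by (simp add: T_add T_scale span_add span_scale)
  qed (simp add: span_zero)
  have XN: "X \<nu> y \<in> ?N" if "\<nu> \<in> P" "y \<in> ?N" for \<nu> y
    using that(2)
  proof (induction rule: span_induct_alt)
    case (step c y z)
    then obtain w where w: "w \<in> weyl R" "y = f \<sigma> x w" by blast
    have "X \<nu> y \<in> ?N" unfolding w(2) wsp_X[OF f_wsp[OF w(1)] that(1)] by (intro span_scale gen w)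
    then show ?case using step by (simp add: X_add X_scale span_add span_scale)
  qed (simp add: span_zero)
  have sub: "?N \<subseteq> V" using f_wsp wsp_V by (intro span_minimal[OF _ subspace_V]) blast
  have "x \<in> ?N" using gen[OF weyl_id] f_id by simp
  then have "\<not> ?N \<subseteq> {0}" using assms by blast
  then show ?thesis using irreducible[OF subspace_span sub TN XN] by blast
qed

text \<open>At the letter where a reduced word crosses beta, the current weight has value 1 at a
  simple root, and such a weight space is zero.\<close>

lemma f_inversion_one:
  assumes w: "w \<in> weyl R" and b: "\<beta> \<in> inversions R \<alpha> w" "\<sigma> \<beta> = 1"
  shows "f \<sigma> x w = 0"
proof -
  have "\<beta> \<in> inversions R \<alpha> (wprod is) \<Longrightarrow> reduced_word is \<Longrightarrow> tw is \<sigma> x = 0" for "is"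
  proof (induction "is")
    case Nil
    then show ?case unfolding wprod_Nil inversions_id by blast
  next
    case (Cons i "is")
    have red: "reduced_word is" "inv (wprod is) (\<alpha> i) \<in> pos" using Cons.prems by (auto simp: reduced_word_Cons)
    have "\<beta> = inv (wprod is) (\<alpha> i) \<or> \<beta> \<in> inversions R \<alpha> (wprod is)"
      using Cons.prems(1) inversions_s_up(1)[OF wprod_weyl red(2)] by (simp del: o_apply)
    then have "tw is \<sigma> x = 0"
    proof
      assume "\<beta> = inv (wprod is) (\<alpha> i)"
      then have "torus_act (wprod is) \<sigma> (\<alpha> i) = 1" using b(2) by (simp add: torus_act_def)
      then show ?thesis using wsp_simple_one[OF torus_wprod[OF sg] tw_wsp[OF sg x]] by blast
    qed (use Cons.IH red in blast)
    then show ?case by simp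
  qed
  then show ?thesis using rword[OF w] b(1) by (simp add: f_def)
qed

end

section \<open>Vanishing of the intertwiners at q^2 and q^-2\<close>

lemma tau_zero:
  assumes sg: "\<sigma> \<in> torus \<alpha>" and x: "x \<in> wsp \<sigma>"
    and a: "\<sigma> (\<alpha> i) = q\<^sup>2 \<or> \<sigma> (\<alpha> i) = inverse (q\<^sup>2)"
  shows "tau i \<sigma> x = 0"
proof (rule ccontr)
  assume nz: "tau i \<sigma> x \<noteq> 0"
  then have x0: "x \<noteq> 0" by auto
  define \<tau> n where "\<tau> = torus_act (s i) \<sigma>" and "n = tau i \<sigma> x"
  have t: "\<tau> \<in> torus \<alpha>" unfolding \<tau>_def by (rule torus_act_torus[OF s_weyl sg])
  have n: "n \<in> wsp \<tau>" "n \<noteq> 0" unfolding n_def \<tau>_def using tau_wsp[OF sg x] nz by auto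
  have ne1: "\<sigma> (\<alpha> i) \<noteq> 1" using wsp_simple_one[OF sg x] x0 by blast
  have ts: "torus_act (s i) \<tau> = \<sigma>" by (rule ext) (simp add: \<tau>_def torus_act_s)
  have fs: "f \<tau> n (s i) = 0"
  proof -
    have "f \<tau> n (s i \<circ> id) = tau i (torus_act id \<tau>) (f \<tau> n id)" by (rule f_up[OF t n(1)]) (simp_all add: inv_id)
    also have "\<dots> = tau i \<tau> n" by (simp only: torus_act_id f_id[OF t n(1)])
    also have "\<dots> = g i \<sigma> \<star> x" unfolding \<tau>_def n_def by (rule tau_tau[OF sg x])
    also have "\<dots> = 0" using g_eq_0_iff[OF sg ne1] a by simp
    finally show ?thesis by simp
  qed
  \<comment> \<open>If the vector of w is nonzero and has the weight of x, then w s_i fixes that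
    weight and keeps its value-1 roots positive by \<open>f_inversion_one\<close>. Hence w = s_i,
    where the vector is zero by \<open>fs\<close>. So all the spanning vectors have weights other
    than that of x.\<close>
  have key: "f \<tau> n w = 0 \<or> (\<exists>\<nu>\<in>P. torus_act w \<tau> \<nu> \<noteq> \<sigma> \<nu>)" if w: "w \<in> weyl R" for w
  proof (rule ccontr)
    assume "\<not> ?thesis"
    then have fw: "f \<tau> n w \<noteq> 0" and eq: "\<And>\<nu>. \<nu> \<in> P \<Longrightarrow> torus_act w \<tau> \<nu> = \<sigma> \<nu>" by auto
    define z where "z = w \<circ> s i"
    have z: "z \<in> weyl R" unfolding z_def by (rule weyl_comp[OF w s_weyl])
    have "\<sigma> (z \<nu>) = \<sigma> \<nu>" if nu: "\<nu> \<in> P" for \<nu>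
      using eq[OF weyl_P[OF z nu]] w by (simp add: z_def torus_act_def \<tau>_def)
    moreover have "z \<beta> \<in> pos" if b: "\<beta> \<in> pos" "\<sigma> \<beta> = 1" for \<beta>
    proof -
      have "\<beta> \<noteq> \<alpha> i" using b(2) ne1 by auto
      then have p: "s i \<beta> \<in> pos" using s_pos b(1) by blast
      have "\<tau> (s i \<beta>) = 1" using b(2) by (simp add: \<tau>_def torus_act_s)
      then have "s i \<beta> \<notin> inversions R \<alpha> w" using f_inversion_one[OF t n(1) w] fw by blast
      then have "w (s i \<beta>) \<in> pos" using p weyl_not_pos[OF w pos_root[OF p]] by (auto simp: inversions_def)
      then show ?thesis by (simp add: z_def)
    qed
    ultimately have "z = id" using torus_stabilizer_trivial[OF sg z] by blast
    then have "w = s i" unfolding z_def by (metis comp_id comp_assoc s_s_comp id_comp)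
    then show False using fs fw by simp
  qed
  define W where "W = {w \<in> weyl R. f \<tau> n w \<noteq> 0}"
  have "x \<in> span (f \<tau> n ` weyl R)" using span_f[OF t n] wsp_V[OF x] by simp
  moreover have "f \<tau> n ` weyl R \<subseteq> span (\<Union>\<upsilon>\<in>(\<lambda>w. torus_act w \<tau>) ` W. wsp \<upsilon>)"
  proof clarify
    fix w assume w: "w \<in> weyl R"
    show "f \<tau> n w \<in> span (\<Union>\<upsilon>\<in>(\<lambda>w. torus_act w \<tau>) ` W. wsp \<upsilon>)"
    proof (cases "w \<in> W")
      case True
      then show ?thesis using f_wsp[OF t n(1) w] by (intro span_base) auto
    next
      case False
      then show ?thesis using w by (simp add: W_def span_zero)
    qed
  qed
  ultimately have "x \<in> span (\<Union>\<upsilon>\<in>(\<lambda>w. torus_act w \<tau>) ` W. wsp \<upsilon>)"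
    using span_minimal[OF _ subspace_span] by blast
  moreover have "finite ((\<lambda>w. torus_act w \<tau>) ` W)" using finite_weyl by (simp add: W_def)
  moreover have "\<exists>\<nu>\<in>P. \<upsilon> \<nu> \<noteq> \<sigma> \<nu>" if "\<upsilon> \<in> (\<lambda>w. torus_act w \<tau>) ` W" for \<upsilon>
    using that key by (auto simp: W_def)
  ultimately have "x = 0" using wsp_disjoint_span[OF _ _ x] by blast
  then show False using x0 by simp
qed

end

section \<open>Separation of tableaux by their weights\<close>

context simple_root_system begin

text \<open>The element x = v^-1 u fixes t. If it made a value-1 root beta negative, then -x beta
  would be a positive root with value 1 that v sends to -u beta, which is negative because u does
  not invert beta; but v does not invert such roots.\<close>

lemma torus_act_inj_on_tableaux:
  assumes t: "t \<in> torus \<alpha>" and u: "u \<in> tableaux R \<alpha> q t J" and v: "v \<in> tableaux R \<alpha> q t J"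
    and eq: "\<And>\<nu>. \<nu> \<in> P \<Longrightarrow> torus_act u t \<nu> = torus_act v t \<nu>"
  shows "u = v"
proof -
  have uw: "u \<in> weyl R" "v \<in> weyl R" using u v by (auto simp: tableaux_def)
  have Z: "w \<beta> \<in> pos" if "w \<in> tableaux R \<alpha> q t J" "\<beta> \<in> pos" "t \<beta> = 1" for w \<beta>
    using that weyl_not_pos[of w \<beta>] pos_root by (auto simp: tableaux_def inversions_def Zset_def)
  define x where "x = inv v \<circ> u"
  have x: "x \<in> weyl R" unfolding x_def by (rule weyl_comp[OF weyl_inv[OF uw(2)] uw(1)])
  have tx: "t (x \<nu>) = t \<nu>" if "\<nu> \<in> P" for \<nu>
    using eq[OF weyl_P[OF uw(1) that]] uw by (simp add: torus_act_def x_def)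
  have "x \<beta> \<in> pos" if b: "\<beta> \<in> pos" "t \<beta> = 1" for \<beta>
  proof (rule ccontr)
    assume "x \<beta> \<notin> pos"
    then have p: "- x \<beta> \<in> pos" using weyl_not_pos[OF x pos_root[OF b(1)]] by simp
    have "t (- x \<beta>) = 1" using torus_minus[OF t root_P[OF weyl_root[OF x pos_root[OF b(1)]]]]
      tx[OF root_P[OF pos_root[OF b(1)]]] b(2) by simp
    then have "v (- x \<beta>) \<in> pos" using Z[OF v p] by simp
    then have "- u \<beta> \<in> pos" using uw by (simp add: x_def weyl_minus)
    then show False using Z[OF u b] pos_neg_exclusive by blast
  qed
  then have "x = id" using torus_stabilizer_trivial[OF t x tx] by blast
  then have "v (x \<nu>) = v \<nu>" for \<nu> by simp
  then have "u \<nu> = v \<nu>" for \<nu> using uw by (simp add: x_def)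
  then show ?thesis by blast
qed

text \<open>Multiply by reflections in the zero set until the pairing of \<open>u \<rho>\<close> with \<open>\<rho>\<close> is maximal.\<close>

lemma ex_no_inversions_Zset:
  assumes t: "t \<in> torus \<alpha>" and w: "w \<in> weyl R"
  shows "\<exists>u\<in>weyl R. inversions R \<alpha> u \<inter> Zset R \<alpha> t = {} \<and> (\<forall>\<nu>\<in>P. torus_act u t \<nu> = torus_act w t \<nu>)"
proof -
  define S where "S = {u \<in> weyl R. \<forall>\<nu>\<in>P. torus_act u t \<nu> = torus_act w t \<nu>}"
  have fin: "finite S" using finite_weyl by (simp add: S_def)
  have "S \<noteq> {}" using w by (auto simp: S_def)
  then have "Max ((\<lambda>u. u \<rho> \<bullet> \<rho>) ` S) \<in> (\<lambda>u. u \<rho> \<bullet> \<rho>) ` S" using fin by (intro Max_in) auto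
  then obtain u where u: "u \<in> S" "u \<rho> \<bullet> \<rho> = Max ((\<lambda>u. u \<rho> \<bullet> \<rho>) ` S)" by auto
  have umax: "v \<rho> \<bullet> \<rho> \<le> u \<rho> \<bullet> \<rho>" if "v \<in> S" for v
    unfolding u(2) using that fin by (intro Max_ge) auto
  have uw: "u \<in> weyl R" using u by (simp add: S_def)
  have "\<beta> \<notin> inversions R \<alpha> u" if b: "\<beta> \<in> Zset R \<alpha> t" for \<beta>
  proof
    assume inv: "\<beta> \<in> inversions R \<alpha> u"
    have bp: "\<beta> \<in> pos" "t \<beta> = 1" using b by (auto simp: Zset_def)
    have bR: "\<beta> \<in> R" and b0: "\<beta> \<noteq> 0" using pos_root[OF bp(1)] root_nonzero by auto
    have r: "refl \<beta> \<in> weyl R" using bR by (rule refl_in_refl_group)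
    have ir: "inv (refl \<beta>) = refl \<beta>"
      by (rule inv_unique_comp) (use b0 in \<open>auto simp: fun_eq_iff refl_involution\<close>)
    \<comment> \<open>The reflection subtracts an integral multiple of beta from a weight, which t
      does not notice because its value at beta is 1.\<close>
    have tr: "t (refl \<beta> \<nu>) = t \<nu>" if nu: "\<nu> \<in> P" for \<nu>
    proof -
      obtain k :: int where k: "\<nu> \<bullet> coroot \<beta> = of_int k" using P_coroot_Ints[OF bR nu] by (auto elim: Ints_cases)
      have tm: "t (- \<beta>) = 1" using torus_minus[OF t root_P[OF bR]] bp(2) by simp
      show ?thesis
      proof (cases "0 \<le> k")
        case True
        then have "refl \<beta> \<nu> = \<nu> + of_nat (nat k) *\<^sub>R (- \<beta>)" by (simp add: refl_def k)
        then show ?thesis using torus_scale_nat(2)[OF t nu P_minus[OF root_P[OF bR]], of "nat k"] tm by simp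
      next
        case False
        then have "refl \<beta> \<nu> = \<nu> + of_nat (nat (- k)) *\<^sub>R \<beta>" by (simp add: refl_def k)
        then show ?thesis using torus_scale_nat(2)[OF t nu root_P[OF bR], of "nat (- k)"] bp(2) by simp
      qed
    qed
    have "u \<circ> refl \<beta> \<in> S"
    proof -
      have "torus_act (u \<circ> refl \<beta>) t \<nu> = torus_act u t \<nu>" if "\<nu> \<in> P" for \<nu>
        using tr[OF weyl_P[OF weyl_inv[OF uw] that]] weyl_inv_comp[OF uw r] by (simp add: torus_act_def ir)
      then show ?thesis using u(1) weyl_comp[OF uw r] by (simp add: S_def)
    qed
    \<comment> \<open>Since u beta is negative, composing with the reflection strictly raises the
      pairing, against maximality.\<close>
    then have "u (refl \<beta> \<rho>) \<bullet> \<rho> \<le> u \<rho> \<bullet> \<rho>" using umax by force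
    then have "- ((\<rho> \<bullet> coroot \<beta>) * (u \<beta> \<bullet> \<rho>)) \<le> 0"
      using weyl_linear[OF uw] by (simp add: refl_def linear_diff linear_scale inner_diff_left)
    moreover have "\<rho> \<bullet> coroot \<beta> > 0" using rho_pos[OF bp(1)] b0 by (simp add: coroot_def inner_commute)
    moreover have "u \<beta> \<bullet> \<rho> < 0" using inv rho_pos[of "- u \<beta>"] by (simp add: inversions_def)
    ultimately show False using mult_pos_neg[of "\<rho> \<bullet> coroot \<beta>" "u \<beta> \<bullet> \<rho>"] by linarith
  qed
  then show ?thesis using u(1) by (auto simp: S_def)
qed

end

section \<open>The normalized basis indexed by tableaux\<close>

context hecke_rep begin

text \<open>Along a reduced word each letter adds one inversion beta, and the intertwiner at that
  letter sees the value of sigma at beta as its simple-root value. It kills the vector exactly at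
  q^2 and q^-2, while the value 1 does not occur on a nonzero vector.\<close>

lemma f_nonzero_iff:
  assumes sg: "\<sigma> \<in> torus \<alpha>" and x: "x \<in> wsp \<sigma>" "x \<noteq> 0" and w: "w \<in> weyl R"
  shows "f \<sigma> x w \<noteq> 0 \<longleftrightarrow> (\<forall>\<beta>\<in>inversions R \<alpha> w. \<sigma> \<beta> \<noteq> 1 \<and> \<sigma> \<beta> \<noteq> q\<^sup>2 \<and> \<sigma> \<beta> \<noteq> inverse (q\<^sup>2))"
proof -
  have "reduced_word is \<Longrightarrow> tw is \<sigma> x \<noteq> 0 \<longleftrightarrow>
    (\<forall>\<beta>\<in>inversions R \<alpha> (wprod is). \<sigma> \<beta> \<noteq> 1 \<and> \<sigma> \<beta> \<noteq> q\<^sup>2 \<and> \<sigma> \<beta> \<noteq> inverse (q\<^sup>2))" for "is"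
  proof (induction "is")
    case Nil
    show ?case using x(2) unfolding wprod_Nil inversions_id by simp
  next
    case (Cons i "is")
    have red: "reduced_word is" "inv (wprod is) (\<alpha> i) \<in> pos" using Cons.prems by (auto simp: reduced_word_Cons)
    define \<tau> where "\<tau> = torus_act (wprod is) \<sigma>"
    have t: "\<tau> \<in> torus \<alpha>" "tw is \<sigma> x \<in> wsp \<tau>" unfolding \<tau>_def using torus_wprod[OF sg] tw_wsp[OF sg x(1)] by auto
    have val: "\<sigma> (inv (wprod is) (\<alpha> i)) = \<tau> (\<alpha> i)" by (simp add: \<tau>_def torus_act_def)
    have "tw (i # is) \<sigma> x \<noteq> 0 \<longleftrightarrow> tw is \<sigma> x \<noteq> 0 \<and> \<tau> (\<alpha> i) \<noteq> 1 \<and> \<tau> (\<alpha> i) \<noteq> q\<^sup>2 \<and> \<tau> (\<alpha> i) \<noteq> inverse (q\<^sup>2)"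
      using tau_zero[OF t, of i] tau_nonzero[OF t, of i] wsp_simple_one[OF t, of i] by (auto simp: \<tau>_def)
    moreover have "inversions R \<alpha> (wprod (i # is)) = insert (inv (wprod is) (\<alpha> i)) (inversions R \<alpha> (wprod is))"
      unfolding wprod_Cons by (rule inversions_s_up(1)[OF wprod_weyl red(2)])
    ultimately show ?case using Cons.IH[OF red(1)] val by (metis (no_types, lifting) insert_iff)
  qed
  then show ?thesis using rword[OF w] by (simp add: f_def)
qed

text \<open>Each inversion contributes the reciprocal of the off-diagonal coefficient q^-1 + d of
  the step that creates it. Thus the upward steps, which have coefficient 1 in \<open>f_up\<close>,
  acquire the coefficient of the module formulas.\<close>

definition nrm :: "(real^'n \<Rightarrow> complex) \<Rightarrow> (real^'n \<Rightarrow> real^'n) \<Rightarrow> complex" where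
  "nrm \<sigma> w = (\<Prod>\<beta>\<in>inversions R \<alpha> w. 1 / (inverse q + \<kappa> / (1 - \<sigma> (- \<beta>))))"

lemma nrm_up:
  assumes w: "w \<in> weyl R" and up: "inv w (\<alpha> i) \<in> pos"
  shows "nrm \<sigma> (s i \<circ> w) = nrm \<sigma> w / (inverse q + d i (torus_act w \<sigma>))"
proof -
  have "inv w (- \<alpha> i) = - inv w (\<alpha> i)" using weyl_minus[OF weyl_inv[OF w]] .
  then show ?thesis
    unfolding nrm_def inversions_s_up(1)[OF w up] d_def torus_act_def
    using inversions_s_up(2)[OF w up] finite_inversions by (simp add: prod.insert)
qed

text \<open>With a the simple-root value, multiplying by (a - 1) q turns the factor into q^2 a -
  1.\<close>

lemma norm_factor_nonzero:
  assumes sg: "\<sigma> \<in> torus \<alpha>" and ne: "\<sigma> (\<alpha> i) \<noteq> 1" "\<sigma> (\<alpha> i) \<noteq> inverse (q\<^sup>2)"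
  shows "inverse q + d i \<sigma> \<noteq> 0"
proof
  let ?a = "\<sigma> (\<alpha> i)"
  assume z: "inverse q + d i \<sigma> = 0"
  have a: "?a \<noteq> 0" using torusD(1)[OF sg] by simp
  have nz: "?a - 1 \<noteq> 0" using ne by simp
  have dd: "d i \<sigma> = \<kappa> * ?a / (?a - 1)" unfolding d_eq[OF sg HOL.refl] using nz a by (simp add: divide_simps)
  have "(inverse q + d i \<sigma>) * (?a - 1) * q = 0" using z by simp
  moreover have "(inverse q + d i \<sigma>) * (?a - 1) * q = q\<^sup>2 * ?a - 1"
    unfolding dd using nz q_nonzero by (simp add: field_simps power2_eq_square)
  ultimately have "q\<^sup>2 * ?a = 1" by simp
  then have "?a = inverse (q\<^sup>2)" by (metis inverse_unique)
  then show False using ne by simp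
qed

text \<open>This splitting is why downward steps get the same form of coefficient: one factor
  cancels against the normalization.\<close>

lemma g_factor:
  assumes sg: "\<sigma> \<in> torus \<alpha>" and ne: "\<sigma> (\<alpha> i) \<noteq> 1"
  shows "g i \<sigma> = (inverse q + d i \<sigma>) * (inverse q + d i (torus_act (s i) \<sigma>))"
  unfolding g_def d_flip[OF sg ne] using q_nonzero by (simp add: field_simps)

text \<open>Elements of W are written v w relative to the label w of x, and \<open>f\<close> at v is
  the candidate for v w. An inversion of v is, up to sign, the w-image of a positive root inverted
  by exactly one of v w and w. So \<open>f_nonzero_iff\<close> says that the candidate is nonzero
  exactly when v w and w agree on Z(t) and P(t).\<close>

theorem tableau_basis:
  assumes t: "t \<in> torus \<alpha>" and w: "w \<in> weyl R" and wz: "inversions R \<alpha> w \<inter> Zset R \<alpha> t = {}"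
    and J: "J = inversions R \<alpha> w \<inter> Pset R \<alpha> q t"
    and x: "x \<in> wsp (torus_act w t)" "x \<noteq> 0"
  obtains E where
    "\<And>u. u \<in> tableaux R \<alpha> q t J \<Longrightarrow> E u \<noteq> 0 \<and> E u \<in> wsp (torus_act u t)"
    "\<And>u. u \<in> weyl R \<Longrightarrow> u \<notin> tableaux R \<alpha> q t J \<Longrightarrow> E u = 0"
    "\<And>u i. u \<in> tableaux R \<alpha> q t J \<Longrightarrow>
       T i (E u) = T_diag \<alpha> q t i u \<star> E u + (inverse q + T_diag \<alpha> q t i u) \<star> E (s i \<circ> u)"
    "span (E ` tableaux R \<alpha> q t J) = V"
proof -
  let ?F = "tableaux R \<alpha> q t J"
  define \<sigma> where "\<sigma> = torus_act w t"
  have sg: "\<sigma> \<in> torus \<alpha>" unfolding \<sigma>_def by (rule torus_act_torus[OF w t])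
  have x': "x \<in> wsp \<sigma>" using x by (simp add: \<sigma>_def)
  have iw: "inv w \<in> weyl R" by (rule weyl_inv[OF w])
  have act: "torus_act v \<sigma> = torus_act (v \<circ> w) t" if "v \<in> weyl R" for v
    unfolding \<sigma>_def by (rule torus_act_comp[OF that w, symmetric])
  have w_t: "\<sigma> (w \<gamma>) = t \<gamma>" for \<gamma> using w by (simp add: \<sigma>_def torus_act_def)
  have t_minus: "t (- \<gamma>) = inverse (t \<gamma>)" if "\<gamma> \<in> R" for \<gamma> using torus_minus[OF t root_P[OF that]] .
  let ?ok = "\<lambda>v. \<forall>\<beta>\<in>inversions R \<alpha> v. \<sigma> \<beta> \<noteq> 1 \<and> \<sigma> \<beta> \<noteq> q\<^sup>2 \<and> \<sigma> \<beta> \<noteq> inverse (q\<^sup>2)"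
  have F_iff: "v \<circ> w \<in> ?F \<longleftrightarrow> ?ok v" if v: "v \<in> weyl R" for v
  proof
    assume F: "v \<circ> w \<in> ?F"
    show "?ok v"
    proof (rule ballI, rule ccontr)
      fix \<beta> assume b: "\<beta> \<in> inversions R \<alpha> v" and bad: "\<not> (\<sigma> \<beta> \<noteq> 1 \<and> \<sigma> \<beta> \<noteq> q\<^sup>2 \<and> \<sigma> \<beta> \<noteq> inverse (q\<^sup>2))"
      have bp: "\<beta> \<in> pos" "- v \<beta> \<in> pos" using b by (auto simp: inversions_def)
      define \<gamma> where "\<gamma> = inv w \<beta>"
      have gR: "\<gamma> \<in> R" unfolding \<gamma>_def by (rule weyl_root[OF iw pos_root[OF bp(1)]])
      have wg: "w \<gamma> = \<beta>" using w by (simp add: \<gamma>_def)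
      have tg: "t \<gamma> = \<sigma> \<beta>" using w_t[of \<gamma>] wg by simp
      show False
      proof (cases "\<gamma> \<in> pos")
        case True
        then have "\<gamma> \<in> inversions R \<alpha> (v \<circ> w)" "\<gamma> \<notin> inversions R \<alpha> w"
          using bp wg pos_neg_exclusive by (auto simp: inversions_def)
        moreover have "\<gamma> \<in> Zset R \<alpha> t \<or> \<gamma> \<in> Pset R \<alpha> q t" using bad tg True by (auto simp: Zset_def Pset_def)
        ultimately show False using F J by (auto simp: tableaux_def)
      next
        case False
        then have gp: "- \<gamma> \<in> pos" using not_pos_iff[OF gR] by simp
        have "w (- \<gamma>) = - \<beta>" using wg weyl_minus[OF w] by simp
        then have "- \<gamma> \<in> inversions R \<alpha> w" "- \<gamma> \<notin> inversions R \<alpha> (v \<circ> w)"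
          using bp gp weyl_minus[OF v] pos_neg_exclusive by (auto simp: inversions_def)
        moreover have "- \<gamma> \<in> Zset R \<alpha> t \<or> - \<gamma> \<in> Pset R \<alpha> q t"
          using bad tg gp t_minus[OF gR] by (auto simp: Zset_def Pset_def)
        ultimately show False using F J wz by (auto simp: tableaux_def)
      qed
    qed
  next
    assume ok: "?ok v"
    have "\<gamma> \<in> inversions R \<alpha> (v \<circ> w) \<longleftrightarrow> \<gamma> \<in> inversions R \<alpha> w"
      if g: "\<gamma> \<in> pos" "t \<gamma> = 1 \<or> t \<gamma> = q\<^sup>2 \<or> t \<gamma> = inverse (q\<^sup>2)" for \<gamma>
    proof (cases "w \<gamma> \<in> pos")
      case True
      then have "w \<gamma> \<notin> inversions R \<alpha> v" using ok w_t[of \<gamma>] g(2) by auto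
      then show ?thesis using True pos_neg_exclusive by (auto simp: inversions_def)
    next
      case False
      then have wp: "- w \<gamma> \<in> pos" using weyl_not_pos[OF w pos_root[OF g(1)]] by simp
      have "\<sigma> (- w \<gamma>) = inverse (t \<gamma>)"
        using w_t[of "- \<gamma>"] t_minus[OF pos_root[OF g(1)]] weyl_minus[OF w] by simp
      then have "- w \<gamma> \<notin> inversions R \<alpha> v" using ok g(2) by auto
      then have "v (- w \<gamma>) \<in> pos"
        using wp weyl_not_pos[OF v pos_root[OF wp]] by (auto simp: inversions_def)
      then have "- v (w \<gamma>) \<in> pos" using weyl_minus[OF v] by simp
      then show ?thesis using wp g(1) by (simp add: inversions_def)
    qed
    then have "inversions R \<alpha> (v \<circ> w) \<inter> Zset R \<alpha> t = inversions R \<alpha> w \<inter> Zset R \<alpha> t"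
      "inversions R \<alpha> (v \<circ> w) \<inter> Pset R \<alpha> q t = inversions R \<alpha> w \<inter> Pset R \<alpha> q t"
      by (auto simp: Zset_def Pset_def simp del: o_apply)
    then show "v \<circ> w \<in> ?F" using wz J weyl_comp[OF v w] by (simp add: tableaux_def del: o_apply)
  qed
  define e where "e v = nrm \<sigma> v \<star> f \<sigma> x v" for v
  define E where "E u = e (u \<circ> inv w)" for u
  have E_comp: "E (v \<circ> w) = e v" for v
  proof -
    have "(v \<circ> w) \<circ> inv w = v" using w by (auto simp: fun_eq_iff)
    then show ?thesis by (simp only: E_def)
  qed
  have as_comp: "\<exists>v\<in>weyl R. u = v \<circ> w" if "u \<in> weyl R" for u
    using that w weyl_comp[OF that iw] by (intro bexI[of _ "u \<circ> inv w"]) (auto simp: fun_eq_iff)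
  have f_iff: "f \<sigma> x v \<noteq> 0 \<longleftrightarrow> v \<circ> w \<in> ?F" if "v \<in> weyl R" for v
    using f_nonzero_iff[OF sg x' x(2) that] F_iff[OF that] by simp
  have F_weyl: "?F \<subseteq> weyl R" by (auto simp: tableaux_def)
  have generic: "torus_act v \<sigma> (\<alpha> i) \<noteq> 1 \<and> torus_act v \<sigma> (\<alpha> i) \<noteq> q\<^sup>2 \<and> torus_act v \<sigma> (\<alpha> i) \<noteq> inverse (q\<^sup>2)"
    if v: "v \<in> weyl R" "inv v (\<alpha> i) \<in> pos" "f \<sigma> x (s i \<circ> v) \<noteq> 0" for v i
  proof -
    have "inv v (\<alpha> i) \<in> inversions R \<alpha> (s i \<circ> v)" using inversions_s_up(1)[OF v(1,2)] by simp
    then have "\<sigma> (inv v (\<alpha> i)) \<noteq> 1 \<and> \<sigma> (inv v (\<alpha> i)) \<noteq> q\<^sup>2 \<and> \<sigma> (inv v (\<alpha> i)) \<noteq> inverse (q\<^sup>2)"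
      using f_nonzero_iff[OF sg x' x(2) weyl_comp[OF s_weyl v(1)]] v(3) by blast
    then show ?thesis by (simp add: torus_act_def)
  qed
  have tau_e: "tau i (torus_act v \<sigma>) (e v) = (inverse q + d i (torus_act v \<sigma>)) \<star> e (s i \<circ> v)"
    if v: "v \<in> weyl R" and fv: "f \<sigma> x v \<noteq> 0" for v i
  proof (cases "inv v (\<alpha> i) \<in> pos")
    case up: True
    show ?thesis
    proof (cases "f \<sigma> x (s i \<circ> v) = 0")
      case True
      then show ?thesis using f_up[OF sg x' v up] by (simp add: e_def tau_scale)
    next
      case False
      then have "inverse q + d i (torus_act v \<sigma>) \<noteq> 0"
        using norm_factor_nonzero[OF torus_act_torus[OF v sg]] generic[OF v up] by blast
      then show ?thesis unfolding e_def tau_scale f_up[OF sg x' v up, symmetric] nrm_up[OF v up] by simp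
    qed
  next
    case dn: False
    define v' where "v' = s i \<circ> v"
    have v': "v' \<in> weyl R" unfolding v'_def by (rule weyl_comp[OF s_weyl v])
    have vv: "v = s i \<circ> v'" unfolding v'_def by (simp only: s_s_comp)
    have up: "inv v' (\<alpha> i) \<in> pos" using inversions_s_down(3)[OF v dn] inv_s_comp[OF v, of i] by (simp add: v'_def del: o_apply)
    have gen: "torus_act v' \<sigma> (\<alpha> i) \<noteq> 1" "torus_act v' \<sigma> (\<alpha> i) \<noteq> inverse (q\<^sup>2)"
      using generic[OF v' up] fv vv by auto
    have nz: "inverse q + d i (torus_act v' \<sigma>) \<noteq> 0"
      by (rule norm_factor_nonzero[OF torus_act_torus[OF v' sg] gen])
    have "torus_act v \<sigma> = torus_act (s i) (torus_act v' \<sigma>)" unfolding vv by (rule torus_act_comp[OF s_weyl v'])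
    then have gg: "g i (torus_act v' \<sigma>) = (inverse q + d i (torus_act v' \<sigma>)) * (inverse q + d i (torus_act v \<sigma>))"
      using g_factor[OF torus_act_torus[OF v' sg] gen(1)] by simp
    have nv: "nrm \<sigma> v = nrm \<sigma> v' / (inverse q + d i (torus_act v' \<sigma>))" unfolding vv by (rule nrm_up[OF v' up])
    show ?thesis
      unfolding e_def tau_scale f_down(2)[OF sg x' v dn] v'_def[symmetric] gg nv
      using nz by (simp add: mult_ac)
  qed
  have dT: "d i (torus_act v \<sigma>) = T_diag \<alpha> q t i (v \<circ> w)" if "v \<in> weyl R" for v i
    unfolding d_def T_diag_def act[OF that] ..
  \<comment> \<open>Division by zero could make \<open>nrm\<close> vanish. Along a descent of v the
    vectors stay nonzero, and \<open>generic\<close> then keeps every factor away from 0.\<close>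
  have nrm_nz: "nrm \<sigma> v \<noteq> 0" if v: "v \<in> weyl R" "f \<sigma> x v \<noteq> 0" for v
    using v
  proof (induction "len v" arbitrary: v)
    case 0
    then have "v = id" using len_0_imp_id by metis
    then show ?case unfolding nrm_def by (simp only: inversions_id) simp
  next
    case (Suc n)
    then have "v \<noteq> id" by auto
    then obtain i where dn: "inv v (\<alpha> i) \<notin> pos" using ex_descent Suc.prems by blast
    define v' where "v' = s i \<circ> v"
    have v': "v' \<in> weyl R" unfolding v'_def by (rule weyl_comp[OF s_weyl Suc.prems(1)])
    have vv: "v = s i \<circ> v'" unfolding v'_def by (simp only: s_s_comp)
    have up: "inv v' (\<alpha> i) \<in> pos"
      using inversions_s_down(3)[OF Suc.prems(1) dn] inv_s_comp[OF Suc.prems(1), of i] by (simp add: v'_def del: o_apply)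
    have "f \<sigma> x v' \<noteq> 0" using f_down(1)[OF sg x' Suc.prems(1) dn] Suc.prems(2) unfolding v'_def by auto
    moreover have "n = len v'" using len_s_down[OF Suc.prems(1) dn] Suc.hyps(2) by (simp add: v'_def del: o_apply)
    ultimately have "nrm \<sigma> v' \<noteq> 0" using Suc.hyps(1) v' by blast
    moreover have "inverse q + d i (torus_act v' \<sigma>) \<noteq> 0"
      using norm_factor_nonzero[OF torus_act_torus[OF v' sg]] generic[OF v' up] Suc.prems(2) vv by metis
    ultimately show ?case unfolding vv nrm_up[OF v' up] by simp
  qed
  have E1: "E u \<noteq> 0 \<and> E u \<in> wsp (torus_act u t)" if u: "u \<in> ?F" for u
  proof -
    obtain v where v: "v \<in> weyl R" "u = v \<circ> w" using as_comp u F_weyl by blast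
    then have "f \<sigma> x v \<noteq> 0" using f_iff u by blast
    then show ?thesis unfolding v(2) E_comp using nrm_nz[OF v(1)] f_wsp[OF sg x' v(1)] act[OF v(1)]
      by (simp add: e_def wsp_scale del: o_apply)
  qed
  have E2: "E u = 0" if u: "u \<in> weyl R" "u \<notin> ?F" for u
  proof -
    obtain v where v: "v \<in> weyl R" "u = v \<circ> w" using as_comp u by blast
    then have "f \<sigma> x v = 0" using f_iff u by blast
    then show ?thesis unfolding v(2) E_comp by (simp add: e_def)
  qed
  have E3: "T i (E u) = T_diag \<alpha> q t i u \<star> E u + (inverse q + T_diag \<alpha> q t i u) \<star> E (s i \<circ> u)" if u: "u \<in> ?F" for u i
  proof -
    obtain v where v: "v \<in> weyl R" "u = v \<circ> w" using as_comp u F_weyl by blast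
    then have fv: "f \<sigma> x v \<noteq> 0" using f_iff u by blast
    have "E (s i \<circ> u) = e (s i \<circ> v)" unfolding v(2) comp_assoc[symmetric] by (rule E_comp)
    moreover have "E u = e v" unfolding v(2) by (rule E_comp)
    ultimately show ?thesis
      using T_eq_tau[of i "e v" "torus_act v \<sigma>"] tau_e[OF v(1) fv, of i] dT[OF v(1), of i]
      unfolding v(2) by (simp add: add.commute del: o_apply)
  qed
  have E4: "span (E ` ?F) = V"
  proof
    show "span (E ` ?F) \<subseteq> V" using E1 wsp_V by (intro span_minimal[OF _ subspace_V]) blast
    have "f \<sigma> x v \<in> span (E ` ?F)" if v: "v \<in> weyl R" for v
    proof (cases "f \<sigma> x v = 0")
      case False
      have "E (v \<circ> w) \<in> span (E ` ?F)" using f_iff[OF v] False by (intro span_base imageI) blast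
      then have "(1 / nrm \<sigma> v) \<star> E (v \<circ> w) \<in> span (E ` ?F)" by (rule span_scale)
      then show ?thesis using nrm_nz[OF v False] by (simp add: E_comp e_def del: o_apply)
    qed (simp add: span_zero)
    then have "span (f \<sigma> x ` weyl R) \<subseteq> span (E ` ?F)" by (intro span_minimal[OF _ subspace_span]) blast
    then show "V \<subseteq> span (E ` ?F)" using span_f[OF sg x' x(2)] by simp
  qed
  show ?thesis by (rule that[OF E1 E2 E3 E4])
qed

end

section \<open>The affine Hecke algebra and its modules\<close>

definition words :: "('n::finite \<Rightarrow> real^'n) \<Rightarrow> 'n hgen fword set" where
  "words \<alpha> = {w. set (letters w) \<subseteq> hgens \<alpha>}"

lemma carrier_free: "carrier (free_algebra \<alpha>) = {p. Poly_Mapping.keys p \<subseteq> words \<alpha>}"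
  by (auto simp: free_algebra_def words_def)

lemma free_simps [simp]:
  "x \<otimes>\<^bsub>free_algebra \<alpha>\<^esub> y = x * y" "x \<oplus>\<^bsub>free_algebra \<alpha>\<^esub> y = x + y"
  "\<one>\<^bsub>free_algebra \<alpha>\<^esub> = 1" "\<zero>\<^bsub>free_algebra \<alpha>\<^esub> = 0"
  by (simp_all add: free_algebra_def)

lemma words_add: "u \<in> words \<alpha> \<Longrightarrow> v \<in> words \<alpha> \<Longrightarrow> u + v \<in> words \<alpha>"
  by (simp add: words_def plus_fword_def)

lemma words_zero: "0 \<in> words \<alpha>"
  by (simp add: words_def zero_fword_def)

lemma free_mult: "p \<in> carrier (free_algebra \<alpha>) \<Longrightarrow> r \<in> carrier (free_algebra \<alpha>) \<Longrightarrow> p * r \<in> carrier (free_algebra \<alpha>)"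
  using keys_mult[of p r] words_add unfolding carrier_free by blast

lemma free_add: "p \<in> carrier (free_algebra \<alpha>) \<Longrightarrow> r \<in> carrier (free_algebra \<alpha>) \<Longrightarrow> p + r \<in> carrier (free_algebra \<alpha>)"
  using Poly_Mapping.keys_add[of p r] unfolding carrier_free by blast

lemma keys_uminus_eq: "Poly_Mapping.keys (- p) = Poly_Mapping.keys (p :: 'a \<Rightarrow>\<^sub>0 complex)"
  by (auto simp: in_keys_iff)

lemma free_minus: "p \<in> carrier (free_algebra \<alpha>) \<Longrightarrow> - p \<in> carrier (free_algebra \<alpha>)"
  by (simp add: carrier_free keys_uminus_eq)

lemma free_diff: "p \<in> carrier (free_algebra \<alpha>) \<Longrightarrow> r \<in> carrier (free_algebra \<alpha>) \<Longrightarrow> p - r \<in> carrier (free_algebra \<alpha>)"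
  using free_add[of p \<alpha> "- r"] free_minus[of r \<alpha>] by simp

lemma free_zero: "0 \<in> carrier (free_algebra \<alpha>)"
  by (simp add: carrier_free)

lemma free_one: "1 \<in> carrier (free_algebra \<alpha>)"
  by (simp add: carrier_free words_zero)

lemma free_const: "fconst c \<in> carrier (free_algebra \<alpha>)"
  by (simp add: carrier_free fconst_def words_zero)

lemma free_gen: "x \<in> hgens \<alpha> \<Longrightarrow> fgen x \<in> carrier (free_algebra \<alpha>)"
  by (simp add: carrier_free fgen_def words_def)

lemma free_sum: "(\<And>i. i \<in> S \<Longrightarrow> h i \<in> carrier (free_algebra \<alpha>)) \<Longrightarrow> sum h S \<in> carrier (free_algebra \<alpha>)"
  by (induction S rule: infinite_finite_induct) (auto simp: free_zero free_add)

lemma ring_free: "ring (free_algebra \<alpha>)"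
proof (rule ringI)
  show "abelian_group (free_algebra \<alpha>)"
  proof (rule abelian_groupI)
    fix x assume "x \<in> carrier (free_algebra \<alpha>)"
    then show "\<exists>y\<in>carrier (free_algebra \<alpha>). y \<oplus>\<^bsub>free_algebra \<alpha>\<^esub> x = \<zero>\<^bsub>free_algebra \<alpha>\<^esub>"
      using free_minus by (intro bexI[of _ "- x"]) auto
  qed (auto simp: free_add free_zero algebra_simps)
  show "monoid (free_algebra \<alpha>)"
    by (rule monoidI) (auto simp: free_mult free_one mult.assoc)
qed (auto simp: distrib_right distrib_left)

lemma T_hgens: "GenT i \<in> hgens \<alpha>" and X_hgens: "\<nu> \<in> weight_lattice \<alpha> \<Longrightarrow> GenX \<nu> \<in> hgens \<alpha>"
  by (auto simp: hgens_def)

lemma fpoly_superset: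
  assumes "finite S" "Poly_Mapping.keys p \<subseteq> S"
  shows "fpoly p = (\<Sum>\<nu>\<in>S. fconst (Poly_Mapping.lookup p \<nu>) * fgen (GenX \<nu>))"
  unfolding fpoly_def using assms
  by (intro sum.mono_neutral_left) (auto simp: in_keys_iff fconst_def)

lemma fpoly_add: "fpoly (p + r) = fpoly p + fpoly r"
proof -
  let ?S = "Poly_Mapping.keys p \<union> Poly_Mapping.keys r"
  have "fpoly (p + r) = (\<Sum>\<nu>\<in>?S. fconst (Poly_Mapping.lookup (p + r) \<nu>) * fgen (GenX \<nu>))"
    by (rule fpoly_superset) (auto dest: subsetD[OF Poly_Mapping.keys_add])
  also have "\<dots> = (\<Sum>\<nu>\<in>?S. fconst (Poly_Mapping.lookup p \<nu>) * fgen (GenX \<nu>))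
      + (\<Sum>\<nu>\<in>?S. fconst (Poly_Mapping.lookup r \<nu>) * fgen (GenX \<nu>))"
    by (simp add: lookup_add fconst_def single_add distrib_right sum.distrib)
  also have "\<dots> = fpoly p + fpoly r"
    using fpoly_superset[of ?S p] fpoly_superset[of ?S r] by simp
  finally show ?thesis .
qed

lemma fpoly_zero [simp]: "fpoly 0 = 0" by (simp add: fpoly_def)

lemma fpoly_minus: "fpoly (- p) = - fpoly p"
  using fpoly_add[of p "- p"] by (simp add: eq_neg_iff_add_eq_0 add.commute)

lemma fpoly_sum: "fpoly (sum h S) = (\<Sum>i\<in>S. fpoly (h i))"
  by (induction S rule: infinite_finite_induct) (auto simp: fpoly_add)

lemma fconst_1 [simp]: "fconst 1 = 1"
  by (simp add: fconst_def)

lemma fpoly_single: "fpoly (Poly_Mapping.single \<nu> 1) = fgen (GenX \<nu>)"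
  by (simp add: fpoly_def)

lemma free_fpoly: "p \<in> group_algebra \<alpha> \<Longrightarrow> fpoly p \<in> carrier (free_algebra \<alpha>)"
  unfolding fpoly_def group_algebra_def
  by (intro free_sum free_mult free_const free_gen X_hgens) auto

lemma free_braid_word: "braid_word i j m \<in> carrier (free_algebra \<alpha>)"
  by (induction m arbitrary: i j) (auto intro: free_one free_mult free_gen T_hgens)

lemma poly_mapping_sum_single:
  fixes p :: "'a \<Rightarrow>\<^sub>0 complex"
  shows "p = (\<Sum>k\<in>Poly_Mapping.keys p. Poly_Mapping.single k (Poly_Mapping.lookup p k))"
proof (rule poly_mapping_eqI)
  fix x
  have "(\<Sum>k\<in>Poly_Mapping.keys p. (if k = x then Poly_Mapping.lookup p k else 0)) = Poly_Mapping.lookup p x"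
    by (simp add: in_keys_iff)
  then show "Poly_Mapping.lookup p x = Poly_Mapping.lookup
      (\<Sum>k\<in>Poly_Mapping.keys p. Poly_Mapping.single k (Poly_Mapping.lookup p k)) x"
    by (simp add: lookup_sum lookup_single when_def)
qed

lemma fconst_commute: "fconst c * p = p * fconst c"
proof -
  have "fconst c * p = (\<Sum>k\<in>Poly_Mapping.keys p. fconst c * Poly_Mapping.single k (Poly_Mapping.lookup p k))"
    by (subst poly_mapping_sum_single[of p]) (simp add: sum_distrib_left)
  also have "\<dots> = (\<Sum>k\<in>Poly_Mapping.keys p. Poly_Mapping.single k (Poly_Mapping.lookup p k) * fconst c)"
    by (simp add: fconst_def mult_single mult.commute)
  also have "\<dots> = p * fconst c"
    by (subst (3) poly_mapping_sum_single[of p]) (simp add: sum_distrib_right)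
  finally show ?thesis .
qed

lemma fconst_mult: "fconst (a * b) = fconst a * fconst b" and fconst_add: "fconst (a + b) = fconst a + fconst b"
  by (simp_all add: fconst_def mult_single single_add)

context simple_root_system begin

lemma hecke_relators_carrier: "hecke_relators \<alpha> q \<subseteq> carrier (free_algebra \<alpha>)"
proof
  fix r assume "r \<in> hecke_relators \<alpha> q"
  then show "r \<in> carrier (free_algebra \<alpha>)"
  proof cases
    case (bernstein \<nu> p i)
    then show ?thesis
      by (auto intro!: free_diff free_add free_mult free_gen T_hgens X_hgens free_const free_fpoly s_P)
  qed (auto intro!: free_diff free_add free_mult free_gen T_hgens X_hgens free_const free_one free_braid_word P_add)
qed

lemma hecke_ideal: "ideal (hecke_ideal \<alpha> q) (free_algebra \<alpha>)"
  unfolding hecke_ideal_def by (rule ring.genideal_ideal[OF ring_free hecke_relators_carrier])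

lemma hecke_relator_ideal: "r \<in> hecke_relators \<alpha> q \<Longrightarrow> r \<in> hecke_ideal \<alpha> q"
  unfolding hecke_ideal_def using ring.genideal_self[OF ring_free hecke_relators_carrier] by blast

lemma hclass_hom: "hclass \<alpha> q \<in> ring_hom (free_algebra \<alpha>) (affine_hecke \<alpha> q)"
  using ideal.rcos_ring_hom[OF hecke_ideal, of q] unfolding affine_hecke_def hclass_def[abs_def] .

lemma ring_affine_hecke: "ring (affine_hecke \<alpha> q)"
  unfolding affine_hecke_def by (rule ideal.quotient_is_ring[OF hecke_ideal])

lemma hclass_ideal: "r \<in> hecke_ideal \<alpha> q \<Longrightarrow> hclass \<alpha> q r = \<zero>\<^bsub>affine_hecke \<alpha> q\<^esub>"
  unfolding hclass_def affine_hecke_def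
  using ring.a_rcos_zero[OF ring_free hecke_ideal, of r q] by (simp add: FactRing_def)

lemma hecke_carrier: "h \<in> carrier (affine_hecke \<alpha> q) \<longleftrightarrow> (\<exists>p\<in>carrier (free_algebra \<alpha>). h = hclass \<alpha> q p)"
  unfolding affine_hecke_def hclass_def FactRing_def by (auto simp: A_RCOSETS_def')

text \<open>The shape module acts through an arbitrary representative of a coset; this one lies in
  the free algebra and determines the same coset.\<close>

lemma hecke_rep_choice:
  assumes "h \<in> carrier (affine_hecke \<alpha> q)"
  shows "(SOME p. p \<in> h) \<in> carrier (free_algebra \<alpha>)" "hclass \<alpha> q (SOME p. p \<in> h) = h"
proof -
  obtain p where p: "p \<in> carrier (free_algebra \<alpha>)" "h = hclass \<alpha> q p" using assms hecke_carrier by blast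
  interpret I: ideal "hecke_ideal \<alpha> q" "free_algebra \<alpha>" by (rule hecke_ideal)
  have "p \<in> h" unfolding p(2) hclass_def using p(1) by (rule I.a_rcos_self)
  then have s: "(SOME p. p \<in> h) \<in> h" by (rule someI)
  have "h \<subseteq> carrier (free_algebra \<alpha>)" unfolding p(2) hclass_def
    using p(1) I.a_subset by (intro I.a_r_coset_subset_G) auto
  then show "(SOME p. p \<in> h) \<in> carrier (free_algebra \<alpha>)" using s by blast
  show "hclass \<alpha> q (SOME p. p \<in> h) = h"
    using I.a_repr_independence'[of "SOME p. p \<in> h" p] s p unfolding hclass_def by simp
qed

end

section \<open>Coordinates on a finite dimensional module\<close>

locale hecke_module = simple_root_system R \<alpha> + left_module "affine_hecke \<alpha> q" M
  for R :: "(real^'n) set" and \<alpha> :: "'n \<Rightarrow> real^'n" and q :: complex and M :: "('n free set, 'm) module" +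
  fixes B :: "'m set"
  assumes finite_B: "finite B" and B_carrier: "B \<subseteq> carrier M"
    and spanning: "\<And>x. x \<in> carrier M \<Longrightarrow> \<exists>c. x = (\<Oplus>\<^bsub>M\<^esub>b\<in>B. hconst \<alpha> q (c b) \<odot>\<^bsub>M\<^esub> b)"
begin

abbreviation A where "A \<equiv> carrier (free_algebra \<alpha>)"

definition act :: "'n free \<Rightarrow> 'm \<Rightarrow> 'm" where "act p x = hclass \<alpha> q p \<odot>\<^bsub>M\<^esub> x"

lemma hclass_closed: "p \<in> A \<Longrightarrow> hclass \<alpha> q p \<in> carrier (affine_hecke \<alpha> q)"
  using hecke_carrier by blast

lemma act_closed: "p \<in> A \<Longrightarrow> x \<in> carrier M \<Longrightarrow> act p x \<in> carrier M"
  unfolding act_def by (rule lm_smult_closed[OF hclass_closed])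

lemma act_add: "p \<in> A \<Longrightarrow> r \<in> A \<Longrightarrow> x \<in> carrier M \<Longrightarrow> act (p + r) x = act p x \<oplus>\<^bsub>M\<^esub> act r x"
  unfolding act_def using ring_hom_add[OF hclass_hom, of p r q] lm_smult_l_distr[OF hclass_closed hclass_closed] by simp

lemma act_mult: "p \<in> A \<Longrightarrow> r \<in> A \<Longrightarrow> x \<in> carrier M \<Longrightarrow> act (p * r) x = act p (act r x)"
  unfolding act_def using ring_hom_mult[OF hclass_hom, of p r q] lm_smult_assoc[OF hclass_closed hclass_closed] by simp

lemma act_one: "x \<in> carrier M \<Longrightarrow> act 1 x = x"
  unfolding act_def using ring_hom_one[OF hclass_hom, of q] lm_smult_one by simp

lemma act_right_add: "p \<in> A \<Longrightarrow> x \<in> carrier M \<Longrightarrow> y \<in> carrier M \<Longrightarrow> act p (x \<oplus>\<^bsub>M\<^esub> y) = act p x \<oplus>\<^bsub>M\<^esub> act p y"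
  unfolding act_def by (rule lm_smult_r_distr[OF hclass_closed])

lemma act_right_zero: "p \<in> A \<Longrightarrow> act p \<zero>\<^bsub>M\<^esub> = \<zero>\<^bsub>M\<^esub>"
  using act_right_add[of p "\<zero>\<^bsub>M\<^esub>" "\<zero>\<^bsub>M\<^esub>"] act_closed[of p "\<zero>\<^bsub>M\<^esub>"] M.add.l_cancel_one by simp

lemma act_ideal: assumes "r \<in> hecke_ideal \<alpha> q" "x \<in> carrier M" shows "act r x = \<zero>\<^bsub>M\<^esub>"
proof -
  have 0: "\<zero>\<^bsub>affine_hecke \<alpha> q\<^esub> \<in> carrier (affine_hecke \<alpha> q)" by (rule H.zero_closed)
  then have c: "\<zero>\<^bsub>affine_hecke \<alpha> q\<^esub> \<odot>\<^bsub>M\<^esub> x \<in> carrier M" using assms(2) by (rule lm_smult_closed)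
  have "\<zero>\<^bsub>affine_hecke \<alpha> q\<^esub> \<odot>\<^bsub>M\<^esub> x \<oplus>\<^bsub>M\<^esub> \<zero>\<^bsub>affine_hecke \<alpha> q\<^esub> \<odot>\<^bsub>M\<^esub> x = \<zero>\<^bsub>affine_hecke \<alpha> q\<^esub> \<odot>\<^bsub>M\<^esub> x"
    using lm_smult_l_distr[OF 0 0 assms(2)] by simp
  then have "\<zero>\<^bsub>affine_hecke \<alpha> q\<^esub> \<odot>\<^bsub>M\<^esub> x = \<zero>\<^bsub>M\<^esub>" using c M.add.l_cancel_one by simp
  then show ?thesis unfolding act_def hclass_ideal[OF assms(1)] .
qed

lemma act_eq_relator:
  assumes "p - r \<in> hecke_relators \<alpha> q" "p \<in> A" "r \<in> A" "x \<in> carrier M" shows "act p x = act r x"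
proof -
  have "act p x = act ((p - r) + r) x" by simp
  also have "\<dots> = act (p - r) x \<oplus>\<^bsub>M\<^esub> act r x" using assms free_diff by (intro act_add) auto
  also have "\<dots> = act r x" using act_ideal[OF hecke_relator_ideal[OF assms(1)]] assms act_closed by simp
  finally show ?thesis .
qed

text \<open>\<open>M\<close> is identified with a space of coordinate functions: \<open>\<pi>\<close> evaluates coordinates with respect to
  the spanning set, and \<open>Pr\<close> is a linear projection with the same kernel.\<close>

definition sc :: "complex \<Rightarrow> ('m \<Rightarrow> complex) \<Rightarrow> 'm \<Rightarrow> complex" where "sc a c = (\<lambda>b. a * c b)"

sublocale vs: vector_space sc
  by unfold_locales (auto simp: sc_def fun_eq_iff algebra_simps)

definition \<pi> :: "('m \<Rightarrow> complex) \<Rightarrow> 'm" where "\<pi> c = (\<Oplus>\<^bsub>M\<^esub>b\<in>B. act (fconst (c b)) b)"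

lemma pi_term: "(\<lambda>b. act (fconst (c b)) b) \<in> B \<rightarrow> carrier M"
  using B_carrier act_closed[OF free_const] by auto

lemma pi_closed [simp]: "\<pi> c \<in> carrier M"
  unfolding \<pi>_def by (rule M.finsum_closed[OF pi_term])

lemma pi_add: "\<pi> (c + c') = \<pi> c \<oplus>\<^bsub>M\<^esub> \<pi> c'"
proof -
  have "\<pi> (c + c') = (\<Oplus>\<^bsub>M\<^esub>b\<in>B. act (fconst (c b)) b \<oplus>\<^bsub>M\<^esub> act (fconst (c' b)) b)"
    unfolding \<pi>_def using B_carrier pi_term
    by (intro M.finsum_cong') (auto simp: fconst_add act_add free_const)
  then show ?thesis unfolding \<pi>_def using M.finsum_addf[OF pi_term pi_term] by simp
qed

lemma act_finsum:
  assumes "p \<in> A" "finite S" "h \<in> S \<rightarrow> carrier M"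
  shows "act p (\<Oplus>\<^bsub>M\<^esub>b\<in>S. h b) = (\<Oplus>\<^bsub>M\<^esub>b\<in>S. act p (h b))"
  using assms(2,3)
proof (induction S rule: finite_induct)
  case empty
  then show ?case using act_right_zero[OF assms(1)] by simp
next
  case (insert b S)
  then have "h b \<in> carrier M" "h \<in> S \<rightarrow> carrier M" by auto
  moreover have "(\<lambda>b. act p (h b)) \<in> S \<rightarrow> carrier M" using insert act_closed[OF assms(1)] by auto
  ultimately show ?case using insert act_closed[OF assms(1)] act_right_add[OF assms(1)] M.finsum_closed by simp
qed

lemma pi_scale: "\<pi> (sc a c) = act (fconst a) (\<pi> c)"
proof -
  have "\<pi> (sc a c) = (\<Oplus>\<^bsub>M\<^esub>b\<in>B. act (fconst a) (act (fconst (c b)) b))"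
    unfolding \<pi>_def sc_def using B_carrier pi_term
    by (intro M.finsum_cong') (auto simp: fconst_mult act_mult free_const act_closed)
  then show ?thesis unfolding \<pi>_def using act_finsum[OF free_const finite_B pi_term] by simp
qed

lemma pi_surj: "x \<in> carrier M \<Longrightarrow> \<exists>c. \<pi> c = x"
  using spanning[of x] by (auto simp: \<pi>_def act_def hconst_def)

text \<open>Extend a basis D of the kernel of the evaluation to a basis of the whole function space;
  the projection kills D and fixes the remaining basis vectors.\<close>

lemma ex_projection:
  "\<exists>Pr. Vector_Spaces.linear sc sc Pr \<and> (\<forall>c. \<pi> (Pr c) = \<pi> c) \<and> (\<forall>c. \<pi> c = \<zero>\<^bsub>M\<^esub> \<longrightarrow> Pr c = 0)"
proof -
  interpret vp: vector_space_pair sc sc by unfold_locales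
  define K where "K = {c. \<pi> c = \<zero>\<^bsub>M\<^esub>}"
  have pi0: "\<pi> 0 = \<zero>\<^bsub>M\<^esub>" using pi_add[of 0 0] M.add.l_cancel_one[of "\<pi> 0" "\<pi> 0"] by simp
  have K: "vs.subspace K"
    by (rule vs.subspaceI) (simp_all add: K_def pi0 pi_add pi_scale act_right_zero free_const)
  obtain D where D: "D \<subseteq> K" "vs.independent D" "K \<subseteq> vs.span D" by (rule vs.maximal_independent_subset[of K])
  obtain D' where D': "D \<subseteq> D'" "vs.independent D'" "UNIV \<subseteq> vs.span D'"
    by (rule vs.maximal_independent_subset_extend[OF subset_UNIV D(2)])
  obtain Pr where Pr: "Vector_Spaces.linear sc sc Pr" "\<forall>c\<in>D'. Pr c = (if c \<in> D then 0 else c)"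
    using vp.linear_independent_extend[OF D'(2), of "\<lambda>c. if c \<in> D then 0 else c"] by blast
  interpret Pr: Vector_Spaces.linear sc sc Pr by (rule Pr(1))
  have "c - Pr c \<in> K" for c
  proof -
    have "c \<in> vs.span D'" using D'(3) by blast
    then show ?thesis
    proof (induction rule: vs.span_induct_alt)
      case base
      then show ?case unfolding Pr.zero diff_0_right by (rule vs.subspace_0[OF K])
    next
      case (step a x y)
      have "x - Pr x \<in> K" using step(1) Pr(2) D(1) vs.subspace_0[OF K] by auto
      then have "sc a (x - Pr x) + (y - Pr y) \<in> K" using step(2) K vs.subspace_add vs.subspace_scale by blast
      moreover have "sc a (x - Pr x) + (y - Pr y) = (sc a x + y) - Pr (sc a x + y)"
        unfolding Pr.add Pr.scale vs.scale_right_diff_distrib by (rule add_diff_add[symmetric])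
      ultimately show ?case by metis
    qed
  qed
  then have "\<pi> (Pr c) = \<pi> c" for c
  proof -
    have "\<pi> c = \<pi> ((c - Pr c) + Pr c)" by simp
    also have "\<dots> = \<pi> (Pr c)" unfolding pi_add using \<open>c - Pr c \<in> K\<close> by (simp add: K_def)
    finally show ?thesis by simp
  qed
  moreover have "Pr c = 0" if "\<pi> c = \<zero>\<^bsub>M\<^esub>" for c
  proof -
    have "c \<in> vs.span D" using that D(3) by (auto simp: K_def)
    then show ?thesis
    proof (induction rule: vs.span_induct_alt)
      case (step a x y)
      have "Pr x = 0" using step(1) Pr(2) D'(1) by (metis subsetD)
      then show ?case by (simp only: Pr.add Pr.scale step(2) vs.scale_zero_right add_0_left)
    qed (rule Pr.zero)
  qed
  ultimately show ?thesis using Pr(1) by blast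
qed

definition Pr :: "('m \<Rightarrow> complex) \<Rightarrow> 'm \<Rightarrow> complex" where
  "Pr = (SOME Pr. Vector_Spaces.linear sc sc Pr \<and> (\<forall>c. \<pi> (Pr c) = \<pi> c) \<and> (\<forall>c. \<pi> c = \<zero>\<^bsub>M\<^esub> \<longrightarrow> Pr c = 0))"

lemma Pr: "Vector_Spaces.linear sc sc Pr" "\<pi> (Pr c) = \<pi> c" "\<pi> c = \<zero>\<^bsub>M\<^esub> \<Longrightarrow> Pr c = 0"
  using someI_ex[OF ex_projection] unfolding Pr_def[symmetric] by auto

sublocale Pr: Vector_Spaces.linear sc sc Pr by (rule Pr(1))

lemma pi_diff: "\<pi> c = \<pi> c' \<Longrightarrow> \<pi> (c - c') = \<zero>\<^bsub>M\<^esub>"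
  using pi_add[of "c - c'" c'] M.add.r_cancel_one[of "\<pi> c'" "\<pi> (c - c')"] by simp

lemma Pr_eq: "\<pi> c = \<pi> c' \<Longrightarrow> Pr c = Pr c'"
  using Pr(3)[OF pi_diff] Pr.diff[of c c'] by simp

definition V :: "('m \<Rightarrow> complex) set" where "V = range Pr"

lemma Pr_V: "c \<in> V \<Longrightarrow> Pr c = c"
  unfolding V_def using Pr_eq[OF Pr(2)] by auto

lemma pi_inj_V: "c \<in> V \<Longrightarrow> c' \<in> V \<Longrightarrow> \<pi> c = \<pi> c' \<Longrightarrow> c = c'"
  using Pr_eq Pr_V by metis

definition \<phi> :: "'m \<Rightarrow> 'm \<Rightarrow> complex" where "\<phi> x = Pr (SOME c. \<pi> c = x)"

lemma pi_phi: "x \<in> carrier M \<Longrightarrow> \<pi> (\<phi> x) = x"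
  unfolding \<phi>_def Pr(2) using someI_ex[OF pi_surj] .

lemma phi_V: "\<phi> x \<in> V" by (simp add: \<phi>_def V_def)

lemma phi_pi: "\<phi> (\<pi> c) = Pr c"
  using pi_inj_V[OF phi_V, of "Pr c" "\<pi> c"] pi_phi[OF pi_closed] Pr(2) by (simp add: V_def)

lemma phi_add: "x \<in> carrier M \<Longrightarrow> y \<in> carrier M \<Longrightarrow> \<phi> (x \<oplus>\<^bsub>M\<^esub> y) = \<phi> x + \<phi> y"
  using phi_pi[of "\<phi> x + \<phi> y"] by (simp add: pi_add pi_phi Pr.add Pr_V phi_V)

lemma phi_scale: "x \<in> carrier M \<Longrightarrow> \<phi> (act (fconst a) x) = sc a (\<phi> x)"
  using phi_pi[of "sc a (\<phi> x)"] by (simp add: pi_scale pi_phi Pr.scale Pr_V phi_V)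

lemma phi_inj: "x \<in> carrier M \<Longrightarrow> y \<in> carrier M \<Longrightarrow> \<phi> x = \<phi> y \<Longrightarrow> x = y"
  using pi_phi by metis

lemma phi_zero: "\<phi> \<zero>\<^bsub>M\<^esub> = 0"
  using phi_add[of "\<zero>\<^bsub>M\<^esub>" "\<zero>\<^bsub>M\<^esub>"] by simp

lemma phi_eq_0: "x \<in> carrier M \<Longrightarrow> \<phi> x = 0 \<longleftrightarrow> x = \<zero>\<^bsub>M\<^esub>"
  using phi_inj[of x "\<zero>\<^bsub>M\<^esub>"] phi_zero by auto

lemma subspace_V: "vs.subspace V"
  unfolding V_def using Pr.subspace_image[OF vs.subspace_UNIV] .

definition op :: "'n free \<Rightarrow> ('m \<Rightarrow> complex) \<Rightarrow> 'm \<Rightarrow> complex" where "op p c = \<phi> (act p (\<pi> c))"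

lemma op_V: "op p c \<in> V" by (simp add: op_def phi_V)

lemma pi_op: "p \<in> A \<Longrightarrow> \<pi> (op p c) = act p (\<pi> c)"
  by (simp add: op_def pi_phi act_closed)

lemma op_right_add: "p \<in> A \<Longrightarrow> op p (c + c') = op p c + op p c'"
  by (simp add: op_def pi_add act_right_add phi_add act_closed)

lemma op_right_scale: assumes p: "p \<in> A" shows "op p (sc a c) = sc a (op p c)"
proof -
  have "act p (act (fconst a) (\<pi> c)) = act (fconst a) (act p (\<pi> c))"
    using act_mult[OF p free_const pi_closed] act_mult[OF free_const p pi_closed] fconst_commute[of a p] by metis
  then show ?thesis by (simp add: op_def pi_scale phi_scale act_closed p)
qed

lemma op_add: "p \<in> A \<Longrightarrow> r \<in> A \<Longrightarrow> op (p + r) c = op p c + op r c"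
  by (simp add: op_def act_add phi_add act_closed)

lemma op_mult: "p \<in> A \<Longrightarrow> r \<in> A \<Longrightarrow> op (p * r) c = op p (op r c)"
  by (simp add: op_def act_mult pi_phi act_closed)

lemma op_const: "op (fconst a) c = sc a (Pr c)"
  by (simp add: op_def phi_scale phi_pi)

lemma op_one: "op 1 c = Pr c"
  by (simp add: op_def act_one phi_pi)

lemma op_minus: assumes "p \<in> A" shows "op (- p) c = - op p c"
proof -
  have "op (p + - p) c = op p c + op (- p) c" using assms free_minus by (intro op_add) auto
  moreover have "op (0 :: 'n free) c = 0" using op_add[OF free_zero free_zero, of c] by simp
  ultimately show ?thesis by (simp add: eq_neg_iff_add_eq_0 add.commute)
qed

lemma op_zero: "op 0 c = 0" using op_add[OF free_zero free_zero, of c] by simp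

lemma op_sum: "(\<And>i. i \<in> S \<Longrightarrow> h i \<in> A) \<Longrightarrow> op (sum h S) c = (\<Sum>i\<in>S. op (h i) c)"
  by (induction S rule: infinite_finite_induct) (auto simp: op_zero op_add free_sum)

lemma op_relator: "p - r \<in> hecke_relators \<alpha> q \<Longrightarrow> p \<in> A \<Longrightarrow> r \<in> A \<Longrightarrow> op p c = op r c"
  unfolding op_def using act_eq_relator[OF _ _ _ pi_closed] by simp

end

section \<open>The defining relations as identities of operators\<close>

lemma single_Word: "Poly_Mapping.single (Word (x # xs)) c = fgen x * Poly_Mapping.single (Word xs) (c::complex)"
  by (simp add: fgen_def mult_single plus_fword_def)

lemma free_single: "set xs \<subseteq> hgens \<alpha> \<Longrightarrow> Poly_Mapping.single (Word xs) c \<in> carrier (free_algebra \<alpha>)"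
  by (simp add: carrier_free words_def)

text \<open>This exhibits the quotient in the Bernstein relation as a finite geometric sum.\<close>

lemma telescope_single:
  fixes a b :: "'a::ab_group_add"
  assumes "\<And>j. e (Suc j) = e j + b"
  shows "(\<Sum>j<n. Poly_Mapping.single (e j) (1::complex)) * (1 - Poly_Mapping.single b 1)
    = Poly_Mapping.single (e 0) 1 - Poly_Mapping.single (e n) 1"
proof -
  have "(\<Sum>j<n. Poly_Mapping.single (e j) (1::complex)) * (1 - Poly_Mapping.single b 1)
    = (\<Sum>j<n. Poly_Mapping.single (e j) 1 - Poly_Mapping.single (e (Suc j)) 1)"
    by (simp add: sum_distrib_right right_diff_distrib mult_single assms sum_subtractf)
  also have "\<dots> = Poly_Mapping.single (e 0) 1 - Poly_Mapping.single (e n) 1"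
    by (rule sum_lessThan_telescope')
  finally show ?thesis .
qed

context hecke_module begin

lemma op_fgen_word:
  assumes "set xs \<subseteq> hgens \<alpha>" "c \<in> V"
  shows "op (Poly_Mapping.single (Word xs) a) c = sc a (foldr (\<lambda>x. op (fgen x)) xs c)"
  using assms
proof (induction xs)
  case Nil
  have "Poly_Mapping.single (Word [] :: 'n hgen fword) a = fconst a" by (simp add: fconst_def zero_fword_def)
  then show ?case using Nil by (simp add: op_const Pr_V)
next
  case (Cons x xs)
  then have x: "fgen x \<in> A" and xs: "Poly_Mapping.single (Word xs) a \<in> A" by (auto intro: free_gen free_single)
  show ?case using Cons by (simp add: single_Word op_mult[OF x xs] op_right_scale[OF x])
qed

lemma op_expand:
  assumes p: "p \<in> A" and c: "c \<in> V"
  shows "op p c = (\<Sum>w\<in>Poly_Mapping.keys p. sc (Poly_Mapping.lookup p w) (foldr (\<lambda>x. op (fgen x)) (letters w) c))"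
proof -
  have w: "set (letters w) \<subseteq> hgens \<alpha>" if "w \<in> Poly_Mapping.keys p" for w
    using p that by (auto simp: carrier_free words_def)
  have mem: "Poly_Mapping.single w a \<in> A" if "w \<in> Poly_Mapping.keys p" for w a
    using free_single[OF w[OF that]] by simp
  have "op p c = (\<Sum>w\<in>Poly_Mapping.keys p. op (Poly_Mapping.single w (Poly_Mapping.lookup p w)) c)"
    by (subst poly_mapping_sum_single[of p]) (rule op_sum, rule mem)
  also have "\<dots> = (\<Sum>w\<in>Poly_Mapping.keys p. sc (Poly_Mapping.lookup p w) (foldr (\<lambda>x. op (fgen x)) (letters w) c))"
    by (intro sum.cong HOL.refl) (metis op_fgen_word[OF w c] fword.collapse)
  finally show ?thesis .
qed

abbreviation Top :: "'n \<Rightarrow> ('m \<Rightarrow> complex) \<Rightarrow> 'm \<Rightarrow> complex" where "Top i \<equiv> op (fgen (GenT i))"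
abbreviation Xop :: "real^'n \<Rightarrow> ('m \<Rightarrow> complex) \<Rightarrow> 'm \<Rightarrow> complex" where "Xop \<nu> \<equiv> op (fgen (GenX \<nu>))"

lemma fT: "fgen (GenT i) \<in> A" and fX: "\<nu> \<in> P \<Longrightarrow> fgen (GenX \<nu>) \<in> A"
  by (auto intro: free_gen T_hgens X_hgens)

lemma op_braid_word: "c \<in> V \<Longrightarrow> op (braid_word i j m) c = foldr Top (altw i j m) c"
  by (induction m arbitrary: i j) (simp_all add: op_one Pr_V op_mult fT free_braid_word)

lemma op_T_T: assumes "c \<in> V" shows "Top i (Top i c) = sc (q - inverse q) (Top i c) + c"
proof -
  have "op (fgen (GenT i) * fgen (GenT i)) c = op (fconst (q - inverse q) * fgen (GenT i) + 1) c"
    by (rule op_relator[OF hecke_relators.quadratic]) (intro free_mult free_add free_one free_const fT)+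
  then show ?thesis using assms
    by (simp add: op_mult op_add fT free_const free_mult free_one op_const op_one Pr_V op_V)
qed

lemma op_braid:
  assumes "i \<noteq> j" "c \<in> V"
  shows "foldr Top (altw i j (cox_order \<alpha> i j)) c = foldr Top (altw j i (cox_order \<alpha> i j)) c"
  using op_relator[OF hecke_relators.braid[OF assms(1)] free_braid_word free_braid_word, of c]
    op_braid_word[OF assms(2)] by simp

lemma op_X_X: assumes "\<nu> \<in> P" "\<mu> \<in> P" shows "Xop \<nu> (Xop \<mu> c) = Xop (\<nu> + \<mu>) c"
  using op_relator[OF hecke_relators.X_mult[OF assms] free_mult[OF fX[OF assms(1)] fX[OF assms(2)]] fX[OF P_add[OF assms]], of c]
    op_mult[OF fX[OF assms(1)] fX[OF assms(2)]] by simp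

lemma op_X_zero: "c \<in> V \<Longrightarrow> Xop 0 c = c"
  using op_relator[OF hecke_relators.X_one fX[OF P_zero] free_one, of c] by (simp add: op_one Pr_V)

lemma op_X_T_poly:
  assumes nu: "\<nu> \<in> P" and p: "p \<in> group_algebra \<alpha>"
    and eq: "p * (1 - Poly_Mapping.single (- \<alpha> i) 1) = Poly_Mapping.single \<nu> 1 - Poly_Mapping.single (s i \<nu>) 1"
  shows "Xop \<nu> (Top i c) = Top i (Xop (s i \<nu>) c) + sc (q - inverse q) (op (fpoly p) c)"
proof -
  have "op (fgen (GenX \<nu>) * fgen (GenT i)) c
    = op (fgen (GenT i) * fgen (GenX (s i \<nu>)) + fconst (q - inverse q) * fpoly p) c"
    by (rule op_relator[OF hecke_relators.bernstein[OF nu p eq]])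
      (intro free_mult free_add free_const free_fpoly fT fX nu s_P p)+
  then show ?thesis using nu p
    by (simp add: op_mult op_add fT fX s_P free_const free_mult free_fpoly op_const Pr_V op_V)
qed

lemma op_X_T:
  assumes nu: "\<nu> \<in> P" and k: "\<nu> \<bullet> coroot (\<alpha> i) = of_int k"
  shows "Xop \<nu> (Top i c) = Top i (Xop (s i \<nu>) c) + sc (q - inverse q)
        (if 0 \<le> k then \<Sum>j<nat k. Xop (\<nu> + of_nat j *\<^sub>R (- \<alpha> i)) c
         else - (\<Sum>j<nat (- k). Xop (\<nu> + of_nat (Suc j) *\<^sub>R \<alpha> i) c))"
proof (cases "0 \<le> k")
  case True
  define e where "e j = \<nu> + of_nat j *\<^sub>R (- \<alpha> i)" for j
  have eP: "e j \<in> P" for j unfolding e_def by (intro P_add nu P_scale_Int P_minus simple_P) simp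
  define p where "p = (\<Sum>j<nat k. Poly_Mapping.single (e j) (1::complex))"
  have "e (nat k) = s i \<nu>" using True by (simp add: e_def refl_def k)
  moreover have "e 0 = \<nu>" by (simp add: e_def)
  moreover have "e (Suc j) = e j + - \<alpha> i" for j by (simp add: e_def algebra_simps)
  ultimately have eq: "p * (1 - Poly_Mapping.single (- \<alpha> i) 1) = Poly_Mapping.single \<nu> 1 - Poly_Mapping.single (s i \<nu>) 1"
    using telescope_single[of e "- \<alpha> i" "nat k"] by (simp only: p_def)
  have p: "p \<in> group_algebra \<alpha>"
    unfolding group_algebra_def p_def using eP by (auto dest!: subsetD[OF keys_sum])
  have "op (fpoly p) c = (\<Sum>j<nat k. Xop (e j) c)"
    unfolding p_def fpoly_sum fpoly_single by (rule op_sum) (rule fX[OF eP])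
  then show ?thesis using op_X_T_poly[OF nu p eq] True by (simp add: e_def)
next
  case False
  \<comment> \<open>For negative k the series runs from s_i nu down to nu, so its sum p is minus the
    quotient. The exponents \<open>e'\<close> are the same ones counted upwards from nu.\<close>
  define e where "e j = s i \<nu> + of_nat j *\<^sub>R (- \<alpha> i)" for j
  define e' where "e' j = \<nu> + of_nat (Suc j) *\<^sub>R \<alpha> i" for j
  let ?n = "nat (- k)"
  have eP: "e' j \<in> P" for j unfolding e'_def by (intro P_add nu P_scale_Int simple_P) simp
  define p where "p = (\<Sum>j<?n. Poly_Mapping.single (e j) (1::complex))"
  have "e ?n = \<nu>" using False by (simp add: e_def refl_def k)
  moreover have "e 0 = s i \<nu>" by (simp add: e_def)
  moreover have "e (Suc j) = e j + - \<alpha> i" for j by (simp add: e_def algebra_simps)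
  ultimately have "p * (1 - Poly_Mapping.single (- \<alpha> i) 1) = Poly_Mapping.single (s i \<nu>) 1 - Poly_Mapping.single \<nu> 1"
    using telescope_single[of e "- \<alpha> i" ?n] by (simp only: p_def)
  then have eq: "(- p) * (1 - Poly_Mapping.single (- \<alpha> i) 1) = Poly_Mapping.single \<nu> 1 - Poly_Mapping.single (s i \<nu>) 1"
    by simp
  have ee: "e j = e' (?n - Suc j)" if "j < ?n" for j
  proof -
    have "real (Suc (?n - Suc j)) = - of_int k - real j" using that by simp
    then show ?thesis unfolding e_def e'_def by (simp add: refl_def k algebra_simps)
  qed
  have p': "p = (\<Sum>j<?n. Poly_Mapping.single (e' j) 1)"
  proof -
    have "p = (\<Sum>j<?n. Poly_Mapping.single (e' (?n - Suc j)) 1)" unfolding p_def by (intro sum.cong) (auto simp: ee)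
    also have "\<dots> = (\<Sum>j<?n. Poly_Mapping.single (e' j) 1)" by (rule sum.nat_diff_reindex)
    finally show ?thesis .
  qed
  have p: "- p \<in> group_algebra \<alpha>"
    unfolding group_algebra_def p' using eP by (auto simp: keys_uminus_eq dest!: subsetD[OF keys_sum])
  have "op (fpoly p) c = (\<Sum>j<?n. Xop (e' j) c)"
    unfolding p' fpoly_sum fpoly_single by (rule op_sum) (rule fX[OF eP])
  moreover have "fpoly p \<in> A" unfolding p' fpoly_sum fpoly_single by (rule free_sum) (rule fX[OF eP])
  ultimately have "op (fpoly (- p)) c = - (\<Sum>j<?n. Xop (e' j) c)" by (simp add: fpoly_minus op_minus)
  then show ?thesis using op_X_T_poly[OF nu p eq] False by (simp add: e'_def)
qed

lemma op_closed_subspace: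
  assumes N: "vs.subspace N" "N \<subseteq> V" and T: "\<And>i x. x \<in> N \<Longrightarrow> Top i x \<in> N"
    and X: "\<And>\<nu> x. \<nu> \<in> P \<Longrightarrow> x \<in> N \<Longrightarrow> Xop \<nu> x \<in> N"
    and p: "p \<in> A" and x: "x \<in> N"
  shows "op p x \<in> N"
proof -
  have g: "op (fgen y) z \<in> N" if "y \<in> hgens \<alpha>" "z \<in> N" for y z
    using that T X by (auto simp: hgens_def)
  have "foldr (\<lambda>x. op (fgen x)) xs x \<in> N" if "set xs \<subseteq> hgens \<alpha>" for xs
    using that by (induction xs) (auto simp: x g)
  then show ?thesis
    unfolding op_expand[OF p subsetD[OF N(2) x]] using p N(1)
    by (intro vs.subspace_sum vs.subspace_scale) (auto simp: carrier_free words_def)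
qed

text \<open>The evaluation carries a stable subspace of \<open>V\<close> to a submodule of M and is
  injective on \<open>V\<close>. Negation in M is the action of the scalar -1.\<close>

lemma op_irreducible:
  assumes irr: "irreducible_module (affine_hecke \<alpha> q) M"
    and N: "vs.subspace N" "N \<subseteq> V" and T: "\<And>i x. x \<in> N \<Longrightarrow> Top i x \<in> N"
    and X: "\<And>\<nu> x. \<nu> \<in> P \<Longrightarrow> x \<in> N \<Longrightarrow> Xop \<nu> x \<in> N"
  shows "N \<subseteq> {0} \<or> N = V"
proof -
  have opN: "op p x \<in> N" if "p \<in> A" "x \<in> N" for p x
    by (rule op_closed_subspace[OF N T X that])
  have act_N: "act p (\<pi> x) \<in> \<pi> ` N" if "p \<in> A" "x \<in> N" for p x
    using opN[OF that] pi_op[OF that(1), of x] by (metis image_eqI)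
  have m1: "act (fconst (- 1)) m = \<ominus>\<^bsub>M\<^esub> m" if m: "m \<in> carrier M" for m
  proof -
    have "act (fconst (-1)) m \<oplus>\<^bsub>M\<^esub> m = act (fconst (-1) + 1) m" using m by (simp add: act_add free_const free_one act_one)
    also have "fconst (-1) + 1 = (0 :: 'n free)" using fconst_add[of "-1" 1] by (simp add: fconst_def)
    also have "act 0 m = \<zero>\<^bsub>M\<^esub>" using act_add[OF free_zero free_zero m] act_closed[OF free_zero m] M.add.l_cancel_one by simp
    finally show ?thesis using m act_closed[OF free_const m] M.minus_equality by simp
  qed
  have "left_submodule (affine_hecke \<alpha> q) M (\<pi> ` N)"
    unfolding left_submodule_def
  proof
    show "subgroup (\<pi> ` N) (add_monoid M)"
    proof (rule M.add.subgroupI)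
      show "\<pi> ` N \<subseteq> carrier M" by auto
      show "\<pi> ` N \<noteq> {}" using vs.subspace_0[OF N(1)] by blast
      fix a assume "a \<in> \<pi> ` N"
      then show "\<ominus>\<^bsub>M\<^esub> a \<in> \<pi> ` N" using act_N[OF free_const[of "-1"]] m1 by auto
      fix b assume "b \<in> \<pi> ` N"
      with \<open>a \<in> \<pi> ` N\<close> show "a \<oplus>\<^bsub>M\<^esub> b \<in> \<pi> ` N"
        using vs.subspace_add[OF N(1)] by (auto simp: pi_add[symmetric])
    qed
    show "\<forall>h\<in>carrier (affine_hecke \<alpha> q). \<forall>x\<in>\<pi> ` N. h \<odot>\<^bsub>M\<^esub> x \<in> \<pi> ` N"
      using act_N by (auto simp: hecke_carrier act_def)
  qed
  then have "\<pi> ` N = {\<zero>\<^bsub>M\<^esub>} \<or> \<pi> ` N = carrier M" using irr unfolding irreducible_module_def by blast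
  then show ?thesis
  proof
    assume z: "\<pi> ` N = {\<zero>\<^bsub>M\<^esub>}"
    have "x = 0" if "x \<in> N" for x
    proof -
      have "\<pi> x = \<zero>\<^bsub>M\<^esub>" using z that by blast
      then show ?thesis using Pr(3)[of x] Pr_V[of x] that N(2) by auto
    qed
    then show ?thesis by blast
  next
    assume c: "\<pi> ` N = carrier M"
    have "V \<subseteq> N"
    proof
      fix x assume "x \<in> V"
      have "\<pi> x \<in> \<pi> ` N" unfolding c by simp
      then show "x \<in> N" using pi_inj_V[OF \<open>x \<in> V\<close>] N(2) by blast
    qed
    then show ?thesis using N(2) by blast
  qed
qed

lemma wsp_correspondence:
  "m \<in> weight_space \<alpha> q M \<sigma> \<longleftrightarrow> m \<in> carrier M \<and> (\<forall>\<nu>\<in>P. Xop \<nu> (\<phi> m) = sc (\<sigma> \<nu>) (\<phi> m))"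
proof -
  have "hX \<alpha> q \<nu> \<odot>\<^bsub>M\<^esub> m = hconst \<alpha> q (\<sigma> \<nu>) \<odot>\<^bsub>M\<^esub> m \<longleftrightarrow> Xop \<nu> (\<phi> m) = sc (\<sigma> \<nu>) (\<phi> m)"
    if m: "m \<in> carrier M" and nu: "\<nu> \<in> P" for \<nu>
  proof -
    have "Xop \<nu> (\<phi> m) = \<phi> (act (fgen (GenX \<nu>)) m)" by (simp add: op_def pi_phi m)
    moreover have "sc (\<sigma> \<nu>) (\<phi> m) = \<phi> (act (fconst (\<sigma> \<nu>)) m)" by (simp add: phi_scale m)
    moreover have "act (fgen (GenX \<nu>)) m \<in> carrier M" "act (fconst (\<sigma> \<nu>)) m \<in> carrier M"
      using act_closed[OF fX[OF nu] m] act_closed[OF free_const m] by auto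
    ultimately show ?thesis using phi_inj by (metis act_def hX_def hconst_def)
  qed
  then show ?thesis unfolding weight_space_def by auto
qed

text \<open>Iterates of X^nu - sigma(nu) on coordinates correspond to powers in the quotient ring,
  the form in which generalized weight spaces are defined.\<close>

lemma op_calibrated:
  assumes cal: "calibrated \<alpha> q M" and sg: "\<sigma> \<in> torus \<alpha>" and x: "x \<in> V"
    and gen: "\<And>\<nu>. \<nu> \<in> P \<Longrightarrow> \<exists>k>0. ((\<lambda>y. Xop \<nu> y - sc (\<sigma> \<nu>) y) ^^ k) x = 0" and nu: "\<nu> \<in> P"
  shows "Xop \<nu> x = sc (\<sigma> \<nu>) x"
proof -
  interpret H: ring "affine_hecke \<alpha> q" by (rule ring_affine_hecke)
  define D where "D \<mu> = fgen (GenX \<mu>) - fconst (\<sigma> \<mu>)" for \<mu>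
  have DA: "D \<mu> \<in> A" if "\<mu> \<in> P" for \<mu> unfolding D_def by (intro free_diff fX that free_const)
  have opD: "op (D \<mu>) y = Xop \<mu> y - sc (\<sigma> \<mu>) y" if "\<mu> \<in> P" "y \<in> V" for \<mu> y
    using op_add[OF fX[OF that(1)] free_minus[OF free_const]] op_minus[OF free_const]
    by (simp add: D_def op_const Pr_V[OF that(2)])
  have pow: "op (D \<mu> ^ k) x = ((\<lambda>y. Xop \<mu> y - sc (\<sigma> \<mu>) y) ^^ k) x \<and> D \<mu> ^ k \<in> A" if "\<mu> \<in> P" for \<mu> k
  proof (induction k)
    case 0
    then show ?case by (simp add: op_one Pr_V[OF x] free_one)
  next
    case (Suc k)
    then have k: "op (D \<mu> ^ k) x = ((\<lambda>y. Xop \<mu> y - sc (\<sigma> \<mu>) y) ^^ k) x" "D \<mu> ^ k \<in> A" by blast+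
    have "op (D \<mu> ^ Suc k) x = op (D \<mu>) (op (D \<mu> ^ k) x)"
      unfolding power_Suc by (rule op_mult[OF DA[OF that] k(2)])
    also have "\<dots> = Xop \<mu> (op (D \<mu> ^ k) x) - sc (\<sigma> \<mu>) (op (D \<mu> ^ k) x)" by (rule opD[OF that op_V])
    finally show ?case unfolding power_Suc k(1)
      by (simp only: funpow.simps o_apply free_mult[OF DA[OF that] k(2)] simp_thms)
  qed
  have hpow: "(hX \<alpha> q \<mu> \<ominus>\<^bsub>affine_hecke \<alpha> q\<^esub> hconst \<alpha> q (\<sigma> \<mu>)) [^]\<^bsub>affine_hecke \<alpha> q\<^esub> k = hclass \<alpha> q (D \<mu> ^ k)"
    if mu: "\<mu> \<in> P" for \<mu> and k :: nat
  proof -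
    have hc: "hclass \<alpha> q p \<in> carrier (affine_hecke \<alpha> q)" if "p \<in> A" for p using that by (rule hclass_closed)
    have "hclass \<alpha> q (D \<mu>) \<oplus>\<^bsub>affine_hecke \<alpha> q\<^esub> hconst \<alpha> q (\<sigma> \<mu>) = hX \<alpha> q \<mu>"
      using ring_hom_add[OF hclass_hom DA[OF mu] free_const, of q "\<sigma> \<mu>"] by (simp add: hconst_def hX_def D_def)
    then have "hX \<alpha> q \<mu> \<ominus>\<^bsub>affine_hecke \<alpha> q\<^esub> hconst \<alpha> q (\<sigma> \<mu>) = hclass \<alpha> q (D \<mu>)"
      using hc[OF DA[OF mu]] hc[OF free_const, of "\<sigma> \<mu>"]
      by (metis H.add.inv_solve_right' H.minus_eq hconst_def H.a_closed)
    moreover have "hclass \<alpha> q (D \<mu>) [^]\<^bsub>affine_hecke \<alpha> q\<^esub> k = hclass \<alpha> q (D \<mu> ^ k)"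
    proof (induction k)
      case 0
      then show ?case using ring_hom_one[OF hclass_hom, of q] by simp
    next
      case (Suc k)
      then show ?case using ring_hom_mult[OF hclass_hom, of "D \<mu> ^ k" "D \<mu>" q] pow[OF mu, of k] DA[OF mu]
        by (simp add: power_commutes)
    qed
    ultimately show ?thesis by simp
  qed
  have "\<pi> x \<in> gen_weight_space \<alpha> q M \<sigma>"
    unfolding gen_weight_space_def
  proof (clarsimp)
    fix \<mu> assume mu: "\<mu> \<in> P"
    obtain k where k: "k > 0" "((\<lambda>y. Xop \<mu> y - sc (\<sigma> \<mu>) y) ^^ k) x = 0" using gen[OF mu] by blast
    have "op (D \<mu> ^ k) x = 0" "D \<mu> ^ k \<in> A" using pow[OF mu] k by auto
    then have "act (D \<mu> ^ k) (\<pi> x) = \<zero>\<^bsub>M\<^esub>" unfolding op_def using phi_eq_0[OF act_closed[OF _ pi_closed]] by blast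
    then show "\<exists>k::nat. 0 < k \<and> ((hX \<alpha> q \<mu> \<ominus>\<^bsub>affine_hecke \<alpha> q\<^esub> hconst \<alpha> q (\<sigma> \<mu>)) [^]\<^bsub>affine_hecke \<alpha> q\<^esub> k) \<odot>\<^bsub>M\<^esub> \<pi> x = \<zero>\<^bsub>M\<^esub>"
      using k(1) by (intro exI[of _ k]) (simp add: hpow[OF mu] act_def)
  qed
  then have "\<pi> x \<in> weight_space \<alpha> q M \<sigma>" using cal sg unfolding calibrated_def by blast
  then show ?thesis using nu by (simp add: wsp_correspondence phi_pi Pr_V[OF x])
qed

text \<open>The locale asks for linear operators at every vector, whereas only lattice vectors give
  generators of the algebra; outside P the zero operator is used.\<close>

definition XX :: "real^'n \<Rightarrow> ('m \<Rightarrow> complex) \<Rightarrow> 'm \<Rightarrow> complex" where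
  "XX \<nu> c = (if \<nu> \<in> P then Xop \<nu> c else 0)"

lemma XX_eq: "\<nu> \<in> P \<Longrightarrow> XX \<nu> = Xop \<nu>"
  by (simp add: XX_def fun_eq_iff)

lemma hecke_rep:
  assumes q: "q \<noteq> 0" "\<forall>k::nat. 0 < k \<longrightarrow> q ^ k \<noteq> 1"
    and irr: "irreducible_module (affine_hecke \<alpha> q) M" and cal: "calibrated \<alpha> q M"
  shows "hecke_rep R \<alpha> sc q V Top XX"
proof (unfold_locales, goal_cases)
  \<comment> \<open>Goal 14 is the Bernstein relation, 15 irreducibility and 16 the calibration
    axiom.\<close>
  case (14 \<nu> x i k)
  have "\<nu> + of_nat j *\<^sub>R (- \<alpha> i) \<in> P" "\<nu> + of_nat (Suc j) *\<^sub>R \<alpha> i \<in> P" for j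
    using 14 by (auto intro!: P_add P_scale_Int P_minus simple_P)
  then show ?case using op_X_T[OF 14(1,3), of x] 14(1) by (simp only: XX_eq s_P)
next
  case (15 N)
  then show ?case using op_irreducible[OF irr, of N] by (simp add: XX_eq)
next
  case (16 \<sigma> x \<nu>)
  have "\<exists>k>0. ((\<lambda>y. Xop \<nu> y - sc (\<sigma> \<nu>) y) ^^ k) x = 0" if "\<nu> \<in> P" for \<nu>
    using 16(3)[OF that] by (simp only: XX_eq[OF that])
  then show ?case using op_calibrated[OF cal 16(1,2) _ 16(4)] by (simp add: XX_eq 16(4))
qed (use q in \<open>auto simp: subspace_V XX_def op_right_add op_right_scale fT fX op_V op_T_T op_X_X op_X_zero P_add intro: op_braid\<close>)

end

section \<open>Comparison with the module attached to the shape\<close>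

context hecke_module begin

lemma op_right_zero: "p \<in> A \<Longrightarrow> op p 0 = 0"
  using op_right_scale[of p 0 0] by (simp only: vs.scale_zero_left)

lemma op_right_sum: assumes "p \<in> A" shows "op p (sum h S) = (\<Sum>i\<in>S. op p (h i))"
proof (induction S rule: infinite_finite_induct)
  case (infinite S)
  show ?case unfolding sum.infinite[OF infinite] by (rule op_right_zero[OF assms])
next
  case empty
  show ?case unfolding sum.empty by (rule op_right_zero[OF assms])
next
  case (insert x F)
  then show ?case unfolding sum.insert[OF insert(1,2)] op_right_add[OF assms] by (simp only:)
qed

context
  fixes t :: "real^'n \<Rightarrow> complex" and J :: "(real^'n) set"
    and E :: "(real^'n \<Rightarrow> real^'n) \<Rightarrow> 'm \<Rightarrow> complex"
  assumes E_V: "\<And>u. u \<in> tableaux R \<alpha> q t J \<Longrightarrow> E u \<in> V"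
    and E_X: "\<And>u \<nu>. u \<in> tableaux R \<alpha> q t J \<Longrightarrow> \<nu> \<in> P \<Longrightarrow> Xop \<nu> (E u) = sc (torus_act u t \<nu>) (E u)"
    and E_outside: "\<And>u. u \<in> weyl R \<Longrightarrow> u \<notin> tableaux R \<alpha> q t J \<Longrightarrow> E u = 0"
    and E_T: "\<And>u i. u \<in> tableaux R \<alpha> q t J \<Longrightarrow>
       Top i (E u) = sc (T_diag \<alpha> q t i u) (E u) + sc (inverse q + T_diag \<alpha> q t i u) (E (s i \<circ> u))"
    and E_span: "vs.span (E ` tableaux R \<alpha> q t J) = V"
    and E_independent: "\<And>c u. (\<Sum>u\<in>tableaux R \<alpha> q t J. sc (c u) (E u)) = 0 \<Longrightarrow> u \<in> tableaux R \<alpha> q t J \<Longrightarrow> c u = 0"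
begin

abbreviation F :: "(real^'n \<Rightarrow> real^'n) set" where "F \<equiv> tableaux R \<alpha> q t J"
abbreviation S where "S \<equiv> shape_module R \<alpha> q t J"

text \<open>The comparison runs from the shape module to M. It turns the action of every element of
  the free algebra into the action on M, so the choice of representatives in the shape module is
  harmless; the isomorphism is its inverse.\<close>

definition Psi :: "((real^'n \<Rightarrow> real^'n) \<Rightarrow> complex) \<Rightarrow> 'm \<Rightarrow> complex" where
  "Psi c = (\<Sum>u\<in>F. sc (c u) (E u))"

lemma finite_F: "finite F"
  using finite_weyl by (rule finite_subset[rotated]) (auto simp: tableaux_def)

lemma carrier_S: "carrier S = {c. \<forall>u. u \<notin> F \<longrightarrow> c u = 0}"
  by (simp add: shape_module_def Let_def)

lemma add_S: "c \<oplus>\<^bsub>S\<^esub> c' = (\<lambda>u. c u + c' u)"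
  by (simp add: shape_module_def Let_def)

lemma smult_S: "h \<odot>\<^bsub>S\<^esub> c = free_act \<alpha> q t F (SOME p. p \<in> h) c"
  by (simp add: shape_module_def Let_def)

lemma Psi_V: "Psi c \<in> V"
  unfolding Psi_def by (intro vs.subspace_sum vs.subspace_scale subspace_V E_V)

lemma Psi_add: "Psi (\<lambda>u. c u + c' u) = Psi c + Psi c'"
  by (simp only: Psi_def vs.scale_left_distrib sum.distrib)

lemma Psi_scale: "Psi (\<lambda>u. a * c u) = sc a (Psi c)"
  by (simp only: Psi_def vs.scale_sum_right vs.scale_scale)

lemma Psi_zero: "Psi (\<lambda>u. 0) = 0"
  by (simp only: Psi_def vs.scale_zero_left sum.neutral_const)

lemma Psi_sum: "Psi (\<lambda>u. \<Sum>i\<in>I. c i u) = (\<Sum>i\<in>I. Psi (c i))"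
proof (induction I rule: infinite_finite_induct)
  case (infinite I)
  show ?case unfolding sum.infinite[OF infinite] by (rule Psi_zero)
next
  case empty
  show ?case unfolding sum.empty by (rule Psi_zero)
next
  case (insert x I)
  then show ?case unfolding sum.insert[OF insert(1,2)] by (simp only: Psi_add)
qed

lemma Psi_delta: "u \<in> F \<Longrightarrow> Psi (\<lambda>w. if w = u then a else 0) = sc a (E u)"
proof -
  assume u: "u \<in> F"
  have "sc (if w = u then a else 0) (E w) = (if w = u then sc a (E w) else 0)" for w
    by (cases "w = u") (simp_all only: if_True if_False vs.scale_zero_left simp_thms)
  then have "Psi (\<lambda>w. if w = u then a else 0) = (\<Sum>w\<in>F. if w = u then sc a (E w) else 0)"
    by (simp only: Psi_def)
  also have "\<dots> = sc a (E u)" using u finite_F by (subst sum.delta) (simp_all only: if_True)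
  finally show ?thesis .
qed

lemma Psi_surj: "y \<in> V \<Longrightarrow> \<exists>c\<in>carrier S. Psi c = y"
proof -
  assume "y \<in> V"
  then have "y \<in> vs.span (E ` F)" by (simp only: E_span)
  then show ?thesis
  proof (induction rule: vs.span_induct_alt)
    case base
    show ?case using Psi_zero by (intro bexI[of _ "\<lambda>u. 0"]) (simp_all add: carrier_S)
  next
    case (step a x y)
    then obtain u c where u: "u \<in> F" "x = E u" "c \<in> carrier S" "Psi c = y" by blast
    have "Psi (\<lambda>w. (if w = u then a else 0) + c w) = sc a x + y"
      by (simp only: Psi_add Psi_delta[OF u(1)] u(2,4))
    moreover have "(\<lambda>w. (if w = u then a else 0) + c w) \<in> carrier S" using u by (auto simp: carrier_S)
    ultimately show ?case by blast
  qed
qed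

lemma Psi_inj: assumes "c \<in> carrier S" "c' \<in> carrier S" "Psi c = Psi c'" shows "c = c'"
proof
  fix u
  have "Psi (\<lambda>u. c u + (- 1) * c' u) = 0"
    unfolding Psi_add Psi_scale assms(3) by (simp only: vs.scale_minus_left vs.scale_one right_minus)
  then have "u \<in> F \<Longrightarrow> c u + (- 1) * c' u = 0" unfolding Psi_def by (rule E_independent)
  then show "c u = c' u" using assms(1,2) by (cases "u \<in> F") (auto simp: carrier_S)
qed

lemma Psi_gen_on_basis:
  assumes x: "x \<in> hgens \<alpha>" and w: "w \<in> F"
  shows "Psi (gen_on_basis \<alpha> q t F x w) = op (fgen x) (E w)"
proof -
  have sb: "Psi (\<lambda>u. a * shape_basis F v u) = (if v \<in> F then sc a (E v) else 0)" for a v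
  proof (cases "v \<in> F")
    case True
    have "(\<lambda>u. a * shape_basis F v u) = (\<lambda>u. if u = v then a else 0)" using True by (auto simp: shape_basis_def)
    then show ?thesis using True by (simp only: Psi_delta if_True)
  next
    case False
    have "(\<lambda>u. a * shape_basis F v u) = (\<lambda>u. 0)" using False by (auto simp: shape_basis_def)
    then show ?thesis using False by (simp only: Psi_zero if_False)
  qed
  show ?thesis
  proof (cases x)
    case (GenX \<nu>)
    then have "\<nu> \<in> P" using x by (auto simp: hgens_def)
    then show ?thesis using w by (simp only: GenX gen_on_basis.simps sb if_True E_X)
  next
    case (GenT i)
    have ww: "s i \<circ> w \<in> weyl R" using w by (intro weyl_comp s_weyl) (simp add: tableaux_def)
    \<comment> \<open>The convention that v_{s_i w} is zero outside the tableaux matches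
      \<open>E_outside\<close>.\<close>
    have "(if s i \<circ> w \<in> F then sc a (E (s i \<circ> w)) else 0) = sc a (E (s i \<circ> w))" for a
      using E_outside[OF ww] by (cases "s i \<circ> w \<in> F") (simp_all only: if_True if_False vs.scale_zero_right simp_thms)
    then show ?thesis using w by (simp only: GenT gen_on_basis.simps Psi_add sb if_True E_T)
  qed
qed

lemma Psi_gen_act:
  assumes x: "x \<in> hgens \<alpha>" shows "Psi (gen_act \<alpha> q t F x c) = op (fgen x) (Psi c)"
proof -
  have "Psi (gen_act \<alpha> q t F x c) = (\<Sum>w\<in>F. sc (c w) (op (fgen x) (E w)))"
    unfolding gen_act_def Psi_sum Psi_scale by (intro sum.cong HOL.refl) (simp only: Psi_gen_on_basis[OF x])
  also have "\<dots> = op (fgen x) (Psi c)"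
    unfolding Psi_def op_right_sum[OF free_gen[OF x]] by (simp only: op_right_scale[OF free_gen[OF x]])
  finally show ?thesis .
qed

lemma Psi_word: "set xs \<subseteq> hgens \<alpha> \<Longrightarrow>
  Psi (foldr (gen_act \<alpha> q t F) xs c) = foldr (\<lambda>x. op (fgen x)) xs (Psi c)"
  by (induction xs) (simp_all add: Psi_gen_act)

lemma Psi_free_act: assumes p: "p \<in> A" shows "Psi (free_act \<alpha> q t F p c) = op p (Psi c)"
proof -
  have "Psi (free_act \<alpha> q t F p c)
    = (\<Sum>w\<in>Poly_Mapping.keys p. sc (Poly_Mapping.lookup p w) (Psi (foldr (gen_act \<alpha> q t F) (letters w) c)))"
    unfolding free_act_def Psi_sum Psi_scale ..
  also have "\<dots> = op p (Psi c)"
    unfolding op_expand[OF p Psi_V] using p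
    by (intro sum.cong HOL.refl) (subst Psi_word, auto simp: carrier_free words_def)
  finally show ?thesis .
qed

lemma free_act_closed: assumes "c \<in> carrier S" shows "free_act \<alpha> q t F p c \<in> carrier S"
proof -
  have g: "gen_on_basis \<alpha> q t F x w u = 0" if "u \<notin> F" for x w u
    using that by (cases x) (auto simp: shape_basis_def)
  have "foldr (gen_act \<alpha> q t F) xs c u = 0" if "u \<notin> F" for xs u
    using assms that by (induction xs) (auto simp: carrier_S gen_act_def g)
  then show ?thesis by (simp add: carrier_S free_act_def)
qed

lemma shape_module_iso: "module_iso (affine_hecke \<alpha> q) M S"
proof -
  define G where "G c = \<pi> (Psi c)" for c
  have bij: "bij_betw G (carrier S) (carrier M)"
  proof (rule bij_betw_imageI)
    show "inj_on G (carrier S)"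
      unfolding G_def by (rule inj_onI) (rule Psi_inj, assumption, assumption, rule pi_inj_V[OF Psi_V Psi_V])
    show "G ` carrier S = carrier M"
    proof
      show "carrier M \<subseteq> G ` carrier S"
      proof
        fix m assume m: "m \<in> carrier M"
        obtain c where "c \<in> carrier S" "Psi c = \<phi> m" using Psi_surj[OF phi_V] by blast
        then show "m \<in> G ` carrier S" using pi_phi[OF m] by (intro image_eqI[of _ _ c]) (simp_all only: G_def)
      qed
    qed (auto simp: G_def)
  qed
  have add: "G (c \<oplus>\<^bsub>S\<^esub> c') = G c \<oplus>\<^bsub>M\<^esub> G c'" for c c'
    unfolding G_def add_S Psi_add pi_add ..
  have S_add: "c \<oplus>\<^bsub>S\<^esub> c' \<in> carrier S" if "c \<in> carrier S" "c' \<in> carrier S" for c c'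
    unfolding add_S using that by (simp add: carrier_S)
  have smult: "G (h \<odot>\<^bsub>S\<^esub> c) = h \<odot>\<^bsub>M\<^esub> G c" if h: "h \<in> carrier (affine_hecke \<alpha> q)" for h c
    unfolding G_def smult_S Psi_free_act[OF hecke_rep_choice(1)[OF h]] pi_op[OF hecke_rep_choice(1)[OF h]]
      act_def hecke_rep_choice(2)[OF h] ..
  have S_smult: "h \<odot>\<^bsub>S\<^esub> c \<in> carrier S" if "c \<in> carrier S" for h c
    unfolding smult_S by (rule free_act_closed[OF that])
  let ?\<phi> = "inv_into (carrier S) G"
  have G_inv: "G (?\<phi> m) = m" "?\<phi> m \<in> carrier S" if "m \<in> carrier M" for m
    using bij that by (auto simp: bij_betw_def f_inv_into_f intro: inv_into_into)
  have inv_G: "?\<phi> (G c) = c" if "c \<in> carrier S" for c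
    using bij that by (simp add: bij_betw_def)
  show ?thesis unfolding module_iso_def
  proof (intro exI[of _ ?\<phi>] conjI ballI)
    show "bij_betw ?\<phi> (carrier M) (carrier S)" by (rule bij_betw_inv_into[OF bij])
  next
    fix x y assume xy: "x \<in> carrier M" "y \<in> carrier M"
    show "?\<phi> (x \<oplus>\<^bsub>M\<^esub> y) = ?\<phi> x \<oplus>\<^bsub>S\<^esub> ?\<phi> y"
      using inv_G[OF S_add[OF G_inv(2)[OF xy(1)] G_inv(2)[OF xy(2)]]] unfolding add G_inv(1)[OF xy(1)] G_inv(1)[OF xy(2)] .
  next
    fix h x assume h: "h \<in> carrier (affine_hecke \<alpha> q)" and x: "x \<in> carrier M"
    show "?\<phi> (h \<odot>\<^bsub>M\<^esub> x) = h \<odot>\<^bsub>S\<^esub> ?\<phi> x"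
      using inv_G[OF S_smult[OF G_inv(2)[OF x]], of h] unfolding smult[OF h] G_inv(1)[OF x] .
  qed
qed

end
end

text \<open>Several elements of W may give the same weight, and J is a shape only for a label
  without inversions in the zero set. The second conjunct is stated for such labels, and the first
  shows that every occurring weight has one.\<close>

theorem theorem4p5:
  fixes R :: "(real^'n) set"
    and \<alpha> :: "'n \<Rightarrow> real^'n"
    and q :: complex
    and M :: "('n free set, 'm) module"
    and t :: "real^'n \<Rightarrow> complex"
  assumes "root_system R" and "reduced_roots R" and "irreducible_roots R"
    and "simple_roots R \<alpha>"
    and "q \<noteq> 0" and "\<forall>k::nat. 0 < k \<longrightarrow> q ^ k \<noteq> 1"
    and "irreducible_module (affine_hecke \<alpha> q) M"
    and "calibrated \<alpha> q M"
    and "central_character R \<alpha> q M t"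
  shows "(\<forall>w\<in>weyl R. weight_space \<alpha> q M (torus_act w t) \<noteq> {\<zero>\<^bsub>M\<^esub>} \<longrightarrow>
           (\<exists>u\<in>weyl R. inversions R \<alpha> u \<inter> Zset R \<alpha> t = {} \<and>
              (\<forall>\<nu>\<in>weight_lattice \<alpha>. torus_act u t \<nu> = torus_act w t \<nu>))) \<and>
         (\<forall>w\<in>weyl R. \<forall>J.
           weight_space \<alpha> q M (torus_act w t) \<noteq> {\<zero>\<^bsub>M\<^esub>} \<longrightarrow>
           inversions R \<alpha> w \<inter> Zset R \<alpha> t = {} \<longrightarrow>
           J = inversions R \<alpha> w \<inter> Pset R \<alpha> q t \<longrightarrow>
             placed_skew_shape R \<alpha> q t J \<and>
             module_iso (affine_hecke \<alpha> q) M (shape_module R \<alpha> q t J))"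
proof -
  interpret simple_root_system R \<alpha> using assms(1,2,4) by unfold_locales
  interpret left_module "affine_hecke \<alpha> q" M using assms(7) by (simp add: irreducible_module_def)
  obtain B where B: "finite B" "B \<subseteq> carrier M"
    "\<And>x. x \<in> carrier M \<Longrightarrow> \<exists>c. x = (\<Oplus>\<^bsub>M\<^esub>b\<in>B. hconst \<alpha> q (c b) \<odot>\<^bsub>M\<^esub> b)"
    using assms(8) unfolding calibrated_def finite_dim_def by blast
  interpret hecke_module R \<alpha> q M B using B by unfold_locales auto
  interpret rep: hecke_rep R \<alpha> sc q V Top XX by (rule hecke_rep[OF assms(5-8)])
  have t: "t \<in> torus \<alpha>" using assms(9) by (simp add: central_character_def)
  have wsp_iff: "x \<in> rep.wsp \<sigma> \<longleftrightarrow> x \<in> V \<and> (\<forall>\<nu>\<in>P. Xop \<nu> x = sc (\<sigma> \<nu>) x)" for x \<sigma>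
    by (auto simp: rep.wsp_def XX_eq)
  have second: "placed_skew_shape R \<alpha> q t J \<and> module_iso (affine_hecke \<alpha> q) M (shape_module R \<alpha> q t J)"
    if w: "w \<in> weyl R" and M: "weight_space \<alpha> q M (torus_act w t) \<noteq> {\<zero>\<^bsub>M\<^esub>}"
      and wz: "inversions R \<alpha> w \<inter> Zset R \<alpha> t = {}" and J: "J = inversions R \<alpha> w \<inter> Pset R \<alpha> q t" for w J
  proof -
    have "\<zero>\<^bsub>M\<^esub> \<in> weight_space \<alpha> q M (torus_act w t)"
      unfolding wsp_correspondence phi_zero using op_right_scale[OF fX, of _ 0 0]
      by (simp only: M.zero_closed vs.scale_zero_left vs.scale_zero_right) simp
    then obtain m where m: "m \<in> weight_space \<alpha> q M (torus_act w t)" "m \<noteq> \<zero>\<^bsub>M\<^esub>" using M by blast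
    then have mc: "m \<in> carrier M" and x: "\<phi> m \<in> rep.wsp (torus_act w t)" "\<phi> m \<noteq> 0"
      using phi_eq_0[of m] phi_V[of m] unfolding wsp_correspondence wsp_iff by blast+
    obtain E where E: "\<And>u. u \<in> tableaux R \<alpha> q t J \<Longrightarrow> E u \<noteq> 0 \<and> E u \<in> rep.wsp (torus_act u t)"
      "\<And>u. u \<in> weyl R \<Longrightarrow> u \<notin> tableaux R \<alpha> q t J \<Longrightarrow> E u = 0"
      "\<And>u i. u \<in> tableaux R \<alpha> q t J \<Longrightarrow>
        Top i (E u) = sc (T_diag \<alpha> q t i u) (E u) + sc (inverse q + T_diag \<alpha> q t i u) (E (s i \<circ> u))"
      "vs.span (E ` tableaux R \<alpha> q t J) = V"
    proof (rule rep.tableau_basis[OF t w wz J x], goal_cases)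
      case (1 E)
      show thesis by (rule 1(1)[OF 1(2-5)])
    qed
    have "w \<in> tableaux R \<alpha> q t J" using w wz J by (simp add: tableaux_def)
    then have shape: "placed_shape R \<alpha> q t J" using t J by (auto simp: placed_shape_def)
    have "calibratable \<alpha> q i j (torus_act u t)" if u: "u \<in> tableaux R \<alpha> q t J" for u i j
    proof (rule rep.calibratable_Nwt)
      have "u \<in> weyl R" using u by (simp add: tableaux_def)
      then show "rep.Nwt (torus_act u t)" unfolding rep.Nwt_def using E(1)[OF u] torus_act_torus[OF _ t] by blast
    qed
    then have skew: "placed_skew_shape R \<alpha> q t J" using shape by (simp add: placed_skew_shape_def)
    have fin: "finite (tableaux R \<alpha> q t J)"
      using finite_weyl by (rule finite_subset[rotated]) (auto simp: tableaux_def)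
    \<comment> \<open>Distinct tableaux have weights that differ on P, so each vector E u lies
      outside the span of the others.\<close>
    have indep: "c u = 0" if sum0: "(\<Sum>u\<in>tableaux R \<alpha> q t J. sc (c u) (E u)) = 0" and u: "u \<in> tableaux R \<alpha> q t J" for c u
    proof -
      let ?F' = "tableaux R \<alpha> q t J - {u}"
      have "sc (c u) (E u) = - (\<Sum>v\<in>?F'. sc (c v) (E v))"
        using sum0 unfolding sum.remove[OF fin u] by (rule eq_neg_iff_add_eq_0[THEN iffD2])
      moreover have "(\<Sum>v\<in>?F'. sc (c v) (E v)) \<in> vs.span (\<Union>\<tau>\<in>(\<lambda>v. torus_act v t) ` ?F'. rep.wsp \<tau>)"
        using E(1) by (intro vs.span_sum vs.span_scale vs.span_base) blast
      ultimately have in_span: "sc (c u) (E u) \<in> vs.span (\<Union>\<tau>\<in>(\<lambda>v. torus_act v t) ` ?F'. rep.wsp \<tau>)"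
        by (simp only: vs.span_neg)
      have in_wsp: "sc (c u) (E u) \<in> rep.wsp (torus_act u t)" using E(1)[OF u] rep.wsp_scale by blast
      have sep: "\<exists>\<nu>\<in>P. \<tau> \<nu> \<noteq> torus_act u t \<nu>" if tau: "\<tau> \<in> (\<lambda>v. torus_act v t) ` ?F'" for \<tau>
      proof (rule ccontr)
        assume eq: "\<not> ?thesis"
        obtain v where v: "v \<in> tableaux R \<alpha> q t J" "v \<noteq> u" "\<tau> = torus_act v t" using tau by blast
        have "v = u" by (rule torus_act_inj_on_tableaux[OF t v(1) u]) (use eq v(3) in blast)
        then show False using v(2) by contradiction
      qed
      have "sc (c u) (E u) = 0"
        by (rule rep.wsp_disjoint_span[OF _ sep in_wsp in_span]) (use fin in \<open>auto\<close>)
      then show ?thesis using E(1)[OF u] vs.scale_eq_0_iff by blast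
    qed
    have EV: "E u \<in> V" "\<And>\<nu>. \<nu> \<in> P \<Longrightarrow> Xop \<nu> (E u) = sc (torus_act u t \<nu>) (E u)"
      if "u \<in> tableaux R \<alpha> q t J" for u using E(1)[OF that] unfolding wsp_iff by blast+
    have "module_iso (affine_hecke \<alpha> q) M (shape_module R \<alpha> q t J)"
    proof (rule shape_module_iso[where t = t and J = J and E = E], goal_cases)
      case (1 u)
      then show ?case by (rule EV(1))
    next
      case (2 u \<nu>)
      then show ?case by (rule EV(2))
    next
      case (3 u)
      then show ?case by (rule E(2))
    next
      case (4 u i)
      then show ?case by (rule E(3))
    next
      case 5
      show ?case by (rule E(4))
    next
      case (6 c u)
      then show ?case by (rule indep)
    qed
    then show ?thesis using skew by blast
  qed
  have first: "\<exists>u\<in>weyl R. inversions R \<alpha> u \<inter> Zset R \<alpha> t = {} \<and> (\<forall>\<nu>\<in>P. torus_act u t \<nu> = torus_act w t \<nu>)"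
    if "w \<in> weyl R" for w by (rule ex_no_inversions_Zset[OF t that])
  show ?thesis using first second by blast
qed

end
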